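(* Let $m,n$ be relatively prime positive integers, let $1<p<\infty$, $a,b\in\mathbb R$ and $c>0$. Then the operator $S^+_{a,b,c}$ is bounded on $L^p(H_{m/n})$ if and only if the following three conditions all hold: $$-ap<1<(b+1)p,$$ $$(c-2a)(m+n-1)p<4(m+n)<\big((2b-c)(m+n-1)+4(m+n)\big)p,$$ $$c\le a+b+2.$$
   Context: For relatively prime positive integers $m,n$, the rational Hartogs triangle is $H_{m/n}=\{(z_1,z_2)\in\mathbb C^2:|z_1|^m<|z_2|^n<1\}$. $dV$ denotes Lebesgue measure on $\mathbb C^2$, and $L^p(H_{m/n})$ is taken with respect to $dV$. $B_{m/n}(z,w)$ denotes the Bergman kernel of $H_{m/n}$, i.e. the reproducing kernel of the Hilbert space of holomorphic functions on $H_{m/n}$ that are square integrable with respect to $dV$; it satisfies $B_{m/n}(z,z)>0$. For $a,b\in\mathbb R$ and $c>0$ define $$S^+_{a,b,c}f(z)=\int_{H_{m/n}}\frac{|B_{m/n}(z,w)|^{c/2}}{B_{m/n}(z,z)^{a/2}B_{m/n}(w,w)^{b/2}}\,f(w)\,dV(w).$$ An integral operator is bounded on $L^p$ if for every $f\in L^p$ the defining integral converges absolutely for almost every $z$ and the operator satisfies $\|Sf\|_{L^p}\le C\|f\|_{L^p}$ with $C$ independent of $f$. *)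

theory Defs
  imports "HOL-Analysis.Analysis"
begin

definition hartogs :: "nat \<Rightarrow> nat \<Rightarrow> (complex \<times> complex) set" where
  "hartogs m n = {(z1, z2). norm z1 ^ m < norm z2 ^ n \<and> norm z2 ^ n < 1}"

text \<open>Holomorphy in two variables, on an open set: the (real) Frechet derivative exists at
  every point and is complex linear.\<close>

definition holomorphic2_on :: "(complex \<times> complex \<Rightarrow> complex) \<Rightarrow> (complex \<times> complex) set \<Rightarrow> bool" where
  "holomorphic2_on f \<Omega> \<longleftrightarrow>
     (\<forall>z\<in>\<Omega>. \<exists>d1 d2. (f has_derivative (\<lambda>h. d1 * fst h + d2 * snd h)) (at z))"

definition bergman_space :: "(complex \<times> complex) set \<Rightarrow> (complex \<times> complex \<Rightarrow> complex) set" where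
  "bergman_space \<Omega> = {f. holomorphic2_on f \<Omega> \<and> integrable (lebesgue_on \<Omega>) (\<lambda>z. (norm (f z))\<^sup>2)}"

text \<open>A kernel on \<open>\<Omega>\<close> is a total function here, so its values off
  \<open>\<Omega> \<times> \<Omega>\<close> are fixed to be 0; this makes the reproducing kernel unique.\<close>

definition is_bergman_kernel ::
    "(complex \<times> complex) set \<Rightarrow> (complex \<times> complex \<Rightarrow> complex \<times> complex \<Rightarrow> complex) \<Rightarrow> bool" where
  "is_bergman_kernel \<Omega> K \<longleftrightarrow>
     (\<forall>w\<in>\<Omega>. (\<lambda>z. K z w) \<in> bergman_space \<Omega> \<and>
        (\<forall>f\<in>bergman_space \<Omega>. f w = (\<integral>z. f z * cnj (K z w) \<partial>lebesgue_on \<Omega>))) \<and>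
     (\<forall>z w. z \<notin> \<Omega> \<or> w \<notin> \<Omega> \<longrightarrow> K z w = 0)"

definition bergman_kernel ::
    "(complex \<times> complex) set \<Rightarrow> complex \<times> complex \<Rightarrow> complex \<times> complex \<Rightarrow> complex" where
  "bergman_kernel \<Omega> = (THE K. is_bergman_kernel \<Omega> K)"

text \<open>\<open>L\<^sup>p\<close> is modelled by functions rather than by their almost-everywhere classes.\<close>

definition Lp_space :: "real \<Rightarrow> (complex \<times> complex) set \<Rightarrow> (complex \<times> complex \<Rightarrow> complex) set" where
  "Lp_space p \<Omega> = {f. f \<in> borel_measurable (lebesgue_on \<Omega>) \<and>
     integrable (lebesgue_on \<Omega>) (\<lambda>z. norm (f z) powr p)}"

definition Lp_norm :: "real \<Rightarrow> (complex \<times> complex) set \<Rightarrow> (complex \<times> complex \<Rightarrow> complex) \<Rightarrow> real" where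
  "Lp_norm p \<Omega> f = (\<integral>z. norm (f z) powr p \<partial>lebesgue_on \<Omega>) powr (1 / p)"

definition integral_operator ::
    "(complex \<times> complex) set \<Rightarrow> (complex \<times> complex \<Rightarrow> complex \<times> complex \<Rightarrow> real) \<Rightarrow>
     (complex \<times> complex \<Rightarrow> complex) \<Rightarrow> complex \<times> complex \<Rightarrow> complex" where
  "integral_operator \<Omega> k f z = (\<integral>w. k z w *\<^sub>R f w \<partial>lebesgue_on \<Omega>)"

text \<open>Bochner integrability is absolute convergence. Membership of the image in \<open>L\<^sup>p\<close> is
  required explicitly, because the Bochner integral in \<open>Lp_norm\<close> is 0 when it diverges.\<close>

definition bounded_integral_operator_on_Lp ::
    "(complex \<times> complex) set \<Rightarrow> real \<Rightarrow>
     (complex \<times> complex \<Rightarrow> complex \<times> complex \<Rightarrow> real) \<Rightarrow> bool" where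
  "bounded_integral_operator_on_Lp \<Omega> p k \<longleftrightarrow>
     (\<exists>C. \<forall>f\<in>Lp_space p \<Omega>.
        (AE z in lebesgue_on \<Omega>. integrable (lebesgue_on \<Omega>) (\<lambda>w. k z w *\<^sub>R f w)) \<and>
        integral_operator \<Omega> k f \<in> Lp_space p \<Omega> \<and>
        Lp_norm p \<Omega> (integral_operator \<Omega> k f) \<le> C * Lp_norm p \<Omega> f)"

text \<open>The integral kernel of \<open>S\<^sup>+\<^bsub>a,b,c\<^esub>\<close>. On the diagonal the Bergman kernel is real and
  positive, so taking its real part loses nothing.\<close>

definition S_plus_kernel ::
    "nat \<Rightarrow> nat \<Rightarrow> real \<Rightarrow> real \<Rightarrow> real \<Rightarrow> complex \<times> complex \<Rightarrow> complex \<times> complex \<Rightarrow> real" where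
  "S_plus_kernel m n a b c z w =
     norm (bergman_kernel (hartogs m n) z w) powr (c / 2) /
     (Re (bergman_kernel (hartogs m n) z z) powr (a / 2) *
      Re (bergman_kernel (hartogs m n) w w) powr (b / 2))"

end

theory Submission
  imports Defs "HOL-Complex_Analysis.Complex_Analysis"
begin

text \<open>
  The map \<open>(x, l) \<mapsto> (x l\<^sup>n, l\<^sup>m)\<close> is an \<open>m\<close>-fold covering of the Hartogs triangle by the bidisc without
  \<open>{l = 0}\<close>, so its Bergman kernel arises from that of the bidisc by averaging over the deck group:
  with \<open>v = x cnj y\<close> and \<open>p = l cnj k\<close> it equals
  \<open>P(v, p) / (\<pi>\<^sup>2 m p\<^sup>m\<^sup>+\<^sup>n\<^sup>-\<^sup>1 (1 - v\<^sup>m)\<^sup>2 (1 - p\<^sup>m)\<^sup>2)\<close> for a polynomial \<open>P\<close>. In the variables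
  \<open>z\<^sub>1\<^sup>m / z\<^sub>2\<^sup>n\<close> and \<open>z\<^sub>2\<close> its size therefore splits into a power of \<open>|z\<^sub>2|\<close> at the origin and two
  singularities of disc type, at \<open>|z\<^sub>1\<^sup>m / z\<^sub>2\<^sup>n| = 1\<close> and at \<open>|z\<^sub>2| = 1\<close>.

  Sufficiency is Schur's test with a weight that is a product of powers of these three quantities,
  integrated by the Forelli--Rudin estimates. For necessity, one monomial of \<open>P\<close> dominates when
  \<open>v\<close> or \<open>p\<close> is small, which bounds the kernel from below. Boundedness of the operator and of its
  adjoint then forces the weights to be integrable near \<open>|z\<^sub>2| = 1\<close> and near the origin, and
  \<open>c \<le> a + b + 2\<close> follows by testing on bidiscs of radius \<open>\<eta> / 2\<close> in \<open>z\<^sub>2\<close> that shrink to a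
  boundary point with \<open>|z\<^sub>2| = 1\<close>.
\<close>

section \<open>Integration over the Hartogs triangle\<close>

text \<open>Multiplied by the Jacobian factor l^(m+n-1), a square-integrable holomorphic function on
  the triangle pulls back to one on the bidisc without l = 0. Square integrability makes the
  singularity at l = 0 removable, so the reproducing formula of the full bidisc applies; it comes
  from Cauchy's formula in polar coordinates. The index pairs of \<open>bk_poly\<close> obey the
  congruence l = n r modulo m. Coprimality makes it a bijection of residues, so exactly one monomial
  v^(r-1) p^(l-1) has r = 1 and exactly one has l = 1: the former dominates as v tends to 0, the
  latter as p tends to 0, where it carries the full pole at the origin. Hence the two kinds of
  integrability conditions are tested on different regions. In the sufficiency part c enters the
  disc-type factors only through c <= a + b + 2: these factors have modulus at most 2, so c may be
  raised to the critical exponent a + b + 2, at which the powers of the boundary distances balance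
  exactly in Schur's test. At the origin c is kept, and the strict inequalities with m + n express
  integrability of a power of |z2|.\<close>

lemma ball_measurable[measurable]: "ball (a::'a::metric_space) r \<in> sets borel"
  by simp

lemma emeasure_ball_complex: "0 \<le> r \<Longrightarrow> emeasure lborel (ball (c::complex) r) = ennreal (pi * r\<^sup>2)"
  by (simp add: emeasure_ball unit_ball_vol_2)

lemma emeasure_cball_complex: "0 \<le> r \<Longrightarrow> emeasure lborel (cball (c::complex) r) = ennreal (pi * r\<^sup>2)"
  by (simp add: emeasure_cball unit_ball_vol_2)

lemma nn_integral_distr_borel:
  assumes f: "f \<in> borel_measurable borel" and g: "g \<in> M \<rightarrow>\<^sub>M borel"
  shows "(\<integral>\<^sup>+x. f x \<partial>distr M borel g) = (\<integral>\<^sup>+x. f (g x) \<partial>M)"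
  using f by (intro nn_integral_distr g) simp

lemma nn_integral_lborel_plus:
  fixes a :: "'a::euclidean_space"
  assumes f: "f \<in> borel_measurable borel"
  shows "(\<integral>\<^sup>+x. f (a + x) \<partial>lborel) = (\<integral>\<^sup>+x. f x \<partial>lborel)"
  using nn_integral_distr_borel[OF f, of "(+) a" lborel] by (simp add: lborel_distr_plus)

lemma nn_integral_lborel_uminus:
  fixes f :: "'a::euclidean_space \<Rightarrow> ennreal"
  assumes f: "f \<in> borel_measurable borel"
  shows "(\<integral>\<^sup>+x. f (- x) \<partial>lborel) = (\<integral>\<^sup>+x. f x \<partial>lborel)"
proof -
  have "lborel = density (distr lborel borel (\<lambda>x::'a. - x)) (\<lambda>_. 1)"
    using lborel_affine[of "-1" "0::'a"] by simp
  then have "distr lborel borel (\<lambda>x::'a. - x) = lborel" by (simp add: density_1)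
  then show ?thesis using nn_integral_distr_borel[OF f, of uminus lborel] by simp
qed

text \<open>Uniqueness of Haar measure: the double integral of \<open>1\<^sub>A(x) 1\<^sub>B(x+y)\<close>, evaluated in both
  orders, gives \<open>M A * lborel B = M B * lborel A\<close>.\<close>

lemma translation_invariant_eq_lborel:
  fixes M :: "'a::euclidean_space measure"
  assumes sets[measurable_cong]: "sets M = sets borel"
    and inv: "\<And>a. distr M borel ((+) a) = M"
    and fin: "\<And>r. emeasure M (ball 0 r) < \<infinity>"
    and eq: "emeasure M (ball 0 1) = emeasure lborel (ball (0::'a) 1)"
  shows "M = lborel"
proof (rule measure_eqI)
  show "sets M = sets lborel" by (simp add: sets)
next
  have spM: "space M = UNIV" using sets by (metis sets_eq_imp_space_eq space_borel)
  have "sigma_finite_measure M"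
  proof
    show "\<exists>A. countable A \<and> A \<subseteq> sets M \<and> \<Union>A = space M \<and> (\<forall>a\<in>A. emeasure M a \<noteq> \<infinity>)"
    proof (intro exI conjI ballI)
      show "countable (range (\<lambda>n::nat. ball (0::'a) (real n)))" by simp
      show "range (\<lambda>n::nat. ball (0::'a) (real n)) \<subseteq> sets M" by (auto simp: sets)
      show "(\<Union>n::nat. ball (0::'a) (real n)) = space M"
        using reals_Archimedean2 by (auto simp: spM)
      show "\<And>a. a \<in> range (\<lambda>n::nat. ball (0::'a) (real n)) \<Longrightarrow> emeasure M a \<noteq> \<infinity>"
        using fin by (auto simp: less_top[symmetric])
    qed
  qed
  then interpret M: sigma_finite_measure M .
  interpret P: pair_sigma_finite M lborel ..
  fix A assume "A \<in> sets M"
  then have [measurable]: "A \<in> sets borel" by (simp add: sets)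
  define B where "B = ball (0::'a) 1"
  have [measurable]: "B \<in> sets borel" by (simp add: B_def)
  have eqB: "emeasure M B = emeasure lborel B" using eq by (simp add: B_def)
  have "emeasure M A * emeasure lborel B = (\<integral>\<^sup>+x. indicator A x * (\<integral>\<^sup>+y. indicator B (x + y) \<partial>lborel) \<partial>M)"
  proof -
    have "(\<integral>\<^sup>+y. indicator B (x + y) \<partial>lborel) = emeasure lborel B" for x :: 'a
      by (simp add: nn_integral_lborel_plus)
    then show ?thesis by (simp add: nn_integral_multc)
  qed
  also have "\<dots> = (\<integral>\<^sup>+x. \<integral>\<^sup>+y. indicator A x * indicator B (x + y) \<partial>lborel \<partial>M)"
    by (intro nn_integral_cong) (simp add: nn_integral_cmult)
  also have "\<dots> = (\<integral>\<^sup>+y. \<integral>\<^sup>+x. indicator A x * indicator B (x + y) \<partial>M \<partial>lborel)"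
    by (subst P.Fubini') auto
  also have "\<dots> = (\<integral>\<^sup>+y. \<integral>\<^sup>+x. indicator A (x - y) * indicator B x \<partial>M \<partial>lborel)"
  proof (rule nn_integral_cong)
    fix y :: 'a
    have "(\<integral>\<^sup>+x. indicator A x * indicator B (x + y) \<partial>M)
        = (\<integral>\<^sup>+x. indicator A x * indicator B (x + y) \<partial>distr M borel ((+) (-y)))"
      by (simp add: inv)
    also have "\<dots> = (\<integral>\<^sup>+x. indicator A (x - y) * indicator B x \<partial>M)"
      by (subst nn_integral_distr_borel) simp_all
    finally show "(\<integral>\<^sup>+x. indicator A x * indicator B (x + y) \<partial>M) = (\<integral>\<^sup>+x. indicator A (x - y) * indicator B x \<partial>M)" .
  qed
  also have "\<dots> = (\<integral>\<^sup>+x. \<integral>\<^sup>+y. indicator A (x - y) * indicator B x \<partial>lborel \<partial>M)"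
    by (subst P.Fubini') auto
  also have "\<dots> = (\<integral>\<^sup>+x. emeasure lborel A * indicator B x \<partial>M)"
  proof (intro nn_integral_cong)
    fix x :: 'a
    have "(\<integral>\<^sup>+y. indicator A (x + - y) \<partial>lborel) = (\<integral>\<^sup>+y. indicator A (x + y) \<partial>lborel)"
      by (rule nn_integral_lborel_uminus[where f="\<lambda>y. indicator A (x + y)"]) simp
    then have "(\<integral>\<^sup>+y. indicator A (x - y) \<partial>lborel) = emeasure lborel A" by (simp add: nn_integral_lborel_plus)
    then show "(\<integral>\<^sup>+y. indicator A (x - y) * indicator B x \<partial>lborel) = emeasure lborel A * indicator B x"
      by (simp add: nn_integral_multc)
  qed
  also have "\<dots> = emeasure lborel A * emeasure lborel B" by (simp add: nn_integral_cmult eqB)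
  finally have *: "emeasure M A * emeasure lborel B = emeasure lborel A * emeasure lborel B" .
  have "emeasure lborel B \<noteq> 0" "emeasure lborel B \<noteq> \<infinity>"
    using emeasure_lborel_ball_finite[of "0::'a" 1] unit_ball_vol_pos[of "real DIM('a)"]
    unfolding B_def
    by (auto simp: emeasure_ball ennreal_eq_0_iff not_le)
  then show "emeasure M A = emeasure lborel A"
    using * by (simp add: ennreal_mult_cancel_left mult.commute[of _ "emeasure lborel B"])
qed

text \<open>By the uniqueness lemma only two checks remain: the rescaled image measure is
  translation invariant, because a translation can be pulled through the linear map, and it gives
  balls about 0 the right mass.\<close>

lemma lborel_complex_mult:
  fixes \<alpha> :: complex assumes "\<alpha> \<noteq> 0"
  shows "density (distr lborel borel ((*) \<alpha>)) (\<lambda>_. ennreal ((norm \<alpha>)\<^sup>2)) = lborel"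
proof (rule translation_invariant_eq_lborel)
  let ?M = "density (distr lborel borel ((*) \<alpha>)) (\<lambda>_. ennreal ((norm \<alpha>)\<^sup>2))"
  have [measurable]: "(*) \<alpha> \<in> borel_measurable borel" by simp
  have ball: "emeasure ?M (ball 0 r) = ennreal (pi * r\<^sup>2)" if "0 \<le> r" for r
  proof -
    have "(*) \<alpha> -` ball 0 r = ball 0 (r / norm \<alpha>)"
      using assms by (auto simp: norm_mult field_simps)
    then have "emeasure ?M (ball 0 r) = ennreal ((norm \<alpha>)\<^sup>2) * ennreal (pi * (r / norm \<alpha>)\<^sup>2)"
      using that by (subst emeasure_density) (auto simp: nn_integral_cmult_indicator emeasure_distr emeasure_ball_complex)
    also have "\<dots> = ennreal (pi * r\<^sup>2)"
      using assms by (simp add: ennreal_mult'[symmetric] power_divide)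
    finally show ?thesis .
  qed
  show "sets ?M = sets borel" by simp
  show "emeasure ?M (ball 0 r) < \<infinity>" for r
    by (cases "0 \<le> r") (simp_all add: ball ball_empty)
  show "emeasure ?M (ball 0 1) = emeasure lborel (ball (0::complex) 1)"
    by (simp add: ball emeasure_ball_complex)
  show "distr ?M borel ((+) a) = ?M" for a
  proof (rule measure_eqI)
    fix A assume "A \<in> sets (distr ?M borel ((+) a))"
    then have [measurable]: "A \<in> sets borel" by simp
    have "emeasure (distr ?M borel ((+) a)) A = ennreal ((norm \<alpha>)\<^sup>2) * (\<integral>\<^sup>+z. indicator A (a + \<alpha> * z) \<partial>lborel)"
      by (simp add: nn_integral_indicator[symmetric] nn_integral_distr nn_integral_density nn_integral_cmult
             del: nn_integral_indicator)
    also have "(\<integral>\<^sup>+z. indicator A (a + \<alpha> * z) \<partial>lborel) = (\<integral>\<^sup>+z. indicator A (\<alpha> * (a / \<alpha> + z)) \<partial>lborel)"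
      using assms by (simp add: algebra_simps)
    also have "\<dots> = (\<integral>\<^sup>+z. indicator A (\<alpha> * z) \<partial>lborel)"
      by (rule nn_integral_lborel_plus[where f="\<lambda>z. indicator A (\<alpha> * z)"]) simp
    also have "ennreal ((norm \<alpha>)\<^sup>2) * \<dots> = emeasure ?M A"
      by (simp add: nn_integral_indicator[symmetric] nn_integral_distr nn_integral_density nn_integral_cmult
             del: nn_integral_indicator)
    finally show "emeasure (distr ?M borel ((+) a)) A = emeasure ?M A" .
  qed simp
qed

lemma nn_integral_complex_mult:
  assumes [measurable]: "f \<in> borel_measurable borel" and "\<alpha> \<noteq> (0::complex)"
  shows "(\<integral>\<^sup>+z. f z \<partial>lborel) = ennreal ((norm \<alpha>)\<^sup>2) * (\<integral>\<^sup>+z. f (\<alpha> * z) \<partial>lborel)"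
proof -
  have "(\<integral>\<^sup>+z. f z \<partial>lborel) = (\<integral>\<^sup>+z. f z \<partial>density (distr lborel borel ((*) \<alpha>)) (\<lambda>_. ennreal ((norm \<alpha>)\<^sup>2)))"
    by (simp add: lborel_complex_mult assms)
  also have "\<dots> = ennreal ((norm \<alpha>)\<^sup>2) * (\<integral>\<^sup>+z. f (\<alpha> * z) \<partial>lborel)"
    by (simp add: nn_integral_density nn_integral_distr nn_integral_cmult)
  finally show ?thesis .
qed

text \<open>The disc of radius sqrt x has area pi x, so in the squared radius area becomes pi times
  length and no Jacobian factor appears. This is why squared radii serve as the radial variable
  below. The two measures are compared on half-lines.\<close>

lemma distr_disc_norm_sq:
  "distr (restrict_space lborel (ball (0::complex) 1)) borel (\<lambda>z. (norm z)\<^sup>2)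
     = density lborel (\<lambda>x. ennreal pi * indicator {0<..<1} x)"
    (is "?L = ?R")
proof (rule measure_eqI_lessThan)
  have [measurable]: "(\<lambda>z::complex. (norm z)\<^sup>2) \<in> borel_measurable (restrict_space lborel (ball 0 1))"
    by (intro measurable_restrict_space1) simp
  have L: "emeasure ?L {x<..} = emeasure lborel {z. norm (z::complex) < 1 \<and> x < (norm z)\<^sup>2}" for x
  proof -
    have "emeasure ?L {x<..} = emeasure (restrict_space lborel (ball (0::complex) 1)) ((\<lambda>z. (norm z)\<^sup>2) -` {x<..} \<inter> ball 0 1)"
      by (subst emeasure_distr) (auto simp: space_restrict_space)
    also have "\<dots> = emeasure lborel ((\<lambda>z::complex. (norm z)\<^sup>2) -` {x<..} \<inter> ball 0 1)"
      by (rule emeasure_restrict_space) auto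
    also have "(\<lambda>z::complex. (norm z)\<^sup>2) -` {x<..} \<inter> ball 0 1 = {z. norm (z::complex) < 1 \<and> x < (norm z)\<^sup>2}"
      by auto
    finally show ?thesis .
  qed
  have R: "emeasure ?R {x<..} = ennreal pi * emeasure lborel ({0<..<1} \<inter> {x<..})" for x
  proof -
    have "emeasure ?R {x<..} = (\<integral>\<^sup>+y. ennreal pi * indicator ({0<..<1} \<inter> {x<..}) y \<partial>lborel)"
      by (subst emeasure_density) (auto intro!: nn_integral_cong simp: indicator_def)
    then show ?thesis by (simp add: nn_integral_cmult)
  qed
  show "sets ?L = sets borel" "sets ?R = sets borel" by auto
  show eq: "emeasure ?L {x<..} = emeasure ?R {x<..}" for x
  proof -
    consider "x < 0" | "0 \<le> x" "x < 1" | "1 \<le> x" by linarith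
    then show ?thesis
    proof cases
      case 1
      then have "{z. norm (z::complex) < 1 \<and> x < (norm z)\<^sup>2} = ball 0 1"
        by (auto intro: less_le_trans)
      moreover have "{0<..<1} \<inter> {x<..} = {0<..<1::real}" using 1 by auto
      ultimately show ?thesis by (simp add: L R emeasure_ball_complex)
    next
      case 2
      have "{z. norm (z::complex) < 1 \<and> x < (norm z)\<^sup>2} = ball 0 1 - cball 0 (sqrt x)"
      proof -
        have "x < (norm z)\<^sup>2 \<longleftrightarrow> sqrt x < norm z" for z :: complex
          using real_sqrt_less_iff[of x "(norm z)\<^sup>2"] by simp
        then show ?thesis unfolding set_eq_iff mem_Collect_eq Diff_iff mem_ball_0 mem_cball_0 not_le by blast
      qed
      moreover have "emeasure lborel (ball 0 1 - cball (0::complex) (sqrt x)) = ennreal pi - ennreal (pi * x)"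
        using 2 le_less_trans[of _ "sqrt x" 1]
        by (subst emeasure_Diff) (auto simp: emeasure_ball_complex emeasure_cball_complex)
      moreover have "{0<..<1} \<inter> {x<..} = {x<..<1::real}" using 2 by auto
      ultimately show ?thesis using 2
        by (simp add: L R ennreal_minus ennreal_mult'[symmetric] algebra_simps)
    next
      case 3
      have "(norm z)\<^sup>2 \<le> x" if "norm z < 1" for z :: complex
        using 3 power_le_one[of "norm z" 2] that by simp
      then have "{z. norm (z::complex) < 1 \<and> x < (norm z)\<^sup>2} = {}" by (force simp: not_le)
      moreover have "{0<..<1} \<inter> {x<..} = ({}::real set)" using 3 by auto
      ultimately show ?thesis unfolding L R by (simp only: emeasure_empty mult_zero_right)
    qed
  qed
  show "emeasure ?L {x<..} < \<infinity>" for x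
  proof -
    have "emeasure lborel ({0<..<1} \<inter> {x<..}) \<le> emeasure lborel {0<..<1::real}"
      by (intro emeasure_mono) auto
    then have "ennreal pi * emeasure lborel ({0<..<1} \<inter> {x<..}) \<le> ennreal pi * 1"
      by (intro mult_left_mono) auto
    also have "\<dots> < \<infinity>" by simp
    finally show ?thesis unfolding eq R .
  qed
qed

lemma nn_integral_disc_radial:
  fixes f :: "real \<Rightarrow> ennreal"
  assumes [measurable]: "f \<in> borel_measurable borel"
  shows "(\<integral>\<^sup>+z. f ((norm (z::complex))\<^sup>2) * indicator (ball 0 1) z \<partial>lborel)
       = ennreal pi * (\<integral>\<^sup>+x. f x * indicator {0<..<1} x \<partial>lborel)"
proof -
  have m[measurable]: "(\<lambda>z::complex. (norm z)\<^sup>2) \<in> borel_measurable (restrict_space lborel (ball 0 1))"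
    by (intro measurable_restrict_space1) simp
  have "(\<integral>\<^sup>+z. f ((norm (z::complex))\<^sup>2) * indicator (ball 0 1) z \<partial>lborel)
      = (\<integral>\<^sup>+z. f ((norm (z::complex))\<^sup>2) \<partial>restrict_space lborel (ball 0 1))"
    by (subst nn_integral_restrict_space) auto
  also have "\<dots> = (\<integral>\<^sup>+x. f x \<partial>distr (restrict_space lborel (ball (0::complex) 1)) borel (\<lambda>z. (norm z)\<^sup>2))"
    by (subst nn_integral_distr) auto
  also have "\<dots> = (\<integral>\<^sup>+x. ennreal pi * indicator {0<..<1} x * f x \<partial>lborel)"
    unfolding distr_disc_norm_sq by (subst nn_integral_density) auto
  also have "\<dots> = ennreal pi * (\<integral>\<^sup>+x. f x * indicator {0<..<1} x \<partial>lborel)"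
    by (subst nn_integral_cmult[symmetric]) (auto simp: ac_simps)
  finally show ?thesis .
qed

lemma nn_integral_disc_rotate:
  assumes [measurable]: "f \<in> borel_measurable borel"
  shows "(\<integral>\<^sup>+z. f (cis t * z) * indicator (ball 0 1) z \<partial>lborel) = (\<integral>\<^sup>+z. f z * indicator (ball (0::complex) 1) z \<partial>lborel)"
proof -
  have "indicator (ball 0 1) (cis t * z) = (indicator (ball 0 1) z :: ennreal)" for z
    by (auto simp: indicator_def norm_mult)
  then show ?thesis
    by (subst (2) nn_integral_complex_mult[where \<alpha>="cis t"]) auto
qed

lemma cis_measurable[measurable]: "cis \<in> borel_measurable borel"
  by (intro borel_measurable_continuous_onI continuous_intros)

text \<open>Periodicity of \<open>cis\<close>: the shift is reduced modulo 2 pi to some b in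
  \<open>{0..<2*pi}\<close>, and the part of the interval that overshoots is moved back by one
  period.\<close>

lemma nn_integral_circle_shift:
  fixes f :: "complex \<Rightarrow> ennreal"
  assumes [measurable]: "f \<in> borel_measurable borel"
  shows "(\<integral>\<^sup>+t. f (cis (t + a)) * indicator {0..<2*pi} t \<partial>lborel) = (\<integral>\<^sup>+t. f (cis t) * indicator {0..<2*pi} t \<partial>lborel)"
proof -
  define g where "g t = f (cis t)" for t
  have [measurable]: "g \<in> borel_measurable borel"
    unfolding g_def by (intro measurable_compose[OF _ assms] borel_measurable_continuous_onI) (auto intro!: continuous_intros)
  have sh: "(\<integral>\<^sup>+t. h t \<partial>lborel) = (\<integral>\<^sup>+t. h (t + c) \<partial>lborel)" if "h \<in> borel_measurable borel"
    for h :: "real \<Rightarrow> ennreal" and c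
    using nn_integral_lborel_plus[OF that, of c] by (simp add: add.commute)
  have per: "g (t + 2 * pi * of_int k) = g t" for t k
    by (simp add: g_def cis_mult[symmetric] cis_multiple_2pi)
  define k where "k = \<lfloor>a / (2*pi)\<rfloor>"
  define b where "b = a - 2*pi*k"
  have b: "0 \<le> b" "b < 2*pi"
    using floor_divide_lower[of "2*pi" a] floor_divide_upper[of "2*pi" a] unfolding b_def k_def
    by (auto simp: algebra_simps)
  have ga: "g (t + a) = g (t + b)" for t
    using per[of "t + b" k] by (simp add: b_def algebra_simps)
  have "(\<integral>\<^sup>+t. g (t + a) * indicator {0..<2*pi} t \<partial>lborel) = (\<integral>\<^sup>+t. g (t + b) * indicator {0..<2*pi} t \<partial>lborel)"
    by (simp add: ga)
  also have "\<dots> = (\<integral>\<^sup>+t. g t * indicator {b..<2*pi+b} t \<partial>lborel)"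
    by (subst (2) sh[where c=b]) (auto intro!: nn_integral_cong simp: indicator_def)
  also have "\<dots> = (\<integral>\<^sup>+t. g t * indicator {b..<2*pi} t + g t * indicator {2*pi..<2*pi+b} t \<partial>lborel)"
    using b by (auto intro!: nn_integral_cong simp: indicator_def)
  also have "\<dots> = (\<integral>\<^sup>+t. g t * indicator {b..<2*pi} t \<partial>lborel) + (\<integral>\<^sup>+t. g t * indicator {2*pi..<2*pi+b} t \<partial>lborel)"
    by (subst nn_integral_add) auto
  also have "(\<integral>\<^sup>+t. g t * indicator {2*pi..<2*pi+b} t \<partial>lborel) = (\<integral>\<^sup>+t. g t * indicator {0..<b} t \<partial>lborel)"
    using per[of _ 1]
    by (subst sh[where c="2*pi"]) (auto intro!: nn_integral_cong simp: indicator_def)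
  also have "(\<integral>\<^sup>+t. g t * indicator {b..<2*pi} t \<partial>lborel) + (\<integral>\<^sup>+t. g t * indicator {0..<b} t \<partial>lborel)
     = (\<integral>\<^sup>+t. g t * indicator {b..<2*pi} t + g t * indicator {0..<b} t \<partial>lborel)"
    by (subst nn_integral_add) auto
  also have "\<dots> = (\<integral>\<^sup>+t. g t * indicator {0..<2*pi} t \<partial>lborel)"
    using b by (auto intro!: nn_integral_cong simp: indicator_def)
  finally show ?thesis unfolding g_def .
qed

text \<open>Rotating by \<open>r * t\<close> instead of \<open>t\<close> lets the same averaging serve for power maps.\<close>

lemma nn_integral_disc_average:
  fixes f :: "complex \<Rightarrow> ennreal" and r :: real
  assumes [measurable]: "f \<in> borel_measurable borel"
  shows "(\<integral>\<^sup>+z. f z * indicator (ball 0 1) z \<partial>lborel)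
       = (\<integral>\<^sup>+z. ennreal (1/(2*pi)) * (\<integral>\<^sup>+t. f (cis (r * t) * z) * indicator {0..<2*pi} t \<partial>lborel) * indicator (ball 0 1) z \<partial>lborel)"
proof -
  have "(\<integral>\<^sup>+z. ennreal (1/(2*pi)) * (\<integral>\<^sup>+t. f (cis (r * t) * z) * indicator {0..<2*pi} t \<partial>lborel) * indicator (ball 0 1) z \<partial>lborel)
     = (\<integral>\<^sup>+z. (\<integral>\<^sup>+t. ennreal (1/(2*pi)) * (f (cis (r * t) * z) * indicator {0..<2*pi} t) * indicator (ball 0 1) z \<partial>lborel) \<partial>lborel)"
    by (intro nn_integral_cong) (simp add: nn_integral_cmult nn_integral_multc)
  also have "\<dots> = (\<integral>\<^sup>+t. (\<integral>\<^sup>+z. ennreal (1/(2*pi)) * (f (cis (r * t) * z) * indicator {0..<2*pi} t) * indicator (ball 0 1) z \<partial>lborel) \<partial>lborel)"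
    by (rule lborel_pair.Fubini') measurable
  also have "\<dots> = (\<integral>\<^sup>+t. (\<integral>\<^sup>+z. f z * indicator (ball 0 1) z \<partial>lborel) * ennreal (1/(2*pi)) * indicator {0..<2*pi} t \<partial>lborel)"
  proof (intro nn_integral_cong)
    fix t :: real
    have "(\<integral>\<^sup>+z. ennreal (1/(2*pi)) * (f (cis (r * t) * z) * indicator {0..<2*pi} t) * indicator (ball 0 1) z \<partial>lborel)
       = (\<integral>\<^sup>+z. (ennreal (1/(2*pi)) * indicator {0..<2*pi} t) * (f (cis (r * t) * z) * indicator (ball 0 1) z) \<partial>lborel)"
      by (simp add: ac_simps)
    also have "\<dots> = (ennreal (1/(2*pi)) * indicator {0..<2*pi} t) * (\<integral>\<^sup>+z. f z * indicator (ball 0 1) z \<partial>lborel)"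
      by (subst nn_integral_cmult) (auto simp: nn_integral_disc_rotate)
    finally show "(\<integral>\<^sup>+z. ennreal (1/(2*pi)) * (f (cis (r * t) * z) * indicator {0..<2*pi} t) * indicator (ball 0 1) z \<partial>lborel)
       = (\<integral>\<^sup>+z. f z * indicator (ball 0 1) z \<partial>lborel) * ennreal (1/(2*pi)) * indicator {0..<2*pi} t"
      by (simp add: ac_simps)
  qed
  also have "\<dots> = (\<integral>\<^sup>+z. f z * indicator (ball 0 1) z \<partial>lborel) * (ennreal (1/(2*pi)) * ennreal (2*pi))"
    by (simp add: nn_integral_cmult mult.assoc)
  also have "ennreal (1/(2*pi)) * ennreal (2*pi) = 1" by (simp add: ennreal_mult'[symmetric])
  finally show ?thesis by simp
qed

lemma nn_integral_indicator_Ioo_Icc: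
  fixes f :: "real \<Rightarrow> ennreal"
  shows "(\<integral>\<^sup>+x. f x * indicator {a<..<b} x \<partial>lborel) = (\<integral>\<^sup>+x. f x * indicator {a..b} x \<partial>lborel)"
proof (rule nn_integral_cong_AE)
  have "AE x in lborel. x \<noteq> a" "AE x in lborel. x \<noteq> b" by (auto intro: AE_lborel_singleton)
  then show "AE x in lborel. f x * indicator {a<..<b} x = f x * indicator {a..b} x"
    by eventually_elim (auto simp: indicator_def)
qed

section \<open>Polar coordinates and power maps on the disc\<close>

definition bidisc :: "(complex \<times> complex) set" where "bidisc = ball 0 1 \<times> ball 0 1"

lemma bidisc_measurable[measurable]: "bidisc \<in> sets borel"
  by (simp add: bidisc_def open_Times)

lemma bidisc_iff: "(x, y) \<in> bidisc \<longleftrightarrow> norm x < 1 \<and> norm y < 1"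
  by (simp add: bidisc_def)

lemma indicator_bidisc: "indicator bidisc (x, y) = indicator (ball 0 1) x * (indicator (ball 0 1) y :: 'a::semiring_1)"
  by (auto simp: bidisc_def indicator_def)

lemma emeasure_bidisc: "emeasure lborel bidisc = ennreal (pi * pi)"
  unfolding bidisc_def
  by (subst lborel_prod[symmetric], subst lborel.emeasure_pair_measure_Times) (simp_all add: emeasure_ball_complex ennreal_mult)

text \<open>The argument \<open>x\<close> is the squared radius, in keeping with
  \<open>distr_disc_norm_sq\<close>.\<close>

definition circle_mean :: "(complex \<Rightarrow> ennreal) \<Rightarrow> real \<Rightarrow> ennreal" where
  "circle_mean f x = ennreal (1/(2*pi)) * (\<integral>\<^sup>+t. f (complex_of_real (sqrt x) * cis t) * indicator {0..<2*pi} t \<partial>lborel)"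

lemma circle_mean_measurable[measurable]:
  assumes [measurable]: "f \<in> borel_measurable borel"
  shows "circle_mean f \<in> borel_measurable borel"
  unfolding circle_mean_def by measurable

lemma circle_mean_rotate:
  assumes [measurable]: "f \<in> borel_measurable borel"
  shows "ennreal (1/(2*pi)) * (\<integral>\<^sup>+t. f (cis t * z) * indicator {0..<2*pi} t \<partial>lborel) = circle_mean f ((norm z)\<^sup>2)"
proof -
  have "cis t * z = complex_of_real (norm z) * cis (t + Arg z)" for t
    using rcis_cmod_Arg[of z] by (metis cis_mult mult.assoc mult.left_commute rcis_def)
  then have "(\<integral>\<^sup>+t. f (cis t * z) * indicator {0..<2*pi} t \<partial>lborel)
      = (\<integral>\<^sup>+t. f (complex_of_real (norm z) * cis (t + Arg z)) * indicator {0..<2*pi} t \<partial>lborel)"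
    by simp
  also have "\<dots> = (\<integral>\<^sup>+t. f (complex_of_real (norm z) * cis t) * indicator {0..<2*pi} t \<partial>lborel)"
    by (rule nn_integral_circle_shift[where f="\<lambda>w. f (complex_of_real (norm z) * w)"]) simp
  finally show ?thesis by (simp add: circle_mean_def)
qed

lemma nn_integral_disc_polar:
  assumes [measurable]: "f \<in> borel_measurable borel"
  shows "(\<integral>\<^sup>+z. f z * indicator (ball 0 1) z \<partial>lborel) = ennreal pi * (\<integral>\<^sup>+x. circle_mean f x * indicator {0<..<1} x \<partial>lborel)"
  using nn_integral_disc_average[OF assms, of 1]
  by (simp add: circle_mean_rotate nn_integral_disc_radial)

text \<open>The map z -> z^m has real Jacobian m^2 |z|^(2(m-1)) and covers the disc m times, which
  leaves one factor m in the weight. Averaging over rotations by t/m makes the integrand radial, and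
  the claim becomes the substitution x -> x^m on the unit interval.\<close>

lemma nn_integral_disc_power:
  fixes f :: "complex \<Rightarrow> ennreal"
  assumes [measurable]: "f \<in> borel_measurable borel" and m: "0 < m"
  shows "(\<integral>\<^sup>+z. f z * indicator (ball 0 1) z \<partial>lborel)
       = (\<integral>\<^sup>+z. ennreal (real m * norm z ^ (2 * (m - 1))) * f (z ^ m) * indicator (ball 0 1) z \<partial>lborel)"
proof -
  have "(\<integral>\<^sup>+z. ennreal (real m * norm z ^ (2 * (m - 1))) * f (z ^ m) * indicator (ball 0 1) z \<partial>lborel)
     = (\<integral>\<^sup>+z. (ennreal (1/(2*pi)) * (\<integral>\<^sup>+t. ennreal (real m * norm (cis (1/m * t) * z) ^ (2 * (m - 1))) * f ((cis (1/m * t) * z) ^ m) * indicator {0..<2*pi} t \<partial>lborel)) * indicator (ball 0 1) z \<partial>lborel)"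
    by (rule nn_integral_disc_average) measurable
  also have "\<dots> = (\<integral>\<^sup>+z. (ennreal (real m * ((norm (z::complex))\<^sup>2) ^ (m - 1)) * circle_mean f (((norm z)\<^sup>2)^m)) * indicator (ball 0 1) z \<partial>lborel)"
  proof (intro nn_integral_cong)
    fix z :: complex
    \<comment> \<open>Rotating z by t/m rotates z^m by t, so one turn of t sweeps the whole circle
      through z^m.\<close>
    have 1: "(cis (1/m * t) * z) ^ m = cis t * z ^ m" for t
    proof -
      have "cis (1/m * t) ^ m = cis t" using m by (subst Complex.DeMoivre) simp
      then show ?thesis by (simp add: power_mult_distrib)
    qed
    have "(\<integral>\<^sup>+t. ennreal (real m * norm (cis (1/m * t) * z) ^ (2 * (m - 1))) * f ((cis (1/m * t) * z) ^ m) * indicator {0..<2*pi} t \<partial>lborel)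
       = (\<integral>\<^sup>+t. ennreal (real m * norm z ^ (2 * (m - 1))) * (f (cis t * z ^ m) * indicator {0..<2*pi} t) \<partial>lborel)"
      unfolding 1 by (simp add: norm_mult mult.assoc)
    also have "\<dots> = ennreal (real m * norm z ^ (2 * (m - 1))) * (\<integral>\<^sup>+t. f (cis t * z ^ m) * indicator {0..<2*pi} t \<partial>lborel)"
      by (rule nn_integral_cmult) measurable
    finally have "ennreal (1/(2*pi)) * (\<integral>\<^sup>+t. ennreal (real m * norm (cis (1/m * t) * z) ^ (2 * (m - 1))) * f ((cis (1/m * t) * z) ^ m) * indicator {0..<2*pi} t \<partial>lborel)
       = ennreal (real m * norm z ^ (2 * (m - 1))) * circle_mean f ((norm (z^m))\<^sup>2)"
      by (simp add: circle_mean_rotate[symmetric] ac_simps)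
    then show "(ennreal (1/(2*pi)) * (\<integral>\<^sup>+t. ennreal (real m * norm (cis (1/m * t) * z) ^ (2 * (m - 1))) * f ((cis (1/m * t) * z) ^ m) * indicator {0..<2*pi} t \<partial>lborel)) * indicator (ball 0 1) z
       = (ennreal (real m * ((norm z)\<^sup>2) ^ (m - 1)) * circle_mean f (((norm z)\<^sup>2)^m)) * indicator (ball 0 1) z"
      by (simp add: norm_power power_mult[symmetric] mult.commute)
  qed
  also have "\<dots> = ennreal pi * (\<integral>\<^sup>+x. (ennreal (real m * x ^ (m - 1)) * circle_mean f (x^m)) * indicator {0<..<1} x \<partial>lborel)"
    by (rule nn_integral_disc_radial) measurable
  also have "(\<integral>\<^sup>+x. (ennreal (real m * x ^ (m - 1)) * circle_mean f (x^m)) * indicator {0<..<1} x \<partial>lborel)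
     = (\<integral>\<^sup>+x. circle_mean f (x^m) * ennreal (real m * x ^ (m - 1)) * indicator {0..1} x \<partial>lborel)"
    unfolding nn_integral_indicator_Ioo_Icc by (simp add: ac_simps)
  also have "\<dots> = (\<integral>\<^sup>+x. circle_mean f x * indicator {0^m..1^m} x \<partial>lborel)"
    by (rule nn_integral_substitution_aux[symmetric]) (auto intro!: derivative_eq_intros continuous_intros)
  also have "\<dots> = (\<integral>\<^sup>+x. circle_mean f x * indicator {0<..<1} x \<partial>lborel)"
    using m unfolding nn_integral_indicator_Ioo_Icc by (simp add: zero_power)
  also have "ennreal pi * \<dots> = (\<integral>\<^sup>+z. f z * indicator (ball 0 1) z \<partial>lborel)"
    by (simp add: nn_integral_disc_polar)
  finally show ?thesis by simp
qed

lemma nn_integral_lborel_pair: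
  fixes f :: "'a::euclidean_space \<times> 'b::euclidean_space \<Rightarrow> ennreal"
  assumes [measurable]: "f \<in> borel_measurable borel"
  shows "(\<integral>\<^sup>+z. f z \<partial>lborel) = (\<integral>\<^sup>+y. \<integral>\<^sup>+x. f (x, y) \<partial>lborel \<partial>lborel)"
    and "(\<integral>\<^sup>+z. f z \<partial>lborel) = (\<integral>\<^sup>+x. \<integral>\<^sup>+y. f (x, y) \<partial>lborel \<partial>lborel)"
proof -
  have *: "f \<in> borel_measurable (lborel \<Otimes>\<^sub>M lborel)" by (simp add: lborel_prod)
  show "(\<integral>\<^sup>+z. f z \<partial>lborel) = (\<integral>\<^sup>+y. \<integral>\<^sup>+x. f (x, y) \<partial>lborel \<partial>lborel)"
    by (subst lborel_prod[symmetric]) (rule lborel_pair.nn_integral_snd[OF *, symmetric])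
  show "(\<integral>\<^sup>+z. f z \<partial>lborel) = (\<integral>\<^sup>+x. \<integral>\<^sup>+y. f (x, y) \<partial>lborel \<partial>lborel)"
    by (subst lborel_prod[symmetric]) (rule lborel.nn_integral_fst[OF *, symmetric])
qed

section \<open>The covering of the Hartogs triangle by the bidisc\<close>

lemma open_hartogs: "open (hartogs m n)"
proof -
  have "hartogs m n = {z. norm (fst z) ^ m < norm (snd z) ^ n} \<inter> {z. norm (snd z) ^ n < 1}"
    by (auto simp: hartogs_def)
  then show ?thesis by (auto intro!: open_Int open_Collect_less continuous_intros)
qed

lemma hartogs_measurable[measurable]: "hartogs m n \<in> sets borel"
  by (simp add: open_hartogs)

definition hmap :: "nat \<Rightarrow> nat \<Rightarrow> complex \<times> complex \<Rightarrow> complex \<times> complex" where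
  "hmap m n x = (fst x * snd x ^ n, snd x ^ m)"

lemma hmap_measurable[measurable]: "hmap m n \<in> borel_measurable borel"
  unfolding hmap_def by (intro borel_measurable_continuous_onI continuous_intros)

text \<open>Both |z1|^m and |z2|^n acquire the factor |l|^(mn), so the first defining inequality
  reduces to |x|^m < 1.\<close>

lemma hmap_in_hartogs_iff:
  assumes "0 < m" "0 < n" "l \<noteq> 0"
  shows "hmap m n (x, l) \<in> hartogs m n \<longleftrightarrow> norm x < 1 \<and> norm l < 1"
proof -
  have "norm (x * l ^ n) ^ m < norm (l ^ m) ^ n \<longleftrightarrow> norm x ^ m * norm l ^ (m * n) < 1 * norm l ^ (m * n)"
    by (simp add: norm_mult norm_power power_mult_distrib power_mult[symmetric] mult.commute)
  also have "\<dots> \<longleftrightarrow> norm x ^ m < 1" using assms by (intro mult_less_cancel_right_pos zero_less_power) simp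
  also have "\<dots> \<longleftrightarrow> norm x < 1" using assms by (simp add: power_less_one_iff)
  finally have 1: "norm (x * l ^ n) ^ m < norm (l ^ m) ^ n \<longleftrightarrow> norm x < 1" .
  have "norm (l ^ m) ^ n < 1 \<longleftrightarrow> norm l < 1"
    using assms by (simp add: norm_power power_mult[symmetric] power_less_one_iff)
  with 1 show ?thesis by (auto simp: hmap_def hartogs_def)
qed

lemma hmap_weight_measurable[measurable]:
  "(\<lambda>x::complex \<times> complex. ennreal (real m * norm (snd x) ^ k)) \<in> borel_measurable borel"
  by (intro measurable_compose[OF _ measurable_ennreal] borel_measurable_continuous_onI continuous_intros)

text \<open>For fixed l, multiplication by l^n in the first variable contributes |l|^(2n), and the
  power map l -> l^m contributes m |l|^(2(m-1)). The factor is m instead of m^2 because the covering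
  has m sheets.\<close>

lemma nn_integral_hartogs:
  assumes [measurable]: "f \<in> borel_measurable borel" and m: "0 < m" and n: "0 < n"
  shows "(\<integral>\<^sup>+z. f z * indicator (hartogs m n) z \<partial>lborel)
     = (\<integral>\<^sup>+x. ennreal (real m * norm (snd x) ^ (2 * (m + n - 1))) * f (hmap m n x) * indicator bidisc x \<partial>lborel)"
proof -
  define J where "J y = (\<integral>\<^sup>+x. f (x, y) * indicator (hartogs m n) (x, y) \<partial>lborel)" for y
  have [measurable]: "J \<in> borel_measurable borel" unfolding J_def by measurable
  have [measurable]: "(\<lambda>x. f (hmap m n x)) \<in> borel_measurable borel"
    by (rule measurable_compose[OF hmap_measurable assms(1)])
  have nz: "AE l in lborel. l \<noteq> (0::complex)" by (rule AE_lborel_singleton)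
  have "(\<integral>\<^sup>+z. f z * indicator (hartogs m n) z \<partial>lborel) = (\<integral>\<^sup>+y. J y \<partial>lborel)"
    unfolding J_def by (rule nn_integral_lborel_pair) measurable
  also have "\<dots> = (\<integral>\<^sup>+y. J y * indicator (ball 0 1) y \<partial>lborel)"
  proof (intro nn_integral_cong)
    fix y :: complex
    show "J y = J y * indicator (ball 0 1) y"
    proof (cases "norm y < 1")
      case False
      then have "(x, y) \<notin> hartogs m n" for x
        using n one_le_power[of "norm y" n] by (auto simp: hartogs_def not_less)
      then show ?thesis by (simp add: J_def)
    qed auto
  qed
  also have "\<dots> = (\<integral>\<^sup>+l. ennreal (real m * norm l ^ (2 * (m - 1))) * J (l ^ m) * indicator (ball 0 1) l \<partial>lborel)"
    by (rule nn_integral_disc_power) (auto simp: m)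
  also have "\<dots> = (\<integral>\<^sup>+l. (\<integral>\<^sup>+x. ennreal (real m * norm l ^ (2 * (m + n - 1))) * f (hmap m n (x, l)) * indicator bidisc (x, l) \<partial>lborel) \<partial>lborel)"
  proof (rule nn_integral_cong_AE, use nz in eventually_elim)
    fix l :: complex assume l: "l \<noteq> 0"
    have "J (l ^ m) = ennreal ((norm (l^n))\<^sup>2) * (\<integral>\<^sup>+x. f (l^n * x, l^m) * indicator (hartogs m n) (l^n * x, l^m) \<partial>lborel)"
      unfolding J_def using l by (intro nn_integral_complex_mult) auto
    also have "(\<integral>\<^sup>+x. f (l^n * x, l^m) * indicator (hartogs m n) (l^n * x, l^m) \<partial>lborel)
      = (\<integral>\<^sup>+x. f (hmap m n (x, l)) * indicator bidisc (x, l) \<partial>lborel)"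
    proof (intro nn_integral_cong)
      fix x
      have "(l^n * x, l^m) = hmap m n (x, l)" by (simp add: hmap_def)
      then show "f (l^n * x, l^m) * indicator (hartogs m n) (l^n * x, l^m) = f (hmap m n (x, l)) * indicator bidisc (x, l)"
        using hmap_in_hartogs_iff[OF m n l, of x] by (auto simp: indicator_def bidisc_iff)
    qed
    finally have J: "J (l ^ m) = ennreal ((norm (l^n))\<^sup>2) * (\<integral>\<^sup>+x. f (hmap m n (x, l)) * indicator bidisc (x, l) \<partial>lborel)" .
    have e: "norm l ^ (2 * (m - 1)) * (norm (l^n))\<^sup>2 = norm l ^ (2 * (m + n - 1))"
    proof -
      have "2 * (m + n - 1) = 2 * (m - 1) + n * 2" using m by simp
      then show ?thesis by (simp only: power_add power_mult norm_power)
    qed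
    have "(\<integral>\<^sup>+x. ennreal (real m * norm l ^ (2 * (m + n - 1))) * f (hmap m n (x, l)) * indicator bidisc (x, l) \<partial>lborel)
       = ennreal (real m * norm l ^ (2 * (m + n - 1))) * (\<integral>\<^sup>+x. f (hmap m n (x, l)) * indicator bidisc (x, l) \<partial>lborel)"
      by (subst nn_integral_cmult[symmetric]) (auto simp: mult.assoc)
    also have "\<dots> = ennreal (real m * norm l ^ (2 * (m - 1))) * J (l ^ m)"
      unfolding J e[symmetric] by (simp add: ennreal_mult mult.assoc)
    also have "\<dots> = ennreal (real m * norm l ^ (2 * (m - 1))) * J (l ^ m) * indicator (ball 0 1) l"
    proof (cases "norm l < 1")
      case False
      then have "indicator bidisc (x, l) = (0::ennreal)" for x :: complex by (auto simp: bidisc_iff)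
      then show ?thesis by (simp add: J)
    qed auto
    finally show "ennreal (real m * norm l ^ (2 * (m - 1))) * J (l ^ m) * indicator (ball 0 1) l
       = (\<integral>\<^sup>+x. ennreal (real m * norm l ^ (2 * (m + n - 1))) * f (hmap m n (x, l)) * indicator bidisc (x, l) \<partial>lborel)" ..
  qed
  also have "\<dots> = (\<integral>\<^sup>+x. ennreal (real m * norm (snd x) ^ (2 * (m + n - 1))) * f (hmap m n x) * indicator bidisc x \<partial>lborel)"
    by (rule nn_integral_lborel_pair(1)[of "\<lambda>x. ennreal (real m * norm (snd x) ^ (2 * (m + n - 1))) * f (hmap m n x) * indicator bidisc x", simplified fst_conv snd_conv, symmetric])
       (intro borel_measurable_times_ennreal hmap_weight_measurable borel_measurable_indicator bidisc_measurable; simp)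
  finally show ?thesis .
qed

text \<open>The same change of variables as an equality of measures; in this form it also transfers
  Bochner integrals of complex functions, in \<open>integral_hartogs\<close>.\<close>

lemma distr_hmap:
  assumes m: "0 < m" and n: "0 < n"
  shows "distr (density lborel (\<lambda>x. ennreal (real m * norm (snd x) ^ (2 * (m + n - 1))) * indicator bidisc x)) borel (hmap m n)
    = density lborel (indicator (hartogs m n))" (is "distr (density lborel ?d) borel _ = ?R")
proof (rule measure_eqI)
  fix A assume "A \<in> sets (distr (density lborel ?d) borel (hmap m n))"
  then have [measurable]: "A \<in> sets borel" by simp
  have [measurable]: "?d \<in> borel_measurable borel"
    by (intro borel_measurable_times_ennreal hmap_weight_measurable borel_measurable_indicator bidisc_measurable)
  have [measurable]: "(\<lambda>x. indicator A (hmap m n x) :: ennreal) \<in> borel_measurable borel"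
    by (rule measurable_compose[OF hmap_measurable]) measurable
  have "emeasure (distr (density lborel ?d) borel (hmap m n)) A = (\<integral>\<^sup>+x. indicator A x \<partial>distr (density lborel ?d) borel (hmap m n))"
    by simp
  also have "\<dots> = (\<integral>\<^sup>+x. indicator A (hmap m n x) \<partial>density lborel ?d)"
    by (rule nn_integral_distr_borel) auto
  also have "\<dots> = (\<integral>\<^sup>+x. ?d x * indicator A (hmap m n x) \<partial>lborel)"
    by (rule nn_integral_density) auto
  also have "\<dots> = (\<integral>\<^sup>+z. indicator A z * indicator (hartogs m n) z \<partial>lborel)"
    using nn_integral_hartogs[of "indicator A" m n] m n by (simp add: ac_simps)
  also have "\<dots> = emeasure ?R A"
    by (subst emeasure_density) (auto simp: mult.commute)
  finally show "emeasure (distr (density lborel ?d) borel (hmap m n)) A = emeasure ?R A" .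
qed simp

section \<open>The reproducing formula for the bidisc\<close>

text \<open>Young's inequality for f / a^(1/p) and g / b^(1/q), multiplied back and integrated. The
  bounds a and b stand in place of the norms, so callers need only estimates; the cases a = 0 and b
  = 0 are separate because the normalisation divides by them.\<close>

lemma nn_integral_Holder:
  fixes f g :: "'a \<Rightarrow> real"
  assumes [measurable]: "f \<in> borel_measurable M" "g \<in> borel_measurable M"
    and f0: "\<And>x. 0 \<le> f x" and g0: "\<And>x. 0 \<le> g x"
    and pq: "1 < p" "1 < q" "1/p + 1/q = 1"
    and a: "(\<integral>\<^sup>+x. ennreal (f x powr p) \<partial>M) \<le> ennreal a" "0 \<le> a"
    and b: "(\<integral>\<^sup>+x. ennreal (g x powr q) \<partial>M) \<le> ennreal b" "0 \<le> b"
  shows "(\<integral>\<^sup>+x. ennreal (f x * g x) \<partial>M) \<le> ennreal (a powr (1/p) * b powr (1/q))"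
proof -
  consider "a = 0" | "b = 0" | "0 < a" "0 < b" using a b by linarith
  then show ?thesis
  proof cases
    case 1
    then have "(\<integral>\<^sup>+x. ennreal (f x powr p) \<partial>M) = 0" using a by simp
    then have "AE x in M. f x powr p = 0" by (subst (asm) nn_integral_0_iff_AE) (auto simp: ennreal_eq_0_iff antisym)
    then have "(\<integral>\<^sup>+x. ennreal (f x * g x) \<partial>M) = (\<integral>\<^sup>+x. 0 \<partial>M)"
      by (intro nn_integral_cong_AE) (auto elim!: eventually_mono)
    then show ?thesis by simp
  next
    case 2
    then have "(\<integral>\<^sup>+x. ennreal (g x powr q) \<partial>M) = 0" using b by simp
    then have "AE x in M. g x powr q = 0" by (subst (asm) nn_integral_0_iff_AE) (auto simp: ennreal_eq_0_iff antisym)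
    then have "(\<integral>\<^sup>+x. ennreal (f x * g x) \<partial>M) = (\<integral>\<^sup>+x. 0 \<partial>M)"
      by (intro nn_integral_cong_AE) (auto elim!: eventually_mono)
    then show ?thesis by simp
  next
    case 3
    define c where "c = a powr (1/p) * b powr (1/q)"
    have c0: "0 \<le> c" by (simp add: c_def)
    have p1: "0 \<le> c / (p * a)" "0 \<le> c / (q * b)" using 3 pq c0 by simp_all
    have young: "f x * g x \<le> c / (p * a) * f x powr p + c / (q * b) * g x powr q" for x
    proof -
      have "f x / a powr (1/p) * (g x / b powr (1/q)) \<le> (f x / a powr (1/p)) powr p / p + (g x / b powr (1/q)) powr q / q"
        using pq f0 g0 by (intro Youngs_inequality) auto
      also have "\<dots> = f x powr p / (p * a) + g x powr q / (q * b)"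
        using 3 pq f0 g0 by (simp add: powr_divide powr_powr mult.commute)
      finally have "c * (f x / a powr (1/p) * (g x / b powr (1/q))) \<le> c * (f x powr p / (p * a) + g x powr q / (q * b))"
        using c0 by (rule mult_left_mono)
      moreover have "c * (f x / a powr (1/p) * (g x / b powr (1/q))) = f x * g x"
        using 3 by (simp add: c_def)
      ultimately show ?thesis by (simp add: algebra_simps)
    qed
    have "(\<integral>\<^sup>+x. ennreal (f x * g x) \<partial>M) \<le> (\<integral>\<^sup>+x. ennreal (c / (p * a)) * ennreal (f x powr p) + ennreal (c / (q * b)) * ennreal (g x powr q) \<partial>M)"
    proof (rule nn_integral_mono)
      fix x
      have "ennreal (f x * g x) \<le> ennreal (c / (p * a) * f x powr p + c / (q * b) * g x powr q)"
        by (rule ennreal_leI[OF young])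
      then show "ennreal (f x * g x) \<le> ennreal (c / (p * a)) * ennreal (f x powr p) + ennreal (c / (q * b)) * ennreal (g x powr q)"
        using 3 pq c0 by (simp add: ennreal_mult[symmetric] ennreal_plus[symmetric] del: ennreal_plus)
    qed
    also have "\<dots> = ennreal (c / (p * a)) * (\<integral>\<^sup>+x. ennreal (f x powr p) \<partial>M) + ennreal (c / (q * b)) * (\<integral>\<^sup>+x. ennreal (g x powr q) \<partial>M)"
      by (subst nn_integral_add) (auto simp: nn_integral_cmult)
    also have "\<dots> \<le> ennreal (c / (p * a)) * ennreal a + ennreal (c / (q * b)) * ennreal b"
      by (intro add_mono mult_left_mono a b) auto
    also have "\<dots> = ennreal (c / (p * a) * a + c / (q * b) * b)"
      unfolding ennreal_mult[OF p1(1) a(2), symmetric] ennreal_mult[OF p1(2) b(2), symmetric]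
      using p1 a(2) b(2) by (intro ennreal_plus[symmetric] mult_nonneg_nonneg)
    also have "c / (p * a) * a + c / (q * b) * b = c"
    proof -
      have "c / (p * a) * a + c / (q * b) * b = c * (1/p + 1/q)" using 3 pq(1,2) by (simp add: distrib_left)
      then show ?thesis by (simp only: pq(3) mult_1_right)
    qed
    finally show ?thesis by (simp add: c_def)
  qed
qed

text \<open>In the squared radius x the area element r dr dt is dx dt / 2. Stating this as a
  push-forward makes it usable for complex-valued integrands.\<close>

lemma distr_polar_disc:
  "distr (density lborel (\<lambda>(x,t). ennreal (1/2 * indicator {0..1} x * indicator {0..2*pi} t))) borel
     (\<lambda>(x,t). complex_of_real (sqrt x) * cis t) = density lborel (indicator (ball 0 1))"
    (is "distr (density lborel ?d) borel ?g = ?R")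
proof (rule measure_eqI)
  fix A assume "A \<in> sets (distr (density lborel ?d) borel ?g)"
  then have [measurable]: "A \<in> sets borel" by simp
  have d[measurable]: "?d \<in> borel_measurable borel" unfolding borel_prod[symmetric] by measurable
  have g[measurable]: "?g \<in> borel_measurable borel" unfolding borel_prod[symmetric] by measurable
  have Ag[measurable]: "(\<lambda>x. indicator A (?g x) :: ennreal) \<in> borel_measurable borel"
    by (rule measurable_compose[OF g]) simp
  have "emeasure (distr (density lborel ?d) borel ?g) A = (\<integral>\<^sup>+x. indicator A x \<partial>distr (density lborel ?d) borel ?g)"
    by simp
  also have "\<dots> = (\<integral>\<^sup>+x. indicator A (?g x) \<partial>density lborel ?d)"
    by (rule nn_integral_distr_borel) auto
  also have "\<dots> = (\<integral>\<^sup>+x. ?d x * indicator A (?g x) \<partial>lborel)"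
    by (rule nn_integral_density) (use d Ag in simp_all)
  also have "\<dots> = (\<integral>\<^sup>+x. \<integral>\<^sup>+t. ?d (x, t) * indicator A (?g (x, t)) \<partial>lborel \<partial>lborel)"
    by (rule nn_integral_lborel_pair(2)) measurable
  also have "\<dots> = (\<integral>\<^sup>+x. ennreal pi * (circle_mean (indicator A) x * indicator {0..1} x) \<partial>lborel)"
  proof (rule nn_integral_cong)
    fix x :: real
    have "(\<integral>\<^sup>+t. ?d (x, t) * indicator A (?g (x, t)) \<partial>lborel)
        = (\<integral>\<^sup>+t. (ennreal (1/2) * indicator {0..1} x) * (indicator A (complex_of_real (sqrt x) * cis t) * indicator {0..2*pi} t) \<partial>lborel)"
      by (intro nn_integral_cong) (auto simp: indicator_def)
    also have "\<dots> = (ennreal (1/2) * indicator {0..1} x) * (\<integral>\<^sup>+t. indicator A (complex_of_real (sqrt x) * cis t) * indicator {0..2*pi} t \<partial>lborel)"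
      by (rule nn_integral_cmult) measurable
    also have "(\<integral>\<^sup>+t. indicator A (complex_of_real (sqrt x) * cis t) * indicator {0..2*pi} t \<partial>lborel)
      = (\<integral>\<^sup>+t. indicator A (complex_of_real (sqrt x) * cis t) * indicator {0..<2*pi} t \<partial>lborel)"
    proof (rule nn_integral_cong_AE)
      have "AE t in lborel. t \<noteq> 2*pi" by (rule AE_lborel_singleton)
      then show "AE t in lborel. (indicator A (complex_of_real (sqrt x) * cis t) * indicator {0..2*pi} t :: ennreal) = indicator A (complex_of_real (sqrt x) * cis t) * indicator {0..<2*pi} t"
        by eventually_elim (auto simp: indicator_def)
    qed
    also have "ennreal (1/2) * indicator {0..1} x * \<dots> = ennreal pi * (circle_mean (indicator A) x * indicator {0..1} x)"
    proof -
      have "ennreal (1/2) = ennreal pi * ennreal (1/(2*pi))" by (simp add: ennreal_mult'[symmetric])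
      then show ?thesis unfolding circle_mean_def by (simp add: ac_simps)
    qed
    finally show "(\<integral>\<^sup>+t. ?d (x, t) * indicator A (?g (x, t)) \<partial>lborel) = ennreal pi * (circle_mean (indicator A) x * indicator {0..1} x)" .
  qed
  also have "\<dots> = ennreal pi * (\<integral>\<^sup>+x. circle_mean (indicator A) x * indicator {0..1} x \<partial>lborel)"
    by (rule nn_integral_cmult) measurable
  also have "\<dots> = (\<integral>\<^sup>+z. indicator A z * indicator (ball 0 1) z \<partial>lborel)"
    by (simp add: nn_integral_disc_polar nn_integral_indicator_Ioo_Icc)
  also have "\<dots> = emeasure ?R A"
    by (subst emeasure_density) (auto simp: mult.commute)
  finally show "emeasure (distr (density lborel ?d) borel ?g) A = emeasure ?R A" .
qed simp

lemma integral_disc_polar: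
  fixes h :: "complex \<Rightarrow> complex"
  assumes h[measurable]: "h \<in> borel_measurable borel" and int: "integrable lborel (\<lambda>z. indicator (ball 0 1) z *\<^sub>R h z)"
  shows "(\<integral>z. indicator (ball 0 1) z *\<^sub>R h z \<partial>lborel)
    = (\<integral>x. indicator {0..1} x *\<^sub>R (1/2 * (\<integral>t. indicator {0..2*pi} t *\<^sub>R h (complex_of_real (sqrt x) * cis t) \<partial>lborel)) \<partial>lborel)"
proof -
  define d :: "real \<times> real \<Rightarrow> real" where "d = (\<lambda>(x,t). 1/2 * indicator {0..1} x * indicator {0..2*pi} t)"
  define g :: "real \<times> real \<Rightarrow> complex" where "g = (\<lambda>(x,t). complex_of_real (sqrt x) * cis t)"
  have dm[measurable]: "d \<in> borel_measurable borel" unfolding borel_prod[symmetric] d_def by measurable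
  have gm[measurable]: "g \<in> borel_measurable borel" unfolding borel_prod[symmetric] g_def by measurable
  have hg[measurable]: "(\<lambda>x. h (g x)) \<in> borel_measurable borel" by (rule measurable_compose[OF gm h])
  have d0: "0 \<le> d x" for x by (auto simp: d_def split: prod.split)
  have D: "distr (density lborel (\<lambda>x. ennreal (d x))) borel g = density lborel (\<lambda>z. ennreal (indicator (ball 0 1) z))"
  proof -
    have "(\<lambda>x. ennreal (d x)) = (\<lambda>(x,t). ennreal (1/2 * indicator {0..1} x * indicator {0..2*pi} t))"
      by (auto simp: d_def)
    moreover have "(\<lambda>z::complex. ennreal (indicator (ball 0 1) z)) = indicator (ball 0 1)"
      by (auto simp: indicator_def)
    ultimately show ?thesis using distr_polar_disc by (simp add: g_def)
  qed
  have "integrable (density lborel (\<lambda>z. ennreal (indicator (ball 0 1) z))) h"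
    by (subst integrable_density) (auto simp: int)
  then have "integrable (density lborel (\<lambda>x. ennreal (d x))) (\<lambda>x. h (g x))"
    unfolding D[symmetric] by (subst (asm) integrable_distr_eq) auto
  then have I: "integrable lborel (\<lambda>x. d x *\<^sub>R h (g x))"
    by (subst (asm) integrable_density) (auto simp: d0)
  have "(\<integral>z. indicator (ball 0 1) z *\<^sub>R h z \<partial>lborel) = (\<integral>z. h z \<partial>density lborel (\<lambda>z. ennreal (indicator (ball 0 1) z)))"
    by (subst integral_density) auto
  also have "\<dots> = (\<integral>x. h (g x) \<partial>density lborel (\<lambda>x. ennreal (d x)))"
    unfolding D[symmetric] by (subst integral_distr) auto
  also have "\<dots> = (\<integral>x. d x *\<^sub>R h (g x) \<partial>lborel)"
    by (subst integral_density) (auto simp: d0)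
  also have "\<dots> = (\<integral>x. d x *\<^sub>R h (g x) \<partial>(lborel \<Otimes>\<^sub>M lborel))" by (simp add: lborel_prod)
  also have "\<dots> = (\<integral>x. \<integral>t. d (x,t) *\<^sub>R h (g (x,t)) \<partial>lborel \<partial>lborel)"
    using lborel_pair.integral_fst'[of "\<lambda>x. d x *\<^sub>R h (g x)"] I by (simp add: lborel_prod)
  also have "\<dots> = (\<integral>x. indicator {0..1} x *\<^sub>R (1/2 * (\<integral>t. indicator {0..2*pi} t *\<^sub>R h (complex_of_real (sqrt x) * cis t) \<partial>lborel)) \<partial>lborel)"
  proof (rule Bochner_Integration.integral_cong[OF refl])
    fix x :: real
    have "d (x, t) *\<^sub>R h (g (x, t)) = (indicator {0..1} x * (1/2)) *\<^sub>R (indicator {0..2*pi} t *\<^sub>R h (complex_of_real (sqrt x) * cis t))" for t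
      by (simp add: d_def g_def mult_ac)
    then have "(\<integral>t. d (x,t) *\<^sub>R h (g (x,t)) \<partial>lborel) = (indicator {0..1} x * (1/2)) *\<^sub>R (\<integral>t. indicator {0..2*pi} t *\<^sub>R h (complex_of_real (sqrt x) * cis t) \<partial>lborel)"
      by (simp only: integral_scaleR_right)
    then show "(\<integral>t. d (x,t) *\<^sub>R h (g (x,t)) \<partial>lborel) = indicator {0..1} x *\<^sub>R (1/2 * (\<integral>t. indicator {0..2*pi} t *\<^sub>R h (complex_of_real (sqrt x) * cis t) \<partial>lborel))"
      by (simp add: scaleR_conv_of_real)
  qed
  finally show ?thesis .
qed

text \<open>On the unit circle cnj u = 1/u, so with w = \<eta> s the factor 1/(1 - w cnj u)^2 equals
  u^2/(u - w)^2, and dt = du/(i u). The integral is therefore Cauchy's formula for the derivative at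
  w of F u = u g(s u), and this derivative is the right-hand side.\<close>

lemma circle_integral_derivative:
  fixes g :: "complex \<Rightarrow> complex"
  assumes g: "g holomorphic_on ball 0 1" and s: "0 \<le> s" "s < 1" and \<eta>: "norm \<eta> < 1"
  shows "(\<integral>t. indicator {0..2*pi} t *\<^sub>R (g (complex_of_real s * cis t) / (1 - \<eta> * cnj (complex_of_real s * cis t))\<^sup>2) \<partial>lborel)
     = 2 * pi * (g (s\<^sup>2 * \<eta>) + s\<^sup>2 * \<eta> * deriv g (s\<^sup>2 * \<eta>))"
proof -
  let ?w = "\<eta> * complex_of_real s"
  define F where "F u = u * g (complex_of_real s * u)" for u
  have w: "norm ?w < 1" using s \<eta> by (simp add: norm_mult) (meson le_less_trans mult_left_le less_imp_le norm_ge_zero)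
  have in1: "complex_of_real s * u \<in> ball 0 1" if "norm u \<le> 1" for u :: complex
    using s that by (simp add: norm_mult) (meson le_less_trans mult_left_le)
  have Fhol: "F holomorphic_on ball 0 1" unfolding F_def
    by (intro holomorphic_intros holomorphic_on_compose_gen[OF _ g, unfolded o_def]) (use in1 in \<open>auto simp: less_imp_le\<close>)
  have gc: "continuous_on (ball 0 1) g" using g by (rule holomorphic_on_imp_continuous_on)
  have Fcont: "continuous_on (cball 0 1) F" unfolding F_def
    by (intro continuous_intros continuous_on_compose2[OF gc]) (use in1 in auto)
  have "(F has_field_derivative (1 / (2 * of_real pi * \<i>) * contour_integral(circlepath 0 1) (\<lambda>u. F u / (u - ?w)^2))) (at ?w)"
    by (rule Cauchy_derivative_integral_circlepath(2)[OF Fcont Fhol]) (use w in auto)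
  moreover have "(F has_field_derivative (g (s\<^sup>2 * \<eta>) + s\<^sup>2 * \<eta> * deriv g (s\<^sup>2 * \<eta>))) (at ?w)"
  proof -
    have e: "complex_of_real s * ?w = s\<^sup>2 * \<eta>" by (simp add: power2_eq_square)
    have "(g has_field_derivative deriv g (complex_of_real s * ?w)) (at (complex_of_real s * ?w))"
      by (rule holomorphic_derivI[OF g]) (use in1[of ?w] w in auto)
    then have "(g has_field_derivative deriv g (s\<^sup>2 * \<eta>)) (at (complex_of_real s * ?w))"
      unfolding e .
    then have "((\<lambda>u. g (complex_of_real s * u)) has_field_derivative (deriv g (s\<^sup>2 * \<eta>) * s)) (at ?w)"
      by (auto intro!: derivative_eq_intros DERIV_chain2[where f=g and g="\<lambda>u. complex_of_real s * u" and Db="of_real s"])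
    then show ?thesis unfolding F_def
      by (auto intro!: derivative_eq_intros simp: power2_eq_square mult_ac)
  qed
  ultimately have "1 / (2 * of_real pi * \<i>) * contour_integral(circlepath 0 1) (\<lambda>u. F u / (u - ?w)^2) = g (s\<^sup>2 * \<eta>) + s\<^sup>2 * \<eta> * deriv g (s\<^sup>2 * \<eta>)"
    by (rule DERIV_unique)
  then have ci: "contour_integral(circlepath 0 1) (\<lambda>u. F u / (u - ?w)^2) = 2 * pi * \<i> * (g (s\<^sup>2 * \<eta>) + s\<^sup>2 * \<eta> * deriv g (s\<^sup>2 * \<eta>))"
    by (simp add: field_simps)
  let ?G = "\<lambda>t. g (complex_of_real s * cis t) / (1 - \<eta> * cnj (complex_of_real s * cis t))\<^sup>2"
  have ne: "1 - \<eta> * cnj (complex_of_real s * cis t) \<noteq> 0" for t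
  proof
    assume "1 - \<eta> * cnj (complex_of_real s * cis t) = 0"
    then have "norm (\<eta> * cnj (complex_of_real s * cis t)) = 1" by (metis eq_iff_diff_eq_0 norm_one)
    then show False using w s by (simp add: norm_mult)
  qed
  have G: "?G t * \<i> = F (cis t) / (cis t - ?w)^2 * \<i> * cis t" for t
  proof -
    have "(cis t - ?w) = cis t * (1 - \<eta> * cnj (complex_of_real s * cis t))"
      by (simp add: algebra_simps cis_cnj cis_mult)
    then show ?thesis by (simp add: F_def power_mult_distrib power2_eq_square)
  qed
  have cont: "continuous_on {0..2*pi} ?G"
    by (intro continuous_intros continuous_on_compose2[OF gc]) (use in1 ne in auto)
  have "(\<integral>t. indicator {0..2*pi} t *\<^sub>R ?G t \<partial>lborel) = integral {0..2*pi} ?G"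
    using set_borel_integral_eq_integral(2)[OF borel_integrable_atLeastAtMost'[OF cont]] by (simp add: set_lebesgue_integral_def)
  moreover have "contour_integral(circlepath 0 1) (\<lambda>u. F u / (u - ?w)^2) = integral {0..2*pi} (\<lambda>t. ?G t * \<i>)"
  proof -
    have "contour_integral(circlepath 0 1) (\<lambda>u. F u / (u - ?w)^2)
       = integral {0..2*pi} (\<lambda>t. F (0 + complex_of_real 1 * cis t) / (0 + complex_of_real 1 * cis t - ?w)^2 * complex_of_real 1 * \<i> * cis t)"
      unfolding circlepath_def by (rule contour_integral_part_circlepath_eq) simp
    also have "\<dots> = integral {0..2*pi} (\<lambda>t. ?G t * \<i>)"
      unfolding G by simp
    finally show ?thesis .
  qed
  moreover have "integral {0..2*pi} (\<lambda>t. ?G t * \<i>) = integral {0..2*pi} ?G * \<i>"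
    by (rule integral_mult_left)
  ultimately show ?thesis using ci by (simp add: mult.assoc)
qed

text \<open>In polar coordinates the circle integrals are given by
  \<open>circle_integral_derivative\<close>, and what remains is an exact derivative in the squared
  radius. Integrability of g suffices; it is used only to justify the polar decomposition of the
  area integral.\<close>

lemma disc_reproducing:
  fixes g :: "complex \<Rightarrow> complex"
  assumes g: "g holomorphic_on ball 0 1" and int: "integrable lborel (\<lambda>z. indicator (ball 0 1) z *\<^sub>R g z)"
    and \<eta>: "norm \<eta> < 1"
  shows "integrable lborel (\<lambda>z. indicator (ball 0 1) z *\<^sub>R (g z / (1 - \<eta> * cnj z)\<^sup>2))"
    and "(\<integral>z. indicator (ball 0 1) z *\<^sub>R (g z / (1 - \<eta> * cnj z)\<^sup>2) \<partial>lborel) = pi * g \<eta>"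
proof -
  define g' where "g' z = indicator (ball 0 1) z *\<^sub>R g z" for z
  have [measurable]: "g' \<in> borel_measurable borel" unfolding g'_def
    by (intro borel_measurable_continuous_on_indicator holomorphic_on_imp_continuous_on g) simp
  define h where "h z = g' z / (1 - \<eta> * cnj z)\<^sup>2" for z
  have [measurable]: "cnj \<in> borel_measurable borel"
    by (intro borel_measurable_continuous_onI continuous_intros)
  have hm[measurable]: "h \<in> borel_measurable borel" unfolding h_def by measurable
  have h: "indicator (ball 0 1) z *\<^sub>R (g z / (1 - \<eta> * cnj z)\<^sup>2) = indicator (ball 0 1) z *\<^sub>R h z" for z
    by (auto simp: h_def g'_def indicator_def)
  have bd: "norm (indicator (ball 0 1) z *\<^sub>R h z) \<le> norm (1 / (1 - norm \<eta>)\<^sup>2 * norm (g' z))" for z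
  proof (cases "norm z < 1")
    case True
    have "norm (\<eta> * cnj z) \<le> norm \<eta>" using True by (simp add: norm_mult mult_left_le)
    then have "1 - norm \<eta> \<le> norm (1 - \<eta> * cnj z)" by (smt (verit) norm_one norm_triangle_ineq2)
    then have "(1 - norm \<eta>)\<^sup>2 \<le> (norm (1 - \<eta> * cnj z))\<^sup>2" using \<eta> by (intro power_mono) auto
    moreover have "0 < (1 - norm \<eta>)\<^sup>2" using \<eta> by simp
    ultimately have "norm (g' z) / (norm (1 - \<eta> * cnj z))\<^sup>2 \<le> norm (g' z) / (1 - norm \<eta>)\<^sup>2"
      by (intro divide_left_mono mult_pos_pos) auto
    then show ?thesis using True by (simp add: h_def norm_divide norm_power)
  qed simp
  show I: "integrable lborel (\<lambda>z. indicator (ball 0 1) z *\<^sub>R (g z / (1 - \<eta> * cnj z)\<^sup>2))"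
    unfolding h
  proof (rule Bochner_Integration.integrable_bound)
    show "integrable lborel (\<lambda>z. 1 / (1 - norm \<eta>)\<^sup>2 * norm (g' z))"
      using int unfolding g'_def by (intro integrable_mult_right integrable_norm)
    show "AE z in lborel. norm (indicator (ball 0 1) z *\<^sub>R h z) \<le> norm (1 / (1 - norm \<eta>)\<^sup>2 * norm (g' z))"
      using bd by auto
  qed measurable
  let ?\<phi> = "\<lambda>x::real. g (x * \<eta>) + x * \<eta> * deriv g (x * \<eta>)"
  have xin: "complex_of_real x * \<eta> \<in> ball 0 1" if "x \<in> {0..1}" for x
  proof -
    have "\<bar>x\<bar> * norm \<eta> \<le> 1 * norm \<eta>" using that by (intro mult_right_mono) auto
    then show ?thesis using \<eta> by (simp add: norm_mult)
  qed
  have "(\<integral>z. indicator (ball 0 1) z *\<^sub>R (g z / (1 - \<eta> * cnj z)\<^sup>2) \<partial>lborel)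
     = (\<integral>x. indicator {0..1} x *\<^sub>R (1/2 * (\<integral>t. indicator {0..2*pi} t *\<^sub>R h (complex_of_real (sqrt x) * cis t) \<partial>lborel)) \<partial>lborel)"
    unfolding h using I unfolding h by (rule integral_disc_polar[OF hm])
  also have "\<dots> = (\<integral>x. of_real pi * (indicator {0..1} x *\<^sub>R ?\<phi> x) \<partial>lborel)"
  proof (rule integral_cong_AE)
    \<comment> \<open>The radius 1 is excluded because \<open>circle_integral_derivative\<close>
      needs a circle inside the open disc.\<close>
    have "AE x in lborel. x \<noteq> (1::real)" by (rule AE_lborel_singleton)
    then show "AE x in lborel. indicator {0..1} x *\<^sub>R (1/2 * (\<integral>t. indicator {0..2*pi} t *\<^sub>R h (complex_of_real (sqrt x) * cis t) \<partial>lborel))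
       = of_real pi * (indicator {0..1} x *\<^sub>R ?\<phi> x)"
    proof eventually_elim
      case (elim x)
      show ?case
      proof (cases "x \<in> {0..1}")
        case True
        then have x: "0 \<le> sqrt x" "sqrt x < 1" using elim by auto
        have "h (complex_of_real (sqrt x) * cis t) = g (complex_of_real (sqrt x) * cis t) / (1 - \<eta> * cnj (complex_of_real (sqrt x) * cis t))\<^sup>2" for t
          using x by (simp add: h_def g'_def norm_mult indicator_def)
        then have "(\<integral>t. indicator {0..2*pi} t *\<^sub>R h (complex_of_real (sqrt x) * cis t) \<partial>lborel)
           = 2 * pi * (g ((sqrt x)\<^sup>2 * \<eta>) + (sqrt x)\<^sup>2 * \<eta> * deriv g ((sqrt x)\<^sup>2 * \<eta>))"
          using circle_integral_derivative[OF g x \<eta>] by simp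
        moreover have "complex_of_real (sqrt x) ^ 2 = of_real x" using True by (simp flip: of_real_power)
        ultimately show ?thesis using True by (simp add: mult_ac)
      qed simp
    qed
    have "continuous_on {0..1} ?\<phi>"
      by (intro continuous_intros continuous_on_compose2[OF holomorphic_on_imp_continuous_on[OF g]]
           continuous_on_compose2[OF holomorphic_on_imp_continuous_on[OF holomorphic_deriv[OF g open_ball]]]) (use xin in auto)
    then show "(\<lambda>x. of_real pi * (indicator {0..1} x *\<^sub>R ?\<phi> x)) \<in> borel_measurable lborel"
      by (intro borel_measurable_times borel_measurable_const measurable_lborel1) (auto intro: borel_measurable_continuous_on_indicator)
    show "(\<lambda>x. indicator {0..1} x *\<^sub>R (1/2 * (\<integral>t. indicator {0..2*pi} t *\<^sub>R h (complex_of_real (sqrt x) * cis t) \<partial>lborel))) \<in> borel_measurable lborel"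
      by measurable
  qed
  also have "\<dots> = of_real pi * (\<integral>x. indicator {0..1} x *\<^sub>R ?\<phi> x \<partial>lborel)"
    by (rule integral_mult_right_zero)
  \<comment> \<open>The integrand is the derivative of x g(x \<eta>) with respect to x, so the
    integral is the boundary value g \<eta> at x = 1.\<close>
  also have "(\<integral>x. indicator {0..1} x *\<^sub>R ?\<phi> x \<partial>lborel) = 1 * g (of_real 1 * \<eta>) - 0 * g (of_real 0 * \<eta>)"
  proof -
    have "((\<lambda>x. of_real x * g (of_real x * \<eta>)) has_vector_derivative ?\<phi> x) (at x within {0..1})" if x: "x \<in> {0..1}" for x
    proof -
      have "(g has_field_derivative deriv g (of_real x * \<eta>)) (at (of_real x * \<eta>))"
        by (rule holomorphic_derivI[OF g open_ball xin[OF x]])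
      then have "((\<lambda>z. g (z * \<eta>)) has_field_derivative deriv g (of_real x * \<eta>) * \<eta>) (at (of_real x))"
        by (auto intro!: derivative_eq_intros DERIV_chain2[where f=g and g="\<lambda>z. z * \<eta>" and Db=\<eta>])
      then have "((\<lambda>z. z * g (z * \<eta>)) has_field_derivative ?\<phi> x) (at (of_real x))"
        by (auto intro!: derivative_eq_intros)
      then have "((\<lambda>z. z * g (z * \<eta>)) has_field_derivative ?\<phi> x) (at (of_real x) within of_real ` {0..1})"
        by (rule has_field_derivative_at_within)
      then show ?thesis
        using has_vector_derivative_real_field[of "\<lambda>z. z * g (z * \<eta>)" "?\<phi> x" x "{0..1}"]
          \<open>((\<lambda>z. z * g (z * \<eta>)) has_field_derivative ?\<phi> x) (at (of_real x))\<close> by simp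
    qed
    moreover have "continuous_on {0..1} ?\<phi>"
      by (intro continuous_intros continuous_on_compose2[OF holomorphic_on_imp_continuous_on[OF g]]
           continuous_on_compose2[OF holomorphic_on_imp_continuous_on[OF holomorphic_deriv[OF g open_ball]]]) (use xin in auto)
    ultimately have "(\<integral>x. indicator {0..1} x *\<^sub>R ?\<phi> x \<partial>lborel) = of_real 1 * g (of_real 1 * \<eta>) - of_real 0 * g (of_real 0 * \<eta>)"
      by (intro integral_FTC_Icc) auto
    then show ?thesis by simp
  qed
  finally show "(\<integral>z. indicator (ball 0 1) z *\<^sub>R (g z / (1 - \<eta> * cnj z)\<^sup>2) \<partial>lborel) = pi * g \<eta>" by simp
qed

section \<open>Square-integrable holomorphic functions on the disc\<close>

lemma cnj_measurable[measurable]: "cnj \<in> borel_measurable borel"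
  by (intro borel_measurable_continuous_onI continuous_intros)

lemma norm_one_minus_ge:
  assumes "norm (z::complex) \<le> 1"
  shows "1 - norm \<eta> \<le> norm (1 - \<eta> * cnj z)"
proof -
  have "norm (\<eta> * cnj z) \<le> norm \<eta>" using assms by (simp add: norm_mult mult_left_le)
  then show ?thesis by (smt (verit) norm_one norm_triangle_ineq2)
qed

lemma holomorphic_disc_measurable:
  assumes "g holomorphic_on S" "open S"
  shows "(\<lambda>z. indicator S z *\<^sub>R g z) \<in> borel_measurable borel"
  using assms by (intro borel_measurable_continuous_on_indicator holomorphic_on_imp_continuous_on) auto

text \<open>Cauchy-Schwarz against the constant 1 on a set of area pi. The second claim supplies the
  hypothesis of \<open>disc_reproducing\<close>.\<close>

lemma disc_square_integrable_bound:
  fixes g :: "complex \<Rightarrow> complex"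
  assumes [measurable]: "(\<lambda>z. indicator (ball 0 1) z *\<^sub>R g z) \<in> borel_measurable borel"
    and a: "(\<integral>\<^sup>+z. ennreal ((norm (g z))\<^sup>2) * indicator (ball 0 1) z \<partial>lborel) \<le> ennreal a" "0 \<le> a"
  shows "(\<integral>\<^sup>+z. ennreal (norm (indicator (ball 0 1) z *\<^sub>R g z)) \<partial>lborel) \<le> ennreal (sqrt (a * pi))"
    and "integrable lborel (\<lambda>z. indicator (ball 0 1) z *\<^sub>R g z)"
proof -
  let ?i = "\<lambda>z::complex. indicator (ball 0 1) z :: real"
  have "(\<integral>\<^sup>+z. ennreal (norm (?i z *\<^sub>R g z)) \<partial>lborel) = (\<integral>\<^sup>+z. ennreal (norm (?i z *\<^sub>R g z) * ?i z) \<partial>lborel)"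
    by (intro nn_integral_cong) (auto simp: indicator_def)
  also have "\<dots> \<le> ennreal (a powr (1/2) * pi powr (1/2))"
  proof (rule nn_integral_Holder)
    have "(\<integral>\<^sup>+z. ennreal (norm (?i z *\<^sub>R g z) powr 2) \<partial>lborel) = (\<integral>\<^sup>+z. ennreal ((norm (g z))\<^sup>2) * indicator (ball 0 1) z \<partial>lborel)"
      by (intro nn_integral_cong) (auto simp: indicator_def)
    then show "(\<integral>\<^sup>+z. ennreal (norm (?i z *\<^sub>R g z) powr 2) \<partial>lborel) \<le> ennreal a" using a by simp
    have i2: "ennreal (?i z powr 2) = indicator (ball 0 1) z" for z
      by (cases "z \<in> ball 0 1") simp_all
    show "(\<integral>\<^sup>+z. ennreal (?i z powr 2) \<partial>lborel) \<le> ennreal pi"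
      unfolding i2 by (simp add: emeasure_ball_complex)
    show "(\<lambda>z. norm (?i z *\<^sub>R g z)) \<in> borel_measurable lborel" by measurable
  qed (use a(2) in simp_all)
  also have "a powr (1/2) * pi powr (1/2) = sqrt (a * pi)"
    using a by (simp add: powr_half_sqrt real_sqrt_mult)
  finally show *: "(\<integral>\<^sup>+z. ennreal (norm (?i z *\<^sub>R g z)) \<partial>lborel) \<le> ennreal (sqrt (a * pi))" .
  then have "(\<integral>\<^sup>+z. ennreal (norm (?i z *\<^sub>R g z)) \<partial>lborel) < \<infinity>"
    by (rule le_less_trans) simp
  then show "integrable lborel (\<lambda>z. indicator (ball 0 1) z *\<^sub>R g z)"
    by (intro integrableI_bounded) auto
qed

text \<open>In the reproducing formula the kernel is at most (1 - |\<xi>|)^(-2), and Cauchy-Schwarz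
  bounds the integral of |g|; squaring gives the fourth power. At \<xi> = 0 the constant is 1/pi,
  the one in the sub-mean-value inequality.\<close>

lemma disc_point_bound:
  fixes g :: "complex \<Rightarrow> complex"
  assumes g: "g holomorphic_on ball 0 1" and \<xi>: "norm \<xi> < 1"
  shows "ennreal ((norm (g \<xi>))\<^sup>2) \<le> ennreal (1 / (pi * (1 - norm \<xi>)^4)) * (\<integral>\<^sup>+z. ennreal ((norm (g z))\<^sup>2) * indicator (ball 0 1) z \<partial>lborel)"
proof (cases "(\<integral>\<^sup>+z. ennreal ((norm (g z))\<^sup>2) * indicator (ball 0 1) z \<partial>lborel)")
  case top
  define c where "c = 1 / (pi * (1 - norm \<xi>)^4)"
  have "0 < c" using \<xi> by (simp add: c_def)
  then have "ennreal c * top = top" by (simp add: ennreal_mult_eq_top_iff)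
  then show ?thesis unfolding top c_def[symmetric] by simp
next
  case (real a)
  let ?i = "\<lambda>z::complex. indicator (ball 0 1) z :: real"
  note m[measurable] = holomorphic_disc_measurable[OF g open_ball]
  note b = disc_square_integrable_bound[OF m eq_refl[OF real(2)] real(1)]
  note r = disc_reproducing[OF g b(2) \<xi>]
  let ?f = "\<lambda>z. ?i z *\<^sub>R (g z / (1 - \<xi> * cnj z)\<^sup>2)"
  have "ennreal (pi * norm (g \<xi>)) = ennreal (norm (\<integral>z. ?f z \<partial>lborel))"
    unfolding r(2) by (simp add: norm_mult)
  also have "\<dots> \<le> (\<integral>\<^sup>+z. ennreal (norm (?f z)) \<partial>lborel)"
    by (rule integral_norm_bound_ennreal[OF r(1)])
  also have "\<dots> \<le> (\<integral>\<^sup>+z. ennreal (1 / (1 - norm \<xi>)\<^sup>2) * ennreal (norm (?i z *\<^sub>R g z)) \<partial>lborel)"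
  proof (rule nn_integral_mono)
    fix z :: complex
    show "ennreal (norm (?f z)) \<le> ennreal (1 / (1 - norm \<xi>)\<^sup>2) * ennreal (norm (?i z *\<^sub>R g z))"
    proof (cases "norm z < 1")
      case True
      have "1 - norm \<xi> \<le> norm (1 - \<xi> * cnj z)" using True by (intro norm_one_minus_ge) simp
      then have "(1 - norm \<xi>)\<^sup>2 \<le> (norm (1 - \<xi> * cnj z))\<^sup>2" using \<xi> by (intro power_mono) auto
      moreover have "0 < (1 - norm \<xi>)\<^sup>2" using \<xi> by simp
      ultimately have "norm (g z) / (norm (1 - \<xi> * cnj z))\<^sup>2 \<le> norm (g z) / (1 - norm \<xi>)\<^sup>2"
        by (intro divide_left_mono mult_pos_pos) auto
      then show ?thesis using True by (simp add: norm_divide norm_power ennreal_mult'[symmetric])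
    qed simp
  qed
  also have "\<dots> = ennreal (1 / (1 - norm \<xi>)\<^sup>2) * (\<integral>\<^sup>+z. ennreal (norm (?i z *\<^sub>R g z)) \<partial>lborel)"
    by (rule nn_integral_cmult) measurable
  also have "\<dots> \<le> ennreal (1 / (1 - norm \<xi>)\<^sup>2) * ennreal (sqrt (a * pi))"
    by (intro mult_left_mono b(1)) simp
  also have "\<dots> = ennreal (1 / (1 - norm \<xi>)\<^sup>2 * sqrt (a * pi))"
    using real by (intro ennreal_mult[symmetric]) auto
  finally have "pi * norm (g \<xi>) \<le> 1 / (1 - norm \<xi>)\<^sup>2 * sqrt (a * pi)"
    using real by (subst (asm) ennreal_le_iff) auto
  then have "(pi * norm (g \<xi>))\<^sup>2 \<le> (1 / (1 - norm \<xi>)\<^sup>2 * sqrt (a * pi))\<^sup>2"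
    by (intro power_mono) auto
  also have "\<dots> = a * pi / (1 - norm \<xi>)^4" using real
    by (simp add: power_mult_distrib power_divide power_mult[symmetric])
  finally have "pi\<^sup>2 * (norm (g \<xi>))\<^sup>2 \<le> a * pi / (1 - norm \<xi>)^4" by (simp add: power_mult_distrib)
  then have "(norm (g \<xi>))\<^sup>2 \<le> 1 / (pi * (1 - norm \<xi>)^4) * a"
    using \<xi> by (simp add: field_simps power2_eq_square)
  then have "ennreal ((norm (g \<xi>))\<^sup>2) \<le> ennreal (1 / (pi * (1 - norm \<xi>)^4) * a)" by (rule ennreal_leI)
  also have "\<dots> = ennreal (1 / (pi * (1 - norm \<xi>)^4)) * ennreal a"
    using real by (intro ennreal_mult) auto
  finally show ?thesis unfolding real(2) .
qed

text \<open>The point bound at the centre of the unit disc, carried to an arbitrary disc by the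
  affine map z -> w + r z, whose area factor is r^2.\<close>

lemma submean_square:
  fixes g :: "complex \<Rightarrow> complex"
  assumes g: "g holomorphic_on ball w r" and r: "0 < r"
  shows "ennreal (pi * r\<^sup>2 * (norm (g w))\<^sup>2) \<le> (\<integral>\<^sup>+z. ennreal ((norm (g z))\<^sup>2) * indicator (ball w r) z \<partial>lborel)"
proof -
  let ?h = "\<lambda>z. g (w + complex_of_real r * z)"
  let ?F = "\<lambda>z. ennreal ((norm (indicator (ball w r) z *\<^sub>R g z))\<^sup>2)"
  have [measurable]: "(\<lambda>z. indicator (ball w r) z *\<^sub>R g z) \<in> borel_measurable borel"
    by (rule holomorphic_disc_measurable[OF g open_ball])
  have [measurable]: "?F \<in> borel_measurable borel" by measurable
  have hol: "?h holomorphic_on ball 0 1"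
    by (intro holomorphic_on_compose_gen[OF _ g, unfolded o_def] holomorphic_intros)
       (use r in \<open>auto simp: dist_norm norm_mult\<close>)
  have "ennreal ((norm (g w))\<^sup>2) \<le> ennreal (1 / pi) * (\<integral>\<^sup>+z. ennreal ((norm (?h z))\<^sup>2) * indicator (ball 0 1) z \<partial>lborel)"
    using disc_point_bound[OF hol, of 0] by simp
  then have "ennreal (pi * r\<^sup>2) * ennreal ((norm (g w))\<^sup>2) \<le> ennreal (pi * r\<^sup>2) * (ennreal (1 / pi) * (\<integral>\<^sup>+z. ennreal ((norm (?h z))\<^sup>2) * indicator (ball 0 1) z \<partial>lborel))"
    by (rule mult_left_mono) simp
  also have "\<dots> = (ennreal (pi * r\<^sup>2) * ennreal (1 / pi)) * (\<integral>\<^sup>+z. ennreal ((norm (?h z))\<^sup>2) * indicator (ball 0 1) z \<partial>lborel)"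
    by (simp only: mult.assoc)
  also have "ennreal (pi * r\<^sup>2) * ennreal (1 / pi) = ennreal (r\<^sup>2)"
    by (subst ennreal_mult[symmetric]) auto
  also have "ennreal (r\<^sup>2) * (\<integral>\<^sup>+z. ennreal ((norm (?h z))\<^sup>2) * indicator (ball 0 1) z \<partial>lborel)
     = ennreal ((norm (complex_of_real r))\<^sup>2) * (\<integral>\<^sup>+z. ?F (w + of_real r * z) \<partial>lborel)"
    using r by (auto intro!: arg_cong2[where f="(*)"] nn_integral_cong simp: indicator_def dist_norm norm_mult)
  also have "\<dots> = (\<integral>\<^sup>+z. ?F (w + z) \<partial>lborel)"
  proof (intro nn_integral_complex_mult[symmetric, of "\<lambda>z. ?F (w + z)"])
    show "(\<lambda>z. ?F (w + z)) \<in> borel_measurable borel" by measurable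
  qed (use r in simp)
  also have "\<dots> = (\<integral>\<^sup>+z. ?F z \<partial>lborel)" by (rule nn_integral_lborel_plus) measurable
  also have "\<dots> = (\<integral>\<^sup>+z. ennreal ((norm (g z))\<^sup>2) * indicator (ball w r) z \<partial>lborel)"
    by (intro nn_integral_cong) (auto simp: indicator_def)
  finally show ?thesis by (simp add: ennreal_mult)
qed

text \<open>The sub-mean-value inequality on the disc of radius |w|/2 about w bounds |w g(w)|^2 by a
  constant times the integral of |g|^2 near 0, which tends to 0. Hence z g(z) tends to 0 and
  Riemann's theorem applies.\<close>

lemma square_integrable_removable:
  fixes g :: "complex \<Rightarrow> complex"
  assumes g: "g holomorphic_on ball 0 1 - {0}"
    and fin: "(\<integral>\<^sup>+z. ennreal ((norm (g z))\<^sup>2) * indicator (ball 0 1 - {0}) z \<partial>lborel) < \<infinity>"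
  obtains g' where "g' holomorphic_on ball 0 1" "\<And>z. z \<in> ball 0 1 - {0} \<Longrightarrow> g' z = g z"
proof -
  define F where "F z = ennreal ((norm (indicator (ball 0 1 - {0}) z *\<^sub>R g z))\<^sup>2)" for z
  have [measurable]: "(\<lambda>z. indicator (ball 0 1 - {0}) z *\<^sub>R g z) \<in> borel_measurable borel"
    by (rule holomorphic_disc_measurable[OF g]) auto
  have Fm[measurable]: "F \<in> borel_measurable borel" unfolding F_def by measurable
  have F: "F z = ennreal ((norm (g z))\<^sup>2) * indicator (ball 0 1 - {0}) z" for z
    by (auto simp: F_def indicator_def)
  define \<mu> where "\<mu> = density lborel F"
  have fin': "emeasure \<mu> A \<noteq> \<infinity>" if [measurable]: "A \<in> sets borel" for A
  proof -
    have "emeasure \<mu> A \<le> (\<integral>\<^sup>+z. F z \<partial>lborel)"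
      by (auto simp: \<mu>_def emeasure_density intro!: nn_integral_mono simp: indicator_def)
    also have "\<dots> < \<infinity>" using fin by (simp add: F)
    finally show ?thesis by simp
  qed
  \<comment> \<open>Continuity from above of the finite measure with density |g|^2: its mass on the
    shrinking balls tends to the mass of the origin, which is 0.\<close>
  have lim: "(\<lambda>i::nat. emeasure \<mu> (ball 0 (1 / real (Suc i)))) \<longlonglongrightarrow> emeasure \<mu> (\<Inter>i::nat. ball 0 (1 / real (Suc i)))"
  proof (rule Lim_emeasure_decseq)
    show "decseq (\<lambda>i. ball (0::complex) (1 / real (Suc i)))"
      unfolding decseq_def by (intro allI impI subset_ball frac_le) auto
  next
    show "emeasure \<mu> (ball 0 (1 / real (Suc i))) \<noteq> \<infinity>" for i by (rule fin') measurable
  qed (auto simp: \<mu>_def)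
  have "(\<Inter>i::nat. ball 0 (1 / real (Suc i))) = {0::complex}"
  proof -
    have "z = 0" if "\<And>i::nat. norm z < 1 / real (Suc i)" for z :: complex
    proof (rule ccontr)
      assume "z \<noteq> 0"
      then obtain i where "inverse (real (Suc i)) < norm z" using reals_Archimedean[of "norm z"] by auto
      with that[of i] show False by (simp add: inverse_eq_divide)
    qed
    then show ?thesis by auto
  qed
  moreover have "emeasure \<mu> {0} = 0"
    by (simp add: \<mu>_def emeasure_density F)
  ultimately have lim0: "(\<lambda>i::nat. emeasure \<mu> (ball 0 (1 / real (Suc i)))) \<longlonglongrightarrow> 0" using lim by simp
  have "((\<lambda>z. (z - 0) * g z) \<longlongrightarrow> 0) (at 0)"
    unfolding tendsto_iff
  proof (intro allI impI)
    fix e :: real assume e: "0 < e"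
    have "\<forall>\<^sub>F i in sequentially. emeasure \<mu> (ball 0 (1 / real (Suc i))) < ennreal (pi * e\<^sup>2 / 4)"
      using e by (intro order_tendstoD(2)[OF lim0]) simp
    then obtain i where i: "emeasure \<mu> (ball 0 (1 / real (Suc i))) < ennreal (pi * e\<^sup>2 / 4)"
      by (auto simp: eventually_sequentially)
    have "\<forall>\<^sub>F z in at 0. z \<noteq> 0 \<and> norm z < 1 / (2 * real (Suc i))"
      unfolding eventually_at by (rule exI[of _ "1 / (2 * real (Suc i))"]) (auto simp: dist_norm)
    then show "\<forall>\<^sub>F z in at 0. dist ((z - 0) * g z) 0 < e"
    proof eventually_elim
      case (elim w)
      \<comment> \<open>With this radius the disc about w avoids 0 and stays inside the ball of
        radius 2 |w| about 0, which lies in the ball of index i.\<close>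
      let ?r = "norm w / 2"
      have wb: "2 * norm w < 1 / real (Suc i)" using elim by (simp add: field_simps)
      have "1 / real (Suc i) \<le> 1" by (simp add: field_simps)
      have sub: "ball w ?r \<subseteq> (ball 0 1 - {0}) \<inter> ball 0 (1 / real (Suc i))"
      proof
        fix z assume "z \<in> ball w ?r"
        then have 1: "norm (w - z) < norm w / 2" by (simp add: dist_norm)
        have "norm z \<le> norm w + norm (w - z)" by (metis norm_minus_commute norm_triangle_sub)
        then have 2: "norm z < 2 * norm w" using 1 norm_ge_zero[of w] by linarith
        have "norm z < 1 / real (Suc i)" using 2 wb by (rule less_trans)
        moreover have "norm z < 1" using calculation \<open>1 / real (Suc i) \<le> 1\<close> by (rule less_le_trans)
        moreover have "z \<noteq> 0" using 1 by auto
        ultimately show "z \<in> (ball 0 1 - {0}) \<inter> ball 0 (1 / real (Suc i))" by (simp del: of_nat_Suc)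
      qed
      have "ennreal (pi * ?r\<^sup>2 * (norm (g w))\<^sup>2) \<le> (\<integral>\<^sup>+z. ennreal ((norm (g z))\<^sup>2) * indicator (ball w ?r) z \<partial>lborel)"
        by (rule submean_square) (use elim sub in \<open>auto intro: holomorphic_on_subset[OF g]\<close>)
      also have "\<dots> \<le> (\<integral>\<^sup>+z. F z * indicator (ball 0 (1 / real (Suc i))) z \<partial>lborel)"
        using sub by (intro nn_integral_mono) (auto simp: F indicator_def)
      also have "\<dots> = emeasure \<mu> (ball 0 (1 / real (Suc i)))"
        by (simp add: \<mu>_def emeasure_density)
      also note i
      finally have "pi * ?r\<^sup>2 * (norm (g w))\<^sup>2 < pi * e\<^sup>2 / 4"
        by (subst (asm) ennreal_less_iff) auto
      then have "(norm (w * g w))\<^sup>2 < e\<^sup>2" by (simp add: norm_mult power_mult_distrib power_divide)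
      then show ?case using e by (simp add: power2_less_imp_less)
    qed
  qed
  then show thesis
    using holomorphic_on_extend_lim[OF g] that by (auto simp: interior_open)
qed

text \<open>Fubini and two applications of the disc formula, first in x, then in l along the slice
  through \<omega>. Holomorphy in l is assumed only off l = 0, as for pullbacks from the triangle;
  the slice extends over 0 because it is square integrable.\<close>

lemma bidisc_reproducing:
  fixes G :: "complex \<times> complex \<Rightarrow> complex"
  assumes G[measurable]: "G \<in> borel_measurable borel"
    and fin: "(\<integral>\<^sup>+x. ennreal ((norm (G x))\<^sup>2) * indicator bidisc x \<partial>lborel) < \<infinity>"
    and h1: "\<And>l. 0 < norm l \<Longrightarrow> norm l < 1 \<Longrightarrow> (\<lambda>x. G (x, l)) holomorphic_on ball 0 1"
    and h2: "\<And>x. norm x < 1 \<Longrightarrow> (\<lambda>l. G (x, l)) holomorphic_on ball 0 1 - {0}"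
    and \<omega>: "norm \<omega> < 1" and \<eta>: "0 < norm \<eta>" "norm \<eta> < 1"
  shows "integrable lborel (\<lambda>x. indicator bidisc x *\<^sub>R (G x / ((1 - \<omega> * cnj (fst x))\<^sup>2 * (1 - \<eta> * cnj (snd x))\<^sup>2)))" (is "integrable lborel ?f")
    and "(\<integral>x. indicator bidisc x *\<^sub>R (G x / ((1 - \<omega> * cnj (fst x))\<^sup>2 * (1 - \<eta> * cnj (snd x))\<^sup>2)) \<partial>lborel) = pi\<^sup>2 * G (\<omega>, \<eta>)"
proof -
  have nz: "AE l in lborel. l \<noteq> (0::complex)" by (rule AE_lborel_singleton)
  have kc: "continuous_on UNIV (\<lambda>x::complex\<times>complex. (1 - \<omega> * cnj (fst x))\<^sup>2 * (1 - \<eta> * cnj (snd x))\<^sup>2)"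
    by (intro continuous_intros)
  have [measurable]: "(\<lambda>x::complex\<times>complex. (1 - \<omega> * cnj (fst x))\<^sup>2 * (1 - \<eta> * cnj (snd x))\<^sup>2) \<in> borel_measurable borel"
    by (rule borel_measurable_continuous_onI[OF kc])
  have fm[measurable]: "?f \<in> borel_measurable borel" by measurable
  let ?c = "(1 - norm \<omega>)\<^sup>2 * (1 - norm \<eta>)\<^sup>2"
  have c: "0 < ?c" using \<omega> \<eta> by simp
  have bd: "norm (?f x) \<le> 1 / ?c * (indicator bidisc x + (norm (G x))\<^sup>2 * indicator bidisc x)" for x
  proof (cases "x \<in> bidisc")
    case True
    then have x: "norm (fst x) \<le> 1" "norm (snd x) \<le> 1" by (auto simp: bidisc_def)
    have "?c \<le> (norm (1 - \<omega> * cnj (fst x)))\<^sup>2 * (norm (1 - \<eta> * cnj (snd x)))\<^sup>2"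
      using norm_one_minus_ge[OF x(1), of \<omega>] norm_one_minus_ge[OF x(2), of \<eta>] \<omega> \<eta>
      by (intro mult_mono power_mono) auto
    then have "norm (G x) / ((norm (1 - \<omega> * cnj (fst x)))\<^sup>2 * (norm (1 - \<eta> * cnj (snd x)))\<^sup>2) \<le> norm (G x) / ?c"
      using c by (intro divide_left_mono mult_pos_pos) auto
    also have "\<dots> \<le> (1 + (norm (G x))\<^sup>2) / ?c"
    proof (rule divide_right_mono)
      have "0 \<le> (norm (G x) - 1/2)\<^sup>2" by simp
      moreover have "(norm (G x) - 1/2)\<^sup>2 = (norm (G x))\<^sup>2 - norm (G x) + 1/4"
        by (simp add: power2_eq_square field_simps)
      ultimately show "norm (G x) \<le> 1 + (norm (G x))\<^sup>2" by linarith
    qed (use c in simp)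
    finally show ?thesis using True by (simp add: norm_divide norm_mult norm_power)
  qed simp
  show I: "integrable lborel ?f"
  proof (rule Bochner_Integration.integrable_bound)
    show "AE x in lborel. norm (?f x) \<le> norm (1 / ?c * (indicator bidisc x + (norm (G x))\<^sup>2 * indicator bidisc x))"
      by (intro AE_I2 order_trans[OF bd]) (simp only: real_norm_def abs_ge_self)
    have "integrable lborel (\<lambda>x. indicator bidisc x :: real)" by (simp add: emeasure_bidisc)
    moreover have "integrable lborel (\<lambda>x. (norm (G x))\<^sup>2 * indicator bidisc x)"
    proof (rule integrableI_bounded)
      have "(\<integral>\<^sup>+x. ennreal (norm ((norm (G x))\<^sup>2 * indicator bidisc x)) \<partial>lborel) = (\<integral>\<^sup>+x. ennreal ((norm (G x))\<^sup>2) * indicator bidisc x \<partial>lborel)"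
        by (intro nn_integral_cong) (auto simp: indicator_def)
      then show "(\<integral>\<^sup>+x. ennreal (norm ((norm (G x))\<^sup>2 * indicator bidisc x)) \<partial>lborel) < \<infinity>" using fin by simp
    qed measurable
    ultimately show "integrable lborel (\<lambda>x. 1 / ?c * (indicator bidisc x + (norm (G x))\<^sup>2 * indicator bidisc x))"
      by (intro integrable_mult_right Bochner_Integration.integrable_add)
  qed measurable
  define S where "S l = (\<integral>\<^sup>+x. ennreal ((norm (G (x, l)))\<^sup>2) * indicator (ball 0 1) x \<partial>lborel)" for l
  have [measurable]: "S \<in> borel_measurable borel" unfolding S_def by measurable
  have Sfin: "(\<integral>\<^sup>+l. S l * indicator (ball 0 1) l \<partial>lborel) < \<infinity>"
  proof -
    have "(\<integral>\<^sup>+x. ennreal ((norm (G x))\<^sup>2) * indicator bidisc x \<partial>lborel) = (\<integral>\<^sup>+l. (\<integral>\<^sup>+x. ennreal ((norm (G (x, l)))\<^sup>2) * indicator bidisc (x, l) \<partial>lborel) \<partial>lborel)"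
      by (rule nn_integral_lborel_pair(1)) measurable
    also have "\<dots> = (\<integral>\<^sup>+l. S l * indicator (ball 0 1) l \<partial>lborel)"
    proof (rule nn_integral_cong)
      fix l :: complex
      have "(\<integral>\<^sup>+x. ennreal ((norm (G (x, l)))\<^sup>2) * indicator bidisc (x, l) \<partial>lborel)
         = (\<integral>\<^sup>+x. ennreal ((norm (G (x, l)))\<^sup>2) * indicator (ball 0 1) x * indicator (ball 0 1) l \<partial>lborel)"
        by (simp add: indicator_bidisc mult.assoc)
      then show "(\<integral>\<^sup>+x. ennreal ((norm (G (x, l)))\<^sup>2) * indicator bidisc (x, l) \<partial>lborel) = S l * indicator (ball 0 1) l"
        unfolding S_def by (simp add: nn_integral_multc)
    qed
    finally show ?thesis using fin by simp
  qed
  \<comment> \<open>Tonelli makes the slices at fixed l square integrable for almost every l; this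
    suffices, since they are then integrated over l.\<close>
  have "AE l in lborel. S l * indicator (ball 0 1) l \<noteq> \<infinity>"
    using Sfin by (intro nn_integral_PInf_AE) auto
  then have inner: "AE l in lborel. (\<integral>x. ?f (x, l) \<partial>lborel) = indicator (ball 0 1) l *\<^sub>R (pi * G (\<omega>, l) / (1 - \<eta> * cnj l)\<^sup>2)"
    using nz
  proof eventually_elim
    case (elim l)
    show ?case
    proof (cases "norm l < 1")
      case True
      then have "S l \<noteq> \<infinity>" using elim by simp
      then obtain a where a: "S l = ennreal a" "0 \<le> a" by (cases "S l") auto
      have hl: "(\<lambda>x. G (x, l)) holomorphic_on ball 0 1" using elim True by (intro h1) auto
      note b = disc_square_integrable_bound(2)[OF holomorphic_disc_measurable[OF hl open_ball] eq_refl[OF a(1)[unfolded S_def]] a(2)]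
      note r = disc_reproducing[OF hl b \<omega>]
      have "?f (x, l) = (indicator (ball 0 1) x *\<^sub>R (G (x, l) / (1 - \<omega> * cnj x)\<^sup>2)) * (1 / (1 - \<eta> * cnj l)\<^sup>2)" for x
        using True by (auto simp: indicator_def bidisc_iff)
      then have "(\<integral>x. ?f (x, l) \<partial>lborel) = (\<integral>x. indicator (ball 0 1) x *\<^sub>R (G (x, l) / (1 - \<omega> * cnj x)\<^sup>2) \<partial>lborel) * (1 / (1 - \<eta> * cnj l)\<^sup>2)"
        by (simp only: integral_mult_left_zero)
      then show ?thesis using True by (simp add: r(2))
    next
      case False
      then have "indicator bidisc (x, l) = (0::real)" for x by (simp add: bidisc_iff)
      then show ?thesis using False by simp
    qed
  qed
  \<comment> \<open>The one slice at x = \<omega> is a null set, so Tonelli does not give its square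
    integrability. The point bound at \<omega>, applied for each fixed l and integrated over l,
    does.\<close>
  have hw: "(\<lambda>l. G (\<omega>, l)) holomorphic_on ball 0 1 - {0}" by (rule h2[OF \<omega>])
  have "(\<integral>\<^sup>+l. ennreal ((norm (G (\<omega>, l)))\<^sup>2) * indicator (ball 0 1 - {0}) l \<partial>lborel)
     \<le> (\<integral>\<^sup>+l. ennreal (1 / (pi * (1 - norm \<omega>)^4)) * (S l * indicator (ball 0 1) l) \<partial>lborel)"
  proof (rule nn_integral_mono)
    fix l :: complex
    show "ennreal ((norm (G (\<omega>, l)))\<^sup>2) * indicator (ball 0 1 - {0}) l \<le> ennreal (1 / (pi * (1 - norm \<omega>)^4)) * (S l * indicator (ball 0 1) l)"
      using disc_point_bound[OF h1 \<omega>, of l] by (auto simp: indicator_def S_def)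
  qed
  also have "\<dots> = ennreal (1 / (pi * (1 - norm \<omega>)^4)) * (\<integral>\<^sup>+l. S l * indicator (ball 0 1) l \<partial>lborel)"
    by (rule nn_integral_cmult) measurable
  also have "\<dots> < \<infinity>" using Sfin by (simp add: ennreal_mult_less_top)
  finally have finw: "(\<integral>\<^sup>+l. ennreal ((norm (G (\<omega>, l)))\<^sup>2) * indicator (ball 0 1 - {0}) l \<partial>lborel) < \<infinity>" .
  obtain g where g: "g holomorphic_on ball 0 1" "\<And>l. l \<in> ball 0 1 - {0} \<Longrightarrow> g l = G (\<omega>, l)"
    using square_integrable_removable[OF hw finw] by blast
  have "(\<integral>\<^sup>+l. ennreal ((norm (g l))\<^sup>2) * indicator (ball 0 1) l \<partial>lborel) = (\<integral>\<^sup>+l. ennreal ((norm (G (\<omega>, l)))\<^sup>2) * indicator (ball 0 1 - {0}) l \<partial>lborel)"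
    by (rule nn_integral_cong_AE, use nz in eventually_elim) (auto simp: indicator_def g(2))
  moreover define I where "I = (\<integral>\<^sup>+l. ennreal ((norm (g l))\<^sup>2) * indicator (ball 0 1) l \<partial>lborel)"
  ultimately have "I < \<infinity>" using finw by simp
  then obtain a where "I = ennreal a" "0 \<le> a" by (cases I) auto
  then have a: "(\<integral>\<^sup>+l. ennreal ((norm (g l))\<^sup>2) * indicator (ball 0 1) l \<partial>lborel) = ennreal a" "0 \<le> a"
    by (simp_all add: I_def)
  note b = disc_square_integrable_bound(2)[OF holomorphic_disc_measurable[OF g(1) open_ball] eq_refl[OF a(1)] a(2)]
  note r = disc_reproducing[OF g(1) b \<eta>(2)]
  have "(\<integral>x. ?f x \<partial>lborel) = (\<integral>x. ?f x \<partial>(lborel \<Otimes>\<^sub>M lborel))" by (simp add: lborel_prod)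
  also have "\<dots> = (\<integral>l. \<integral>x. ?f (x, l) \<partial>lborel \<partial>lborel)"
    using lborel_pair.integral_snd[of "\<lambda>x l. ?f (x, l)"] I by (simp add: lborel_prod case_prod_beta')
  also have "\<dots> = (\<integral>l. pi * (indicator (ball 0 1) l *\<^sub>R (g l / (1 - \<eta> * cnj l)\<^sup>2)) \<partial>lborel)"
  proof (rule integral_cong_AE)
    show "AE l in lborel. (\<integral>x. ?f (x, l) \<partial>lborel) = pi * (indicator (ball 0 1) l *\<^sub>R (g l / (1 - \<eta> * cnj l)\<^sup>2))"
      using inner nz by eventually_elim (auto simp: indicator_def g(2))
    show "(\<lambda>l. \<integral>x. ?f (x, l) \<partial>lborel) \<in> borel_measurable lborel"
    proof (rule lborel.borel_measurable_lebesgue_integral)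
      have "(\<lambda>x::complex\<times>complex. (snd x, fst x)) \<in> borel_measurable borel"
        by (intro borel_measurable_continuous_onI continuous_intros)
      from measurable_compose[OF this fm]
      show "(\<lambda>(l, x). ?f (x, l)) \<in> borel_measurable (lborel \<Otimes>\<^sub>M lborel)"
        unfolding case_prod_beta' by (simp only: lborel_prod measurable_lborel1 measurable_lborel2)
    qed
    show "(\<lambda>l. pi * (indicator (ball 0 1) l *\<^sub>R (g l / (1 - \<eta> * cnj l)\<^sup>2))) \<in> borel_measurable lborel"
      using r(1) by (intro borel_measurable_times borel_measurable_const) (rule borel_measurable_integrable)
  qed
  also have "\<dots> = pi * (pi * g \<eta>)" using r(2) by (subst integral_mult_right_zero) simp
  also have "\<dots> = pi\<^sup>2 * G (\<omega>, \<eta>)" using g(2)[of \<eta>] \<eta> by (simp add: power2_eq_square)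
  finally show "(\<integral>x. ?f x \<partial>lborel) = pi\<^sup>2 * G (\<omega>, \<eta>)" .
qed

section \<open>The Bergman kernel of the Hartogs triangle\<close>

text \<open>The divisibility is the congruence l = n r modulo m, written with m - r so that it stays
  within the natural numbers. It selects the terms that survive summation over the m-th roots of
  unity in \<open>bk_poly_roots\<close>.\<close>

definition bk_idx :: "nat \<Rightarrow> nat \<Rightarrow> (nat \<times> nat) set" where
  "bk_idx m n = {(r, l). r \<in> {1..m} \<and> l \<in> {1..m} \<and> m dvd l + n * (m - r)}"

text \<open>The factor r + (m - r) v^m, times v^(r-1), is the numerator over (1 - v^m)^2 of the part
  of the series of 1/(1 - v)^2 whose exponents are r - 1 modulo m; likewise for p and l.\<close>

definition bk_poly :: "nat \<Rightarrow> nat \<Rightarrow> complex \<Rightarrow> complex \<Rightarrow> complex" where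
  "bk_poly m n v p = (\<Sum>(r,l)\<in>bk_idx m n. (of_nat r + of_nat (m - r) * v ^ m) * (of_nat l + of_nat (m - l) * p ^ m)
      * (v ^ (r - 1) * p ^ (l - 1)))"

text \<open>The kernel in the variables s = z1 cnj w1 and t = z2 cnj w2 of the triangle itself,
  which satisfy s = v p^n and t = p^m. On \<open>bk_idx\<close> the division by m is exact, so no
  roots of t occur; the power t^(n+1) in the denominator keeps the exponents in the numerator
  nonnegative.\<close>

definition bk :: "nat \<Rightarrow> nat \<Rightarrow> complex \<Rightarrow> complex \<Rightarrow> complex" where
  "bk m n s t = (\<Sum>(r,l)\<in>bk_idx m n. (of_nat r + of_nat (m - r) * (s ^ m / t ^ n)) * (of_nat l + of_nat (m - l) * t)
      * (s ^ (r - 1) * t ^ ((l + n * (m - r)) div m)))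
     / (of_real (pi\<^sup>2) * of_nat m * t ^ (n + 1) * (1 - s ^ m / t ^ n)\<^sup>2 * (1 - t)\<^sup>2)"

lemma finite_bk_idx: "finite (bk_idx m n)"
  by (rule finite_subset[of _ "{1..m} \<times> {1..m}"]) (auto simp: bk_idx_def)

text \<open>For p = l cnj k the power p^(m+n-1) left in the denominator is the product of the
  Jacobian factors l^(m+n-1) and cnj k^(m+n-1) of the covering at the two points.\<close>

lemma bk_pullback:
  assumes m: "0 < m" and p: "p \<noteq> 0"
  shows "bk m n (v * p ^ n) (p ^ m)
    = bk_poly m n v p / (of_real (pi\<^sup>2) * of_nat m * p ^ (m + n - 1) * (1 - v ^ m)\<^sup>2 * (1 - p ^ m)\<^sup>2)"
proof -
  have u: "(v * p ^ n) ^ m / (p ^ m) ^ n = v ^ m"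
    using p by (simp add: power_mult_distrib power_mult[symmetric] mult.commute)
  have tm: "(v * p ^ n) ^ (r - 1) * (p ^ m) ^ ((l + n * (m - r)) div m)
      = v ^ (r - 1) * p ^ (l - 1) * ((p ^ m) ^ (n + 1) / p ^ (m + n - 1))"
    if "(r, l) \<in> bk_idx m n" for r l
  proof -
    have rl: "1 \<le> r" "r \<le> m" "1 \<le> l" "m dvd l + n * (m - r)" using that by (auto simp: bk_idx_def)
    obtain r' where r': "r = Suc r'" using rl by (cases r) auto
    obtain l' where l': "l = Suc l'" using rl by (cases l) auto
    obtain d where d: "m = r + d" using rl le_Suc_ex by blast
    have e: "n * (r - 1) + (l + n * (m - r)) + (m + n - 1) = (l - 1) + m * (n + 1)"
      unfolding d r' l' by (simp add: algebra_simps)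
    have "(v * p ^ n) ^ (r - 1) * (p ^ m) ^ ((l + n * (m - r)) div m) = v ^ (r - 1) * (p ^ (n * (r - 1)) * p ^ (l + n * (m - r)))"
      using rl(4) by (simp add: power_mult_distrib power_mult[symmetric])
    also have "p ^ (n * (r - 1)) * p ^ (l + n * (m - r)) = p ^ (l - 1) * ((p ^ m) ^ (n + 1) / p ^ (m + n - 1))"
    proof -
      have "p ^ (n * (r - 1)) * p ^ (l + n * (m - r)) * p ^ (m + n - 1) = p ^ (l - 1) * (p ^ m) ^ (n + 1)"
        by (simp only: power_add[symmetric] power_mult[symmetric] e)
      then show ?thesis using p by (simp add: field_simps)
    qed
    finally show ?thesis by (simp only: mult.assoc)
  qed
  have "(\<Sum>(r,l)\<in>bk_idx m n. (of_nat r + of_nat (m - r) * v ^ m) * (of_nat l + of_nat (m - l) * p ^ m)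
      * ((v * p ^ n) ^ (r - 1) * (p ^ m) ^ ((l + n * (m - r)) div m))) = bk_poly m n v p * ((p ^ m) ^ (n + 1) / p ^ (m + n - 1))"
    unfolding bk_poly_def sum_distrib_right
  proof (rule sum.cong[OF refl], safe)
    fix r l assume "(r, l) \<in> bk_idx m n"
    from tm[OF this] show "(of_nat r + of_nat (m - r) * v ^ m) * (of_nat l + of_nat (m - l) * p ^ m)
      * ((v * p ^ n) ^ (r - 1) * (p ^ m) ^ ((l + n * (m - r)) div m))
     = (of_nat r + of_nat (m - r) * v ^ m) * (of_nat l + of_nat (m - l) * p ^ m)
      * (v ^ (r - 1) * p ^ (l - 1)) * ((p ^ m) ^ (n + 1) / p ^ (m + n - 1))"
      by (simp only: mult.assoc)
  qed
  then have "bk m n (v * p ^ n) (p ^ m) = bk_poly m n v p * ((p ^ m) ^ (n + 1) / p ^ (m + n - 1))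
     / (of_real (pi\<^sup>2) * of_nat m * (p ^ m) ^ (n + 1) * (1 - v ^ m)\<^sup>2 * (1 - p ^ m)\<^sup>2)"
    unfolding bk_def u by simp
  also have "\<dots> = bk_poly m n v p / (of_real (pi\<^sup>2) * of_nat m * p ^ (m + n - 1) * (1 - v ^ m)\<^sup>2 * (1 - p ^ m)\<^sup>2)"
  proof -
    have "(p ^ m) ^ (n + 1) \<noteq> 0" using p by simp
    then show ?thesis by (simp add: divide_simps del: power_Suc)
  qed
  finally show ?thesis .
qed

text \<open>Grouping the terms of the series of \<open>1/(1-x)\<^sup>2\<close> by residues modulo \<open>m\<close>.\<close>

lemma one_minus_square_residues:
  fixes x :: complex
  shows "(1 - x)\<^sup>2 * (\<Sum>r=1..m. (of_nat r + of_nat (m - r) * x ^ m) * x ^ (r - 1)) = (1 - x ^ m)\<^sup>2"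
proof -
  let ?g = "\<Sum>r<m. x ^ r"
  \<comment> \<open>Telescoping of the coefficients r against the geometric sum. The complementary
    coefficients m - r in \<open>B\<close> are handled by subtracting this from m times the
    geometric sum.\<close>
  have A: "(1 - x) * (\<Sum>r=1..k. of_nat r * x ^ (r - 1)) = (\<Sum>r<k. x ^ r) - of_nat k * x ^ k" for k
  proof (induction k)
    case (Suc k)
    have "(1 - x) * (\<Sum>r=1..Suc k. of_nat r * x ^ (r - 1))
        = (1 - x) * (\<Sum>r=1..k. of_nat r * x ^ (r - 1)) + (1 - x) * (of_nat (Suc k) * x ^ k)"
      by (simp add: distrib_left)
    also have "\<dots> = (\<Sum>r<Suc k. x ^ r) - of_nat (Suc k) * x ^ Suc k"
      unfolding Suc.IH by (simp add: algebra_simps)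
    finally show ?case .
  qed simp
  have G: "(1 - x) * (\<Sum>r<k. x ^ r) = 1 - x ^ k" for k
    by (rule one_diff_power_eq[symmetric])
  have sh: "(\<Sum>r=1..k. x ^ (r - 1)) = (\<Sum>r<k. x ^ r)" for k
    by (induction k) auto
  have "(\<Sum>r=1..m. of_nat (m - r) * x ^ (r - 1)) = (\<Sum>r=1..m. of_nat m * x ^ (r - 1) - of_nat r * x ^ (r - 1))"
    by (rule sum.cong) (auto simp: of_nat_diff algebra_simps)
  also have "\<dots> = of_nat m * ?g - (\<Sum>r=1..m. of_nat r * x ^ (r - 1))"
    by (simp only: sum_subtractf sum_distrib_left[symmetric] sh)
  finally have e: "(\<Sum>r=1..m. of_nat (m - r) * x ^ (r - 1)) = of_nat m * ?g - (\<Sum>r=1..m. of_nat r * x ^ (r - 1))" .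
  have B: "(1 - x) * (\<Sum>r=1..m. of_nat (m - r) * x ^ (r - 1)) = of_nat m * (1 - x ^ m) - (?g - of_nat m * x ^ m)"
  proof -
    have "(1 - x) * (c * y - z) = c * ((1 - x) * y) - (1 - x) * z" for c y z :: complex
      by (simp add: algebra_simps)
    then show ?thesis unfolding e by (simp only: A G)
  qed
  have "(\<Sum>r=1..m. (of_nat r + of_nat (m - r) * x ^ m) * x ^ (r - 1))
     = (\<Sum>r=1..m. of_nat r * x ^ (r - 1)) + x ^ m * (\<Sum>r=1..m. of_nat (m - r) * x ^ (r - 1))"
    by (simp add: sum_distrib_left sum.distrib[symmetric] algebra_simps)
  then have "(1 - x) * (\<Sum>r=1..m. (of_nat r + of_nat (m - r) * x ^ m) * x ^ (r - 1)) = ?g * (1 - x ^ m)"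
    using A[of m] B by (simp only: distrib_left mult.left_commute[of "1 - x"]) (simp add: algebra_simps)
  then have "(1 - x)\<^sup>2 * (\<Sum>r=1..m. (of_nat r + of_nat (m - r) * x ^ m) * x ^ (r - 1)) = (1 - x) * ?g * (1 - x ^ m)"
    by (simp only: power2_eq_square mult.assoc)
  then show ?thesis by (simp only: G power2_eq_square)
qed

text \<open>With d = \<open>ru m k\<close>, the map (x, l) -> (cnj d^n x, d l) is the deck
  transformation of \<open>hmap\<close> with index k.\<close>

definition ru :: "nat \<Rightarrow> nat \<Rightarrow> complex" where
  "ru m k = exp (2 * of_real pi * \<i> * of_nat k / of_nat m)"

lemma norm_ru[simp]: "norm (ru m k) = 1"
  by (simp add: ru_def)

lemma ru_power: "0 < m \<Longrightarrow> ru m k ^ m = 1"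
  unfolding ru_def using complex_root_unity[of m k] by simp

lemma ru_cnj: "ru m k * cnj (ru m k) = 1"
  using complex_norm_square[of "ru m k"] by simp

lemma sum_ru_power:
  assumes m: "0 < m"
  shows "(\<Sum>k<m. ru m k ^ d) = (if m dvd d then of_nat m else 0)"
proof -
  let ?w = "exp (2 * of_real pi * \<i> * of_nat d / of_nat m)"
  have w: "ru m k ^ d = ?w ^ k" for k
    by (simp add: ru_def exp_of_nat_mult[symmetric] mult_ac)
  have w1: "?w = 1 \<longleftrightarrow> m dvd d" using complex_root_unity_eq_1[of m d] m by simp
  have wm: "?w ^ m = 1" using complex_root_unity[of m d] m by simp
  show ?thesis
  proof (cases "m dvd d")
    case True
    then show ?thesis using w1 by (simp only: w) simp
  next
    case False
    then have "?w \<noteq> 1" using w1 by simp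
    then have "(\<Sum>k<m. ?w ^ k) = 0" using wm by (simp add: geometric_sum)
    then show ?thesis using False by (simp only: w) simp
  qed
qed

text \<open>Up to constants and the power of p, the left side sums the bidisc kernel over the deck
  group, with the Jacobian \<open>ru m k ^ (n - 1)\<close> of (x, l) -> (d^n x, cnj d l) as weight.
  Splitting both inverse squares by residues modulo m and using orthogonality of the roots leaves
  exactly the pairs in \<open>bk_idx\<close>.\<close>

lemma bk_poly_roots:
  assumes m: "0 < m" and n: "0 < n" and v: "norm v < 1" and p: "norm p < 1"
  shows "(\<Sum>k<m. ru m k ^ (n - 1) / ((1 - ru m k ^ n * v)\<^sup>2 * (1 - cnj (ru m k) * p)\<^sup>2))
      = of_nat m * bk_poly m n v p / ((1 - v ^ m)\<^sup>2 * (1 - p ^ m)\<^sup>2)"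
proof -
  let ?a = "\<lambda>r. of_nat r + of_nat (m - r) * v ^ m :: complex"
  let ?b = "\<lambda>l. of_nat l + of_nat (m - l) * p ^ m :: complex"
  have ne: "1 - z \<noteq> 0" if "norm z < 1" for z :: complex using that by auto
  have vm: "1 - v ^ m \<noteq> 0" "1 - p ^ m \<noteq> 0"
    using m v p by (intro ne; simp add: norm_power power_less_one_iff)+
  have inv: "1 / (1 - z)\<^sup>2 = (\<Sum>r=1..m. (of_nat r + of_nat (m - r) * z ^ m) * z ^ (r - 1)) / (1 - z ^ m)\<^sup>2"
    if "norm z < 1" for z :: complex
  proof -
    have "1 - z ^ m \<noteq> 0" using m that by (intro ne) (simp add: norm_power power_less_one_iff)
    then show ?thesis using one_minus_square_residues[of z m] ne[OF that] by (simp add: divide_simps mult.commute)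
  qed
  have 1: "ru m k ^ (n - 1) / ((1 - ru m k ^ n * v)\<^sup>2 * (1 - cnj (ru m k) * p)\<^sup>2)
     = (\<Sum>r=1..m. \<Sum>l=1..m. ?a r * ?b l * (v ^ (r - 1) * p ^ (l - 1)) * cnj (ru m k ^ (l + n * (m - r)))) / ((1 - v ^ m)\<^sup>2 * (1 - p ^ m)\<^sup>2)" for k
  proof -
    let ?d = "ru m k"
    have nv: "norm (?d ^ n * v) < 1" "norm (cnj ?d * p) < 1" using v p by (simp_all add: norm_mult norm_power)
    have dm: "(?d ^ n * v) ^ m = v ^ m" "(cnj ?d * p) ^ m = p ^ m"
      using ru_power[OF m, of k] by (simp_all add: power_mult_distrib power_mult[symmetric] mult.commute[of n])
         (simp_all add: power_mult flip: complex_cnj_power)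
    \<comment> \<open>Multiplied by \<open>?d ^ (l + n * (m - r))\<close> both sides become 1: on
      the left the conjugate powers cancel l - 1 of the exponents and m n remain.\<close>
    have X: "?d ^ (n - 1) * ((?d ^ n) ^ (r - 1) * cnj ?d ^ (l - 1)) = cnj (?d ^ (l + n * (m - r)))"
      if rl: "r \<in> {1..m}" "l \<in> {1..m}" for r l
    proof -
      obtain r' where r': "r = Suc r'" using rl by (cases r) auto
      obtain l' where l': "l = Suc l'" using rl by (cases l) auto
      obtain n' where n': "n = Suc n'" using n by (cases n) auto
      obtain e where e: "m = r + e" using rl le_Suc_ex by auto
      let ?L = "?d ^ (n - 1) * ((?d ^ n) ^ (r - 1) * cnj ?d ^ (l - 1))"
      have "?L * ?d ^ (l + n * (m - r)) = ?d ^ ((n - 1) + n * (r - 1) + 1 + n * (m - r)) * (?d ^ (l - 1) * cnj ?d ^ (l - 1))"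
        unfolding l' by (simp add: power_add power_mult mult_ac)
      also have "?d ^ (l - 1) * cnj ?d ^ (l - 1) = 1"
        by (simp add: power_mult_distrib[symmetric] ru_cnj)
      also have "(n - 1) + n * (r - 1) + 1 + n * (m - r) = m * n" unfolding e n' r' by (simp add: algebra_simps)
      also have "?d ^ (m * n) = 1" by (simp add: power_mult ru_power m)
      finally have "?L * ?d ^ (l + n * (m - r)) = 1" by simp
      moreover have "cnj (?d ^ (l + n * (m - r))) * ?d ^ (l + n * (m - r)) = 1"
        by (simp add: power_mult_distrib[symmetric] ru_cnj mult.commute[of "cnj ?d"])
      moreover have "?d ^ (l + n * (m - r)) \<noteq> 0" by (metis norm_ru norm_zero power_not_zero zero_neq_one)
      ultimately show ?thesis by (metis mult_right_cancel)
    qed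
    have "?d ^ (n - 1) / ((1 - ?d ^ n * v)\<^sup>2 * (1 - cnj ?d * p)\<^sup>2)
       = ?d ^ (n - 1) * (1 / (1 - ?d ^ n * v)\<^sup>2) * (1 / (1 - cnj ?d * p)\<^sup>2)" by simp
    also have "\<dots> = ?d ^ (n - 1) * ((\<Sum>r=1..m. ?a r * (?d ^ n * v) ^ (r - 1)) / (1 - v ^ m)\<^sup>2) * ((\<Sum>l=1..m. ?b l * (cnj ?d * p) ^ (l - 1)) / (1 - p ^ m)\<^sup>2)"
      unfolding inv[OF nv(1)] inv[OF nv(2)] dm ..
    also have "\<dots> = (\<Sum>r=1..m. \<Sum>l=1..m. ?d ^ (n - 1) * ((?a r * (?d ^ n * v) ^ (r - 1)) * (?b l * (cnj ?d * p) ^ (l - 1)))) / ((1 - v ^ m)\<^sup>2 * (1 - p ^ m)\<^sup>2)"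
    proof -
      have "(\<Sum>r=1..m. \<Sum>l=1..m. ?d ^ (n - 1) * ((?a r * (?d ^ n * v) ^ (r - 1)) * (?b l * (cnj ?d * p) ^ (l - 1))))
        = ?d ^ (n - 1) * ((\<Sum>r=1..m. ?a r * (?d ^ n * v) ^ (r - 1)) * (\<Sum>l=1..m. ?b l * (cnj ?d * p) ^ (l - 1)))"
        unfolding sum_product by (simp only: sum_distrib_left)
      then show ?thesis by (simp only: times_divide_eq_left times_divide_eq_right divide_divide_eq_left mult.assoc)
    qed
    also have "(\<Sum>r=1..m. \<Sum>l=1..m. ?d ^ (n - 1) * ((?a r * (?d ^ n * v) ^ (r - 1)) * (?b l * (cnj ?d * p) ^ (l - 1))))
      = (\<Sum>r=1..m. \<Sum>l=1..m. ?a r * ?b l * (v ^ (r - 1) * p ^ (l - 1)) * cnj (?d ^ (l + n * (m - r))))"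
    proof (intro sum.cong refl)
      fix r l assume rl: "r \<in> {1..m}" "l \<in> {1..m}"
      show "?d ^ (n - 1) * ((?a r * (?d ^ n * v) ^ (r - 1)) * (?b l * (cnj ?d * p) ^ (l - 1)))
         = ?a r * ?b l * (v ^ (r - 1) * p ^ (l - 1)) * cnj (?d ^ (l + n * (m - r)))"
        unfolding X[OF rl, symmetric] power_mult_distrib by (simp only: mult_ac)
    qed
    finally show ?thesis .
  qed
  have "(\<Sum>k<m. \<Sum>r=1..m. \<Sum>l=1..m. ?a r * ?b l * (v ^ (r - 1) * p ^ (l - 1)) * cnj (ru m k ^ (l + n * (m - r))))
     = (\<Sum>r=1..m. \<Sum>l=1..m. \<Sum>k<m. ?a r * ?b l * (v ^ (r - 1) * p ^ (l - 1)) * cnj (ru m k ^ (l + n * (m - r))))"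
    by (subst sum.swap) (intro sum.cong refl sum.swap)
  also have "\<dots> = (\<Sum>r=1..m. \<Sum>l=1..m. if m dvd l + n * (m - r) then of_nat m * (?a r * ?b l * (v ^ (r - 1) * p ^ (l - 1))) else 0)"
  proof (intro sum.cong refl)
    fix r l
    have "(\<Sum>k<m. cnj (ru m k ^ (l + n * (m - r)))) = cnj (\<Sum>k<m. ru m k ^ (l + n * (m - r)))" by simp
    then have "(\<Sum>k<m. cnj (ru m k ^ (l + n * (m - r)))) = (if m dvd l + n * (m - r) then of_nat m else 0)"
      unfolding sum_ru_power[OF m] by (simp split: if_splits)
    then show "(\<Sum>k<m. ?a r * ?b l * (v ^ (r - 1) * p ^ (l - 1)) * cnj (ru m k ^ (l + n * (m - r))))
       = (if m dvd l + n * (m - r) then of_nat m * (?a r * ?b l * (v ^ (r - 1) * p ^ (l - 1))) else 0)"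
      unfolding sum_distrib_left[symmetric]
      by (cases "m dvd l + n * (m - r)") (simp_all only: if_True if_False mult_zero_right mult_zero_left mult_ac)
  qed
  also have "\<dots> = (\<Sum>(r,l)\<in>{1..m} \<times> {1..m}. if m dvd l + n * (m - r) then of_nat m * (?a r * ?b l * (v ^ (r - 1) * p ^ (l - 1))) else 0)"
    by (simp only: sum.cartesian_product)
  also have "\<dots> = (\<Sum>(r,l)\<in>bk_idx m n. of_nat m * (?a r * ?b l * (v ^ (r - 1) * p ^ (l - 1))))"
    by (rule sum.mono_neutral_cong_right) (auto simp: bk_idx_def split: if_splits)
  also have "\<dots> = of_nat m * bk_poly m n v p"
    unfolding bk_poly_def by (simp only: sum_distrib_left case_prod_beta')
  finally show ?thesis unfolding 1 by (simp only: sum_divide_distrib[symmetric])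
qed

text \<open>The condition of \<open>holomorphic2_on\<close> at a single point, isolated so that
  differentiability of the explicit kernel can be assembled by closure rules.\<close>

definition complex_diff2 :: "(complex \<times> complex \<Rightarrow> complex) \<Rightarrow> complex \<times> complex \<Rightarrow> bool" where
  "complex_diff2 f z \<longleftrightarrow> (\<exists>d1 d2. (f has_derivative (\<lambda>h. d1 * fst h + d2 * snd h)) (at z))"

lemma complex_diff2_const: "complex_diff2 (\<lambda>_. c) z"
  unfolding complex_diff2_def by (intro exI[of _ 0]) auto

lemma complex_diff2_fst: "complex_diff2 fst z"
  unfolding complex_diff2_def by (intro exI[of _ 1] exI[of _ 0]) (auto intro: derivative_eq_intros)

lemma complex_diff2_snd: "complex_diff2 snd z"
  unfolding complex_diff2_def by (intro exI[of _ 0] exI[of _ 1]) (auto intro: derivative_eq_intros)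

lemma complex_diff2_add:
  assumes "complex_diff2 f z" "complex_diff2 g z"
  shows "complex_diff2 (\<lambda>x. f x + g x) z"
proof -
  obtain a b c d where f: "(f has_derivative (\<lambda>h. a * fst h + b * snd h)) (at z)"
    and g: "(g has_derivative (\<lambda>h. c * fst h + d * snd h)) (at z)"
    using assms by (auto simp: complex_diff2_def)
  have "((\<lambda>x. f x + g x) has_derivative (\<lambda>h. (a + c) * fst h + (b + d) * snd h)) (at z)"
    by (rule has_derivative_eq_rhs[OF has_derivative_add[OF f g]]) (auto simp: algebra_simps)
  then show ?thesis by (auto simp: complex_diff2_def)
qed

lemma complex_diff2_mult:
  assumes "complex_diff2 f z" "complex_diff2 g z"
  shows "complex_diff2 (\<lambda>x. f x * g x) z"
proof -
  obtain a b c d where f: "(f has_derivative (\<lambda>h. a * fst h + b * snd h)) (at z)"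
    and g: "(g has_derivative (\<lambda>h. c * fst h + d * snd h)) (at z)"
    using assms by (auto simp: complex_diff2_def)
  have "((\<lambda>x. f x * g x) has_derivative (\<lambda>h. (f z * c + a * g z) * fst h + (f z * d + b * g z) * snd h)) (at z)"
    by (rule has_derivative_eq_rhs[OF has_derivative_mult[OF f g]]) (auto simp: algebra_simps)
  then show ?thesis by (auto simp: complex_diff2_def)
qed

lemma complex_diff2_inverse:
  assumes "complex_diff2 f z" "f z \<noteq> 0"
  shows "complex_diff2 (\<lambda>x. inverse (f x)) z"
proof -
  obtain a b where f: "(f has_derivative (\<lambda>h. a * fst h + b * snd h)) (at z)"
    using assms by (auto simp: complex_diff2_def)
  let ?i = "inverse (f z)"
  have "((\<lambda>x. inverse (f x)) has_derivative (\<lambda>h. (- (?i * a * ?i)) * fst h + (- (?i * b * ?i)) * snd h)) (at z)"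
    by (rule has_derivative_eq_rhs[OF Deriv.has_derivative_inverse[OF assms(2) f]]) (auto simp: algebra_simps)
  then show ?thesis unfolding complex_diff2_def by (intro exI)
qed

lemma complex_diff2_divide:
  "complex_diff2 f z \<Longrightarrow> complex_diff2 g z \<Longrightarrow> g z \<noteq> 0 \<Longrightarrow> complex_diff2 (\<lambda>x. f x / g x) z"
  unfolding divide_inverse by (intro complex_diff2_mult complex_diff2_inverse)

lemma complex_diff2_diff:
  assumes "complex_diff2 f z" "complex_diff2 g z"
  shows "complex_diff2 (\<lambda>x. f x - g x) z"
  using complex_diff2_add[OF assms(1) complex_diff2_mult[OF complex_diff2_const[of "-1"] assms(2)]] by simp

lemma complex_diff2_power: "complex_diff2 f z \<Longrightarrow> complex_diff2 (\<lambda>x. f x ^ k) z"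
  by (induction k) (auto intro: complex_diff2_const complex_diff2_mult)

lemma complex_diff2_sum: "(\<And>i. i \<in> I \<Longrightarrow> complex_diff2 (f i) z) \<Longrightarrow> complex_diff2 (\<lambda>x. \<Sum>i\<in>I. f i x) z"
  by (induction I rule: infinite_finite_induct) (auto intro: complex_diff2_const complex_diff2_add)

lemmas complex_diff2_intros = complex_diff2_const complex_diff2_fst complex_diff2_snd complex_diff2_add
  complex_diff2_diff complex_diff2_mult complex_diff2_divide complex_diff2_power complex_diff2_sum

text \<open>Restriction to a holomorphic curve. Applied to the curves of constant l and of constant
  x in the cover, it gives holomorphy in each variable separately, as
  \<open>bidisc_reproducing\<close> requires.\<close>

lemma complex_diff2_chain:
  assumes "complex_diff2 f (a l, b l)" "(a has_field_derivative a') (at l)" "(b has_field_derivative b') (at l)"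
  shows "(\<lambda>x. f (a x, b x)) field_differentiable at l"
proof -
  obtain c d where f: "(f has_derivative (\<lambda>h. c * fst h + d * snd h)) (at (a l, b l))"
    using assms(1) by (auto simp: complex_diff2_def)
  have "((\<lambda>x. (a x, b x)) has_derivative (\<lambda>h. (a' * h, b' * h))) (at l)"
    using assms(2,3) by (intro has_derivative_Pair) (auto simp: has_field_derivative_def)
  from diff_chain_at[OF this f] have "((\<lambda>x. f (a x, b x)) has_derivative (\<lambda>h. (c * a' + d * b') * h)) (at l)"
    by (auto simp: o_def algebra_simps elim: has_derivative_eq_rhs)
  then show ?thesis by (auto simp: field_differentiable_def has_field_derivative_def)
qed

text \<open>The explicit candidate for the Bergman kernel. The value 0 off the triangle follows the
  convention of \<open>is_bergman_kernel\<close>, under which the kernel is unique.\<close>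

definition hk :: "nat \<Rightarrow> nat \<Rightarrow> complex \<times> complex \<Rightarrow> complex \<times> complex \<Rightarrow> complex" where
  "hk m n z w = (if z \<in> hartogs m n \<and> w \<in> hartogs m n
     then bk m n (fst z * cnj (fst w)) (snd z * cnj (snd w)) else 0)"

lemma hartogs_snd:
  assumes "z \<in> hartogs m n" "0 < n"
  shows "snd z \<noteq> 0" "norm (snd z) < 1"
proof -
  have z: "norm (fst z) ^ m < norm (snd z) ^ n" "norm (snd z) ^ n < 1" using assms by (auto simp: hartogs_def)
  show "snd z \<noteq> 0"
  proof
    assume "snd z = 0"
    then have "norm (fst z) ^ m < 0" using z assms by (simp add: zero_power)
    then show False by (simp add: not_less[symmetric])
  qed
  show "norm (snd z) < 1" using z assms by (simp add: power_less_one_iff)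
qed

lemma hartogs_lift:
  assumes z: "z \<in> hartogs m n" and m: "0 < m" and n: "0 < n"
  obtains x l where "norm x < 1" "l \<noteq> 0" "norm l < 1" "z = hmap m n (x, l)"
proof -
  obtain l where l: "snd z = l ^ m" using exists_complex_root[of m "snd z"] m by auto
  have l0: "l \<noteq> 0" using hartogs_snd[OF z n] m l by (auto simp: zero_power)
  have "z = hmap m n (fst z / l ^ n, l)" using l l0 by (simp add: hmap_def prod_eq_iff)
  moreover have "norm (fst z / l ^ n) < 1 \<and> norm l < 1"
    using hmap_in_hartogs_iff[OF m n l0, of "fst z / l ^ n"] z calculation by simp
  ultimately show thesis using that l0 by blast
qed

lemma hk_hmap:
  assumes m: "0 < m" and n: "0 < n" and x: "norm x < 1" "l \<noteq> 0" "norm l < 1" and y: "norm y < 1" "k \<noteq> 0" "norm k < 1"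
  shows "hk m n (hmap m n (x, l)) (hmap m n (y, k))
    = bk_poly m n (x * cnj y) (l * cnj k) / (of_real (pi\<^sup>2) * of_nat m * (l * cnj k) ^ (m + n - 1)
        * (1 - (x * cnj y) ^ m)\<^sup>2 * (1 - (l * cnj k) ^ m)\<^sup>2)"
proof -
  have "fst (hmap m n (x, l)) * cnj (fst (hmap m n (y, k))) = (x * cnj y) * (l * cnj k) ^ n"
    by (simp add: hmap_def power_mult_distrib)
  moreover have "snd (hmap m n (x, l)) * cnj (snd (hmap m n (y, k))) = (l * cnj k) ^ m"
    by (simp add: hmap_def power_mult_distrib)
  moreover have "l * cnj k \<noteq> 0" using x y by simp
  ultimately show ?thesis
    unfolding hk_def using hmap_in_hartogs_iff[OF m n x(2), of x] hmap_in_hartogs_iff[OF m n y(2), of y] x y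
    by (simp only: bk_pullback[OF m] simp_thms if_True)
qed

text \<open>The kernel as a sum of bidisc kernels serves the reproducing property; the closed
  quotient of \<open>hk_hmap\<close> serves the size estimates.\<close>

lemma hk_hmap_roots:
  assumes m: "0 < m" and n: "0 < n" and x: "norm x < 1" "l \<noteq> 0" "norm l < 1" and y: "norm y < 1" "k \<noteq> 0" "norm k < 1"
  shows "hk m n (hmap m n (x, l)) (hmap m n (y, k))
    = 1 / (of_real (pi\<^sup>2) * (of_nat m)\<^sup>2 * (l * cnj k) ^ (m + n - 1))
      * (\<Sum>j<m. ru m j ^ (n - 1) / ((1 - ru m j ^ n * (x * cnj y))\<^sup>2 * (1 - cnj (ru m j) * (l * cnj k))\<^sup>2))"
proof -
  have prod: "norm (a * cnj b) < 1" if "norm a < 1" "norm b < 1" for a b :: complex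
    using that mult_strict_mono'[of "norm a" 1 "norm b" 1] by (simp add: norm_mult)
  show ?thesis
    unfolding hk_hmap[OF assms] bk_poly_roots[OF m n prod[OF x(1) y(1)] prod[OF x(3) y(3)]]
    using m by (simp add: power2_eq_square)
qed

lemma card_bk_idx: "card (bk_idx m n) \<le> m * m"
proof -
  have "card (bk_idx m n) \<le> card ({1..m} \<times> {1..m})"
    by (rule card_mono) (auto simp: bk_idx_def)
  then show ?thesis by simp
qed

lemma norm_residue_coef_le:
  assumes "r \<le> m" "norm (z::complex) \<le> 1"
  shows "norm (of_nat r + of_nat (m - r) * z ^ m) \<le> real m"
proof -
  have "norm (of_nat (m - r) * z ^ m) \<le> real (m - r) * 1"
    unfolding norm_mult norm_power using assms by (intro mult_mono power_le_one) (auto simp del: of_nat_diff)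
  then have "norm (of_nat r + of_nat (m - r) * z ^ m) \<le> real r + real (m - r)"
    by (intro order_trans[OF norm_triangle_ineq] add_mono) auto
  then show ?thesis using assms by (simp add: of_nat_diff)
qed

text \<open>At most m^2 index pairs occur, and each coefficient is at most m^2 in modulus.\<close>

lemma norm_bk_poly_le:
  assumes "norm v \<le> 1" "norm p \<le> 1"
  shows "norm (bk_poly m n v p) \<le> real m ^ 4"
proof -
  have "norm (bk_poly m n v p) \<le> (\<Sum>(r,l)\<in>bk_idx m n. real m * real m)"
    unfolding bk_poly_def
  proof (rule sum_norm_le, safe)
    fix r l assume rl: "(r, l) \<in> bk_idx m n"
    then have r: "r \<le> m" "l \<le> m" by (auto simp: bk_idx_def)
    have "norm (v ^ (r - 1) * p ^ (l - 1)) \<le> 1"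
      unfolding norm_mult norm_power using assms by (intro mult_le_one power_le_one) auto
    then show "norm ((of_nat r + of_nat (m - r) * v ^ m) * (of_nat l + of_nat (m - l) * p ^ m) * (v ^ (r - 1) * p ^ (l - 1))) \<le> real m * real m"
      unfolding norm_mult[of "_ * _" "v ^ _ * _"] norm_mult[of "of_nat r + _"]
      using mult_mono[OF mult_mono[OF norm_residue_coef_le[OF r(1) assms(1)] norm_residue_coef_le[OF r(2) assms(2)]], of "norm (v ^ (r - 1) * p ^ (l - 1))" 1] by auto
  qed
  also have "\<dots> = real (card (bk_idx m n)) * (real m * real m)" by simp
  also have "\<dots> \<le> real (m * m) * (real m * real m)"
    by (intro mult_right_mono of_nat_mono card_bk_idx) auto
  finally show ?thesis by (simp add: power4_eq_xxxx mult_ac)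
qed

lemma hk_denominator_nonzero:
  assumes z: "z \<in> hartogs m n" and w: "w \<in> hartogs m n" and m: "0 < m" and n: "0 < n"
  shows "snd z * cnj (snd w) \<noteq> 0" "1 - snd z * cnj (snd w) \<noteq> 0"
    "1 - (fst z * cnj (fst w)) ^ m / (snd z * cnj (snd w)) ^ n \<noteq> 0"
proof -
  have ne: "1 - a \<noteq> 0" if "norm a < 1" for a :: complex using that by auto
  note zs = hartogs_snd[OF z n] and ws = hartogs_snd[OF w n]
  show "snd z * cnj (snd w) \<noteq> 0" using zs ws by simp
  show "1 - snd z * cnj (snd w) \<noteq> 0"
    using mult_strict_mono'[of "norm (snd z)" 1 "norm (snd w)" 1] zs ws by (intro ne) (simp add: norm_mult)
  have "norm (fst z) ^ m / norm (snd z) ^ n < 1" "norm (fst w) ^ m / norm (snd w) ^ n < 1"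
    using z w zs ws by (auto simp: hartogs_def divide_simps)
  then have "(norm (fst z) ^ m / norm (snd z) ^ n) * (norm (fst w) ^ m / norm (snd w) ^ n) < 1 * 1"
    by (intro mult_strict_mono') auto
  then show "1 - (fst z * cnj (fst w)) ^ m / (snd z * cnj (snd w)) ^ n \<noteq> 0"
    by (intro ne) (simp add: norm_mult norm_divide norm_power power_mult_distrib)
qed

lemma hk_holomorphic:
  assumes w: "w \<in> hartogs m n" and m: "0 < m" and n: "0 < n"
  shows "holomorphic2_on (\<lambda>z. hk m n z w) (hartogs m n)"
  unfolding holomorphic2_on_def complex_diff2_def[symmetric]
proof
  fix z assume z: "z \<in> hartogs m n"
  have "complex_diff2 (\<lambda>z. bk m n (fst z * cnj (fst w)) (snd z * cnj (snd w))) z"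
    unfolding bk_def case_prod_beta'
    using hk_denominator_nonzero[OF z w m n] m by (intro complex_diff2_intros) auto
  then obtain d1 d2 where "((\<lambda>z. bk m n (fst z * cnj (fst w)) (snd z * cnj (snd w))) has_derivative (\<lambda>h. d1 * fst h + d2 * snd h)) (at z)"
    by (auto simp: complex_diff2_def)
  then have "((\<lambda>z. hk m n z w) has_derivative (\<lambda>h. d1 * fst h + d2 * snd h)) (at z)"
    by (rule has_derivative_transform_within_open[OF _ open_hartogs z]) (simp add: hk_def w)
  then show "complex_diff2 (\<lambda>z. hk m n z w) z" by (auto simp: complex_diff2_def)
qed

section \<open>Passing from \<open>lebesgue_on\<close> to Borel functions and
  \<open>lborel\<close>\<close>

lemma holomorphic2_on_continuous: "holomorphic2_on f S \<Longrightarrow> continuous_on S f"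
  by (intro continuous_at_imp_continuous_on) (auto simp: holomorphic2_on_def intro: has_derivative_continuous)

lemma holomorphic2_on_measurable:
  "holomorphic2_on f S \<Longrightarrow> open S \<Longrightarrow> (\<lambda>z. indicator S z *\<^sub>R f z) \<in> borel_measurable borel"
  by (intro borel_measurable_continuous_on_indicator holomorphic2_on_continuous) auto

text \<open>Completing the measure does not affect integrability of Borel functions, so the
  integrals of the definitions can be moved to \<open>lborel\<close>, where the changes of variables
  above are stated.\<close>

lemma integrable_lebesgue_on_iff:
  fixes f :: "'a::euclidean_space \<Rightarrow> 'b::{banach, second_countable_topology}"
  assumes "(\<lambda>z. indicator S z *\<^sub>R f z) \<in> borel_measurable borel" "S \<in> sets borel"
  shows "integrable (lebesgue_on S) f \<longleftrightarrow> integrable lborel (\<lambda>z. indicator S z *\<^sub>R f z)"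
proof -
  have "integrable (lebesgue_on S) f \<longleftrightarrow> integrable lebesgue (\<lambda>z. indicator S z *\<^sub>R f z)"
    using assms by (subst integrable_restrict_space) auto
  also have "\<dots> \<longleftrightarrow> integrable lborel (\<lambda>z. indicator S z *\<^sub>R f z)"
    using assms by (intro integrable_completion) simp
  finally show ?thesis .
qed

lemma integral_lebesgue_on:
  fixes f :: "'a::euclidean_space \<Rightarrow> 'b::{banach, second_countable_topology}"
  assumes "(\<lambda>z. indicator S z *\<^sub>R f z) \<in> borel_measurable borel" "S \<in> sets borel"
  shows "(\<integral>z. f z \<partial>lebesgue_on S) = (\<integral>z. indicator S z *\<^sub>R f z \<partial>lborel)"
proof -
  have "(\<integral>z. f z \<partial>lebesgue_on S) = (\<integral>z. indicator S z *\<^sub>R f z \<partial>lebesgue)"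
    using assms by (subst integral_restrict_space) auto
  also have "\<dots> = (\<integral>z. indicator S z *\<^sub>R f z \<partial>lborel)"
    using assms by (intro integral_completion) simp
  finally show ?thesis .
qed

lemma bergman_space_iff:
  assumes "open \<Omega>"
  shows "f \<in> bergman_space \<Omega> \<longleftrightarrow> holomorphic2_on f \<Omega> \<and> (\<integral>\<^sup>+z. ennreal ((norm (f z))\<^sup>2) * indicator \<Omega> z \<partial>lborel) < \<infinity>"
proof (cases "holomorphic2_on f \<Omega>")
  case True
  note m = holomorphic2_on_measurable[OF True assms]
  have "(\<lambda>z. (norm (indicator \<Omega> z *\<^sub>R f z))\<^sup>2) \<in> borel_measurable borel"
    using m by measurable
  moreover have "(\<lambda>z. (norm (indicator \<Omega> z *\<^sub>R f z))\<^sup>2) = (\<lambda>z. indicator \<Omega> z *\<^sub>R (norm (f z))\<^sup>2)"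
    by (auto simp: indicator_def)
  ultimately have m2: "(\<lambda>z. indicator \<Omega> z *\<^sub>R (norm (f z))\<^sup>2) \<in> borel_measurable borel" by simp
  have "integrable (lebesgue_on \<Omega>) (\<lambda>z. (norm (f z))\<^sup>2) \<longleftrightarrow> integrable lborel (\<lambda>z. indicator \<Omega> z *\<^sub>R (norm (f z))\<^sup>2)"
    using m2 assms by (intro integrable_lebesgue_on_iff) auto
  also have "\<dots> \<longleftrightarrow> (\<integral>\<^sup>+z. ennreal (norm (indicator \<Omega> z *\<^sub>R (norm (f z))\<^sup>2)) \<partial>lborel) < \<infinity>"
    using m2 by (simp add: integrable_iff_bounded)
  also have "(\<integral>\<^sup>+z. ennreal (norm (indicator \<Omega> z *\<^sub>R (norm (f z))\<^sup>2)) \<partial>lborel) = (\<integral>\<^sup>+z. ennreal ((norm (f z))\<^sup>2) * indicator \<Omega> z \<partial>lborel)"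
    by (intro nn_integral_cong) (auto simp: indicator_def)
  finally show ?thesis using True by (simp add: bergman_space_def)
qed (simp add: bergman_space_def)

lemma hk_measurable:
  "w \<in> hartogs m n \<Longrightarrow> 0 < m \<Longrightarrow> 0 < n \<Longrightarrow> (\<lambda>z. hk m n z w) \<in> borel_measurable borel"
proof -
  assume w: "w \<in> hartogs m n" "0 < m" "0 < n"
  have "(\<lambda>z. indicator (hartogs m n) z *\<^sub>R hk m n z w) \<in> borel_measurable borel"
    by (rule holomorphic2_on_measurable[OF hk_holomorphic[OF w] open_hartogs])
  moreover have "(\<lambda>z. indicator (hartogs m n) z *\<^sub>R hk m n z w) = (\<lambda>z. hk m n z w)"
    by (auto simp: indicator_def hk_def)
  ultimately show ?thesis by simp
qed

lemma one_minus_power_ge: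
  assumes "norm x \<le> 1" "norm y < 1" "0 < m"
  shows "1 - norm y ^ m \<le> norm (1 - (x * cnj y) ^ m)"
proof -
  have "norm ((x * cnj y) ^ m) \<le> norm y ^ m"
    unfolding norm_power norm_mult using assms by (intro power_mono) (auto simp: mult_left_le_one_le)
  then show ?thesis by (smt (verit) norm_one norm_triangle_ineq2)
qed

text \<open>For fixed w the pulled-back kernel is at most C / |l|^(m+n-1), and the weight
  |l|^(2(m+n-1)) of the change of variables cancels the square of this pole. A bounded integrand on
  the bidisc remains.\<close>

lemma hk_square_integrable:
  assumes w: "w \<in> hartogs m n" and m: "0 < m" and n: "0 < n"
  shows "(\<lambda>z. hk m n z w) \<in> bergman_space (hartogs m n)"
proof -
  obtain y k where y: "norm y < 1" "k \<noteq> 0" "norm k < 1" and w': "w = hmap m n (y, k)"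
    using hartogs_lift[OF w m n] by metis
  have [measurable]: "(\<lambda>z. hk m n z w) \<in> borel_measurable borel" by (rule hk_measurable[OF w m n])
  let ?N = "m + n - 1"
  define C where "C = (real m ^ 4 / (pi\<^sup>2 * real m * norm k ^ ?N * (1 - norm y ^ m)\<^sup>2 * (1 - norm k ^ m)\<^sup>2))"
  have pos: "0 < 1 - norm y ^ m" "0 < 1 - norm k ^ m" using y m by (simp_all add: power_less_one_iff)
  have bound: "norm (hk m n (hmap m n (x, l)) w) \<le> C / norm l ^ ?N" if "norm x < 1" "l \<noteq> 0" "norm l < 1" for x l
  proof -
    have "norm (x * cnj y) \<le> 1" "norm (l * cnj k) \<le> 1" using that y by (auto simp: norm_mult intro!: mult_le_one)
    then have Q: "norm (bk_poly m n (x * cnj y) (l * cnj k)) \<le> real m ^ 4" by (rule norm_bk_poly_le)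
    have D: "(1 - norm y ^ m)\<^sup>2 \<le> (norm (1 - (x * cnj y) ^ m))\<^sup>2" "(1 - norm k ^ m)\<^sup>2 \<le> (norm (1 - (l * cnj k) ^ m))\<^sup>2"
      using one_minus_power_ge[of x y m] one_minus_power_ge[of l k m] that y m pos by (auto intro!: power_mono)
    have "norm (hk m n (hmap m n (x, l)) w) = norm (bk_poly m n (x * cnj y) (l * cnj k)) /
      (pi\<^sup>2 * real m * (norm l * norm k) ^ ?N * (norm (1 - (x * cnj y) ^ m))\<^sup>2 * (norm (1 - (l * cnj k) ^ m))\<^sup>2)"
      unfolding w' hk_hmap[OF m n that y] by (simp add: norm_divide norm_mult norm_power power_mult_distrib)
    also have "\<dots> \<le> real m ^ 4 / (pi\<^sup>2 * real m * (norm l * norm k) ^ ?N * (1 - norm y ^ m)\<^sup>2 * (1 - norm k ^ m)\<^sup>2)"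
      using m y that pos by (intro frac_le Q mult_mono D mult_pos_pos zero_less_power) auto
    also have "\<dots> = C / norm l ^ ?N" by (simp add: C_def power_mult_distrib)
    finally show ?thesis .
  qed
  have "(\<integral>\<^sup>+z. ennreal ((norm (hk m n z w))\<^sup>2) * indicator (hartogs m n) z \<partial>lborel)
     = (\<integral>\<^sup>+x. ennreal (real m * norm (snd x) ^ (2 * ?N)) * ennreal ((norm (hk m n (hmap m n x) w))\<^sup>2) * indicator bidisc x \<partial>lborel)"
    by (rule nn_integral_hartogs[OF _ m n]) measurable
  also have "\<dots> \<le> (\<integral>\<^sup>+x. ennreal (real m * C\<^sup>2) * indicator bidisc x \<partial>lborel)"
  proof (rule nn_integral_mono)
    fix x :: "complex \<times> complex"
    show "ennreal (real m * norm (snd x) ^ (2 * ?N)) * ennreal ((norm (hk m n (hmap m n x) w))\<^sup>2) * indicator bidisc x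
        \<le> ennreal (real m * C\<^sup>2) * indicator bidisc x"
    proof (cases "x \<in> bidisc \<and> snd x \<noteq> 0")
      case True
      then have "norm (hk m n (hmap m n x) w) \<le> C / norm (snd x) ^ ?N"
        using bound[of "fst x" "snd x"] by (auto simp: bidisc_def)
      then have "(norm (hk m n (hmap m n x) w))\<^sup>2 \<le> (C / norm (snd x) ^ ?N)\<^sup>2" by (intro power_mono) auto
      then have "(norm (hk m n (hmap m n x) w))\<^sup>2 \<le> C\<^sup>2 / norm (snd x) ^ (2 * ?N)"
        by (simp add: power_divide power_mult[symmetric] mult.commute)
      then have "norm (snd x) ^ (2 * ?N) * (norm (hk m n (hmap m n x) w))\<^sup>2 \<le> C\<^sup>2"
        using True by (simp add: pos_le_divide_eq mult.commute)
      then have "real m * norm (snd x) ^ (2 * ?N) * (norm (hk m n (hmap m n x) w))\<^sup>2 \<le> real m * C\<^sup>2"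
        using m by simp
      then have "ennreal (real m * norm (snd x) ^ (2 * ?N) * (norm (hk m n (hmap m n x) w))\<^sup>2) \<le> ennreal (real m * C\<^sup>2)"
        by (rule ennreal_leI)
      then show ?thesis using True by (simp add: ennreal_mult)
    next
      case False
      then consider "x \<notin> bidisc" | "snd x = 0" by blast
      then show ?thesis
      proof cases
        case 2
        then have "norm (snd x) ^ (2 * ?N) = 0" using n m by (simp add: zero_power)
        then show ?thesis unfolding \<open>norm (snd x) ^ (2 * ?N) = 0\<close> by simp
      qed simp
    qed
  qed
  also have "\<dots> = ennreal (real m * C\<^sup>2) * emeasure lborel bidisc"
    by (rule nn_integral_cmult_indicator) measurable
  also have "emeasure lborel bidisc = ennreal (pi * pi)" by (rule emeasure_bidisc)
  also have "ennreal (real m * C\<^sup>2) * ennreal (pi * pi) < \<infinity>" by (simp add: ennreal_mult_less_top)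
  finally show ?thesis
    using hk_holomorphic[OF w m n] by (simp add: bergman_space_iff[OF open_hartogs])
qed

lemma integral_hartogs:
  fixes F :: "complex \<times> complex \<Rightarrow> complex"
  assumes F[measurable]: "F \<in> borel_measurable borel" and m: "0 < m" and n: "0 < n"
  shows "(\<integral>z. indicator (hartogs m n) z *\<^sub>R F z \<partial>lborel)
    = (\<integral>x. (real m * norm (snd x) ^ (2 * (m + n - 1)) * indicator bidisc x) *\<^sub>R F (hmap m n x) \<partial>lborel)"
proof -
  define d where "d x = real m * norm (snd x) ^ (2 * (m + n - 1)) * indicator bidisc x" for x :: "complex \<times> complex"
  have c: "continuous_on UNIV (\<lambda>x::complex\<times>complex. real m * norm (snd x) ^ (2 * (m + n - 1)))"
    by (intro continuous_intros)
  have dm[measurable]: "d \<in> borel_measurable borel" unfolding d_def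
    by (intro borel_measurable_times borel_measurable_indicator bidisc_measurable borel_measurable_continuous_onI[OF c])
  have d0: "0 \<le> d x" for x by (simp add: d_def)
  have Fh[measurable]: "(\<lambda>x. F (hmap m n x)) \<in> borel_measurable borel" by (rule measurable_compose[OF hmap_measurable F])
  have e1: "(\<lambda>x. ennreal (real m * norm (snd x) ^ (2 * (m + n - 1))) * indicator bidisc x) = (\<lambda>x. ennreal (d x))"
    by (auto simp: d_def indicator_def)
  have e2: "indicator (hartogs m n) = (\<lambda>z. ennreal (indicator (hartogs m n) z))" by (auto simp: indicator_def)
  have "(\<integral>z. indicator (hartogs m n) z *\<^sub>R F z \<partial>lborel) = (\<integral>z. F z \<partial>density lborel (\<lambda>z. ennreal (indicator (hartogs m n) z)))"
    by (subst integral_density) auto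
  also have "\<dots> = (\<integral>z. F z \<partial>distr (density lborel (\<lambda>x. ennreal (d x))) borel (hmap m n))"
    using distr_hmap[OF m n] unfolding e1 e2 by simp
  also have "\<dots> = (\<integral>x. F (hmap m n x) \<partial>density lborel (\<lambda>x. ennreal (d x)))"
    by (subst integral_distr) auto
  also have "\<dots> = (\<integral>x. d x *\<^sub>R F (hmap m n x) \<partial>lborel)"
    by (subst integral_density) (auto simp: d0)
  finally show ?thesis by (simp only: d_def)
qed

text \<open>The integral is pulled back to the bidisc, where the kernel is a sum over the deck
  group. Each of the m terms is the bidisc formula evaluated at another lift of w, and each returns
  the same multiple of f w.\<close>

lemma hk_reproducing:
  assumes f: "f \<in> bergman_space (hartogs m n)" and w: "w \<in> hartogs m n" and m: "0 < m" and n: "0 < n"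
  shows "f w = (\<integral>z. f z * cnj (hk m n z w) \<partial>lebesgue_on (hartogs m n))"
proof -
  let ?H = "hartogs m n" and ?N = "m + n - 1"
  have hol: "holomorphic2_on f ?H" and fin: "(\<integral>\<^sup>+z. ennreal ((norm (f z))\<^sup>2) * indicator ?H z \<partial>lborel) < \<infinity>"
    using f by (auto simp: bergman_space_iff[OF open_hartogs])
  define f' where "f' z = indicator ?H z *\<^sub>R f z" for z
  have f'm[measurable]: "f' \<in> borel_measurable borel"
    unfolding f'_def by (rule holomorphic2_on_measurable[OF hol open_hartogs])
  obtain \<omega> \<eta> where y: "norm \<omega> < 1" "\<eta> \<noteq> 0" "norm \<eta> < 1" and w': "w = hmap m n (\<omega>, \<eta>)"
    using hartogs_lift[OF w m n] by metis
  \<comment> \<open>The pullback times the holomorphic Jacobian factor. It is built from the cut-off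
    \<open>f'\<close> so that it is Borel measurable on the whole space.\<close>
  define G where "G x = indicator bidisc x *\<^sub>R (f' (hmap m n x) * snd x ^ ?N)" for x
  have fh[measurable]: "(\<lambda>x. f' (hmap m n x)) \<in> borel_measurable borel"
    by (rule measurable_compose[OF hmap_measurable f'm])
  have [measurable]: "(\<lambda>x::complex\<times>complex. snd x ^ ?N) \<in> borel_measurable borel"
    by (intro borel_measurable_continuous_onI continuous_intros)
  have Gm[measurable]: "G \<in> borel_measurable borel" unfolding G_def by measurable
  have Gf: "G (x, l) = f (hmap m n (x, l)) * l ^ ?N" if "norm x < 1" "l \<noteq> 0" "norm l < 1" for x l
    using that hmap_in_hartogs_iff[OF m n that(2), of x] by (simp add: G_def f'_def bidisc_iff)
  have Gfin: "(\<integral>\<^sup>+x. ennreal ((norm (G x))\<^sup>2) * indicator bidisc x \<partial>lborel) < \<infinity>"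
  proof -
    have "(\<integral>\<^sup>+x. ennreal ((norm (G x))\<^sup>2) * indicator bidisc x \<partial>lborel)
       \<le> (\<integral>\<^sup>+x. ennreal (real m * norm (snd x) ^ (2 * ?N)) * ennreal ((norm (f' (hmap m n x)))\<^sup>2) * indicator bidisc x \<partial>lborel)"
    proof (rule nn_integral_mono)
      fix x :: "complex \<times> complex"
      have "(norm (f' (hmap m n x) * snd x ^ ?N))\<^sup>2 = norm (snd x) ^ (2 * ?N) * (norm (f' (hmap m n x)))\<^sup>2"
        by (simp add: norm_mult norm_power power_mult_distrib power_mult[symmetric] mult.commute)
      also have "\<dots> \<le> real m * (norm (snd x) ^ (2 * ?N) * (norm (f' (hmap m n x)))\<^sup>2)"
        using m by (intro mult_right_mono[of 1 "real m", simplified mult_1_left]) auto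
      finally have "ennreal ((norm (f' (hmap m n x) * snd x ^ ?N))\<^sup>2) \<le> ennreal (real m * norm (snd x) ^ (2 * ?N) * (norm (f' (hmap m n x)))\<^sup>2)"
        by (intro ennreal_leI) (simp add: mult.assoc)
      also have "\<dots> = ennreal (real m * norm (snd x) ^ (2 * ?N)) * ennreal ((norm (f' (hmap m n x)))\<^sup>2)"
        by (intro ennreal_mult) auto
      finally show "ennreal ((norm (G x))\<^sup>2) * indicator bidisc x
         \<le> ennreal (real m * norm (snd x) ^ (2 * ?N)) * ennreal ((norm (f' (hmap m n x)))\<^sup>2) * indicator bidisc x"
        by (simp add: G_def indicator_def)
    qed
    also have "\<dots> = (\<integral>\<^sup>+z. ennreal ((norm (f' z))\<^sup>2) * indicator ?H z \<partial>lborel)"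
      by (rule nn_integral_hartogs[OF _ m n, symmetric]) measurable
    also have "\<dots> = (\<integral>\<^sup>+z. ennreal ((norm (f z))\<^sup>2) * indicator ?H z \<partial>lborel)"
      by (intro nn_integral_cong) (auto simp: f'_def indicator_def)
    finally show ?thesis using fin by (rule le_less_trans)
  qed
  have diff: "complex_diff2 f z" if "z \<in> ?H" for z
    using hol that by (auto simp: holomorphic2_on_def complex_diff2_def)
  have h1: "(\<lambda>x. G (x, l)) holomorphic_on ball 0 1" if l: "0 < norm l" "norm l < 1" for l
  proof -
    have "(\<lambda>x. f (x * l ^ n, l ^ m) * l ^ ?N) holomorphic_on ball 0 1"
    proof (intro holomorphic_on_mult holomorphic_on_const)
      show "(\<lambda>x. f (x * l ^ n, l ^ m)) holomorphic_on ball 0 1"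
        unfolding holomorphic_on_def
      proof
        fix x :: complex assume x: "x \<in> ball 0 1"
        then have "(x * l ^ n, l ^ m) \<in> ?H" using hmap_in_hartogs_iff[OF m n, of l x] l by (auto simp: hmap_def)
        then have "(\<lambda>x. f (x * l ^ n, l ^ m)) field_differentiable at x"
          by (intro complex_diff2_chain[where a'="l ^ n" and b'=0] diff) (auto intro!: derivative_eq_intros)
        then show "(\<lambda>x. f (x * l ^ n, l ^ m)) field_differentiable at x within ball 0 1"
          by (rule field_differentiable_at_within)
      qed
    qed
    then show ?thesis
      by (rule holomorphic_transform) (use l Gf in \<open>auto simp: hmap_def\<close>)
  qed
  have h2: "(\<lambda>l. G (x, l)) holomorphic_on ball 0 1 - {0}" if x: "norm x < 1" for x
  proof -
    have "(\<lambda>l. f (x * l ^ n, l ^ m) * l ^ ?N) holomorphic_on ball 0 1 - {0}"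
    proof (intro holomorphic_on_mult holomorphic_intros)
      show "(\<lambda>l. f (x * l ^ n, l ^ m)) holomorphic_on ball 0 1 - {0}"
        unfolding holomorphic_on_def
      proof
        fix l :: complex assume l: "l \<in> ball 0 1 - {0}"
        then have "(x * l ^ n, l ^ m) \<in> ?H" using hmap_in_hartogs_iff[OF m n, of l x] x by (auto simp: hmap_def)
        then have "(\<lambda>l. f (x * l ^ n, l ^ m)) field_differentiable at l"
          by (intro complex_diff2_chain[where a'="x * (of_nat n * l ^ (n - 1))" and b'="of_nat m * l ^ (m - 1)"] diff)
             (auto intro!: derivative_eq_intros)
        then show "(\<lambda>l. f (x * l ^ n, l ^ m)) field_differentiable at l within ball 0 1 - {0}"
          by (rule field_differentiable_at_within)
      qed
    qed
    then show ?thesis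
      by (rule holomorphic_transform) (use x Gf in \<open>auto simp: hmap_def\<close>)
  qed
  \<comment> \<open>The m deck images of the chosen lift of w; \<open>hmap\<close> sends all of them
    to w.\<close>
  define \<omega>' \<eta>' where "\<omega>' j = cnj (ru m j) ^ n * \<omega>" and "\<eta>' j = ru m j * \<eta>" for j
  have pt: "norm (\<omega>' j) < 1" "0 < norm (\<eta>' j)" "norm (\<eta>' j) < 1" for j
    using y by (simp_all add: \<omega>'_def \<eta>'_def norm_mult norm_power)
  define R where "R j x = indicator bidisc x *\<^sub>R (G x / ((1 - \<omega>' j * cnj (fst x))\<^sup>2 * (1 - \<eta>' j * cnj (snd x))\<^sup>2))" for j x
  note rep = bidisc_reproducing[OF Gm Gfin h1 h2 pt]
  have RI: "integrable lborel (R j)" for j unfolding R_def by (rule rep(1))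
  have RV: "(\<integral>x. R j x \<partial>lborel) = pi\<^sup>2 * G (\<omega>' j, \<eta>' j)" for j unfolding R_def by (rule rep(2))
  let ?c = "1 / (of_real (pi\<^sup>2) * of_nat m * \<eta> ^ ?N)"
  have hkm[measurable]: "(\<lambda>z. hk m n z w) \<in> borel_measurable borel" by (rule hk_measurable[OF w m n])
  define F where "F z = f' z * cnj (hk m n z w)" for z
  have Fm[measurable]: "F \<in> borel_measurable borel" unfolding F_def by measurable
  have Ff: "indicator ?H z *\<^sub>R (f z * cnj (hk m n z w)) = F z" "indicator ?H z *\<^sub>R F z = F z" for z
    by (auto simp: F_def f'_def indicator_def)
  have "(\<integral>z. f z * cnj (hk m n z w) \<partial>lebesgue_on ?H) = (\<integral>z. indicator ?H z *\<^sub>R F z \<partial>lborel)"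
    by (subst integral_lebesgue_on) (auto simp: Ff)
  also have "\<dots> = (\<integral>x. (real m * norm (snd x) ^ (2 * ?N) * indicator bidisc x) *\<^sub>R F (hmap m n x) \<partial>lborel)"
    by (rule integral_hartogs[OF Fm m n])
  also have "\<dots> = (\<integral>x. ?c * (\<Sum>j<m. cnj (ru m j) ^ (n - 1) * R j x) \<partial>lborel)"
  proof (rule Bochner_Integration.integral_cong[OF refl])
    fix x :: "complex \<times> complex"
    obtain z l where x: "x = (z, l)" by (cases x)
    show "(real m * norm (snd x) ^ (2 * ?N) * indicator bidisc x) *\<^sub>R F (hmap m n x) = ?c * (\<Sum>j<m. cnj (ru m j) ^ (n - 1) * R j x)"
    proof (cases "x \<in> bidisc \<and> l \<noteq> 0")
      case True
      then have zl: "norm z < 1" "l \<noteq> 0" "norm l < 1" by (auto simp: x bidisc_iff)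
      have in1: "indicator bidisc x = (1::real)" using True by simp
      have Fx: "F (hmap m n x) * l ^ ?N = G x * cnj (hk m n (hmap m n x) w)"
        using True by (simp add: F_def G_def x)
      \<comment> \<open>Of the two factors of the weight, l^N goes into \<open>G\<close> and its
        conjugate cancels the pole of the conjugated kernel.\<close>
      have ll: "complex_of_real (norm l ^ (2 * ?N)) = l ^ ?N * cnj l ^ ?N"
      proof -
        have "complex_of_real (norm l ^ (2 * ?N)) = (complex_of_real ((norm l)\<^sup>2)) ^ ?N" by (simp add: power_mult)
        then show ?thesis by (simp only: complex_norm_square power_mult_distrib)
      qed
      have "(real m * norm (snd x) ^ (2 * ?N) * indicator bidisc x) *\<^sub>R F (hmap m n x)
          = of_nat m * (l ^ ?N * cnj l ^ ?N) * F (hmap m n x)"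
        unfolding in1 ll[symmetric] by (simp add: x scaleR_conv_of_real)
      also have "\<dots> = of_nat m * cnj l ^ ?N * (F (hmap m n x) * l ^ ?N)" by (simp only: mult_ac)
      also have "\<dots> = of_nat m * cnj l ^ ?N * (G x * cnj (hk m n (hmap m n x) w))" by (simp only: Fx)
      also have "cnj (hk m n (hmap m n x) w) = 1 / (of_real (pi\<^sup>2) * (of_nat m)\<^sup>2 * (cnj l * \<eta>) ^ ?N)
         * (\<Sum>j<m. cnj (ru m j) ^ (n - 1) / ((1 - \<omega>' j * cnj z)\<^sup>2 * (1 - \<eta>' j * cnj l)\<^sup>2))"
        unfolding w' x hk_hmap_roots[OF m n zl y] by (simp add: \<omega>'_def \<eta>'_def mult_ac)
      also have "of_nat m * cnj l ^ ?N * (G x * (1 / (of_real (pi\<^sup>2) * (of_nat m)\<^sup>2 * (cnj l * \<eta>) ^ ?N)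
         * (\<Sum>j<m. cnj (ru m j) ^ (n - 1) / ((1 - \<omega>' j * cnj z)\<^sup>2 * (1 - \<eta>' j * cnj l)\<^sup>2))))
        = ?c * (G x * (\<Sum>j<m. cnj (ru m j) ^ (n - 1) / ((1 - \<omega>' j * cnj z)\<^sup>2 * (1 - \<eta>' j * cnj l)\<^sup>2)))"
        using m zl y by (simp add: power_mult_distrib power2_eq_square)
      also have "G x * (\<Sum>j<m. cnj (ru m j) ^ (n - 1) / ((1 - \<omega>' j * cnj z)\<^sup>2 * (1 - \<eta>' j * cnj l)\<^sup>2)) = (\<Sum>j<m. cnj (ru m j) ^ (n - 1) * R j x)"
        unfolding sum_distrib_left R_def in1 by (simp add: x mult.commute)
      finally show ?thesis .
    next
      case False
      then consider "x \<notin> bidisc" | "l = 0" by blast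
      then show ?thesis
      proof cases
        case 1
        then show ?thesis by (simp add: R_def)
      next
        case 2
        then have e0: "norm (snd x) ^ (2 * ?N) = 0" "snd x ^ ?N = 0" using m n by (simp_all add: x zero_power)
        show ?thesis unfolding R_def G_def e0 by simp
      qed
    qed
  qed
  also have "\<dots> = ?c * (\<integral>x. (\<Sum>j<m. cnj (ru m j) ^ (n - 1) * R j x) \<partial>lborel)"
    by (rule integral_mult_right_zero)
  also have "(\<integral>x. (\<Sum>j<m. cnj (ru m j) ^ (n - 1) * R j x) \<partial>lborel) = (\<Sum>j<m. \<integral>x. cnj (ru m j) ^ (n - 1) * R j x \<partial>lborel)"
    using RI by (intro Bochner_Integration.integral_sum integrable_mult_right)
  also have "\<dots> = (\<Sum>j<m. of_real (pi\<^sup>2) * \<eta> ^ ?N * f w)"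
  proof (rule sum.cong[OF refl])
    fix j assume "j \<in> {..<m}"
    have Gj: "G (\<omega>' j, \<eta>' j) = f w * (ru m j * \<eta>) ^ ?N"
    proof -
      have c1: "cnj (ru m j) ^ n * ru m j ^ n = 1"
        by (simp add: power_mult_distrib[symmetric] ru_cnj mult.commute[of "cnj _"])
      have "hmap m n (\<omega>' j, \<eta>' j) = (\<omega> * \<eta> ^ n * (cnj (ru m j) ^ n * ru m j ^ n), ru m j ^ m * \<eta> ^ m)"
        by (simp add: hmap_def \<omega>'_def \<eta>'_def power_mult_distrib mult_ac)
      then have "hmap m n (\<omega>' j, \<eta>' j) = w" unfolding c1 ru_power[OF m] by (simp add: w' hmap_def)
      then show ?thesis using Gf[of "\<omega>' j" "\<eta>' j"] pt[of j] by (simp add: \<eta>'_def)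
    qed
    \<comment> \<open>The root of unity from the deck Jacobian and the one contributed by
      \<open>G\<close> combine to \<open>ru m j ^ m\<close>, which is 1; so the terms do not depend
      on j.\<close>
    have "cnj (ru m j) ^ (n - 1) * ru m j ^ ?N = ru m j ^ m * (cnj (ru m j) ^ (n - 1) * ru m j ^ (n - 1))"
    proof -
      have "?N = m + (n - 1)" using n by simp
      then show ?thesis by (simp only: power_add mult_ac)
    qed
    also have "cnj (ru m j) ^ (n - 1) * ru m j ^ (n - 1) = 1"
      by (simp add: power_mult_distrib[symmetric] ru_cnj mult.commute[of "cnj _"])
    finally have c2: "cnj (ru m j) ^ (n - 1) * ru m j ^ ?N = 1" by (simp add: ru_power m)
    have "(\<integral>x. cnj (ru m j) ^ (n - 1) * R j x \<partial>lborel) = cnj (ru m j) ^ (n - 1) * (of_real (pi\<^sup>2) * (f w * (ru m j ^ ?N * \<eta> ^ ?N)))"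
      by (subst integral_mult_right_zero) (simp only: RV Gj power_mult_distrib of_real_mult of_real_power)
    also have "\<dots> = (cnj (ru m j) ^ (n - 1) * ru m j ^ ?N) * (of_real (pi\<^sup>2) * \<eta> ^ ?N * f w)"
      by (simp only: mult_ac)
    finally show "(\<integral>x. cnj (ru m j) ^ (n - 1) * R j x \<partial>lborel) = of_real (pi\<^sup>2) * \<eta> ^ ?N * f w"
      by (simp only: c2 mult_1_left)
  qed
  also have "\<dots> = of_nat m * (of_real (pi\<^sup>2) * \<eta> ^ ?N * f w)" by simp
  also have "?c * \<dots> = f w" using m y by (simp add: field_simps)
  finally show ?thesis by simp
qed

lemma is_bergman_kernel_hk:
  assumes m: "0 < m" and n: "0 < n"
  shows "is_bergman_kernel (hartogs m n) (hk m n)"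
  unfolding is_bergman_kernel_def
  using hk_square_integrable[OF _ m n] hk_reproducing[OF _ _ m n] by (auto simp: hk_def)

text \<open>Each kernel reproduces the other, and comparing the two integrals gives L w z = cnj (K z
  w). With L = K this is Hermitian symmetry, and the two statements together give K = L on the
  domain.\<close>

lemma is_bergman_kernel_unique:
  assumes K: "is_bergman_kernel \<Omega> K" and L: "is_bergman_kernel \<Omega> L"
  shows "K = L"
proof (intro ext)
  have sym: "L w z = cnj (K z w)" if K: "is_bergman_kernel \<Omega> K" and L: "is_bergman_kernel \<Omega> L" and zw: "z \<in> \<Omega>" "w \<in> \<Omega>" for K L z w
  proof -
    have kw: "(\<lambda>x. K x w) \<in> bergman_space \<Omega>" and lz: "(\<lambda>x. L x z) \<in> bergman_space \<Omega>"
      and rk: "\<forall>f\<in>bergman_space \<Omega>. f w = (\<integral>x. f x * cnj (K x w) \<partial>lebesgue_on \<Omega>)"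
      and rl: "\<forall>f\<in>bergman_space \<Omega>. f z = (\<integral>x. f x * cnj (L x z) \<partial>lebesgue_on \<Omega>)"
      using K L zw unfolding is_bergman_kernel_def by blast+
    have "K z w = (\<integral>x. K x w * cnj (L x z) \<partial>lebesgue_on \<Omega>)" by (rule bspec[OF rl kw])
    moreover have "L w z = (\<integral>x. L x z * cnj (K x w) \<partial>lebesgue_on \<Omega>)" by (rule bspec[OF rk lz])
    moreover have "cnj (\<integral>x. K x w * cnj (L x z) \<partial>lebesgue_on \<Omega>) = (\<integral>x. cnj (K x w * cnj (L x z)) \<partial>lebesgue_on \<Omega>)"
      by (rule Bochner_Integration.integral_cnj[symmetric])
    ultimately show ?thesis by (simp add: mult.commute)
  qed
  fix z w
  show "K z w = L z w"
  proof (cases "z \<in> \<Omega> \<and> w \<in> \<Omega>")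
    case True
    then show ?thesis using sym[OF K K, of w z] sym[OF K L, of w z] by simp
  next
    case False
    have "K z w = 0" "L z w = 0" using K L False unfolding is_bergman_kernel_def by blast+
    then show ?thesis by simp
  qed
qed

lemma bergman_kernel_hartogs:
  assumes "0 < m" "0 < n"
  shows "bergman_kernel (hartogs m n) = hk m n"
  unfolding bergman_kernel_def
proof (rule the_equality)
  show "is_bergman_kernel (hartogs m n) (hk m n)" by (rule is_bergman_kernel_hk[OF assms])
  then show "K = hk m n" if "is_bergman_kernel (hartogs m n) K" for K
    by (rule is_bergman_kernel_unique[OF that])
qed

section \<open>Upper bounds for the kernel\<close>

definition hbase :: "nat \<Rightarrow> nat \<Rightarrow> complex \<times> complex \<Rightarrow> complex" where
  "hbase m n z = fst z ^ m / snd z ^ n"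

lemma hbase_measurable[measurable]: "hbase m n \<in> borel_measurable borel"
  unfolding hbase_def borel_prod[symmetric] by measurable

lemma snd_borel_measurable[measurable]: "(snd :: complex \<times> complex \<Rightarrow> complex) \<in> borel_measurable borel"
  by (intro borel_measurable_continuous_onI continuous_intros)

text \<open>The product of the two disc-type defining functions. Its square is exactly the
  denominator removed in \<open>hsize\<close>.\<close>

definition hdist :: "nat \<Rightarrow> nat \<Rightarrow> complex \<times> complex \<Rightarrow> real" where
  "hdist m n z = (1 - (norm (hbase m n z))\<^sup>2) * (1 - (norm (snd z))\<^sup>2)"

text \<open>\<open>bk_poly\<close> at real arguments, see \<open>bk_poly_of_real\<close>. For
  nonnegative arguments nothing cancels, so it dominates each of its monomials.\<close>

definition bkr :: "nat \<Rightarrow> nat \<Rightarrow> real \<Rightarrow> real \<Rightarrow> real" where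
  "bkr m n v p = (\<Sum>(r,l)\<in>bk_idx m n. (real r + real (m - r) * v ^ m) * (real l + real (m - l) * p ^ m)
      * (v ^ (r - 1) * p ^ (l - 1)))"

text \<open>The diagonal of the kernel with its singularities on \<open>|z\<^sub>1|\<^sup>m = |z\<^sub>2|\<^sup>n\<close> and \<open>|z\<^sub>2| = 1\<close> removed.\<close>

definition hsize :: "nat \<Rightarrow> nat \<Rightarrow> complex \<times> complex \<Rightarrow> real" where
  "hsize m n z = Re (hk m n z z) * (hdist m n z)\<^sup>2"

lemma bk_poly_of_real: "bk_poly m n (of_real v) (of_real p) = of_real (bkr m n v p)"
  unfolding bk_poly_def bkr_def by (simp add: case_prod_beta')

lemma hbase_hmap: "0 < m \<Longrightarrow> l \<noteq> 0 \<Longrightarrow> hbase m n (hmap m n (x, l)) = x ^ m"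
  by (simp add: hbase_def hmap_def power_mult_distrib power_mult[symmetric] mult.commute)

lemma norm_hbase_less:
  assumes "z \<in> hartogs m n" "0 < m" "0 < n"
  shows "norm (hbase m n z) < 1"
proof -
  obtain x l where x: "norm x < 1" "l \<noteq> 0" "norm l < 1" "z = hmap m n (x, l)"
    using hartogs_lift[OF assms] by metis
  then show ?thesis using assms(2) by (simp add: hbase_hmap norm_power power_less_one_iff)
qed

lemma hdist_pos:
  assumes "z \<in> hartogs m n" "0 < m" "0 < n"
  shows "0 < hdist m n z" "hdist m n z \<le> 1"
proof -
  have "(norm (hbase m n z))\<^sup>2 < 1" "(norm (snd z))\<^sup>2 < 1"
    using norm_hbase_less[OF assms] hartogs_snd[OF assms(1,3)] by (auto simp: abs_square_less_1)
  then show "0 < hdist m n z" "hdist m n z \<le> 1"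
    unfolding hdist_def by (auto intro!: mult_pos_pos mult_le_one)
qed

lemma bkr_ge:
  assumes "(r, l) \<in> bk_idx m n" "0 \<le> v" "0 \<le> p"
  shows "v ^ (r - 1) * p ^ (l - 1) \<le> bkr m n v p"
proof -
  have "1 * 1 \<le> (real r + real (m - r) * v ^ m) * (real l + real (m - l) * p ^ m)"
    using assms by (intro mult_mono) (auto simp: bk_idx_def intro!: add_increasing2)
  then have "1 * (v ^ (r - 1) * p ^ (l - 1)) \<le> (real r + real (m - r) * v ^ m) * (real l + real (m - l) * p ^ m) * (v ^ (r - 1) * p ^ (l - 1))"
    using assms by (intro mult_right_mono) auto
  also have "\<dots> \<le> bkr m n v p"
  proof -
    let ?f = "\<lambda>(r,l). (real r + real (m - r) * v ^ m) * (real l + real (m - l) * p ^ m) * (v ^ (r - 1) * p ^ (l - 1))"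
    have "?f (r, l) \<le> sum ?f (bk_idx m n)"
      using assms by (intro member_le_sum finite_bk_idx) auto
    then show ?thesis unfolding bkr_def by (simp only: prod.case)
  qed
  finally show ?thesis by simp
qed

lemma bkr_le:
  assumes "0 \<le> v" "v \<le> 1" "0 \<le> p" "p \<le> 1"
  shows "bkr m n v p \<le> real m ^ 4"
proof -
  have "bkr m n v p \<le> norm (complex_of_real (bkr m n v p))" by simp
  also have "\<dots> = norm (bk_poly m n (of_real v) (of_real p))" by (simp only: bk_poly_of_real)
  also have "\<dots> \<le> real m ^ 4" using assms by (intro norm_bk_poly_le) auto
  finally show ?thesis .
qed

text \<open>Each monomial at the mixed point factors into one for (x, l) and one for (y, k), whose
  squares are monomials on the diagonal and hence at most \<open>bkr\<close>. The off-diagonal size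
  is thus controlled by the geometric mean of diagonal values, which lets the kernel bound split
  into a part in z and a part in w.\<close>

lemma norm_bk_poly_le_sqrt:
  assumes "norm x \<le> 1" "norm l \<le> 1" "norm y \<le> 1" "norm k \<le> 1"
  shows "norm (bk_poly m n (x * cnj y) (l * cnj k))
    \<le> real m ^ 4 * sqrt (bkr m n ((norm x)\<^sup>2) ((norm l)\<^sup>2) * bkr m n ((norm y)\<^sup>2) ((norm k)\<^sup>2))"
proof -
  let ?S = "sqrt (bkr m n ((norm x)\<^sup>2) ((norm l)\<^sup>2) * bkr m n ((norm y)\<^sup>2) ((norm k)\<^sup>2))"
  have le1: "norm (x * cnj y) \<le> 1" "norm (l * cnj k) \<le> 1" using assms by (auto simp: norm_mult intro!: mult_le_one)
  have "norm (bk_poly m n (x * cnj y) (l * cnj k)) \<le> (\<Sum>(r,q)\<in>bk_idx m n. real m * real m * ?S)"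
    unfolding bk_poly_def
  proof (rule sum_norm_le, safe)
    fix r q assume rl: "(r, q) \<in> bk_idx m n"
    then have r: "r \<le> m" "q \<le> m" by (auto simp: bk_idx_def)
    let ?X = "norm x ^ (r - 1) * norm l ^ (q - 1)" and ?Y = "norm y ^ (r - 1) * norm k ^ (q - 1)"
    have "?X\<^sup>2 \<le> bkr m n ((norm x)\<^sup>2) ((norm l)\<^sup>2)" "?Y\<^sup>2 \<le> bkr m n ((norm y)\<^sup>2) ((norm k)\<^sup>2)"
      using bkr_ge[OF rl, of "(norm x)\<^sup>2" "(norm l)\<^sup>2"] bkr_ge[OF rl, of "(norm y)\<^sup>2" "(norm k)\<^sup>2"]
      by (simp_all add: power_mult_distrib power_mult[symmetric] mult.commute)
    then have "?X\<^sup>2 * ?Y\<^sup>2 \<le> bkr m n ((norm x)\<^sup>2) ((norm l)\<^sup>2) * bkr m n ((norm y)\<^sup>2) ((norm k)\<^sup>2)"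
      by (intro mult_mono) (auto intro: order_trans[OF zero_le_power2])
    then have "?X * ?Y \<le> ?S" by (intro real_le_rsqrt) (simp add: power_mult_distrib)
    then have "norm ((x * cnj y) ^ (r - 1) * (l * cnj k) ^ (q - 1)) \<le> ?S"
      by (simp add: norm_mult norm_power power_mult_distrib mult_ac)
    then show "norm ((of_nat r + of_nat (m - r) * (x * cnj y) ^ m) * (of_nat q + of_nat (m - q) * (l * cnj k) ^ m) * ((x * cnj y) ^ (r - 1) * (l * cnj k) ^ (q - 1))) \<le> real m * real m * ?S"
      unfolding norm_mult[of "_ * _" "_ ^ _ * _"] norm_mult[of "of_nat r + _"]
      by (intro mult_mono norm_residue_coef_le r le1) auto
  qed
  also have "\<dots> = real (card (bk_idx m n)) * (real m * real m * ?S)" by simp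
  also have "\<dots> \<le> real (m * m) * (real m * real m * ?S)"
  proof -
    have "0 \<le> ?S" unfolding bkr_def by (intro real_sqrt_ge_zero mult_nonneg_nonneg sum_nonneg) auto
    then show ?thesis using card_bk_idx[of m n] by (intro mult_right_mono of_nat_mono) auto
  qed
  finally show ?thesis by (simp add: power4_eq_xxxx mult_ac)
qed

text \<open>On the diagonal the singular denominators of the kernel are exactly the square of
  \<open>hdist\<close>, so only the numerator and the pole in l remain.\<close>

lemma hk_diag:
  assumes m: "0 < m" and n: "0 < n" and x: "norm x < 1" "l \<noteq> 0" "norm l < 1"
  shows "hsize m n (hmap m n (x, l)) = bkr m n ((norm x)\<^sup>2) ((norm l)\<^sup>2) / (pi\<^sup>2 * real m * norm l ^ (2 * (m + n - 1)))"
proof -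
  let ?z = "hmap m n (x, l)" and ?N = "m + n - 1"
  have e: "x * cnj x = of_real ((norm x)\<^sup>2)" "l * cnj l = of_real ((norm l)\<^sup>2)"
    by (rule complex_norm_square[symmetric])+
  have pos: "(norm x)\<^sup>2 ^ m \<noteq> 1" "(norm l)\<^sup>2 ^ m \<noteq> 1"
  proof -
    have "norm x ^ (2 * m) < 1" "norm l ^ (2 * m) < 1" using x m by (simp_all add: power_less_one_iff)
    then show "(norm x)\<^sup>2 ^ m \<noteq> 1" "(norm l)\<^sup>2 ^ m \<noteq> 1" unfolding power_mult by linarith+
  qed
  have "hk m n ?z ?z = of_real (bkr m n ((norm x)\<^sup>2) ((norm l)\<^sup>2) / (pi\<^sup>2 * real m * ((norm l)\<^sup>2) ^ ?N * (1 - ((norm x)\<^sup>2) ^ m)\<^sup>2 * (1 - ((norm l)\<^sup>2) ^ m)\<^sup>2))"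
    unfolding hk_hmap[OF m n x x] e bk_poly_of_real by simp
  then have "Re (hk m n ?z ?z) = bkr m n ((norm x)\<^sup>2) ((norm l)\<^sup>2) / (pi\<^sup>2 * real m * ((norm l)\<^sup>2) ^ ?N * (1 - ((norm x)\<^sup>2) ^ m)\<^sup>2 * (1 - ((norm l)\<^sup>2) ^ m)\<^sup>2)"
    by (simp only: Re_complex_of_real)
  moreover have "hdist m n ?z = (1 - ((norm x)\<^sup>2) ^ m) * (1 - ((norm l)\<^sup>2) ^ m)"
    using x by (simp add: hdist_def hbase_hmap[OF m] norm_power power_mult[symmetric] mult.commute) (simp add: hmap_def norm_power power_mult[symmetric] mult.commute)
  ultimately have "hsize m n ?z = bkr m n ((norm x)\<^sup>2) ((norm l)\<^sup>2) / (pi\<^sup>2 * real m * ((norm l)\<^sup>2) ^ ?N * (1 - ((norm x)\<^sup>2) ^ m)\<^sup>2 * (1 - ((norm l)\<^sup>2) ^ m)\<^sup>2)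
     * ((1 - ((norm x)\<^sup>2) ^ m)\<^sup>2 * (1 - ((norm l)\<^sup>2) ^ m)\<^sup>2)"
    unfolding hsize_def by (simp only: power_mult_distrib)
  also have "\<dots> = bkr m n ((norm x)\<^sup>2) ((norm l)\<^sup>2) / (pi\<^sup>2 * real m * ((norm l)\<^sup>2) ^ ?N)"
    using pos by simp
  finally show ?thesis by (simp only: power_mult)
qed

text \<open>Supplies the monomial without v, which stays visible where v = 0. The second index m - q
  with q < m lies in 1..m and solves the congruence for r = 1.\<close>

lemma bk_idx_first:
  assumes "0 < m"
  obtains l where "(1, l) \<in> bk_idx m n"
proof -
  let ?q = "(n * (m - 1)) mod m"
  have q: "?q < m" using assms by simp
  have "m dvd (m - ?q) + n * (m - 1)"
  proof -
    have "(m - ?q) + n * (m - 1) = (m - ?q) + (m * ((n * (m - 1)) div m) + ?q)" by simp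
    also have "\<dots> = m + m * ((n * (m - 1)) div m)" using q by linarith
    also have "\<dots> = m * (1 + (n * (m - 1)) div m)" by simp
    finally show ?thesis by (metis dvd_triv_left)
  qed
  moreover have "1 \<le> m - ?q" using q by linarith
  ultimately have "(1, m - ?q) \<in> bk_idx m n" by (simp add: bk_idx_def)
  then show thesis by (rule that)
qed

lemma norm_snd_hmap_powr:
  assumes "0 < m" "l \<noteq> 0"
  shows "norm (snd (hmap m n (x, l))) powr (- (real k / real m)) = 1 / norm l ^ k"
proof -
  have "norm (snd (hmap m n (x, l))) = norm l powr real m"
    using assms by (simp add: hmap_def norm_power powr_realpow)
  then have "norm (snd (hmap m n (x, l))) powr (- (real k / real m)) = norm l powr (- real k)"
    using assms by (simp add: powr_powr)
  also have "\<dots> = 1 / norm l ^ k" using assms by (simp add: powr_minus powr_realpow divide_inverse)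
  finally show ?thesis .
qed

text \<open>The lower bound keeps only the monomial without v, whose power of |l|^2 is at most m - 1
  and so does not exceed the pole order m + n - 1. The upper bound is the trivial estimate of
  \<open>bkr\<close>; its exponent is the pole order in l divided by m, since |z2| = |l|^m.\<close>

lemma hsize_bounds:
  assumes z: "z \<in> hartogs m n" and m: "0 < m" and n: "0 < n"
  shows "1 / (pi\<^sup>2 * real m) \<le> hsize m n z"
    and "hsize m n z \<le> real m ^ 3 / pi\<^sup>2 * norm (snd z) powr (- (real (2 * (m + n - 1)) / real m))"
proof -
  obtain x l where x: "norm x < 1" "l \<noteq> 0" "norm l < 1" and z': "z = hmap m n (x, l)"
    using hartogs_lift[OF z m n] by metis
  let ?N = "m + n - 1"
  obtain q where q: "(1, q) \<in> bk_idx m n" using bk_idx_first[OF m] by metis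
  have "norm l ^ (2 * ?N) \<le> norm l ^ (2 * (q - 1))"
    using x q n by (intro power_decreasing) (auto simp: bk_idx_def)
  also have "\<dots> \<le> bkr m n ((norm x)\<^sup>2) ((norm l)\<^sup>2)"
    using bkr_ge[OF q, of "(norm x)\<^sup>2" "(norm l)\<^sup>2"] by (simp add: power_mult)
  finally have "norm l ^ (2 * ?N) * (1 / (pi\<^sup>2 * real m)) \<le> bkr m n ((norm x)\<^sup>2) ((norm l)\<^sup>2) * (1 / (pi\<^sup>2 * real m))"
    by (rule mult_right_mono) simp
  then show "1 / (pi\<^sup>2 * real m) \<le> hsize m n z"
    unfolding z' hk_diag[OF m n x] using m x by (simp add: field_simps)
  have "bkr m n ((norm x)\<^sup>2) ((norm l)\<^sup>2) \<le> real m ^ 4"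
    using x by (intro bkr_le) (auto simp: abs_square_le_1)
  then have "hsize m n z \<le> real m ^ 4 / (pi\<^sup>2 * real m * norm l ^ (2 * ?N))"
    unfolding z' hk_diag[OF m n x] by (intro divide_right_mono) auto
  also have "\<dots> = real m ^ 3 / pi\<^sup>2 * (1 / norm l ^ (2 * ?N))"
    using m by (simp add: power4_eq_xxxx power3_eq_cube)
  finally show "hsize m n z \<le> real m ^ 3 / pi\<^sup>2 * norm (snd z) powr (- (real (2 * ?N) / real m))"
    unfolding z' norm_snd_hmap_powr[OF m x(2)] .
qed

lemma hsize_pos: "z \<in> hartogs m n \<Longrightarrow> 0 < m \<Longrightarrow> 0 < n \<Longrightarrow> 0 < hsize m n z"
  by (rule less_le_trans[OF _ hsize_bounds(1)]) simp_all

text \<open>The numerator is bounded by the geometric mean of its diagonal values and the powers of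
  |l| and |k| are shared between the two points, while the singular denominators are the exact ones
  of the kernel.\<close>

lemma norm_hk_le:
  assumes z: "z \<in> hartogs m n" and w: "w \<in> hartogs m n" and m: "0 < m" and n: "0 < n"
  shows "norm (hk m n z w) \<le> real m ^ 4 * sqrt (hsize m n z * hsize m n w)
     / ((norm (1 - hbase m n z * cnj (hbase m n w)))\<^sup>2 * (norm (1 - snd z * cnj (snd w)))\<^sup>2)"
proof -
  obtain x l where x: "norm x < 1" "l \<noteq> 0" "norm l < 1" and z': "z = hmap m n (x, l)"
    using hartogs_lift[OF z m n] by metis
  obtain y k where y: "norm y < 1" "k \<noteq> 0" "norm k < 1" and w': "w = hmap m n (y, k)"
    using hartogs_lift[OF w m n] by metis
  let ?N = "m + n - 1"
  let ?a = "bkr m n ((norm x)\<^sup>2) ((norm l)\<^sup>2)" and ?b = "bkr m n ((norm y)\<^sup>2) ((norm k)\<^sup>2)"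
  let ?D = "(norm (1 - (x * cnj y) ^ m))\<^sup>2 * (norm (1 - (l * cnj k) ^ m))\<^sup>2"
  have S: "sqrt (hsize m n z * hsize m n w) = sqrt (?a * ?b) / (pi\<^sup>2 * real m * (norm l * norm k) ^ ?N)"
  proof -
    have "hsize m n z * hsize m n w = (?a * ?b) / (pi\<^sup>2 * real m * (norm l * norm k) ^ ?N)\<^sup>2"
    proof -
      have "norm l ^ (2 * ?N) = (norm l ^ ?N)\<^sup>2" "norm k ^ (2 * ?N) = (norm k ^ ?N)\<^sup>2"
        by (simp_all only: power_mult[symmetric] mult.commute)
      then show ?thesis unfolding z' w' hk_diag[OF m n x] hk_diag[OF m n y]
        by (simp only: times_divide_times_eq power_mult_distrib power2_eq_square mult_ac)
    qed
    then show ?thesis by (simp add: real_sqrt_divide)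
  qed
  have B: "1 - hbase m n z * cnj (hbase m n w) = 1 - (x * cnj y) ^ m" "1 - snd z * cnj (snd w) = 1 - (l * cnj k) ^ m"
    using x y by (simp_all add: z' w' hbase_hmap[OF m] power_mult_distrib) (simp add: hmap_def)
  have "norm (hk m n z w) = norm (bk_poly m n (x * cnj y) (l * cnj k)) / (pi\<^sup>2 * real m * (norm l * norm k) ^ ?N * ?D)"
    unfolding z' w' hk_hmap[OF m n x y] by (simp add: norm_divide norm_mult norm_power mult_ac)
  also have "\<dots> \<le> (real m ^ 4 * sqrt (?a * ?b)) / (pi\<^sup>2 * real m * (norm l * norm k) ^ ?N * ?D)"
    using x y by (intro divide_right_mono norm_bk_poly_le_sqrt) auto
  also have "\<dots> = real m ^ 4 * sqrt (hsize m n z * hsize m n w) / ?D"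
    unfolding S by simp
  finally show ?thesis unfolding B .
qed

lemma norm_one_minus_pos:
  assumes "norm (a::complex) < 1" "norm b < 1"
  shows "0 < norm (1 - a * cnj b)" "norm (1 - a * cnj b) \<le> 2"
proof -
  have "norm (a * cnj b) < 1" using mult_strict_mono'[of "norm a" 1 "norm b" 1] assms by (simp add: norm_mult)
  then show "0 < norm (1 - a * cnj b)" "norm (1 - a * cnj b) \<le> 2"
    using norm_triangle_ineq4[of 1 "a * cnj b"] by auto
qed

lemma square_powr_half: "0 < x \<Longrightarrow> (x\<^sup>2) powr (e / 2) = x powr e" for x :: real
  using powr_powr[of x 2 "e/2"] by simp

text \<open>Separates the boundary distances, on which Schur's test acts, from \<open>hsize\<close>,
  whose size is governed by the origin.\<close>

lemma S_plus_kernel_eq: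
  assumes z: "z \<in> hartogs m n" and w: "w \<in> hartogs m n" and m: "0 < m" and n: "0 < n"
  shows "S_plus_kernel m n a b c z w = norm (hk m n z w) powr (c / 2)
    * (hsize m n z powr (- a / 2) * hdist m n z powr a) * (hsize m n w powr (- b / 2) * hdist m n w powr b)"
proof -
  have R: "Re (hk m n z z) powr (e / 2) = hsize m n z powr (e / 2) / hdist m n z powr e" if z: "z \<in> hartogs m n" for z e
  proof -
    note d = hdist_pos(1)[OF z m n]
    have "Re (hk m n z z) = hsize m n z / (hdist m n z)\<^sup>2" using d by (simp add: hsize_def)
    then show ?thesis using d hsize_pos[OF z m n] by (simp add: powr_divide square_powr_half)
  qed
  have "S_plus_kernel m n a b c z w = norm (hk m n z w) powr (c / 2) / (Re (hk m n z z) powr (a / 2) * Re (hk m n w w) powr (b / 2))"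
    by (simp add: S_plus_kernel_def bergman_kernel_hartogs[OF m n])
  then show ?thesis unfolding R[OF z] R[OF w]
    by (simp add: powr_minus field_simps)
qed

lemma S_plus_kernel_outside:
  assumes "z \<notin> hartogs m n \<or> w \<notin> hartogs m n" "0 < m" "0 < n"
  shows "S_plus_kernel m n a b c z w = 0"
  using assms by (auto simp: S_plus_kernel_def bergman_kernel_hartogs hk_def)

lemma S_plus_kernel_nonneg: "0 \<le> S_plus_kernel m n a b c z w"
  by (simp add: S_plus_kernel_def)

text \<open>For e >= 0 the upper bound on \<open>hsize\<close> applies and gives a pole, for e < 0
  the constant lower bound; \<open>max 0 e\<close> records both cases.\<close>

lemma hsize_powr_le:
  assumes m: "0 < m" and n: "0 < n"
  obtains C where "0 \<le> C" "\<And>z. z \<in> hartogs m n \<Longrightarrow>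
     hsize m n z powr e \<le> C * norm (snd z) powr (- (real (2 * (m + n - 1)) / real m * max 0 e))"
proof (cases "0 \<le> e")
  case True
  let ?\<kappa> = "real (2 * (m + n - 1)) / real m"
  show thesis
  proof (rule that[of "(real m ^ 3 / pi\<^sup>2) powr e"])
    fix z assume z: "z \<in> hartogs m n"
    have "hsize m n z powr e \<le> (real m ^ 3 / pi\<^sup>2 * norm (snd z) powr (- ?\<kappa>)) powr e"
      using True hsize_pos[OF z m n] hsize_bounds(2)[OF z m n] by (intro powr_mono2) auto
    also have "\<dots> = (real m ^ 3 / pi\<^sup>2) powr e * norm (snd z) powr (- (?\<kappa> * max 0 e))"
      using True by (subst powr_mult) (simp_all add: powr_powr)
    finally show "hsize m n z powr e \<le> (real m ^ 3 / pi\<^sup>2) powr e * norm (snd z) powr (- (?\<kappa> * max 0 e))" .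
  qed simp
next
  case False
  show thesis
  proof (rule that[of "(1 / (pi\<^sup>2 * real m)) powr e"])
    fix z assume z: "z \<in> hartogs m n"
    have "hsize m n z powr e \<le> (1 / (pi\<^sup>2 * real m)) powr e"
      using False m hsize_bounds(1)[OF z m n] by (intro powr_mono2') auto
    then show "hsize m n z powr e \<le> (1 / (pi\<^sup>2 * real m)) powr e * norm (snd z) powr (- (real (2 * (m + n - 1)) / real m * max 0 e))"
      using False hartogs_snd(1)[OF z n] by simp
  qed simp
qed

text \<open>The power c/2 of the geometric mean in \<open>norm_hk_le\<close> gives
  \<open>hsize\<close> to the power c/4 at each point, whence c/4 - a/2 and c/4 - b/2. The exponent
  of the singular factors is raised from c to d at the cost of 2^(d-c) each, because these factors
  are at most 2.\<close>

lemma S_plus_kernel_le: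
  assumes m: "0 < m" and n: "0 < n" and c: "0 < c" "c \<le> d"
  defines "\<kappa> \<equiv> real (2 * (m + n - 1)) / real m"
  obtains C where "0 \<le> C" "\<And>z w. z \<in> hartogs m n \<Longrightarrow> w \<in> hartogs m n \<Longrightarrow>
     S_plus_kernel m n a b c z w \<le> C * (norm (snd z) powr (- (\<kappa> * max 0 (c/4 - a/2))) * hdist m n z powr a)
       * (norm (snd w) powr (- (\<kappa> * max 0 (c/4 - b/2))) * hdist m n w powr b)
       / (norm (1 - hbase m n z * cnj (hbase m n w)) powr d * norm (1 - snd z * cnj (snd w)) powr d)"
proof -
  obtain C1 where C1: "0 \<le> C1" "\<And>z. z \<in> hartogs m n \<Longrightarrow> hsize m n z powr (c/4 - a/2) \<le> C1 * norm (snd z) powr (- (\<kappa> * max 0 (c/4 - a/2)))"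
    using hsize_powr_le[OF m n] unfolding \<kappa>_def by metis
  obtain C2 where C2: "0 \<le> C2" "\<And>z. z \<in> hartogs m n \<Longrightarrow> hsize m n z powr (c/4 - b/2) \<le> C2 * norm (snd z) powr (- (\<kappa> * max 0 (c/4 - b/2)))"
    using hsize_powr_le[OF m n] unfolding \<kappa>_def by metis
  define C0 where "C0 = (real m ^ 4) powr (c/2) * (2 powr (d - c) * 2 powr (d - c))"
  show thesis
  proof (rule that[of "C0 * C1 * C2"])
    show "0 \<le> C0 * C1 * C2" using C1(1) C2(1) by (simp add: C0_def)
    fix z w assume z: "z \<in> hartogs m n" and w: "w \<in> hartogs m n"
    let ?U = "norm (1 - hbase m n z * cnj (hbase m n w))" and ?T = "norm (1 - snd z * cnj (snd w))"
    have U: "0 < ?U" "?U \<le> 2" by (intro norm_one_minus_pos norm_hbase_less z w m n)+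
    have T: "0 < ?T" "?T \<le> 2" by (intro norm_one_minus_pos hartogs_snd[OF z n] hartogs_snd[OF w n])+
    have up: "1 / X powr c \<le> 2 powr (d - c) / X powr d" if "0 < X" "X \<le> 2" for X :: real
    proof -
      have "X powr (d - c) \<le> 2 powr (d - c)" using that c by (intro powr_mono2) auto
      then show ?thesis using that by (simp add: powr_diff field_simps)
    qed
    have "norm (hk m n z w) powr (c/2) \<le> (real m ^ 4 * sqrt (hsize m n z * hsize m n w) / (?U\<^sup>2 * ?T\<^sup>2)) powr (c/2)"
      using c norm_hk_le[OF z w m n] by (intro powr_mono2) auto
    also have "\<dots> = (real m ^ 4) powr (c/2) * (hsize m n z powr (c/4) * hsize m n w powr (c/4)) * ((1 / ?U powr c) * (1 / ?T powr c))"
    proof -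
      have s: "sqrt (hsize m n z * hsize m n w) = (hsize m n z * hsize m n w) powr (1/2)"
        using hsize_pos[OF z m n] hsize_pos[OF w m n] by (simp add: powr_half_sqrt)
      show ?thesis unfolding s using hsize_pos[OF z m n] hsize_pos[OF w m n] m U T
        by (simp add: powr_divide powr_mult powr_powr square_powr_half)
    qed
    also have "\<dots> \<le> (real m ^ 4) powr (c/2) * (hsize m n z powr (c/4) * hsize m n w powr (c/4)) * ((2 powr (d - c) / ?U powr d) * (2 powr (d - c) / ?T powr d))"
      by (intro mult_left_mono mult_mono up U T) auto
    also have "\<dots> = C0 * (hsize m n z powr (c/4) * hsize m n w powr (c/4)) / (?U powr d * ?T powr d)"
      by (simp add: C0_def)
    finally have K: "norm (hk m n z w) powr (c/2) \<le> C0 * (hsize m n z powr (c/4) * hsize m n w powr (c/4)) / (?U powr d * ?T powr d)" .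
    have "S_plus_kernel m n a b c z w \<le> (C0 * (hsize m n z powr (c/4) * hsize m n w powr (c/4)) / (?U powr d * ?T powr d))
       * (hsize m n z powr (- a / 2) * hdist m n z powr a) * (hsize m n w powr (- b / 2) * hdist m n w powr b)"
      unfolding S_plus_kernel_eq[OF z w m n] by (intro mult_right_mono K) auto
    also have "\<dots> = C0 * (hsize m n z powr (c/4 - a/2) * hdist m n z powr a) * (hsize m n w powr (c/4 - b/2) * hdist m n w powr b) / (?U powr d * ?T powr d)"
    proof -
      have "hsize m n z powr (c/4 - a/2) = hsize m n z powr (c/4) * hsize m n z powr (- a / 2)"
        "hsize m n w powr (c/4 - b/2) = hsize m n w powr (c/4) * hsize m n w powr (- b / 2)"
        by (simp_all add: powr_add[symmetric])
      then show ?thesis by (simp only: times_divide_eq_left times_divide_eq_right mult_ac)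
    qed
    also have "\<dots> \<le> C0 * (C1 * norm (snd z) powr (- (\<kappa> * max 0 (c/4 - a/2))) * hdist m n z powr a)
       * (C2 * norm (snd w) powr (- (\<kappa> * max 0 (c/4 - b/2))) * hdist m n w powr b) / (?U powr d * ?T powr d)"
      using C1(1) C2(1) by (intro divide_right_mono mult_mono mult_left_mono mult_right_mono C1(2) C2(2) z w mult_nonneg_nonneg) (auto simp: C0_def)
    finally show "S_plus_kernel m n a b c z w \<le> C0 * C1 * C2 * (norm (snd z) powr (- (\<kappa> * max 0 (c/4 - a/2))) * hdist m n z powr a)
       * (norm (snd w) powr (- (\<kappa> * max 0 (c/4 - b/2))) * hdist m n w powr b) / (?U powr d * ?T powr d)"
      by (simp only: mult_ac)
  qed
qed

section \<open>Forelli--Rudin estimates\<close>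

text \<open>Up to pi/3 the difference sin x - x/2 increases, since cos is at least 1/2 there. Beyond
  pi/3 the chain x/2 <= 4/5 <= sqrt 3 / 2 <= sin x closes the gap.\<close>

lemma sin_ge_half:
  assumes "0 \<le> x" "x \<le> pi / 2"
  shows "x / 2 \<le> sin x"
proof (cases "x \<le> pi / 3")
  case True
  have "sin 0 - 0 / 2 \<le> sin x - x / 2"
  proof (rule DERIV_nonneg_imp_nondecreasing[OF assms(1)])
    fix t assume t: "0 \<le> t" "t \<le> x"
    have "cos (pi / 3) \<le> cos t" using t True by (intro cos_monotone_0_pi_le) auto
    then have "0 \<le> cos t - 1 / 2" by (simp add: cos_60)
    moreover have "((\<lambda>x. sin x - x / 2) has_real_derivative cos t - 1 / 2) (at t)"
      by (auto intro!: derivative_eq_intros)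
    ultimately show "\<exists>y. ((\<lambda>x. sin x - x / 2) has_real_derivative y) (at t) \<and> 0 \<le> y" by blast
  qed
  then show ?thesis by simp
next
  case False
  have "sin (pi / 3) \<le> sin x" using False assms by (intro sin_monotone_2pi_le) auto
  moreover have "x / 2 \<le> 4 / 5"
  proof -
    have "pi \<le> 16 / 5" using pi_approx(2) by simp
    then show ?thesis using assms by linarith
  qed
  moreover have "8 / 5 \<le> sqrt 3" by (rule real_le_rsqrt) (simp add: power2_eq_square)
  ultimately show ?thesis by (simp add: sin_60)
qed

text \<open>The modulus N on the right dominates 1 - \<rho> by the triangle inequality, and |t|/2 <=
  |cis t - 1| <= N + (1 - \<rho>) <= 2 N. Together 1 - \<rho> + |t| <= 5 N, so the constant 8 is
  generous.\<close>

lemma norm_one_minus_cis_ge: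
  assumes "0 \<le> \<rho>" "\<rho> \<le> 1" "\<bar>t\<bar> \<le> pi"
  shows "(1 - \<rho> + \<bar>t\<bar>) / 8 \<le> norm (1 - complex_of_real \<rho> * cis t)"
proof -
  let ?n = "norm (1 - complex_of_real \<rho> * cis t)"
  have 1: "1 - \<rho> \<le> ?n"
    using norm_triangle_ineq2[of 1 "complex_of_real \<rho> * cis t"] assms by (simp add: norm_mult)
  have "norm (cis t - 1) = 2 * \<bar>sin (t / 2)\<bar>"
    using dist_exp_i_1[of t] by (simp add: cis_conv_exp)
  moreover have "\<bar>sin (t / 2)\<bar> = sin (\<bar>t\<bar> / 2)"
  proof (cases "0 \<le> t")
    case True
    then have "0 \<le> sin (t / 2)" using assms by (intro sin_ge_zero) auto
    then show ?thesis using True by simp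
  next
    case False
    then have "0 \<le> sin (- t / 2)" using assms by (intro sin_ge_zero) auto
    then show ?thesis using False by simp
  qed
  moreover have "\<bar>t\<bar> / 2 / 2 \<le> sin (\<bar>t\<bar> / 2)" using assms by (intro sin_ge_half) auto
  ultimately have 2: "\<bar>t\<bar> / 2 \<le> norm (cis t - 1)" by simp
  have "norm (cis t - 1) \<le> ?n + norm (complex_of_real (1 - \<rho>) * cis t)"
    using norm_triangle_ineq4[of "complex_of_real (1 - \<rho>) * cis t" "1 - complex_of_real \<rho> * cis t"] by (simp add: algebra_simps)
  moreover have "norm (complex_of_real (1 - \<rho>) * cis t) = 1 - \<rho>"
    using assms by (simp only: norm_mult norm_of_real norm_cis) simp
  ultimately have "norm (cis t - 1) \<le> ?n + (1 - \<rho>)" by simp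
  moreover have "\<bar>t\<bar> \<le> 2 * norm (cis t - 1)" using 2 by simp
  ultimately have "1 - \<rho> + \<bar>t\<bar> \<le> 8 * ?n" using 1 assms by simp
  then show ?thesis by simp
qed

lemma nn_integral_powr_tail:
  fixes c \<delta> :: real
  assumes "1 < c" "0 < \<delta>"
  shows "(\<integral>\<^sup>+t. ennreal ((\<delta> + t) powr (- c)) * indicator {0..} t \<partial>lborel) = ennreal (\<delta> powr (1 - c) / (c - 1))"
proof -
  have "(\<integral>\<^sup>+t. ennreal ((\<delta> + t) powr (- c)) * indicator {0..} t \<partial>lborel) = ennreal (0 - (- ((\<delta> + 0) powr (1 - c)) / (c - 1)))"
  proof (rule nn_integral_FTC_atLeast[where F="\<lambda>t. - ((\<delta> + t) powr (1 - c)) / (c - 1)"])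
    fix x :: real assume "0 \<le> x"
    then have "((\<lambda>t. (\<delta> + t) powr (1 - c)) has_real_derivative (1 - c) * (\<delta> + x) powr (1 - c - of_nat 1) * 1) (at x)"
      using assms by (intro DERIV_fun_powr) (auto intro!: derivative_eq_intros)
    then have "((\<lambda>t. - ((\<delta> + t) powr (1 - c)) / (c - 1)) has_real_derivative - ((1 - c) * (\<delta> + x) powr (1 - c - 1)) / (c - 1)) (at x)"
      by (intro DERIV_cdivide DERIV_minus) simp
    moreover have "- ((1 - c) * (\<delta> + x) powr (1 - c - 1)) / (c - 1) = (\<delta> + x) powr (- c)"
      using assms by (simp add: field_simps)
    ultimately show "((\<lambda>t. - ((\<delta> + t) powr (1 - c)) / (c - 1)) has_real_derivative (\<delta> + x) powr (- c)) (at x)" by simp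
  next
    have "((\<lambda>t. (\<delta> + t) powr (1 - c)) \<longlongrightarrow> 0) at_top"
      using assms by (intro tendsto_neg_powr) (auto intro!: filterlim_tendsto_add_at_top filterlim_ident)
    then have "((\<lambda>t. - ((\<delta> + t) powr (1 - c)) / (c - 1)) \<longlongrightarrow> - 0 / (c - 1)) at_top"
      using assms by (intro tendsto_intros) auto
    then show "((\<lambda>t. - ((\<delta> + t) powr (1 - c)) / (c - 1)) \<longlongrightarrow> 0) at_top" by simp
  qed auto
  then show ?thesis by simp
qed

lemma nn_integral_powr_0:
  fixes a b :: real
  assumes "-1 < a" "0 \<le> b"
  shows "(\<integral>\<^sup>+x. ennreal (x powr a) * indicator {0..b} x \<partial>lborel) = ennreal (b powr (a + 1) / (a + 1))"
proof -
  have "((\<lambda>x. x powr a) has_integral b powr (a + 1) / (a + 1)) {0..b}"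
    by (rule has_integral_powr_from_0[OF assms])
  then have "((\<lambda>x. if x \<in> {0..b} then x powr a else 0) has_integral b powr (a + 1) / (a + 1)) UNIV"
    by (simp only: has_integral_restrict_UNIV)
  then have "(\<integral>\<^sup>+x. ennreal (if x \<in> {0..b} then x powr a else 0) \<partial>lborel) = ennreal (b powr (a + 1) / (a + 1))"
    by (intro nn_integral_has_integral_lborel) auto
  moreover have "(\<integral>\<^sup>+x. ennreal (if x \<in> {0..b} then x powr a else 0) \<partial>lborel) = (\<integral>\<^sup>+x. ennreal (x powr a) * indicator {0..b} x \<partial>lborel)"
    by (intro nn_integral_cong) (auto simp: indicator_def)
  ultimately show ?thesis by simp
qed

text \<open>One rotation removes the phase a and another centres the singularity in a window with
  |t| <= pi. There the integrand is at most 8^c (1 - \<rho> + |t|)^(-c), whose two tails converge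
  because c > 1.\<close>

lemma circle_kernel_integral_le:
  assumes c: "1 < c" and \<rho>: "0 \<le> \<rho>" "\<rho> < 1"
  shows "(\<integral>\<^sup>+t. ennreal (1 / norm (1 - complex_of_real \<rho> * cis (t + a)) powr c) * indicator {0..<2*pi} t \<partial>lborel)
    \<le> ennreal (8 powr c * (2 / (c - 1)) * (1 - \<rho>) powr (1 - c))"
proof -
  let ?f = "\<lambda>w. ennreal (1 / norm (1 - complex_of_real \<rho> * w) powr c)"
  let ?\<delta> = "1 - \<rho>"
  let ?g = "\<lambda>t::real. ennreal ((?\<delta> + \<bar>t\<bar>) powr (- c))"
  have "(\<integral>\<^sup>+t. ?f (cis (t + a)) * indicator {0..<2*pi} t \<partial>lborel) = (\<integral>\<^sup>+t. ?f (cis t) * indicator {0..<2*pi} t \<partial>lborel)"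
    by (rule nn_integral_circle_shift) measurable
  also have "\<dots> = (\<integral>\<^sup>+t. ?f (cis (t + - pi)) * indicator {0..<2*pi} t \<partial>lborel)"
    by (rule nn_integral_circle_shift[symmetric]) measurable
  also have "\<dots> \<le> (\<integral>\<^sup>+t. ennreal (8 powr c) * ?g (- pi + t) \<partial>lborel)"
  proof (rule nn_integral_mono)
    fix t :: real
    show "?f (cis (t + - pi)) * indicator {0..<2*pi} t \<le> ennreal (8 powr c) * ?g (- pi + t)"
    proof (cases "t \<in> {0..<2*pi}")
      case True
      then have t: "\<bar>t - pi\<bar> \<le> pi" by auto
      have "(?\<delta> + \<bar>t - pi\<bar>) / 8 \<le> norm (1 - complex_of_real \<rho> * cis (t - pi))"
        using \<rho> t by (intro norm_one_minus_cis_ge) auto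
      then have "norm (1 - complex_of_real \<rho> * cis (t - pi)) powr (- c) \<le> ((?\<delta> + \<bar>t - pi\<bar>) / 8) powr (- c)"
        using \<rho> c by (intro powr_mono2') auto
      also have "\<dots> = 8 powr c * (?\<delta> + \<bar>t - pi\<bar>) powr (- c)"
        using \<rho> by (subst powr_divide) (auto simp: powr_minus divide_simps)
      finally have "1 / norm (1 - complex_of_real \<rho> * cis (t - pi)) powr c \<le> 8 powr c * (?\<delta> + \<bar>t - pi\<bar>) powr (- c)"
        by (simp add: powr_minus divide_inverse)
      then have "?f (cis (t - pi)) \<le> ennreal (8 powr c * (?\<delta> + \<bar>t - pi\<bar>) powr (- c))" by (rule ennreal_leI)
      also have "\<dots> = ennreal (8 powr c) * ?g (t - pi)" by (rule ennreal_mult) auto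
      finally show ?thesis using True by simp
    qed simp
  qed
  also have "\<dots> = (\<integral>\<^sup>+t. ennreal (8 powr c) * ?g t \<partial>lborel)"
    by (rule nn_integral_lborel_plus) measurable
  also have "\<dots> = ennreal (8 powr c) * (\<integral>\<^sup>+t. ?g t \<partial>lborel)"
    by (rule nn_integral_cmult) measurable
  also have "(\<integral>\<^sup>+t. ?g t \<partial>lborel) \<le> (\<integral>\<^sup>+t. ?g t * indicator {0..} t + ?g (- t) * indicator {0..} (- t) \<partial>lborel)"
    by (intro nn_integral_mono) (auto simp: indicator_def)
  also have "\<dots> = (\<integral>\<^sup>+t. ?g t * indicator {0..} t \<partial>lborel) + (\<integral>\<^sup>+t. ?g (- t) * indicator {0..} (- t) \<partial>lborel)"
    by (rule nn_integral_add) measurable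
  also have "(\<integral>\<^sup>+t. ?g (- t) * indicator {0..} (- t) \<partial>lborel) = (\<integral>\<^sup>+t. ?g t * indicator {0..} t \<partial>lborel)"
    by (rule nn_integral_lborel_uminus) measurable
  also have "(\<integral>\<^sup>+t. ?g t * indicator {0..} t \<partial>lborel) = (\<integral>\<^sup>+t. ennreal ((?\<delta> + t) powr (- c)) * indicator {0..} t \<partial>lborel)"
    by (intro nn_integral_cong) (auto simp: indicator_def)
  also have "\<dots> = ennreal (?\<delta> powr (1 - c) / (c - 1))" using c \<rho> by (intro nn_integral_powr_tail) auto
  finally show ?thesis using c
    by (simp add: mult_left_mono ennreal_plus[symmetric] ennreal_mult'[symmetric] del: ennreal_plus) (simp add: field_simps)
qed

text \<open>With q = 1 - s the integral is split at q = \<delta>. Below, \<delta> + q is replaced by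
  \<delta>, and \<beta> > -1 gives convergence at 0; above, it is replaced by q, and \<beta> + 2 < c
  gives convergence of the tail. Both parts scale like \<delta>^(\<beta> + 2 - c).\<close>

lemma nn_integral_radial_kernel:
  fixes \<beta> c \<delta> :: real
  assumes \<beta>: "-1 < \<beta>" "\<beta> + 2 < c" and \<delta>: "0 < \<delta>"
  shows "(\<integral>\<^sup>+s. ennreal ((1 - s) powr \<beta> * (\<delta> + (1 - s)) powr (1 - c)) * indicator {0<..<1} s \<partial>lborel)
     \<le> ennreal ((1 / (\<beta> + 1) + 1 / (c - \<beta> - 2)) * \<delta> powr (\<beta> + 2 - c))"
proof -
  let ?h = "\<lambda>q. ennreal (q powr \<beta> * (\<delta> + q) powr (1 - c)) * indicator {0<..<1} q"
  have "(\<integral>\<^sup>+s. ennreal ((1 - s) powr \<beta> * (\<delta> + (1 - s)) powr (1 - c)) * indicator {0<..<1} s \<partial>lborel) = (\<integral>\<^sup>+s. ?h (1 + - s) \<partial>lborel)"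
    by (intro nn_integral_cong) (auto simp: indicator_def)
  also have "\<dots> = (\<integral>\<^sup>+s. ?h (1 + s) \<partial>lborel)"
    by (rule nn_integral_lborel_uminus[where f="\<lambda>s. ?h (1 + s)"]) measurable
  also have "\<dots> = (\<integral>\<^sup>+q. ?h q \<partial>lborel)" by (rule nn_integral_lborel_plus) measurable
  also have "\<dots> \<le> (\<integral>\<^sup>+q. ennreal (\<delta> powr (1 - c)) * (ennreal (q powr \<beta>) * indicator {0..\<delta>} q)
       + ennreal ((\<delta> + (- \<delta> + q)) powr (- (c - \<beta> - 1))) * indicator {0..} (- \<delta> + q) \<partial>lborel)"
  proof (rule nn_integral_mono)
    fix q :: real
    consider "q \<le> 0" | "0 < q" "q \<le> \<delta>" | "\<delta> < q" "0 < q" using \<delta> by linarith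
    then show "?h q \<le> ennreal (\<delta> powr (1 - c)) * (ennreal (q powr \<beta>) * indicator {0..\<delta>} q)
       + ennreal ((\<delta> + (- \<delta> + q)) powr (- (c - \<beta> - 1))) * indicator {0..} (- \<delta> + q)"
    proof cases
      case 2
      have "(\<delta> + q) powr (1 - c) \<le> \<delta> powr (1 - c)" using 2 \<delta> \<beta> by (intro powr_mono2') auto
      then have "q powr \<beta> * (\<delta> + q) powr (1 - c) \<le> \<delta> powr (1 - c) * q powr \<beta>"
        by (subst mult.commute) (intro mult_right_mono, auto)
      then have "ennreal (q powr \<beta> * (\<delta> + q) powr (1 - c)) \<le> ennreal (\<delta> powr (1 - c)) * ennreal (q powr \<beta>)"
        by (simp add: ennreal_mult[symmetric] ennreal_leI)
      then show ?thesis using 2 by (auto simp: indicator_def intro: add_increasing2)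
    next
      case 3
      have "(\<delta> + q) powr (1 - c) \<le> q powr (1 - c)" using 3 \<delta> \<beta> by (intro powr_mono2') auto
      then have "q powr \<beta> * (\<delta> + q) powr (1 - c) \<le> q powr \<beta> * q powr (1 - c)"
        by (intro mult_left_mono) auto
      also have "\<dots> = q powr (- (c - \<beta> - 1))" by (simp add: powr_add[symmetric] algebra_simps)
      finally have "ennreal (q powr \<beta> * (\<delta> + q) powr (1 - c)) \<le> ennreal (q powr (- (c - \<beta> - 1)))" by (rule ennreal_leI)
      then show ?thesis using 3 by (auto simp: indicator_def)
    qed auto
  qed
  also have "\<dots> = (\<integral>\<^sup>+q. ennreal (\<delta> powr (1 - c)) * (ennreal (q powr \<beta>) * indicator {0..\<delta>} q) \<partial>lborel)
     + (\<integral>\<^sup>+q. ennreal ((\<delta> + (- \<delta> + q)) powr (- (c - \<beta> - 1))) * indicator {0..} (- \<delta> + q) \<partial>lborel)"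
    by (rule nn_integral_add) measurable
  also have "(\<integral>\<^sup>+q. ennreal (\<delta> powr (1 - c)) * (ennreal (q powr \<beta>) * indicator {0..\<delta>} q) \<partial>lborel) = ennreal (\<delta> powr (1 - c)) * ennreal (\<delta> powr (\<beta> + 1) / (\<beta> + 1))"
    using \<beta> \<delta> by (subst nn_integral_cmult) (auto simp: nn_integral_powr_0)
  also have "(\<integral>\<^sup>+q. ennreal ((\<delta> + (- \<delta> + q)) powr (- (c - \<beta> - 1))) * indicator {0..} (- \<delta> + q) \<partial>lborel)
     = (\<integral>\<^sup>+q. ennreal ((\<delta> + q) powr (- (c - \<beta> - 1))) * indicator {0..} q \<partial>lborel)"
    by (rule nn_integral_lborel_plus[where f="\<lambda>q. ennreal ((\<delta> + q) powr (- (c - \<beta> - 1))) * indicator {0..} q"]) measurable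
  also have "\<dots> = ennreal (\<delta> powr (1 - (c - \<beta> - 1)) / (c - \<beta> - 1 - 1))"
    using \<beta> \<delta> by (intro nn_integral_powr_tail) auto
  also have "ennreal (\<delta> powr (1 - c)) * ennreal (\<delta> powr (\<beta> + 1) / (\<beta> + 1)) = ennreal (\<delta> powr (\<beta> + 2 - c) / (\<beta> + 1))"
    using \<beta> by (subst ennreal_mult[symmetric]) (auto simp: powr_add[symmetric] algebra_simps)
  also have "\<delta> powr (1 - (c - \<beta> - 1)) / (c - \<beta> - 1 - 1) = \<delta> powr (\<beta> + 2 - c) / (c - \<beta> - 2)"
    by (simp add: algebra_simps)
  also have "ennreal (\<delta> powr (\<beta> + 2 - c) / (\<beta> + 1)) + ennreal (\<delta> powr (\<beta> + 2 - c) / (c - \<beta> - 2))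
      = ennreal ((1 / (\<beta> + 1) + 1 / (c - \<beta> - 2)) * \<delta> powr (\<beta> + 2 - c))"
    using \<beta> by (subst ennreal_plus[symmetric]) (auto simp: algebra_simps)
  finally show ?thesis .
qed

lemma half_powr: "(1 / 2) powr e = 2 powr (- e)" for e :: real
  by (subst powr_divide) (auto simp: powr_minus_divide)

text \<open>The classical disc estimate with an extra weight |y|^\<tau> at the centre, as produced
  by the change of variables on the triangle. The weights do not interact: for squared radius at
  most 1/2 the boundary factors are bounded, and beyond 1/2 the factor |y|^\<tau> is.\<close>

lemma Forelli_Rudin:
  fixes \<beta> \<tau> c :: real
  assumes \<beta>: "-1 < \<beta>" "\<beta> + 2 < c" and \<tau>: "-2 < \<tau>"
  obtains C where "0 \<le> C" "\<And>x::complex. norm x < 1 \<Longrightarrow>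
    (\<integral>\<^sup>+y. ennreal ((1 - (norm y)\<^sup>2) powr \<beta> * norm y powr \<tau> / norm (1 - x * cnj y) powr c) * indicator (ball 0 1) y \<partial>lborel)
     \<le> ennreal (C * (1 - (norm x)\<^sup>2) powr (\<beta> + 2 - c))"
proof -
  define K0 where "K0 = 8 powr c * (2 / (c - 1)) * 4 powr (c - 1) / (2 * pi)"
  define K1 where "K1 = max 1 (2 powr (- \<beta>)) * (1/2) powr (1 - c)"
  define K2 where "K2 = max 1 (2 powr (- \<tau> / 2))"
  define K3 where "K3 = 1 / (\<beta> + 1) + 1 / (c - \<beta> - 2)"
  define C where "C = pi * K0 * (K1 * (1 / (\<tau>/2 + 1)) + K2 * K3) * 2 powr (c - \<beta> - 2)"
  have c1: "1 < c" using \<beta> by simp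
  have K: "0 \<le> K0" "0 \<le> K1" "0 \<le> K2" "0 \<le> K3" using c1 \<beta> by (auto simp: K0_def K1_def K2_def K3_def)
  show thesis
  proof (rule that[of C])
    show "0 \<le> C" using K \<tau> by (simp add: C_def)
    fix x :: complex assume x: "norm x < 1"
    let ?\<delta> = "1 - norm x"
    have \<delta>: "0 < ?\<delta>" "?\<delta> \<le> 1" using x by auto
    let ?f = "\<lambda>y. ennreal ((1 - (norm y)\<^sup>2) powr \<beta> * norm y powr \<tau> / norm (1 - x * cnj y) powr c)"
    \<comment> \<open>The first summand covers squared radii up to 1/2, the second those
      beyond.\<close>
    let ?h = "\<lambda>s. K1 * s powr (\<tau>/2) + K2 * ((1 - s) powr \<beta> * (?\<delta> + (1 - s)) powr (1 - c))"
    have mean: "circle_mean ?f s \<le> ennreal (K0 * ?h s)" if s: "0 < s" "s < 1" for s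
    proof -
      let ?r = "sqrt s" and ?\<rho> = "norm x * sqrt s"
      let ?w = "(1 - s) powr \<beta> * s powr (\<tau>/2)"
      have r: "0 < ?r" "?r < 1" "s \<le> ?r" using s by (auto simp: real_le_rsqrt power2_eq_square mult_left_le)
      have \<rho>: "0 \<le> ?\<rho>" "?\<rho> < 1" using x r mult_strict_mono'[of "norm x" 1 ?r 1] by auto
      have f: "?f (complex_of_real ?r * cis t) = ennreal ?w * ennreal (1 / norm (1 - complex_of_real ?\<rho> * cis (t + Arg (cnj x))) powr c)" for t
      proof -
        have "cnj x = complex_of_real (norm x) * cis (Arg (cnj x))"
          using rcis_cmod_Arg[of "cnj x"] by (simp add: rcis_def)
        then have e: "complex_of_real ?\<rho> * cis (t + Arg (cnj x)) = cnj (x * cnj (complex_of_real ?r * cis t))"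
          by (simp add: cis_mult[symmetric] mult_ac)
        have "norm (1 - x * cnj (complex_of_real ?r * cis t)) = norm (cnj (1 - x * cnj (complex_of_real ?r * cis t)))"
          by (simp only: complex_mod_cnj)
        then have n: "norm (1 - x * cnj (complex_of_real ?r * cis t)) = norm (1 - complex_of_real ?\<rho> * cis (t + Arg (cnj x)))"
          unfolding e by simp
        have "norm (complex_of_real ?r * cis t) = ?r" using r by (simp add: norm_mult)
        moreover have "?r powr \<tau> = s powr (\<tau>/2)" using s by (simp add: powr_half_sqrt[symmetric] powr_powr)
        moreover have "?r\<^sup>2 = s" using s by simp
        ultimately show ?thesis unfolding n by (simp only:) (simp add: ennreal_mult[symmetric])
      qed
      have "circle_mean ?f s = ennreal (1/(2*pi)) * (\<integral>\<^sup>+t. ennreal ?w * (ennreal (1 / norm (1 - complex_of_real ?\<rho> * cis (t + Arg (cnj x))) powr c) * indicator {0..<2*pi} t) \<partial>lborel)"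
        unfolding circle_mean_def f by (simp only: mult.assoc)
      also have "\<dots> = ennreal (1/(2*pi)) * (ennreal ?w * (\<integral>\<^sup>+t. ennreal (1 / norm (1 - complex_of_real ?\<rho> * cis (t + Arg (cnj x))) powr c) * indicator {0..<2*pi} t \<partial>lborel))"
        by (subst nn_integral_cmult) auto
      also have "\<dots> \<le> ennreal (1/(2*pi)) * (ennreal ?w * ennreal (8 powr c * (2 / (c - 1)) * (1 - ?\<rho>) powr (1 - c)))"
        by (intro mult_left_mono circle_kernel_integral_le c1 \<rho>) auto
      also have "\<dots> = ennreal (1/(2*pi) * (?w * (8 powr c * (2 / (c - 1)) * (1 - ?\<rho>) powr (1 - c))))"
        using c1 by (simp only: ennreal_mult[symmetric] mult_nonneg_nonneg powr_ge_zero divide_nonneg_pos)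
           (auto simp: ennreal_mult[symmetric])
      also have "\<dots> \<le> ennreal (K0 * ?h s)"
      proof (rule ennreal_leI)
        \<comment> \<open>The product \<rho> = |x| sqrt s is below both of its factors, so 1 -
          \<rho> dominates 1 - |x| as well as 1 - sqrt s, which is at least (1 - s)/2.\<close>
        have "(?\<delta> + (1 - s)) / 4 \<le> 1 - ?\<rho>"
        proof -
          have "?\<rho> \<le> norm x" using r by (simp add: mult_left_le)
          moreover have "?\<rho> \<le> ?r" using x r by (simp add: mult_left_le_one_le)
          moreover have "1 - s \<le> 2 * (1 - ?r)"
          proof -
            have "0 \<le> (1 - ?r)\<^sup>2" by simp
            then show ?thesis using s by (simp add: power2_diff)
          qed
          moreover have "(1 - X + (1 - s)) / 4 \<le> 1 - R" if "R \<le> X" "R \<le> r" "1 - s \<le> 2 * (1 - r)" "0 < 1 - X" for R X r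
          proof -
            have "1 - X \<le> 1 - R" "1 - s \<le> 2 * (1 - R)" "0 \<le> 1 - R" using that by simp_all
            then have "1 - X + (1 - s) \<le> 4 * (1 - R)" by simp
            then show ?thesis by simp
          qed
          ultimately show ?thesis using \<delta>(1) by blast
        qed
        then have "(1 - ?\<rho>) powr (1 - c) \<le> ((?\<delta> + (1 - s)) / 4) powr (1 - c)"
          using c1 s \<delta> by (intro powr_mono2') auto
        also have "\<dots> = 4 powr (c - 1) * (?\<delta> + (1 - s)) powr (1 - c)"
          using s \<delta> powr_minus[of 4 "c - 1"] by (subst powr_divide) (auto simp: field_simps)
        finally have "1/(2*pi) * (?w * (8 powr c * (2 / (c - 1)) * (1 - ?\<rho>) powr (1 - c)))
           \<le> 1/(2*pi) * (?w * (8 powr c * (2 / (c - 1)) * (4 powr (c - 1) * (?\<delta> + (1 - s)) powr (1 - c))))"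
          using c1 by (intro mult_left_mono) auto
        also have "\<dots> = K0 * (?w * (?\<delta> + (1 - s)) powr (1 - c))"
          unfolding K0_def by (simp only: mult_ac times_divide_eq_left times_divide_eq_right divide_divide_eq_left mult_1_left mult_1_right)
        also have "?w * (?\<delta> + (1 - s)) powr (1 - c) \<le> ?h s"
        proof (cases "s \<le> 1/2")
          case True
          have "(1 - s) powr \<beta> \<le> max 1 (2 powr (- \<beta>))"
          proof (cases "0 \<le> \<beta>")
            case True
            then have "(1 - s) powr \<beta> \<le> 1" using s by (intro powr_le1) auto
            then show ?thesis by simp
          next
            case False
            then have "(1 - s) powr \<beta> \<le> (1/2) powr \<beta>" using True \<open>s \<le> 1/2\<close> by (intro powr_mono2') auto
            also have "\<dots> = 2 powr (- \<beta>)" by (rule half_powr)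
            finally show ?thesis by simp
          qed
          moreover have "(?\<delta> + (1 - s)) powr (1 - c) \<le> (1/2) powr (1 - c)"
            using c1 True \<delta> by (intro powr_mono2') auto
          ultimately have "(1 - s) powr \<beta> * (?\<delta> + (1 - s)) powr (1 - c) \<le> K1"
            unfolding K1_def by (intro mult_mono) auto
          then have "s powr (\<tau>/2) * ((1 - s) powr \<beta> * (?\<delta> + (1 - s)) powr (1 - c)) \<le> s powr (\<tau>/2) * K1"
            by (intro mult_left_mono) auto
          moreover have "0 \<le> K2 * ((1 - s) powr \<beta> * (?\<delta> + (1 - s)) powr (1 - c))" using K by simp
          ultimately show ?thesis by (simp only: mult_ac)
        next
          case False
          have "s powr (\<tau>/2) \<le> K2"
          proof (cases "0 \<le> \<tau>")
            case True
            then have "s powr (\<tau>/2) \<le> 1" using s by (intro powr_le1) auto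
            then show ?thesis by (simp add: K2_def)
          next
            case False
            then have "s powr (\<tau>/2) \<le> (1/2) powr (\<tau>/2)" using \<open>\<not> s \<le> 1/2\<close> by (intro powr_mono2') auto
            also have "\<dots> = 2 powr (- \<tau> / 2)" using half_powr[of "\<tau>/2"] by simp
            finally show ?thesis by (simp add: K2_def)
          qed
          then have "s powr (\<tau>/2) * ((1 - s) powr \<beta> * (?\<delta> + (1 - s)) powr (1 - c)) \<le> K2 * ((1 - s) powr \<beta> * (?\<delta> + (1 - s)) powr (1 - c))"
            by (intro mult_right_mono) auto
          moreover have "0 \<le> K1 * s powr (\<tau>/2)" using K by simp
          ultimately show ?thesis by (simp only: mult_ac)
        qed
        finally show "1/(2*pi) * (?w * (8 powr c * (2 / (c - 1)) * (1 - ?\<rho>) powr (1 - c))) \<le> K0 * ?h s"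
          using K by (simp add: mult_left_mono)
      qed
      finally show ?thesis .
    qed
    have "(\<integral>\<^sup>+y. ?f y * indicator (ball 0 1) y \<partial>lborel) = ennreal pi * (\<integral>\<^sup>+s. circle_mean ?f s * indicator {0<..<1} s \<partial>lborel)"
      by (rule nn_integral_disc_polar) measurable
    also have "\<dots> \<le> ennreal pi * (\<integral>\<^sup>+s. ennreal (K0 * K1) * (ennreal (s powr (\<tau>/2)) * indicator {0..1} s)
        + ennreal (K0 * K2) * (ennreal ((1 - s) powr \<beta> * (?\<delta> + (1 - s)) powr (1 - c)) * indicator {0<..<1} s) \<partial>lborel)"
    proof (intro mult_left_mono nn_integral_mono)
      fix s :: real
      show "circle_mean ?f s * indicator {0<..<1} s \<le> ennreal (K0 * K1) * (ennreal (s powr (\<tau>/2)) * indicator {0..1} s)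
        + ennreal (K0 * K2) * (ennreal ((1 - s) powr \<beta> * (?\<delta> + (1 - s)) powr (1 - c)) * indicator {0<..<1} s)"
      proof (cases "s \<in> {0<..<1}")
        case True
        then have "circle_mean ?f s \<le> ennreal (K0 * ?h s)" by (intro mean) auto
        also have "K0 * ?h s = K0 * K1 * s powr (\<tau>/2) + K0 * K2 * ((1 - s) powr \<beta> * (?\<delta> + (1 - s)) powr (1 - c))"
          by (simp add: algebra_simps)
        also have "ennreal \<dots> = ennreal (K0 * K1) * ennreal (s powr (\<tau>/2)) + ennreal (K0 * K2) * ennreal ((1 - s) powr \<beta> * (?\<delta> + (1 - s)) powr (1 - c))"
          using K by (simp add: ennreal_mult)
        finally show ?thesis using True by simp
      qed simp
    qed simp
    also have "\<dots> = ennreal pi * (ennreal (K0 * K1) * (\<integral>\<^sup>+s. ennreal (s powr (\<tau>/2)) * indicator {0..1} s \<partial>lborel)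
        + ennreal (K0 * K2) * (\<integral>\<^sup>+s. ennreal ((1 - s) powr \<beta> * (?\<delta> + (1 - s)) powr (1 - c)) * indicator {0<..<1} s \<partial>lborel))"
      by (subst nn_integral_add) (auto simp: nn_integral_cmult)
    also have "\<dots> \<le> ennreal pi * (ennreal (K0 * K1) * ennreal (1 powr (\<tau>/2 + 1) / (\<tau>/2 + 1)) + ennreal (K0 * K2) * ennreal (K3 * ?\<delta> powr (\<beta> + 2 - c)))"
      unfolding K3_def using \<tau> \<beta> \<delta>
      by (intro mult_left_mono add_mono nn_integral_radial_kernel eq_refl[OF nn_integral_powr_0]) auto
    also have "\<dots> = ennreal (pi * (K0 * K1 * (1 / (\<tau>/2 + 1)) + K0 * K2 * (K3 * ?\<delta> powr (\<beta> + 2 - c))))"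
      using K \<tau> by (simp add: ennreal_mult[symmetric] ennreal_plus[symmetric] del: ennreal_plus)
    also have "\<dots> \<le> ennreal (C * (1 - (norm x)\<^sup>2) powr (\<beta> + 2 - c))"
    proof (rule ennreal_leI)
      let ?g = "\<beta> + 2 - c"
      \<comment> \<open>The exponent is negative and \<open>?\<delta>\<close> is at most 1, so the
        constant contribution of the inner half is absorbed into the boundary term.\<close>
      have d1: "1 \<le> ?\<delta> powr ?g"
        using powr_mono2'[of ?g ?\<delta> 1] \<beta> \<delta> by simp
      have "1 - (norm x)\<^sup>2 \<le> 2 * ?\<delta>"
      proof -
        have "0 \<le> (1 - norm x)\<^sup>2" by simp
        then show ?thesis by (simp add: power2_diff)
      qed
      moreover have "0 < 1 - (norm x)\<^sup>2" using x by (simp add: abs_square_less_1)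
      ultimately have "(2 * ?\<delta>) powr ?g \<le> (1 - (norm x)\<^sup>2) powr ?g" using \<beta> by (intro powr_mono2') auto
      then have "2 powr (c - \<beta> - 2) * (2 powr ?g * ?\<delta> powr ?g) \<le> 2 powr (c - \<beta> - 2) * (1 - (norm x)\<^sup>2) powr ?g"
        using \<delta> by (subst powr_mult[symmetric]) (auto intro: mult_left_mono)
      moreover have "2 powr (c - \<beta> - 2) * (2 powr ?g * ?\<delta> powr ?g) = ?\<delta> powr ?g"
        by (simp add: mult.assoc[symmetric] powr_add[symmetric])
      ultimately have d2: "?\<delta> powr ?g \<le> 2 powr (c - \<beta> - 2) * (1 - (norm x)\<^sup>2) powr ?g" by simp
      have "pi * (K0 * K1 * (1 / (\<tau>/2 + 1)) + K0 * K2 * (K3 * ?\<delta> powr ?g)) \<le> pi * (K0 * K1 * (1 / (\<tau>/2 + 1)) * ?\<delta> powr ?g + K0 * K2 * (K3 * ?\<delta> powr ?g))"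
      proof -
        have "0 \<le> K0 * K1 * (1 / (\<tau>/2 + 1))" using K \<tau> by simp
        from mult_left_mono[OF d1 this] show ?thesis by (intro mult_left_mono add_right_mono) simp_all
      qed
      also have "\<dots> = pi * K0 * (K1 * (1 / (\<tau>/2 + 1)) + K2 * K3) * ?\<delta> powr ?g" by (simp add: algebra_simps)
      also have "\<dots> \<le> pi * K0 * (K1 * (1 / (\<tau>/2 + 1)) + K2 * K3) * (2 powr (c - \<beta> - 2) * (1 - (norm x)\<^sup>2) powr ?g)"
        using K \<tau> by (intro mult_left_mono d2) auto
      finally show "pi * (K0 * K1 * (1 / (\<tau>/2 + 1)) + K0 * K2 * (K3 * ?\<delta> powr ?g)) \<le> C * (1 - (norm x)\<^sup>2) powr ?g"
        by (simp add: C_def mult.assoc)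
    qed
    finally show "(\<integral>\<^sup>+y. ?f y * indicator (ball 0 1) y \<partial>lborel) \<le> ennreal (C * (1 - (norm x)\<^sup>2) powr (\<beta> + 2 - c))" .
  qed
qed

section \<open>Sufficiency\<close>

text \<open>On the cover the integrand splits, with x^m and l^m as arguments. In l the weight
  supplies the Jacobian m |l|^(2(m-1)) of the power map and leaves |l|^(2n) = |y|^(2n/m). In x there
  is no such Jacobian, so its inverse |y|^(2/m - 2) / m appears.\<close>

lemma nn_integral_hartogs_product:
  assumes f[measurable]: "f \<in> borel_measurable borel" and g[measurable]: "g \<in> borel_measurable borel"
    and m: "0 < m" and n: "0 < n"
  shows "(\<integral>\<^sup>+z. f (hbase m n z) * g (snd z) * indicator (hartogs m n) z \<partial>lborel)
    = ennreal (1 / real m) * (\<integral>\<^sup>+y. f y * ennreal (norm y powr (2 / real m - 2)) * indicator (ball 0 1) y \<partial>lborel)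
       * (\<integral>\<^sup>+y. g y * ennreal (norm y powr (2 * real n / real m)) * indicator (ball 0 1) y \<partial>lborel)"
proof -
  let ?D = "\<lambda>y::complex. indicator (ball 0 1) y :: ennreal"
  have nz: "AE l in lborel. l \<noteq> (0::complex)" by (rule AE_lborel_singleton)
  have [measurable]: "(\<lambda>z. f (hbase m n z)) \<in> borel_measurable borel" "(\<lambda>z. g (snd z :: complex) :: ennreal) \<in> borel_measurable (borel :: (complex \<times> complex) measure)"
    by (rule measurable_compose[OF hbase_measurable f]) measurable
  have wm: "(\<lambda>x::complex \<times> complex. f (fst x ^ m) * (ennreal (real m * norm (snd x) ^ (2 * (m + n - 1))) * g (snd x ^ m))) \<in> borel_measurable borel"
    unfolding borel_prod[symmetric] by measurable
  have "(\<integral>\<^sup>+z. f (hbase m n z) * g (snd z) * indicator (hartogs m n) z \<partial>lborel)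
    = (\<integral>\<^sup>+x. ennreal (real m * norm (snd x) ^ (2 * (m + n - 1))) * (f (hbase m n (hmap m n x)) * g (snd (hmap m n x))) * indicator bidisc x \<partial>lborel)"
    by (rule nn_integral_hartogs[OF _ m n]) measurable
  also have "\<dots> = (\<integral>\<^sup>+x. (f (fst x ^ m) * (ennreal (real m * norm (snd x) ^ (2 * (m + n - 1))) * g (snd x ^ m))) * indicator bidisc x \<partial>lborel)"
  proof (rule nn_integral_cong)
    fix x :: "complex \<times> complex"
    show "ennreal (real m * norm (snd x) ^ (2 * (m + n - 1))) * (f (hbase m n (hmap m n x)) * g (snd (hmap m n x))) * indicator bidisc x
      = (f (fst x ^ m) * (ennreal (real m * norm (snd x) ^ (2 * (m + n - 1))) * g (snd x ^ m))) * indicator bidisc x"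
    proof (cases "snd x = 0")
      case True
      then have "norm (snd x) ^ (2 * (m + n - 1)) = 0" using m n by (simp add: zero_power)
      then have z: "ennreal (real m * norm (snd x) ^ (2 * (m + n - 1))) = 0" by simp
      show ?thesis unfolding z by simp
    next
      case False
      then have "hbase m n (hmap m n x) = fst x ^ m" using hbase_hmap[OF m, of "snd x" n "fst x"] by simp
      moreover have "snd (hmap m n x) = snd x ^ m" by (simp add: hmap_def)
      ultimately show ?thesis by (simp add: mult_ac)
    qed
  qed
  also have "\<dots> = (\<integral>\<^sup>+l. \<integral>\<^sup>+x. (f (x ^ m) * (ennreal (real m * norm l ^ (2 * (m + n - 1))) * g (l ^ m))) * indicator bidisc (x, l) \<partial>lborel \<partial>lborel)"
    using nn_integral_lborel_pair(1)[of "\<lambda>x. (f (fst x ^ m) * (ennreal (real m * norm (snd x) ^ (2 * (m + n - 1))) * g (snd x ^ m))) * indicator bidisc x"]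
      borel_measurable_times_ennreal[OF wm borel_measurable_indicator[OF bidisc_measurable]] by simp
  also have "\<dots> = (\<integral>\<^sup>+l. (\<integral>\<^sup>+x. f (x ^ m) * ?D x \<partial>lborel) * (ennreal (real m * norm l ^ (2 * (m + n - 1))) * g (l ^ m) * ?D l) \<partial>lborel)"
  proof (rule nn_integral_cong)
    fix l :: complex
    have "(\<integral>\<^sup>+x. (f (x ^ m) * (ennreal (real m * norm l ^ (2 * (m + n - 1))) * g (l ^ m))) * indicator bidisc (x, l) \<partial>lborel)
      = (\<integral>\<^sup>+x. (f (x ^ m) * ?D x) * (ennreal (real m * norm l ^ (2 * (m + n - 1))) * g (l ^ m) * ?D l) \<partial>lborel)"
      by (simp only: indicator_bidisc mult_ac)
    also have "\<dots> = (\<integral>\<^sup>+x. f (x ^ m) * ?D x \<partial>lborel) * (ennreal (real m * norm l ^ (2 * (m + n - 1))) * g (l ^ m) * ?D l)"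
      by (rule nn_integral_multc) measurable
    finally show "(\<integral>\<^sup>+x. (f (x ^ m) * (ennreal (real m * norm l ^ (2 * (m + n - 1))) * g (l ^ m))) * indicator bidisc (x, l) \<partial>lborel)
      = (\<integral>\<^sup>+x. f (x ^ m) * ?D x \<partial>lborel) * (ennreal (real m * norm l ^ (2 * (m + n - 1))) * g (l ^ m) * ?D l)" .
  qed
  also have "\<dots> = (\<integral>\<^sup>+x. f (x ^ m) * ?D x \<partial>lborel) * (\<integral>\<^sup>+l. ennreal (real m * norm l ^ (2 * (m + n - 1))) * g (l ^ m) * ?D l \<partial>lborel)"
    by (rule nn_integral_cmult) measurable
  also have "(\<integral>\<^sup>+x. f (x ^ m) * ?D x \<partial>lborel) = ennreal (1 / real m) * (\<integral>\<^sup>+y. f y * ennreal (norm y powr (2 / real m - 2)) * ?D y \<partial>lborel)"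
  proof -
    have "(\<integral>\<^sup>+y. f y * ennreal (norm y powr (2 / real m - 2)) * ?D y \<partial>lborel)
      = (\<integral>\<^sup>+x. ennreal (real m * norm x ^ (2 * (m - 1))) * (f (x ^ m) * ennreal (norm (x ^ m) powr (2 / real m - 2))) * ?D x \<partial>lborel)"
      by (rule nn_integral_disc_power[OF _ m]) measurable
    also have "\<dots> = (\<integral>\<^sup>+x. ennreal (real m) * (f (x ^ m) * ?D x) \<partial>lborel)"
    proof (rule nn_integral_cong_AE, use nz in eventually_elim)
      fix x :: complex assume x: "x \<noteq> 0"
      have "norm (x ^ m) powr (2 / real m - 2) = (norm x powr real m) powr (2 / real m - 2)"
        using x by (simp add: norm_power powr_realpow)
      also have "\<dots> = norm x powr (- real (2 * (m - 1)))"
        using m by (simp add: powr_powr of_nat_diff algebra_simps)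
      also have "\<dots> = 1 / norm x ^ (2 * (m - 1))"
      proof -
        have "norm x powr real (2 * (m - 1)) = norm x ^ (2 * (m - 1))" using x by (intro powr_realpow) simp
        then show ?thesis by (simp only: powr_minus divide_inverse mult_1_left)
      qed
      finally have "norm x ^ (2 * (m - 1)) * norm (x ^ m) powr (2 / real m - 2) = 1" using x by simp
      then have "ennreal (real m * norm x ^ (2 * (m - 1))) * ennreal (norm (x ^ m) powr (2 / real m - 2)) = ennreal (real m)"
        by (simp add: ennreal_mult[symmetric] mult.assoc)
      moreover have "ennreal (real m * norm x ^ (2 * (m - 1))) * (f (x ^ m) * ennreal (norm (x ^ m) powr (2 / real m - 2))) * ?D x
         = (ennreal (real m * norm x ^ (2 * (m - 1))) * ennreal (norm (x ^ m) powr (2 / real m - 2))) * (f (x ^ m) * ?D x)"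
        by (simp only: mult_ac)
      ultimately show "ennreal (real m * norm x ^ (2 * (m - 1))) * (f (x ^ m) * ennreal (norm (x ^ m) powr (2 / real m - 2))) * ?D x = ennreal (real m) * (f (x ^ m) * ?D x)"
        by (simp only:)
    qed
    also have "\<dots> = ennreal (real m) * (\<integral>\<^sup>+x. f (x ^ m) * ?D x \<partial>lborel)" by (rule nn_integral_cmult) measurable
    finally have "ennreal (1 / real m) * (\<integral>\<^sup>+y. f y * ennreal (norm y powr (2 / real m - 2)) * ?D y \<partial>lborel) = (ennreal (1 / real m) * ennreal (real m)) * (\<integral>\<^sup>+x. f (x ^ m) * ?D x \<partial>lborel)"
      by (simp only: mult.assoc)
    also have "ennreal (1 / real m) * ennreal (real m) = 1" using m by (simp add: ennreal_mult'[symmetric])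
    finally show ?thesis by simp
  qed
  also have "(\<integral>\<^sup>+l. ennreal (real m * norm l ^ (2 * (m + n - 1))) * g (l ^ m) * ?D l \<partial>lborel)
     = (\<integral>\<^sup>+y. g y * ennreal (norm y powr (2 * real n / real m)) * ?D y \<partial>lborel)"
  proof -
    have "(\<integral>\<^sup>+y. g y * ennreal (norm y powr (2 * real n / real m)) * ?D y \<partial>lborel)
      = (\<integral>\<^sup>+x. ennreal (real m * norm x ^ (2 * (m - 1))) * (g (x ^ m) * ennreal (norm (x ^ m) powr (2 * real n / real m))) * ?D x \<partial>lborel)"
      by (rule nn_integral_disc_power[OF _ m]) measurable
    also have "\<dots> = (\<integral>\<^sup>+l. ennreal (real m * norm l ^ (2 * (m + n - 1))) * g (l ^ m) * ?D l \<partial>lborel)"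
    proof (rule nn_integral_cong_AE, use nz in eventually_elim)
      fix x :: complex assume x: "x \<noteq> 0"
      have "norm (x ^ m) powr (2 * real n / real m) = (norm x powr real m) powr (2 * real n / real m)"
        using x by (simp add: norm_power powr_realpow)
      also have "\<dots> = norm x powr real (2 * n)" using m by (simp add: powr_powr)
      also have "\<dots> = norm x ^ (2 * n)" using x by (intro powr_realpow) simp
      finally have "norm x ^ (2 * (m - 1)) * norm (x ^ m) powr (2 * real n / real m) = norm x ^ (2 * (m - 1) + 2 * n)"
        by (simp only: power_add)
      also have "2 * (m - 1) + 2 * n = 2 * (m + n - 1)" using m by simp
      finally have "ennreal (real m * norm x ^ (2 * (m - 1))) * ennreal (norm (x ^ m) powr (2 * real n / real m)) = ennreal (real m * norm x ^ (2 * (m + n - 1)))"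
        by (simp add: ennreal_mult[symmetric] mult.assoc)
      moreover have "ennreal (real m * norm x ^ (2 * (m - 1))) * (g (x ^ m) * ennreal (norm (x ^ m) powr (2 * real n / real m))) * ?D x
         = (ennreal (real m * norm x ^ (2 * (m - 1))) * ennreal (norm (x ^ m) powr (2 * real n / real m))) * g (x ^ m) * ?D x"
        by (simp only: mult_ac)
      ultimately show "ennreal (real m * norm x ^ (2 * (m - 1))) * (g (x ^ m) * ennreal (norm (x ^ m) powr (2 * real n / real m))) * ?D x
         = ennreal (real m * norm x ^ (2 * (m + n - 1))) * g (x ^ m) * ?D x"
        by (simp only:)
    qed
    finally show ?thesis by simp
  qed
  finally show ?thesis .
qed

text \<open>Write k f = (k^(1/p) f/h) (k^(1/q) h). Hoelder and \<open>s1\<close> bound the inner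
  integral to the power p by C^(p/q) h^p times the integral of k (f/h)^p; then Tonelli and
  \<open>s2\<close> yield a further factor C, and p/q + 1 = p.\<close>

lemma Schur_test:
  fixes k :: "'a \<Rightarrow> 'a \<Rightarrow> real" and h f :: "'a \<Rightarrow> real"
  assumes sf: "sigma_finite_measure M"
    and k[measurable]: "(\<lambda>(z, w). k z w) \<in> borel_measurable (M \<Otimes>\<^sub>M M)"
    and h[measurable]: "h \<in> borel_measurable M" and f[measurable]: "f \<in> borel_measurable M"
    and k0: "\<And>z w. 0 \<le> k z w" and h0: "\<And>z. 0 < h z" and f0: "\<And>z. 0 \<le> f z"
    and pq: "1 < p" "1 < q" "1/p + 1/q = 1" and C: "0 \<le> C"
    and s1: "\<And>z. (\<integral>\<^sup>+w. ennreal (k z w * h w powr q) \<partial>M) \<le> ennreal (C * h z powr q)"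
    and s2: "\<And>w. (\<integral>\<^sup>+z. ennreal (k z w * h z powr p) \<partial>M) \<le> ennreal (C * h w powr p)"
    and fin: "(\<integral>\<^sup>+w. ennreal (f w powr p) \<partial>M) < \<infinity>"
  shows "AE z in M. (\<integral>\<^sup>+w. ennreal (k z w * f w) \<partial>M) < \<infinity>"
    and "(\<integral>\<^sup>+z. ennreal (enn2real (\<integral>\<^sup>+w. ennreal (k z w * f w) \<partial>M) powr p) \<partial>M)
      \<le> ennreal (C powr p) * (\<integral>\<^sup>+w. ennreal (f w powr p) \<partial>M)"
proof -
  interpret sigma_finite_measure M by (rule sf)
  interpret P: pair_sigma_finite M M ..
  define T where "T z = (\<integral>\<^sup>+w. ennreal (k z w * (f w / h w) powr p) \<partial>M)" for z
  have Tm[measurable]: "T \<in> borel_measurable M" unfolding T_def by measurable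
  have "(\<integral>\<^sup>+z. ennreal (h z powr p) * T z \<partial>M) = (\<integral>\<^sup>+z. \<integral>\<^sup>+w. ennreal (h z powr p) * ennreal (k z w * (f w / h w) powr p) \<partial>M \<partial>M)"
    unfolding T_def by (intro nn_integral_cong nn_integral_cmult[symmetric]) measurable
  also have "\<dots> = (\<integral>\<^sup>+w. \<integral>\<^sup>+z. ennreal (h z powr p) * ennreal (k z w * (f w / h w) powr p) \<partial>M \<partial>M)"
    by (rule P.Fubini'[symmetric]) measurable
  also have "\<dots> = (\<integral>\<^sup>+w. \<integral>\<^sup>+z. ennreal ((f w / h w) powr p) * ennreal (k z w * h z powr p) \<partial>M \<partial>M)"
    using k0 by (intro nn_integral_cong) (simp add: ennreal_mult[symmetric] mult_ac)
  also have "\<dots> = (\<integral>\<^sup>+w. ennreal ((f w / h w) powr p) * (\<integral>\<^sup>+z. ennreal (k z w * h z powr p) \<partial>M) \<partial>M)"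
    by (intro nn_integral_cong nn_integral_cmult) measurable
  also have "\<dots> \<le> (\<integral>\<^sup>+w. ennreal ((f w / h w) powr p) * ennreal (C * h w powr p) \<partial>M)"
    by (intro nn_integral_mono mult_left_mono s2) simp
  also have "\<dots> = (\<integral>\<^sup>+w. ennreal C * ennreal (f w powr p) \<partial>M)"
  proof (rule nn_integral_cong)
    fix w
    have "(f w / h w) powr p * (C * h w powr p) = C * f w powr p"
      using h0[of w] f0[of w] by (simp add: powr_divide)
    then show "ennreal ((f w / h w) powr p) * ennreal (C * h w powr p) = ennreal C * ennreal (f w powr p)"
      using C by (simp add: ennreal_mult[symmetric])
  qed
  also have "\<dots> = ennreal C * (\<integral>\<^sup>+w. ennreal (f w powr p) \<partial>M)" by (rule nn_integral_cmult) measurable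
  finally have T1: "(\<integral>\<^sup>+z. ennreal (h z powr p) * T z \<partial>M) \<le> ennreal C * (\<integral>\<^sup>+w. ennreal (f w powr p) \<partial>M)" .
  have "(\<integral>\<^sup>+z. ennreal (h z powr p) * T z \<partial>M) < \<infinity>"
    using fin by (intro le_less_trans[OF T1]) (simp add: ennreal_mult_less_top)
  then have "AE z in M. ennreal (h z powr p) * T z \<noteq> \<infinity>" by (intro nn_integral_PInf_AE) auto
  \<comment> \<open>Finiteness for almost every z is what permits Hoelder pointwise and also gives
    the absolute convergence claimed first.\<close>
  then have Tfin: "AE z in M. T z < \<infinity>"
  proof eventually_elim
    case (elim z)
    then show ?case using h0[of z] by (auto simp: ennreal_mult_eq_top_iff less_top[symmetric] ennreal_eq_0_iff)
  qed
  have main: "(\<integral>\<^sup>+w. ennreal (k z w * f w) \<partial>M) < \<infinity> \<and>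
     ennreal (enn2real (\<integral>\<^sup>+w. ennreal (k z w * f w) \<partial>M) powr p) \<le> ennreal (C powr (p/q)) * (ennreal (h z powr p) * T z)"
    if z: "z \<in> space M" and T: "T z < \<infinity>" for z
  proof -
    obtain t where t: "T z = ennreal t" "0 \<le> t" using T by (cases "T z") auto
    have [measurable]: "k z \<in> borel_measurable M" using measurable_compose[OF measurable_Pair1'[OF z] k] by (simp add: o_def)
    let ?B = "C * h z powr q"
    have "(\<integral>\<^sup>+w. ennreal (k z w * f w) \<partial>M) = (\<integral>\<^sup>+w. ennreal ((k z w powr (1/p) * (f w / h w)) * (k z w powr (1/q) * h w)) \<partial>M)"
    proof (rule nn_integral_cong)
      fix w
      have "k z w powr (1/p) * k z w powr (1/q) = k z w" using pq k0 by (simp add: powr_add[symmetric])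
      then show "ennreal (k z w * f w) = ennreal ((k z w powr (1/p) * (f w / h w)) * (k z w powr (1/q) * h w))"
        using h0[of w] by (simp add: field_simps)
    qed
    also have "\<dots> \<le> ennreal (t powr (1/p) * ?B powr (1/q))"
    proof (rule nn_integral_Holder)
      show "(\<integral>\<^sup>+w. ennreal ((k z w powr (1/p) * (f w / h w)) powr p) \<partial>M) \<le> ennreal t"
        using k0 f0 h0 pq unfolding t(1)[symmetric] T_def
        by (intro eq_refl nn_integral_cong) (subst powr_mult, simp_all add: powr_powr less_imp_le)
      have "(\<integral>\<^sup>+w. ennreal ((k z w powr (1/q) * h w) powr q) \<partial>M) = (\<integral>\<^sup>+w. ennreal (k z w * h w powr q) \<partial>M)"
        using k0 h0 pq by (intro nn_integral_cong) (simp add: powr_mult powr_powr less_imp_le)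
      then show "(\<integral>\<^sup>+w. ennreal ((k z w powr (1/q) * h w) powr q) \<partial>M) \<le> ennreal ?B" using s1[of z] by simp
    qed (use pq t C f0 h0 k0 in \<open>auto simp: less_imp_le intro!: divide_nonneg_pos\<close>)
    finally have H: "(\<integral>\<^sup>+w. ennreal (k z w * f w) \<partial>M) \<le> ennreal (t powr (1/p) * ?B powr (1/q))" .
    then have "enn2real (\<integral>\<^sup>+w. ennreal (k z w * f w) \<partial>M) \<le> t powr (1/p) * ?B powr (1/q)"
      using enn2real_mono[OF H] by simp
    then have "enn2real (\<integral>\<^sup>+w. ennreal (k z w * f w) \<partial>M) powr p \<le> (t powr (1/p) * ?B powr (1/q)) powr p"
      using pq by (intro powr_mono2) auto
    also have "\<dots> = C powr (p/q) * (h z powr p * t)"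
      using pq C t h0[of z] by (simp add: powr_mult powr_powr)
    finally have "ennreal (enn2real (\<integral>\<^sup>+w. ennreal (k z w * f w) \<partial>M) powr p) \<le> ennreal (C powr (p/q) * (h z powr p * t))"
      by (rule ennreal_leI)
    also have "\<dots> = ennreal (C powr (p/q)) * (ennreal (h z powr p) * T z)"
      using t by (simp add: ennreal_mult)
    finally show ?thesis using le_less_trans[OF H] by simp
  qed
  show "AE z in M. (\<integral>\<^sup>+w. ennreal (k z w * f w) \<partial>M) < \<infinity>"
    using Tfin AE_space by eventually_elim (use main in blast)
  have "(\<integral>\<^sup>+z. ennreal (enn2real (\<integral>\<^sup>+w. ennreal (k z w * f w) \<partial>M) powr p) \<partial>M) \<le> (\<integral>\<^sup>+z. ennreal (C powr (p/q)) * (ennreal (h z powr p) * T z) \<partial>M)"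
    by (rule nn_integral_mono_AE, use Tfin AE_space in eventually_elim) (use main in blast)
  also have "\<dots> = ennreal (C powr (p/q)) * (\<integral>\<^sup>+z. ennreal (h z powr p) * T z \<partial>M)"
    by (rule nn_integral_cmult) measurable
  also have "\<dots> \<le> ennreal (C powr (p/q)) * (ennreal C * (\<integral>\<^sup>+w. ennreal (f w powr p) \<partial>M))"
    by (intro mult_left_mono T1) simp
  also have "\<dots> = ennreal (C powr (p/q) * C) * (\<integral>\<^sup>+w. ennreal (f w powr p) \<partial>M)"
    using C by (simp add: ennreal_mult mult.assoc)
  also have "C powr (p/q) * C = C powr p"
  proof -
    have "p / q + 1 = p"
    proof -
      have "p * (1/p + 1/q) = p" using pq by simp
      then show ?thesis using pq(1) by (simp add: distrib_left)
    qed
    then show ?thesis using C powr_add[of C "p/q" 1] by simp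
  qed
  finally show "(\<integral>\<^sup>+z. ennreal (enn2real (\<integral>\<^sup>+w. ennreal (k z w * f w) \<partial>M) powr p) \<partial>M)
      \<le> ennreal (C powr p) * (\<integral>\<^sup>+w. ennreal (f w powr p) \<partial>M)" .
qed

section \<open>Joint measurability of the kernel\<close>

lemma continuous_on_bk:
  assumes m: "0 < m" and n: "0 < n"
  shows "continuous_on (hartogs m n \<times> hartogs m n)
    (\<lambda>x. bk m n (fst (fst x) * cnj (fst (snd x))) (snd (fst x) * cnj (snd (snd x))))"
  unfolding bk_def case_prod_beta'
  using hk_denominator_nonzero[OF _ _ m n] m by (intro continuous_intros) auto

lemma hk_measurable_pair:
  assumes m: "0 < m" and n: "0 < n"
  shows "(\<lambda>x. hk m n (fst x) (snd x)) \<in> borel_measurable borel"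
proof -
  let ?S = "hartogs m n \<times> hartogs m n"
  have "(\<lambda>x. indicator ?S x *\<^sub>R bk m n (fst (fst x) * cnj (fst (snd x))) (snd (fst x) * cnj (snd (snd x)))) \<in> borel_measurable borel"
    by (intro borel_measurable_continuous_on_indicator continuous_on_bk[OF m n]) (simp add: open_Times open_hartogs)
  moreover have "(\<lambda>x. indicator ?S x *\<^sub>R bk m n (fst (fst x) * cnj (fst (snd x))) (snd (fst x) * cnj (snd (snd x)))) = (\<lambda>x. hk m n (fst x) (snd x))"
    by (auto simp: hk_def indicator_def)
  ultimately show ?thesis by simp
qed

lemma S_plus_kernel_measurable_pair:
  assumes m: "0 < m" and n: "0 < n"
  shows "(\<lambda>(z, w). S_plus_kernel m n a b c z w) \<in> borel_measurable (borel \<Otimes>\<^sub>M borel)"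
proof -
  note hm = hk_measurable_pair[OF m n]
  have dm: "(\<lambda>z. hk m n z z) \<in> borel_measurable borel"
  proof -
    have "(\<lambda>z::complex\<times>complex. (z, z)) \<in> borel_measurable borel" by (intro borel_measurable_continuous_onI continuous_intros)
    from measurable_compose[OF this hm] show ?thesis by simp
  qed
  have [measurable]: "(\<lambda>z. Re (hk m n z z)) \<in> borel_measurable borel"
    by (rule measurable_compose[OF dm]) simp
  have [measurable]: "(\<lambda>x. hk m n (fst x) (snd x)) \<in> borel_measurable (borel \<Otimes>\<^sub>M borel)"
    using hm by (simp add: borel_prod)
  show ?thesis
    unfolding S_plus_kernel_def bergman_kernel_hartogs[OF m n] case_prod_beta' by measurable
qed

lemma S_plus_kernel_measurable:
  assumes m: "0 < m" and n: "0 < n"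
  shows "(\<lambda>w. S_plus_kernel m n a b c z w) \<in> borel_measurable borel"
    and "(\<lambda>z. S_plus_kernel m n a b c z w) \<in> borel_measurable borel"
proof -
  note k = S_plus_kernel_measurable_pair[OF m n, of a b c]
  show "(\<lambda>w. S_plus_kernel m n a b c z w) \<in> borel_measurable borel"
    using measurable_compose[OF measurable_Pair1'[of z borel borel] k] by simp
  show "(\<lambda>z. S_plus_kernel m n a b c z w) \<in> borel_measurable borel"
    using measurable_compose[OF measurable_Pair2'[of w borel borel] k] by simp
qed

text \<open>The product formula turns the integral into two Forelli-Rudin integrals with central
  exponents 2/m - 2 and 2n/m - \<kappa>. The bound on \<kappa> says that the second exceeds -2, the
  threshold for integrability at the origin.\<close>

lemma hartogs_kernel_integral:
  assumes m: "0 < m" and n: "0 < n" and \<beta>: "-1 < \<beta>" "\<beta> + 2 < d" and \<kappa>: "\<kappa> < 2 * real n / real m + 2"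
  obtains C where "0 \<le> C" "\<And>z. z \<in> hartogs m n \<Longrightarrow>
    (\<integral>\<^sup>+w. ennreal (norm (snd w) powr (- \<kappa>) * hdist m n w powr \<beta>
        / (norm (1 - hbase m n z * cnj (hbase m n w)) powr d * norm (1 - snd z * cnj (snd w)) powr d)) * indicator (hartogs m n) w \<partial>lborel)
     \<le> ennreal (C * hdist m n z powr (\<beta> + 2 - d))"
proof -
  have \<tau>: "-2 < 2 / real m - 2" "-2 < 2 * real n / real m - \<kappa>" using m \<kappa> by auto
  obtain C1 where C1: "0 \<le> C1" "\<And>x::complex. norm x < 1 \<Longrightarrow>
    (\<integral>\<^sup>+y. ennreal ((1 - (norm y)\<^sup>2) powr \<beta> * norm y powr (2 / real m - 2) / norm (1 - x * cnj y) powr d) * indicator (ball 0 1) y \<partial>lborel)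
     \<le> ennreal (C1 * (1 - (norm x)\<^sup>2) powr (\<beta> + 2 - d))"
    by (rule Forelli_Rudin[OF \<beta> \<tau>(1)]) (rule that)
  obtain C2 where C2: "0 \<le> C2" "\<And>x::complex. norm x < 1 \<Longrightarrow>
    (\<integral>\<^sup>+y. ennreal ((1 - (norm y)\<^sup>2) powr \<beta> * norm y powr (2 * real n / real m - \<kappa>) / norm (1 - x * cnj y) powr d) * indicator (ball 0 1) y \<partial>lborel)
     \<le> ennreal (C2 * (1 - (norm x)\<^sup>2) powr (\<beta> + 2 - d))"
    by (rule Forelli_Rudin[OF \<beta> \<tau>(2)]) (rule that)
  show thesis
  proof (rule that[of "1 / real m * C1 * C2"])
    show "0 \<le> 1 / real m * C1 * C2" using C1(1) C2(1) by simp
    fix z assume z: "z \<in> hartogs m n"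
    let ?f = "\<lambda>y. ennreal ((1 - (norm y)\<^sup>2) powr \<beta> / norm (1 - hbase m n z * cnj y) powr d)"
    let ?g = "\<lambda>y. ennreal (norm y powr (- \<kappa>) * (1 - (norm y)\<^sup>2) powr \<beta> / norm (1 - snd z * cnj y) powr d)"
    have "(\<integral>\<^sup>+w. ennreal (norm (snd w) powr (- \<kappa>) * hdist m n w powr \<beta>
        / (norm (1 - hbase m n z * cnj (hbase m n w)) powr d * norm (1 - snd z * cnj (snd w)) powr d)) * indicator (hartogs m n) w \<partial>lborel)
      = (\<integral>\<^sup>+w. ?f (hbase m n w) * ?g (snd w) * indicator (hartogs m n) w \<partial>lborel)"
    proof (rule nn_integral_cong)
      fix w
      show "ennreal (norm (snd w) powr (- \<kappa>) * hdist m n w powr \<beta>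
        / (norm (1 - hbase m n z * cnj (hbase m n w)) powr d * norm (1 - snd z * cnj (snd w)) powr d)) * indicator (hartogs m n) w
        = ?f (hbase m n w) * ?g (snd w) * indicator (hartogs m n) w"
      proof (cases "w \<in> hartogs m n")
        case True
        then have "0 \<le> 1 - (norm (hbase m n w))\<^sup>2" "0 \<le> 1 - (norm (snd w))\<^sup>2"
          using norm_hbase_less[OF True m n] hartogs_snd[OF True n] by (auto simp: abs_square_le_1)
        then have "hdist m n w powr \<beta> = (1 - (norm (hbase m n w))\<^sup>2) powr \<beta> * (1 - (norm (snd w))\<^sup>2) powr \<beta>"
          unfolding hdist_def by (intro powr_mult)
        then show ?thesis by (simp add: ennreal_mult[symmetric] mult_ac)
      qed simp
    qed
    also have "\<dots> = ennreal (1 / real m) * (\<integral>\<^sup>+y. ?f y * ennreal (norm y powr (2 / real m - 2)) * indicator (ball 0 1) y \<partial>lborel)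
       * (\<integral>\<^sup>+y. ?g y * ennreal (norm y powr (2 * real n / real m)) * indicator (ball 0 1) y \<partial>lborel)"
      by (rule nn_integral_hartogs_product[OF _ _ m n]) measurable
    also have "(\<integral>\<^sup>+y. ?f y * ennreal (norm y powr (2 / real m - 2)) * indicator (ball 0 1) y \<partial>lborel)
       = (\<integral>\<^sup>+y. ennreal ((1 - (norm y)\<^sup>2) powr \<beta> * norm y powr (2 / real m - 2) / norm (1 - hbase m n z * cnj y) powr d) * indicator (ball 0 1) y \<partial>lborel)"
      by (intro nn_integral_cong) (simp add: ennreal_mult[symmetric])
    also have "(\<integral>\<^sup>+y. ?g y * ennreal (norm y powr (2 * real n / real m)) * indicator (ball 0 1) y \<partial>lborel)
       = (\<integral>\<^sup>+y. ennreal ((1 - (norm y)\<^sup>2) powr \<beta> * norm y powr (2 * real n / real m - \<kappa>) / norm (1 - snd z * cnj y) powr d) * indicator (ball 0 1) y \<partial>lborel)"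
    proof (rule nn_integral_cong)
      fix y :: complex
      have "norm y powr (2 * real n / real m - \<kappa>) = norm y powr (- \<kappa>) * norm y powr (2 * real n / real m)"
        by (simp add: powr_add[symmetric])
      then show "?g y * ennreal (norm y powr (2 * real n / real m)) * indicator (ball 0 1) y
         = ennreal ((1 - (norm y)\<^sup>2) powr \<beta> * norm y powr (2 * real n / real m - \<kappa>) / norm (1 - snd z * cnj y) powr d) * indicator (ball 0 1) y"
        by (simp add: ennreal_mult[symmetric] mult_ac)
    qed
    also have "ennreal (1 / real m) * (\<integral>\<^sup>+y. ennreal ((1 - (norm y)\<^sup>2) powr \<beta> * norm y powr (2 / real m - 2) / norm (1 - hbase m n z * cnj y) powr d) * indicator (ball 0 1) y \<partial>lborel) * \<dots>
      \<le> ennreal (1 / real m) * ennreal (C1 * (1 - (norm (hbase m n z))\<^sup>2) powr (\<beta> + 2 - d)) * ennreal (C2 * (1 - (norm (snd z))\<^sup>2) powr (\<beta> + 2 - d))"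
      by (intro mult_mono mult_left_mono C1(2) C2(2) norm_hbase_less[OF z m n] hartogs_snd[OF z n] zero_le)
    also have "\<dots> = ennreal (1 / real m * C1 * C2 * ((1 - (norm (hbase m n z))\<^sup>2) powr (\<beta> + 2 - d) * (1 - (norm (snd z))\<^sup>2) powr (\<beta> + 2 - d)))"
      using C1(1) C2(1) by (simp add: ennreal_mult[symmetric] mult_ac)
    also have "(1 - (norm (hbase m n z))\<^sup>2) powr (\<beta> + 2 - d) * (1 - (norm (snd z))\<^sup>2) powr (\<beta> + 2 - d) = hdist m n z powr (\<beta> + 2 - d)"
      unfolding hdist_def by (rule powr_mult[symmetric])
    finally show "(\<integral>\<^sup>+w. ennreal (norm (snd w) powr (- \<kappa>) * hdist m n w powr \<beta>
        / (norm (1 - hbase m n z * cnj (hbase m n w)) powr d * norm (1 - snd z * cnj (snd w)) powr d)) * indicator (hartogs m n) w \<partial>lborel)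
     \<le> ennreal (1 / real m * C1 * C2 * hdist m n z powr (\<beta> + 2 - d))" .
  qed
qed

lemma hdist_measurable[measurable]: "hdist m n \<in> borel_measurable borel"
  unfolding hdist_def hbase_def borel_prod[symmetric] by measurable

text \<open>The Schur weight is \<open>(d\<^sub>1 d\<^sub>2)\<^sup>-\<^sup>e |z\<^sub>2|\<^sup>-\<^sup>g\<close>; the exponents \<open>e\<close> and \<open>g\<close> exist exactly
  because of the strict inequalities in the theorem.\<close>

lemma S_plus_bounded_nonneg:
  assumes m: "0 < m" and n: "0 < n" and p: "1 < p" "1 < q" "1/p + 1/q = 1" and c: "0 < c"
    and ab: "- a * p < 1" "1 < (b + 1) * p"
    and A: "(c - 2 * a) * (real m + real n - 1) * p < 4 * (real m + real n)"
    and B: "(c - 2 * b) * (real m + real n - 1) * q < 4 * (real m + real n)"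
    and cab: "c \<le> a + b + 2"
  obtains C where "0 \<le> C" "\<And>f. f \<in> borel_measurable borel \<Longrightarrow> (\<And>w. 0 \<le> f w) \<Longrightarrow> (\<integral>\<^sup>+w. ennreal (f w powr p) \<partial>lborel) < \<infinity> \<Longrightarrow>
     (AE z in lborel. (\<integral>\<^sup>+w. ennreal (S_plus_kernel m n a b c z w * f w) \<partial>lborel) < \<infinity>) \<and>
     (\<integral>\<^sup>+z. ennreal (enn2real (\<integral>\<^sup>+w. ennreal (S_plus_kernel m n a b c z w * f w) \<partial>lborel) powr p) \<partial>lborel)
      \<le> ennreal (C powr p) * (\<integral>\<^sup>+w. ennreal (f w powr p) \<partial>lborel)"
proof -
  let ?k = "real (2 * (m + n - 1)) / real m" and ?N = "2 * real n / real m + 2" and ?S = "S_plus_kernel m n a b c"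
  \<comment> \<open>\<open>\<alpha>\<close> and \<open>\<gamma>\<close> are the pole orders of the
    kernel bound at the origin in z and in w. \<open>?N\<close> is the threshold below which the
    corresponding power of 1/|z2| is integrable over the triangle.\<close>
  define \<alpha> where "\<alpha> = ?k * max 0 (c/4 - a/2)"
  define \<gamma> where "\<gamma> = ?k * max 0 (c/4 - b/2)"
  \<comment> \<open>The critical exponent: with it the powers of \<open>hdist\<close> after
    integration are exactly those of the Schur weight.\<close>
  define d where "d = a + b + 2"
  have k: "?k = 2 * (real m + real n - 1) / real m" using m n by (simp add: of_nat_diff)
  have N0: "?N = 2 * (real m + real n) / real m" using m by (simp add: field_simps)
  have pq: "1 / q = 1 - 1 / p" "p + q = p * q"
    using p by (simp_all add: field_simps)
  have \<alpha>: "0 \<le> \<alpha>" "\<alpha> * p < ?N"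
  proof -
    show "0 \<le> \<alpha>" by (simp add: \<alpha>_def)
    show "\<alpha> * p < ?N"
    proof (cases "0 \<le> c/4 - a/2")
      case True
      have "\<alpha> * p = (c - 2 * a) * (real m + real n - 1) * p / (2 * real m)"
        unfolding \<alpha>_def k using True m by (simp add: max_def field_simps)
      also have "\<dots> < 4 * (real m + real n) / (2 * real m)" using A m by (intro divide_strict_right_mono) auto
      also have "\<dots> = ?N" unfolding N0 using m by (simp add: field_simps)
      finally show ?thesis .
    next
      case False
      then show ?thesis using m by (simp add: \<alpha>_def N0)
    qed
  qed
  have \<gamma>: "0 \<le> \<gamma>" "\<gamma> * q < ?N"
  proof -
    show "0 \<le> \<gamma>" by (simp add: \<gamma>_def)
    show "\<gamma> * q < ?N"
    proof (cases "0 \<le> c/4 - b/2")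
      case True
      have "\<gamma> * q = (c - 2 * b) * (real m + real n - 1) * q / (2 * real m)"
        unfolding \<gamma>_def k using True m by (simp add: max_def field_simps)
      also have "\<dots> < 4 * (real m + real n) / (2 * real m)" using B m by (intro divide_strict_right_mono) auto
      also have "\<dots> = ?N" unfolding N0 using m by (simp add: field_simps)
      finally show ?thesis .
    next
      case False
      then show ?thesis using m by (simp add: \<gamma>_def N0)
    qed
  qed
  \<comment> \<open>Dividing the two conditions by p and q and adding them; this settles the mixed
    cases in \<open>g'\<close>.\<close>
  have \<alpha>\<gamma>: "\<alpha> + \<gamma> < ?N"
  proof -
    have "\<alpha> < ?N / p" "\<gamma> < ?N / q" using \<alpha>(2) \<gamma>(2) p by (simp_all add: pos_less_divide_eq)
    then have "\<alpha> + \<gamma> < ?N * (1/p + 1/q)" by (simp add: distrib_left)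
    then show ?thesis by (simp add: p(3))
  qed
  have "\<exists>e. - a < e * q \<and> e * q < b + 1 \<and> - b < e * p \<and> e * p < a + 1"
  proof -
    have "1 / p < b + 1" using ab(2) p(1) by (simp add: field_simps)
    then have b1: "- (1/q) < b" unfolding pq(1) by simp
    have a1: "- (1/p) < a" using ab(1) p(1) by (simp add: field_simps)
    \<comment> \<open>Two intervals for e must meet. The four comparisons of lower with upper ends
      amount to a > -1/p, b > -1/q and their consequence a + b + 1 > 0.\<close>
    have "max (- a / q) (- b / p) < min ((b + 1) / q) ((a + 1) / p)"
    proof -
      have s: "0 < a + b + 1" using a1 b1 p(3) by linarith
      have "- a / q < (b + 1) / q" using s p by (intro divide_strict_right_mono) auto
      moreover have "- b / p < (a + 1) / p" using s p by (intro divide_strict_right_mono) auto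
      moreover have "- a / q < (a + 1) / p"
      proof -
        have "- (a * (1/p + 1/q)) < 1/p" using a1 p(3) by simp
        then show ?thesis by (simp add: distrib_left add_divide_distrib)
      qed
      moreover have "- b / p < (b + 1) / q"
      proof -
        have "- (b * (1/p + 1/q)) < 1/q" using b1 p(3) by simp
        then show ?thesis by (simp add: distrib_left add_divide_distrib)
      qed
      ultimately show ?thesis by simp
    qed
    then obtain e where "max (- a / q) (- b / p) < e" "e < min ((b + 1) / q) ((a + 1) / p)" using dense by blast
    then have "- a / q < e" "- b / p < e" "e < (b + 1) / q" "e < (a + 1) / p"
      unfolding max_less_iff_conj min_less_iff_conj by blast+
    moreover have "0 < p" "0 < q" using p by simp_all
    ultimately have "- a < e * q \<and> e * q < b + 1 \<and> - b < e * p \<and> e * p < a + 1"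
      by (simp only: pos_divide_less_eq pos_less_divide_eq simp_thms)
    then show ?thesis by blast
  qed
  then obtain e where e: "- a < e * q" "e * q < b + 1" "- b < e * p" "e * p < a + 1" by blast
  \<comment> \<open>The smallest g with g q >= \<alpha> and g p >= \<gamma>. Since p + q = p q, the
    pole orders \<gamma> + g q and \<alpha> + g p are each one of \<gamma> q, \<alpha> p and
    \<alpha> + \<gamma>, all of which lie below \<open>?N\<close>.\<close>
  define g where "g = max (\<alpha> / q) (\<gamma> / p)"
  have g: "\<alpha> \<le> g * q" "\<gamma> \<le> g * p"
    using p by (simp_all add: g_def max_def field_simps)
  have g': "\<gamma> + g * q < ?N" "\<alpha> + g * p < ?N"
  proof -
    have 1: "\<gamma> + \<gamma> / p * q = \<gamma> * q" "\<alpha> + \<alpha> / q * p = \<alpha> * p"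
    proof -
      have "\<gamma> + \<gamma> / p * q = \<gamma> * ((p + q) / p)" "\<alpha> + \<alpha> / q * p = \<alpha> * ((p + q) / q)" using p by (simp_all add: field_simps)
      then show "\<gamma> + \<gamma> / p * q = \<gamma> * q" "\<alpha> + \<alpha> / q * p = \<alpha> * p" using p by (simp_all add: pq(2))
    qed
    show "\<gamma> + g * q < ?N"
    proof (cases "\<alpha> / q \<le> \<gamma> / p")
      case True
      then show ?thesis using 1 \<gamma> by (simp add: g_def max_def)
    next
      case False
      then show ?thesis using \<alpha>\<gamma> p by (simp add: g_def max_def)
    qed
    show "\<alpha> + g * p < ?N"
    proof (cases "\<alpha> / q \<le> \<gamma> / p")
      case True
      then show ?thesis using \<alpha>\<gamma> p by (simp add: g_def max_def)
    next
      case False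
      then show ?thesis using 1 \<alpha> by (simp add: g_def max_def)
    qed
  qed
  obtain C0 where C0: "0 \<le> C0" "\<And>z w. z \<in> hartogs m n \<Longrightarrow> w \<in> hartogs m n \<Longrightarrow>
     ?S z w \<le> C0 * (norm (snd z) powr (- \<alpha>) * hdist m n z powr a) * (norm (snd w) powr (- \<gamma>) * hdist m n w powr b)
       / (norm (1 - hbase m n z * cnj (hbase m n w)) powr d * norm (1 - snd z * cnj (snd w)) powr d)"
    by (rule S_plus_kernel_le[OF m n c cab, of a b, folded \<alpha>_def \<gamma>_def d_def]) (rule that)
  obtain C1 where C1: "0 \<le> C1" "\<And>z. z \<in> hartogs m n \<Longrightarrow>
    (\<integral>\<^sup>+w. ennreal (norm (snd w) powr (- (\<gamma> + g * q)) * hdist m n w powr (b - e * q)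
        / (norm (1 - hbase m n z * cnj (hbase m n w)) powr d * norm (1 - snd z * cnj (snd w)) powr d)) * indicator (hartogs m n) w \<partial>lborel)
     \<le> ennreal (C1 * hdist m n z powr (b - e * q + 2 - d))"
  proof (rule hartogs_kernel_integral[OF m n])
    show "-1 < b - e * q" "b - e * q + 2 < d" "\<gamma> + g * q < ?N" using e g' by (auto simp: d_def)
  qed (rule that)
  obtain C2 where C2: "0 \<le> C2" "\<And>z. z \<in> hartogs m n \<Longrightarrow>
    (\<integral>\<^sup>+w. ennreal (norm (snd w) powr (- (\<alpha> + g * p)) * hdist m n w powr (a - e * p)
        / (norm (1 - hbase m n z * cnj (hbase m n w)) powr d * norm (1 - snd z * cnj (snd w)) powr d)) * indicator (hartogs m n) w \<partial>lborel)
     \<le> ennreal (C2 * hdist m n z powr (a - e * p + 2 - d))"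
  proof (rule hartogs_kernel_integral[OF m n])
    show "-1 < a - e * p" "a - e * p + 2 < d" "\<alpha> + g * p < ?N" using e g' by (auto simp: d_def)
  qed (rule that)
  \<comment> \<open>The value 1 off the triangle keeps \<open>h\<close> positive; the kernel
    vanishes there.\<close>
  define h where "h z = (if z \<in> hartogs m n then hdist m n z powr (- e) * norm (snd z) powr (- g) else 1)" for z
  have [measurable]: "(\<lambda>z::complex\<times>complex. norm (snd z)) \<in> borel_measurable borel"
    by (intro borel_measurable_continuous_onI continuous_intros)
  have hm: "h \<in> borel_measurable borel"
    unfolding h_def by measurable
  have h0: "0 < h z" for z
    using hdist_pos[of z m n] hartogs_snd[of z m n] m n by (auto simp: h_def)
  have hp: "h z powr r = hdist m n z powr (- (e * r)) * norm (snd z) powr (- (g * r))" if "z \<in> hartogs m n" for z r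
    using that hdist_pos[OF that m n] by (simp add: h_def powr_mult powr_powr)
  let ?C = "max (C0 * C1) (C0 * C2)"
  have km: "(\<lambda>(z, w). ?S z w) \<in> borel_measurable (lborel \<Otimes>\<^sub>M lborel)"
  proof -
    have "sets (lborel \<Otimes>\<^sub>M lborel) = sets (borel \<Otimes>\<^sub>M borel :: ((complex \<times> complex) \<times> (complex \<times> complex)) measure)"
      by (intro sets_pair_measure_cong) auto
    then show ?thesis
      using S_plus_kernel_measurable_pair[OF m n, of a b c] measurable_cong_sets by blast
  qed
  \<comment> \<open>As |z2| < 1, the poles of order g q and g p of the weight dominate those of
    order \<alpha> and \<gamma> left over from the kernel.\<close>
  have small: "norm (snd z) powr (- x) \<le> norm (snd z) powr (- y)" if "z \<in> hartogs m n" "x \<le> y" for z x y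
    using hartogs_snd[OF that(1) n] that(2) by (intro powr_mono') auto
  have s1: "(\<integral>\<^sup>+w. ennreal (?S z w * h w powr q) \<partial>lborel) \<le> ennreal (?C * h z powr q)" for z
  proof (cases "z \<in> hartogs m n")
    case z: True
    let ?c = "C0 * (norm (snd z) powr (- \<alpha>) * hdist m n z powr a)"
    let ?I = "\<lambda>w. norm (snd w) powr (- (\<gamma> + g * q)) * hdist m n w powr (b - e * q)
        / (norm (1 - hbase m n z * cnj (hbase m n w)) powr d * norm (1 - snd z * cnj (snd w)) powr d)"
    have c0: "0 \<le> ?c" using C0(1) by simp
    have "(\<integral>\<^sup>+w. ennreal (?S z w * h w powr q) \<partial>lborel) \<le> (\<integral>\<^sup>+w. ennreal ?c * (ennreal (?I w) * indicator (hartogs m n) w) \<partial>lborel)"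
    proof (rule nn_integral_mono)
      fix w
      show "ennreal (?S z w * h w powr q) \<le> ennreal ?c * (ennreal (?I w) * indicator (hartogs m n) w)"
      proof (cases "w \<in> hartogs m n")
        case w: True
        have "?S z w * h w powr q \<le> (?c * (norm (snd w) powr (- \<gamma>) * hdist m n w powr b)
            / (norm (1 - hbase m n z * cnj (hbase m n w)) powr d * norm (1 - snd z * cnj (snd w)) powr d)) * h w powr q"
          by (intro mult_right_mono C0(2) z w) simp
        also have "\<dots> = ?c * ?I w"
        proof -
          have "norm (snd w) powr (- (\<gamma> + g * q)) = norm (snd w) powr (- \<gamma>) * norm (snd w) powr (- (g * q))"
            "hdist m n w powr (b - e * q) = hdist m n w powr b * hdist m n w powr (- (e * q))"
            by (simp_all add: powr_add[symmetric])
          then show ?thesis unfolding hp[OF w] by (simp only: times_divide_eq_left times_divide_eq_right mult_ac)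
        qed
        finally show ?thesis using w c0 by (simp add: ennreal_mult[symmetric] ennreal_leI)
      next
        case False
        then show ?thesis using S_plus_kernel_outside[of z m n w a b c] m n by simp
      qed
    qed
    also have "\<dots> = ennreal ?c * (\<integral>\<^sup>+w. ennreal (?I w) * indicator (hartogs m n) w \<partial>lborel)"
      by (rule nn_integral_cmult) measurable
    also have "\<dots> \<le> ennreal ?c * ennreal (C1 * hdist m n z powr (b - e * q + 2 - d))"
      by (intro mult_left_mono C1(2) z) simp
    also have "\<dots> = ennreal (C0 * C1 * (norm (snd z) powr (- \<alpha>) * (hdist m n z powr a * hdist m n z powr (b - e * q + 2 - d))))"
      using c0 C1(1) by (simp add: ennreal_mult[symmetric] mult_ac)
    also have "hdist m n z powr a * hdist m n z powr (b - e * q + 2 - d) = hdist m n z powr (- (e * q))"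
      by (simp add: powr_add[symmetric] d_def)
    also have "ennreal (C0 * C1 * (norm (snd z) powr (- \<alpha>) * hdist m n z powr (- (e * q)))) \<le> ennreal (?C * h z powr q)"
    proof (rule ennreal_leI)
      have "C0 * C1 * (norm (snd z) powr (- \<alpha>) * hdist m n z powr (- (e * q))) \<le> ?C * (norm (snd z) powr (- (g * q)) * hdist m n z powr (- (e * q)))"
        using C0(1) C1(1) by (intro mult_mono mult_right_mono small[OF z g(1)]) (auto simp: le_max_iff_disj)
      then show "C0 * C1 * (norm (snd z) powr (- \<alpha>) * hdist m n z powr (- (e * q))) \<le> ?C * h z powr q"
        unfolding hp[OF z] by (simp only: mult_ac)
    qed
    finally show ?thesis .
  next
    case False
    then show ?thesis using S_plus_kernel_outside[of z m n _ a b c] m n by simp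
  qed
  have s2: "(\<integral>\<^sup>+z. ennreal (?S z w * h z powr p) \<partial>lborel) \<le> ennreal (?C * h w powr p)" for w
  proof (cases "w \<in> hartogs m n")
    case w: True
    let ?c = "C0 * (norm (snd w) powr (- \<gamma>) * hdist m n w powr b)"
    let ?I = "\<lambda>z. norm (snd z) powr (- (\<alpha> + g * p)) * hdist m n z powr (a - e * p)
        / (norm (1 - hbase m n w * cnj (hbase m n z)) powr d * norm (1 - snd w * cnj (snd z)) powr d)"
    have c0: "0 \<le> ?c" using C0(1) by simp
    have sym: "norm (1 - x * cnj y) = norm (1 - y * cnj x)" for x y :: complex
      using complex_mod_cnj[of "1 - x * cnj y"] by (simp add: mult.commute)
    have "(\<integral>\<^sup>+z. ennreal (?S z w * h z powr p) \<partial>lborel) \<le> (\<integral>\<^sup>+z. ennreal ?c * (ennreal (?I z) * indicator (hartogs m n) z) \<partial>lborel)"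
    proof (rule nn_integral_mono)
      fix z
      show "ennreal (?S z w * h z powr p) \<le> ennreal ?c * (ennreal (?I z) * indicator (hartogs m n) z)"
      proof (cases "z \<in> hartogs m n")
        case z: True
        have "?S z w * h z powr p \<le> (C0 * (norm (snd z) powr (- \<alpha>) * hdist m n z powr a) * (norm (snd w) powr (- \<gamma>) * hdist m n w powr b)
            / (norm (1 - hbase m n z * cnj (hbase m n w)) powr d * norm (1 - snd z * cnj (snd w)) powr d)) * h z powr p"
          by (intro mult_right_mono C0(2) z w) simp
        also have "\<dots> = ?c * ?I z"
        proof -
          have "norm (snd z) powr (- (\<alpha> + g * p)) = norm (snd z) powr (- \<alpha>) * norm (snd z) powr (- (g * p))"
            "hdist m n z powr (a - e * p) = hdist m n z powr a * hdist m n z powr (- (e * p))"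
            by (simp_all add: powr_add[symmetric])
          then show ?thesis unfolding hp[OF z] sym[of "hbase m n z"] sym[of "snd z"]
            by (simp only: times_divide_eq_left times_divide_eq_right mult_ac)
        qed
        finally show ?thesis using z c0 by (simp add: ennreal_mult[symmetric] ennreal_leI)
      next
        case False
        then show ?thesis using S_plus_kernel_outside[of z m n w a b c] m n by simp
      qed
    qed
    also have "\<dots> = ennreal ?c * (\<integral>\<^sup>+w. ennreal (?I w) * indicator (hartogs m n) w \<partial>lborel)"
      by (rule nn_integral_cmult) measurable
    also have "\<dots> \<le> ennreal ?c * ennreal (C2 * hdist m n w powr (a - e * p + 2 - d))"
      by (intro mult_left_mono C2(2) w) simp
    also have "\<dots> = ennreal (C0 * C2 * (norm (snd w) powr (- \<gamma>) * (hdist m n w powr b * hdist m n w powr (a - e * p + 2 - d))))"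
      using c0 C2(1) by (simp add: ennreal_mult[symmetric] mult_ac)
    also have "hdist m n w powr b * hdist m n w powr (a - e * p + 2 - d) = hdist m n w powr (- (e * p))"
      by (simp add: powr_add[symmetric] d_def)
    also have "ennreal (C0 * C2 * (norm (snd w) powr (- \<gamma>) * hdist m n w powr (- (e * p)))) \<le> ennreal (?C * h w powr p)"
    proof (rule ennreal_leI)
      have "C0 * C2 * (norm (snd w) powr (- \<gamma>) * hdist m n w powr (- (e * p))) \<le> ?C * (norm (snd w) powr (- (g * p)) * hdist m n w powr (- (e * p)))"
        using C0(1) C2(1) by (intro mult_mono mult_right_mono small[OF w g(2)]) (auto simp: le_max_iff_disj)
      then show "C0 * C2 * (norm (snd w) powr (- \<gamma>) * hdist m n w powr (- (e * p))) \<le> ?C * h w powr p"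
        unfolding hp[OF w] by (simp only: mult_ac)
    qed
    finally show ?thesis .
  next
    case False
    then show ?thesis using S_plus_kernel_outside[of _ m n w a b c] m n by simp
  qed
  show thesis
  proof (rule that[of ?C])
    show C: "0 \<le> ?C" using C0(1) C1(1) by (simp add: le_max_iff_disj)
    fix f :: "complex \<times> complex \<Rightarrow> real"
    assume f: "f \<in> borel_measurable borel" "\<And>w. 0 \<le> f w" "(\<integral>\<^sup>+w. ennreal (f w powr p) \<partial>lborel) < \<infinity>"
    have "f \<in> borel_measurable lborel" "h \<in> borel_measurable lborel" using f(1) hm by simp_all
    note S = Schur_test[OF lborel.sigma_finite_measure_axioms km this(2,1) S_plus_kernel_nonneg h0 f(2) p C s1 s2 f(3)]
    show "(AE z in lborel. (\<integral>\<^sup>+w. ennreal (?S z w * f w) \<partial>lborel) < \<infinity>) \<and>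
     (\<integral>\<^sup>+z. ennreal (enn2real (\<integral>\<^sup>+w. ennreal (?S z w * f w) \<partial>lborel) powr p) \<partial>lborel)
      \<le> ennreal (?C powr p) * (\<integral>\<^sup>+w. ennreal (f w powr p) \<partial>lborel)"
      using S by blast
  qed
qed

section \<open>Lebesgue measurable functions and their Borel versions\<close>

lemma lebesgue_on_AE_borel:
  fixes \<phi> \<psi> :: "'a::euclidean_space \<Rightarrow> 'b::{banach, second_countable_topology}"
  assumes \<phi>: "\<phi> \<in> borel_measurable (lebesgue_on S)" and \<psi>: "\<psi> \<in> borel_measurable borel" and S: "S \<in> sets borel"
    and eq: "AE w in lborel. indicator S w *\<^sub>R \<phi> w = \<psi> w"
  shows "integrable (lebesgue_on S) \<phi> \<longleftrightarrow> integrable lborel \<psi>"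
    and "(\<integral>w. \<phi> w \<partial>lebesgue_on S) = (\<integral>w. \<psi> w \<partial>lborel)"
proof -
  have SL: "S \<inter> space lebesgue \<in> sets lebesgue" using S by simp
  have m1: "(\<lambda>w. indicator S w *\<^sub>R \<phi> w) \<in> borel_measurable lebesgue"
    using \<phi> borel_measurable_restrict_space_iff[OF SL, of \<phi>] by simp
  have m2: "\<psi> \<in> borel_measurable lebesgue" using \<psi> by (intro measurable_completion) simp
  have eq': "AE w in lebesgue. indicator S w *\<^sub>R \<phi> w = \<psi> w" by (rule AE_completion[OF eq])
  have m3: "\<psi> \<in> borel_measurable lborel" using \<psi> by simp
  show "integrable (lebesgue_on S) \<phi> \<longleftrightarrow> integrable lborel \<psi>"
    unfolding integrable_restrict_space[OF SL] integrable_cong_AE[OF m1 m2 eq'] by (rule integrable_completion[OF m3])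
  show "(\<integral>w. \<phi> w \<partial>lebesgue_on S) = (\<integral>w. \<psi> w \<partial>lborel)"
    unfolding integral_restrict_space[OF SL] integral_cong_AE[OF m1 m2 eq'] by (rule integral_completion[OF m3])
qed

lemma lebesgue_on_borel_version:
  fixes f :: "'a::euclidean_space \<Rightarrow> complex"
  assumes f: "f \<in> borel_measurable (lebesgue_on S)" and S: "S \<in> sets borel"
  obtains g where "g \<in> borel_measurable borel" "AE w in lborel. indicator S w *\<^sub>R f w = g w"
proof -
  have SL: "S \<inter> space lebesgue \<in> sets lebesgue" using S by simp
  let ?F = "\<lambda>w. indicator S w *\<^sub>R f w"
  have m: "?F \<in> borel_measurable lebesgue"
    using f borel_measurable_restrict_space_iff[OF SL, of f] by simp
  have re: "(\<lambda>w. Re (?F w)) \<in> borel_measurable lebesgue" and im: "(\<lambda>w. Im (?F w)) \<in> borel_measurable lebesgue"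
    by (rule measurable_compose[OF m], simp)+
  obtain r where r: "r \<in> borel_measurable lborel" "AE w in lborel. Re (?F w) = r w"
    using completion_ex_borel_measurable_real[OF re] by blast
  obtain i where i: "i \<in> borel_measurable lborel" "AE w in lborel. Im (?F w) = i w"
    using completion_ex_borel_measurable_real[OF im] by blast
  have [measurable]: "r \<in> borel_measurable borel" "i \<in> borel_measurable borel" using r(1) i(1) by simp_all
  have "(\<lambda>w. complex_of_real (r w) + \<i> * complex_of_real (i w)) \<in> borel_measurable borel" by measurable
  moreover have "AE w in lborel. ?F w = complex_of_real (r w) + \<i> * complex_of_real (i w)"
    using r(2) i(2) by eventually_elim (simp add: complex_eq_iff)
  ultimately show thesis by (rule that)
qed

lemma Lp_norm_borel_version:
  fixes f :: "complex \<times> complex \<Rightarrow> complex"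
  assumes f: "f \<in> borel_measurable (lebesgue_on S)" and S: "S \<in> sets borel" and g: "g \<in> borel_measurable borel"
    and eq: "AE w in lborel. indicator S w *\<^sub>R f w = g w"
  shows "f \<in> Lp_space p S \<longleftrightarrow> (\<integral>\<^sup>+w. ennreal (norm (g w) powr p) \<partial>lborel) < \<infinity>"
    and "Lp_norm p S f = enn2real (\<integral>\<^sup>+w. ennreal (norm (g w) powr p) \<partial>lborel) powr (1 / p)"
proof -
  have m1: "(\<lambda>w. norm (f w) powr p) \<in> borel_measurable (lebesgue_on S)" using f by measurable
  have m2: "(\<lambda>w. norm (g w) powr p) \<in> borel_measurable borel" using g by measurable
  have eq': "AE w in lborel. indicator S w *\<^sub>R (norm (f w) powr p) = norm (g w) powr p"
    using eq by eventually_elim (auto simp: indicator_def split: if_splits)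
  note L = lebesgue_on_AE_borel[OF m1 m2 S eq']
  show "f \<in> Lp_space p S \<longleftrightarrow> (\<integral>\<^sup>+w. ennreal (norm (g w) powr p) \<partial>lborel) < \<infinity>"
  proof -
    have "integrable lborel (\<lambda>w. norm (g w) powr p) \<longleftrightarrow> (\<integral>\<^sup>+w. ennreal (norm (g w) powr p) \<partial>lborel) < \<infinity>"
      using m2 by (simp add: integrable_iff_bounded)
    then show ?thesis using f by (simp only: Lp_space_def mem_Collect_eq L(1) simp_thms)
  qed
  show "Lp_norm p S f = enn2real (\<integral>\<^sup>+w. ennreal (norm (g w) powr p) \<partial>lborel) powr (1 / p)"
    unfolding Lp_norm_def L(2) using m2 by (subst integral_eq_nn_integral) auto
qed

lemma AE_lebesgue_on_lborel_iff:
  assumes "S \<in> sets borel" "{w \<in> S. \<not> P w} \<in> sets borel"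
  shows "(AE w in lebesgue_on S. P w) \<longleftrightarrow> (AE w in lborel. w \<in> S \<longrightarrow> P w)"
proof -
  have "(AE w in lebesgue_on S. P w) \<longleftrightarrow> (AE w in lebesgue. w \<in> S \<longrightarrow> P w)"
    using assms by (subst AE_restrict_space_iff) auto
  also have "\<dots> \<longleftrightarrow> (AE w in lborel. w \<in> S \<longrightarrow> P w)"
    by (rule AE_completion_iff)
  finally show ?thesis .
qed

text \<open>Changing f on a null set changes no value of the operator. The alternative in the last
  claim is forced by the convention that \<open>enn2real\<close> is 0 at infinity.\<close>

lemma integral_operator_borel_version:
  fixes f :: "complex \<times> complex \<Rightarrow> complex"
  assumes f: "f \<in> borel_measurable (lebesgue_on (hartogs m n))" and g: "g \<in> borel_measurable borel"
    and eq: "AE w in lborel. indicator (hartogs m n) w *\<^sub>R f w = g w" and m: "0 < m" and n: "0 < n"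
  shows "integrable (lebesgue_on (hartogs m n)) (\<lambda>w. S_plus_kernel m n a b c z w *\<^sub>R f w)
      \<longleftrightarrow> (\<integral>\<^sup>+w. ennreal (S_plus_kernel m n a b c z w * norm (g w)) \<partial>lborel) < \<infinity>"
    and "integral_operator (hartogs m n) (S_plus_kernel m n a b c) f z
      = (\<integral>w. S_plus_kernel m n a b c z w *\<^sub>R g w \<partial>lborel)"
    and "norm (integral_operator (hartogs m n) (S_plus_kernel m n a b c) f z)
      \<le> enn2real (\<integral>\<^sup>+w. ennreal (S_plus_kernel m n a b c z w * norm (g w)) \<partial>lborel)
        \<or> (\<integral>\<^sup>+w. ennreal (S_plus_kernel m n a b c z w * norm (g w)) \<partial>lborel) = \<infinity>"
proof -
  let ?S = "S_plus_kernel m n a b c" and ?H = "hartogs m n"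
  note k[measurable] = S_plus_kernel_measurable(1)[OF m n, of a b c z]
  have "(\<lambda>w. ?S z w) \<in> borel_measurable (lebesgue_on ?H)"
    by (intro measurable_restrict_space1 measurable_completion) simp
  then have m1: "(\<lambda>w. ?S z w *\<^sub>R f w) \<in> borel_measurable (lebesgue_on ?H)" using f by measurable
  have m2: "(\<lambda>w. ?S z w *\<^sub>R g w) \<in> borel_measurable borel" using g by measurable
  have eq': "AE w in lborel. indicator ?H w *\<^sub>R (?S z w *\<^sub>R f w) = ?S z w *\<^sub>R g w"
    using eq by eventually_elim (metis scaleR_left_commute)
  note L = lebesgue_on_AE_borel[OF m1 m2 hartogs_measurable eq']
  have nn: "(\<integral>\<^sup>+w. ennreal (norm (?S z w *\<^sub>R g w)) \<partial>lborel) = (\<integral>\<^sup>+w. ennreal (?S z w * norm (g w)) \<partial>lborel)"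
    by (simp add: S_plus_kernel_nonneg)
  show I: "integrable (lebesgue_on ?H) (\<lambda>w. ?S z w *\<^sub>R f w) \<longleftrightarrow> (\<integral>\<^sup>+w. ennreal (?S z w * norm (g w)) \<partial>lborel) < \<infinity>"
    unfolding L(1) using m2 by (simp add: integrable_iff_bounded S_plus_kernel_nonneg)
  show E: "integral_operator ?H ?S f z = (\<integral>w. ?S z w *\<^sub>R g w \<partial>lborel)"
    unfolding integral_operator_def by (rule L(2))
  show "norm (integral_operator ?H ?S f z) \<le> enn2real (\<integral>\<^sup>+w. ennreal (?S z w * norm (g w)) \<partial>lborel)
        \<or> (\<integral>\<^sup>+w. ennreal (?S z w * norm (g w)) \<partial>lborel) = \<infinity>"
  proof (cases "(\<integral>\<^sup>+w. ennreal (?S z w * norm (g w)) \<partial>lborel) < \<infinity>")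
    case True
    then have "integrable lborel (\<lambda>w. ?S z w *\<^sub>R g w)" using I L(1) by simp
    from integral_norm_bound_ennreal[OF this]
    have "ennreal (norm (integral_operator ?H ?S f z)) \<le> (\<integral>\<^sup>+w. ennreal (?S z w * norm (g w)) \<partial>lborel)"
      unfolding nn E .
    from enn2real_mono[OF this] True show ?thesis by simp
  qed (simp add: less_top[symmetric])
qed

text \<open>The estimate for nonnegative functions is applied to |g|, where g is a Borel version of
  f. The almost everywhere finite integral of the kernel against |g| is the required absolute
  convergence, and it dominates the modulus of the image.\<close>

lemma S_plus_bounded_if:
  assumes m: "0 < m" and n: "0 < n" and p: "1 < p" "1 < q" "1/p + 1/q = 1" and c: "0 < c"
    and ab: "- a * p < 1" "1 < (b + 1) * p"
    and A: "(c - 2 * a) * (real m + real n - 1) * p < 4 * (real m + real n)"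
    and B: "(c - 2 * b) * (real m + real n - 1) * q < 4 * (real m + real n)"
    and cab: "c \<le> a + b + 2"
  shows "bounded_integral_operator_on_Lp (hartogs m n) p (S_plus_kernel m n a b c)"
proof -
  let ?S = "S_plus_kernel m n a b c" and ?H = "hartogs m n"
  obtain C where C: "0 \<le> C" "\<And>f. f \<in> borel_measurable borel \<Longrightarrow> (\<And>w. 0 \<le> f w) \<Longrightarrow> (\<integral>\<^sup>+w. ennreal (f w powr p) \<partial>lborel) < \<infinity> \<Longrightarrow>
     (AE z in lborel. (\<integral>\<^sup>+w. ennreal (?S z w * f w) \<partial>lborel) < \<infinity>) \<and>
     (\<integral>\<^sup>+z. ennreal (enn2real (\<integral>\<^sup>+w. ennreal (?S z w * f w) \<partial>lborel) powr p) \<partial>lborel)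
      \<le> ennreal (C powr p) * (\<integral>\<^sup>+w. ennreal (f w powr p) \<partial>lborel)"
  proof (rule S_plus_bounded_nonneg[OF m n p c ab A B cab], goal_cases)
    case (1 C)
    show ?case by (rule 1(1)[OF 1(2)]) (rule 1(3))
  qed
  have main: "(AE z in lebesgue_on ?H. integrable (lebesgue_on ?H) (\<lambda>w. ?S z w *\<^sub>R f w)) \<and>
        integral_operator ?H ?S f \<in> Lp_space p ?H \<and> Lp_norm p ?H (integral_operator ?H ?S f) \<le> C * Lp_norm p ?H f"
    if f: "f \<in> Lp_space p ?H" for f
  proof -
    have fm: "f \<in> borel_measurable (lebesgue_on ?H)" using f by (simp add: Lp_space_def)
    obtain g where g: "g \<in> borel_measurable borel" "AE w in lborel. indicator ?H w *\<^sub>R f w = g w"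
      using lebesgue_on_borel_version[OF fm hartogs_measurable] by metis
    note [measurable] = g(1)
    define X where "X = (\<integral>\<^sup>+w. ennreal (norm (g w) powr p) \<partial>lborel)"
    have X: "X < \<infinity>" "Lp_norm p ?H f = enn2real X powr (1/p)"
      using f Lp_norm_borel_version[OF fm hartogs_measurable g, of p] by (auto simp: X_def)
    have "(\<lambda>w. norm (g w)) \<in> borel_measurable borel" by measurable
    from C(2)[OF this] X(1) have fin: "AE z in lborel. (\<integral>\<^sup>+w. ennreal (?S z w * norm (g w)) \<partial>lborel) < \<infinity>"
      and bd: "(\<integral>\<^sup>+z. ennreal (enn2real (\<integral>\<^sup>+w. ennreal (?S z w * norm (g w)) \<partial>lborel) powr p) \<partial>lborel) \<le> ennreal (C powr p) * X"
      unfolding X_def by simp_all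
    note O = integral_operator_borel_version[OF fm g m n, of a b c]
    have km: "(\<lambda>(z, w). ?S z w) \<in> borel_measurable (borel \<Otimes>\<^sub>M lborel)"
    proof -
      have "sets (borel \<Otimes>\<^sub>M lborel) = sets (borel \<Otimes>\<^sub>M borel :: ((complex \<times> complex) \<times> (complex \<times> complex)) measure)"
        by (intro sets_pair_measure_cong) auto
      then show ?thesis using S_plus_kernel_measurable_pair[OF m n, of a b c] measurable_cong_sets by blast
    qed
    have gm: "(\<lambda>(z, w). g w) \<in> borel_measurable ((borel :: (complex \<times> complex) measure) \<Otimes>\<^sub>M lborel)"
      by measurable
    have Tm[measurable]: "integral_operator ?H ?S f \<in> borel_measurable borel"
    proof -
      have "(\<lambda>z. \<integral>w. ?S z w *\<^sub>R g w \<partial>lborel) \<in> borel_measurable borel"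
        using borel_measurable_scaleR[OF km gm]
        by (intro lborel.borel_measurable_lebesgue_integral) (simp add: case_prod_beta')
      then show ?thesis using O(2) by presburger
    qed
    have nnm: "(\<lambda>z. \<integral>\<^sup>+w. ennreal (?S z w * norm (g w)) \<partial>lborel) \<in> borel_measurable borel"
    proof (rule lborel.borel_measurable_nn_integral)
      have "(\<lambda>x. ennreal ((case x of (z, w) \<Rightarrow> ?S z w) * norm (case x of (z, w) \<Rightarrow> g w))) \<in> borel_measurable (borel \<Otimes>\<^sub>M lborel)"
        using km gm by measurable
      then show "(\<lambda>(z, w). ennreal (?S z w * norm (g w))) \<in> borel_measurable (borel \<Otimes>\<^sub>M lborel)"
        by (simp add: case_prod_beta')
    qed
    have out: "indicator ?H z *\<^sub>R integral_operator ?H ?S f z = integral_operator ?H ?S f z" for z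
      using S_plus_kernel_outside[of z m n _ a b c] m n by (auto simp: O(2) indicator_def)
    have Tm': "integral_operator ?H ?S f \<in> borel_measurable (lebesgue_on ?H)"
      by (intro measurable_restrict_space1 measurable_completion) simp
    have "(\<integral>\<^sup>+z. ennreal (norm (integral_operator ?H ?S f z) powr p) \<partial>lborel)
        \<le> (\<integral>\<^sup>+z. ennreal (enn2real (\<integral>\<^sup>+w. ennreal (?S z w * norm (g w)) \<partial>lborel) powr p) \<partial>lborel)"
    proof (rule nn_integral_mono_AE, use fin in eventually_elim)
      fix z assume "(\<integral>\<^sup>+w. ennreal (?S z w * norm (g w)) \<partial>lborel) < \<infinity>"
      then have "norm (integral_operator ?H ?S f z) \<le> enn2real (\<integral>\<^sup>+w. ennreal (?S z w * norm (g w)) \<partial>lborel)"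
        using O(3)[of z] by auto
      then show "ennreal (norm (integral_operator ?H ?S f z) powr p) \<le> ennreal (enn2real (\<integral>\<^sup>+w. ennreal (?S z w * norm (g w)) \<partial>lborel) powr p)"
        using p by (intro ennreal_leI powr_mono2) auto
    qed
    also note bd
    finally have T: "(\<integral>\<^sup>+z. ennreal (norm (integral_operator ?H ?S f z) powr p) \<partial>lborel) \<le> ennreal (C powr p) * X" .
    have T0: "ennreal (C powr p) * X < \<infinity>" using X(1) by (simp add: ennreal_mult_less_top)
    note V = Lp_norm_borel_version[OF Tm' hartogs_measurable Tm AE_I2[OF out], of p]
    show ?thesis
    proof (intro conjI)
      have "{z \<in> ?H. \<not> integrable (lebesgue_on ?H) (\<lambda>w. ?S z w *\<^sub>R f w)} = ?H \<inter> ((\<lambda>z. \<integral>\<^sup>+w. ennreal (?S z w * norm (g w)) \<partial>lborel) -` {\<infinity>})"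
        by (auto simp: O(1) less_top[symmetric])
      also have "\<dots> \<in> sets borel"
        using measurable_sets[OF nnm, of "{\<infinity>}"] by (intro sets.Int hartogs_measurable) simp
      finally show "AE z in lebesgue_on ?H. integrable (lebesgue_on ?H) (\<lambda>w. ?S z w *\<^sub>R f w)"
        using fin by (subst AE_lebesgue_on_lborel_iff) (auto simp: O(1))
      show "integral_operator ?H ?S f \<in> Lp_space p ?H"
        unfolding V(1) using le_less_trans[OF T T0] .
      have "enn2real (\<integral>\<^sup>+z. ennreal (norm (integral_operator ?H ?S f z) powr p) \<partial>lborel) \<le> enn2real (ennreal (C powr p) * X)"
        using T T0 by (intro enn2real_mono) auto
      also have "\<dots> = C powr p * enn2real X" by (simp add: enn2real_mult)
      finally have "enn2real (\<integral>\<^sup>+z. ennreal (norm (integral_operator ?H ?S f z) powr p) \<partial>lborel) powr (1/p) \<le> (C powr p * enn2real X) powr (1/p)"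
        using p by (intro powr_mono2) auto
      also have "\<dots> = C * enn2real X powr (1/p)" using C(1) p by (simp add: powr_mult powr_powr)
      finally show "Lp_norm p ?H (integral_operator ?H ?S f) \<le> C * Lp_norm p ?H f"
        unfolding V(2) X(2) .
    qed
  qed
  then show ?thesis unfolding bounded_integral_operator_on_Lp_def by blast
qed

text \<open>Turns boundedness into an inequality between nonnegative integrals in which the image of
  f enters only through a lower bound \<kappa> on a set U, so that no image need be computed in the
  necessity arguments.\<close>

lemma S_plus_bounded_test:
  assumes m: "0 < m" and n: "0 < n" and p: "1 < p"
    and bd: "bounded_integral_operator_on_Lp (hartogs m n) p (S_plus_kernel m n a b c)"
  obtains C where "0 \<le> C" "\<And>f \<kappa> U. f \<in> borel_measurable borel \<Longrightarrow> (\<And>w. 0 \<le> f w) \<Longrightarrow> (\<And>w. w \<notin> hartogs m n \<Longrightarrow> f w = 0) \<Longrightarrow>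
     (\<integral>\<^sup>+w. ennreal (f w powr p) \<partial>lborel) < \<infinity> \<Longrightarrow> U \<subseteq> hartogs m n \<Longrightarrow>
     (\<And>z. z \<in> U \<Longrightarrow> 0 \<le> \<kappa> z \<and> ennreal (\<kappa> z) \<le> (\<integral>\<^sup>+w. ennreal (S_plus_kernel m n a b c z w * f w) \<partial>lborel)) \<Longrightarrow>
     (\<integral>\<^sup>+z. ennreal (\<kappa> z powr p) * indicator U z \<partial>lborel) \<le> ennreal C * (\<integral>\<^sup>+w. ennreal (f w powr p) \<partial>lborel)"
proof -
  let ?S = "S_plus_kernel m n a b c" and ?H = "hartogs m n"
  obtain D where D: "\<And>f. f \<in> Lp_space p ?H \<Longrightarrow> (AE z in lebesgue_on ?H. integrable (lebesgue_on ?H) (\<lambda>w. ?S z w *\<^sub>R f w)) \<and>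
        integral_operator ?H ?S f \<in> Lp_space p ?H \<and> Lp_norm p ?H (integral_operator ?H ?S f) \<le> D * Lp_norm p ?H f"
    using bd unfolding bounded_integral_operator_on_Lp_def by blast
  show thesis
  \<comment> \<open>The constant in the definition of boundedness carries no sign, hence the maximum
    with 0.\<close>
  proof (rule that[of "max 0 D powr p"])
    fix f \<kappa> :: "complex \<times> complex \<Rightarrow> real" and U
    assume f[measurable]: "f \<in> borel_measurable borel" and f0: "\<And>w. 0 \<le> f w" and fH: "\<And>w. w \<notin> ?H \<Longrightarrow> f w = 0"
      and fin: "(\<integral>\<^sup>+w. ennreal (f w powr p) \<partial>lborel) < \<infinity>" and U: "U \<subseteq> ?H"
      and \<kappa>: "\<And>z. z \<in> U \<Longrightarrow> 0 \<le> \<kappa> z \<and> ennreal (\<kappa> z) \<le> (\<integral>\<^sup>+w. ennreal (?S z w * f w) \<partial>lborel)"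
    define g where "g w = complex_of_real (f w)" for w
    have gm[measurable]: "g \<in> borel_measurable borel" unfolding g_def by measurable
    have gm': "g \<in> borel_measurable (lebesgue_on ?H)"
      by (intro measurable_restrict_space1 measurable_completion) simp
    have ng: "norm (g w) = f w" for w using f0[of w] by (simp add: g_def)
    have rep: "AE w in lborel. indicator ?H w *\<^sub>R g w = g w"
      using fH by (intro AE_I2) (auto simp: g_def indicator_def)
    note V = Lp_norm_borel_version[OF gm' hartogs_measurable gm rep, of p, unfolded ng]
    have gL: "g \<in> Lp_space p ?H" using V(1) fin by simp
    let ?T = "integral_operator ?H ?S g"
    note Dg = D[OF gL]
    note O = integral_operator_borel_version[OF gm' gm rep m n, of a b c, unfolded ng]
    have TL: "?T \<in> borel_measurable (lebesgue_on ?H)" using Dg by (simp add: Lp_space_def)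
    obtain t where t: "t \<in> borel_measurable borel" "AE z in lborel. indicator ?H z *\<^sub>R ?T z = t z"
      using lebesgue_on_borel_version[OF TL hartogs_measurable] by metis
    note W = Lp_norm_borel_version[OF TL hartogs_measurable t, of p]
    have tfin: "(\<integral>\<^sup>+z. ennreal (norm (t z) powr p) \<partial>lborel) < \<infinity>" using W(1) Dg by simp
    have ae: "AE z in lebesgue. z \<in> ?H \<longrightarrow> (\<integral>\<^sup>+w. ennreal (?S z w * f w) \<partial>lborel) < \<infinity>"
      using Dg unfolding O(1) by (subst (asm) AE_restrict_space_iff) auto
    have ae': "AE z in lborel. z \<in> ?H \<longrightarrow> (\<integral>\<^sup>+w. ennreal (?S z w * f w) \<partial>lborel) < \<infinity>"
      using ae by (simp only: AE_completion_iff)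
    have val: "?T z = complex_of_real (enn2real (\<integral>\<^sup>+w. ennreal (?S z w * f w) \<partial>lborel))" for z
    proof -
      have "?T z = (\<integral>w. complex_of_real (?S z w * f w) \<partial>lborel)"
        by (simp add: O(2) g_def scaleR_conv_of_real)
      also have "\<dots> = complex_of_real (\<integral>w. ?S z w * f w \<partial>lborel)" by (rule integral_complex_of_real)
      also have "(\<integral>w. ?S z w * f w \<partial>lborel) = enn2real (\<integral>\<^sup>+w. ennreal (?S z w * f w) \<partial>lborel)"
        using S_plus_kernel_measurable(1)[OF m n, of a b c z] f0
        by (intro integral_eq_nn_integral) (auto simp: S_plus_kernel_nonneg)
      finally show ?thesis .
    qed
    have "(\<integral>\<^sup>+z. ennreal (\<kappa> z powr p) * indicator U z \<partial>lborel) \<le> (\<integral>\<^sup>+z. ennreal (norm (t z) powr p) \<partial>lborel)"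
    proof (rule nn_integral_mono_AE, use ae' t(2) in eventually_elim)
      case (elim z)
      show ?case
      proof (cases "z \<in> U")
        case True
        then have zH: "z \<in> ?H" using U by blast
        have "\<kappa> z \<le> enn2real (\<integral>\<^sup>+w. ennreal (?S z w * f w) \<partial>lborel)"
          using enn2real_mono[of "ennreal (\<kappa> z)"] \<kappa>[OF True] elim zH by simp
        also have "\<dots> = norm (t z)" using elim(2) zH by (simp add: val flip: elim(2))
        finally have "\<kappa> z powr p \<le> norm (t z) powr p" using p \<kappa>[OF True] by (intro powr_mono2) auto
        then show ?thesis using True by (simp add: ennreal_leI)
      qed simp
    qed
    also have "\<dots> \<le> ennreal (max 0 D powr p) * (\<integral>\<^sup>+w. ennreal (f w powr p) \<partial>lborel)"
    proof -
      let ?X = "\<integral>\<^sup>+w. ennreal (f w powr p) \<partial>lborel" and ?Y = "\<integral>\<^sup>+z. ennreal (norm (t z) powr p) \<partial>lborel"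
      have "enn2real ?Y powr (1/p) \<le> D * enn2real ?X powr (1/p)" using Dg W(2) V(2) by simp
      also have "\<dots> \<le> max 0 D * enn2real ?X powr (1/p)" by (intro mult_right_mono) auto
      finally have "(enn2real ?Y powr (1/p)) powr p \<le> (max 0 D * enn2real ?X powr (1/p)) powr p"
        using p by (intro powr_mono2) auto
      then have "enn2real ?Y \<le> max 0 D powr p * enn2real ?X" using p by (simp add: powr_powr powr_mult)
      then have "ennreal (enn2real ?Y) \<le> ennreal (max 0 D powr p * enn2real ?X)" by (rule ennreal_leI)
      also have "\<dots> = ennreal (max 0 D powr p) * ennreal (enn2real ?X)" by (intro ennreal_mult) auto
      finally show ?thesis using fin tfin by simp
    qed
    finally show "(\<integral>\<^sup>+z. ennreal (\<kappa> z powr p) * indicator U z \<partial>lborel) \<le> ennreal (max 0 D powr p) * (\<integral>\<^sup>+w. ennreal (f w powr p) \<partial>lborel)" .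
  qed simp
qed

lemma hartogs_finite_measure: "0 < m \<Longrightarrow> 0 < n \<Longrightarrow> emeasure lborel (hartogs m n) < \<infinity>"
proof -
  assume mn: "0 < m" "0 < n"
  have "hartogs m n \<subseteq> bidisc"
  proof
    fix z assume z: "z \<in> hartogs m n"
    then have "norm (fst z) ^ m < 1" by (auto simp: hartogs_def)
    then have "norm (fst z) < 1" using mn by (simp add: power_less_one_iff)
    then show "z \<in> bidisc" using hartogs_snd(2)[OF z mn(2)] by (cases z) (simp add: bidisc_iff)
  qed
  then have "emeasure lborel (hartogs m n) \<le> emeasure lborel bidisc" by (intro emeasure_mono) (simp_all add: bidisc_measurable)
  also have "emeasure lborel bidisc = ennreal (pi * pi)" by (rule emeasure_bidisc)
  also have "\<dots> < \<infinity>" by simp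
  finally show ?thesis .
qed

lemma subset_hartogs_finite:
  assumes "E \<subseteq> hartogs m n" "0 < m" "0 < n"
  shows "emeasure lborel E < \<infinity>"
  using emeasure_mono[OF assms(1), of lborel] hartogs_finite_measure[OF assms(2,3)]
  by (simp add: le_less_trans)

text \<open>The test function is the indicator of E: on U its image is at least \<kappa> times the
  measure of E, so \<kappa> must be p-integrable over U.\<close>

lemma S_plus_bounded_imp_left:
  assumes m: "0 < m" and n: "0 < n" and p: "1 < p"
    and bd: "bounded_integral_operator_on_Lp (hartogs m n) p (S_plus_kernel m n a b c)"
    and E: "E \<subseteq> hartogs m n" "E \<in> sets borel" "emeasure lborel E \<noteq> 0" and U: "U \<subseteq> hartogs m n"
    and \<kappa>: "\<And>z w. z \<in> U \<Longrightarrow> w \<in> E \<Longrightarrow> 0 \<le> \<kappa> z \<and> \<kappa> z \<le> S_plus_kernel m n a b c z w"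
    and \<kappa>m: "(\<lambda>z. ennreal (\<kappa> z powr p) * indicator U z) \<in> borel_measurable borel"
  shows "(\<integral>\<^sup>+z. ennreal (\<kappa> z powr p) * indicator U z \<partial>lborel) < \<infinity>"
proof -
  obtain C where C: "0 \<le> C" "\<And>f \<kappa> U. f \<in> borel_measurable borel \<Longrightarrow> (\<And>w. 0 \<le> f w) \<Longrightarrow> (\<And>w. w \<notin> hartogs m n \<Longrightarrow> f w = 0) \<Longrightarrow>
     (\<integral>\<^sup>+w. ennreal (f w powr p) \<partial>lborel) < \<infinity> \<Longrightarrow> U \<subseteq> hartogs m n \<Longrightarrow>
     (\<And>z. z \<in> U \<Longrightarrow> 0 \<le> \<kappa> z \<and> ennreal (\<kappa> z) \<le> (\<integral>\<^sup>+w. ennreal (S_plus_kernel m n a b c z w * f w) \<partial>lborel)) \<Longrightarrow>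
     (\<integral>\<^sup>+z. ennreal (\<kappa> z powr p) * indicator U z \<partial>lborel) \<le> ennreal C * (\<integral>\<^sup>+w. ennreal (f w powr p) \<partial>lborel)"
  proof (rule S_plus_bounded_test[OF m n p bd], goal_cases)
    case (1 C)
    show ?case by (rule 1(1)[OF 1(2)]) (rule 1(3))
  qed
  obtain \<mu> where \<mu>: "emeasure lborel E = ennreal \<mu>" "0 < \<mu>"
    using subset_hartogs_finite[OF E(1) m n] E(3)
    by (cases "emeasure lborel E") (auto simp: ennreal_eq_0_iff not_le)
  have ind: "(\<integral>\<^sup>+w. ennreal (indicator E w powr p) \<partial>lborel) = ennreal \<mu>"
  proof -
    have "ennreal (indicator E w powr p) = indicator E w" for w by (auto simp: indicator_def)
    then show ?thesis using E(2) \<mu> by simp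
  qed
  have "(\<integral>\<^sup>+z. ennreal ((\<mu> * \<kappa> z) powr p) * indicator U z \<partial>lborel) \<le> ennreal C * (\<integral>\<^sup>+w. ennreal (indicator E w powr p) \<partial>lborel)"
  proof (rule C(2))
    show "(\<integral>\<^sup>+w. ennreal (indicator E w powr p) \<partial>lborel) < \<infinity>" unfolding ind by simp
    fix z assume z: "z \<in> U"
    obtain w where "w \<in> E" using E(3) by (metis all_not_in_conv emeasure_empty)
    then have k0: "0 \<le> \<kappa> z" using \<kappa>[OF z] by blast
    have "ennreal (\<mu> * \<kappa> z) = (\<integral>\<^sup>+w. ennreal (\<kappa> z) * indicator E w \<partial>lborel)"
      using E(2) \<mu> k0 by (simp add: nn_integral_cmult_indicator ennreal_mult mult.commute)
    also have "\<dots> \<le> (\<integral>\<^sup>+w. ennreal (S_plus_kernel m n a b c z w * indicator E w) \<partial>lborel)"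
      using \<kappa>[OF z] by (intro nn_integral_mono) (auto simp: indicator_def intro!: ennreal_leI)
    finally show "0 \<le> \<mu> * \<kappa> z \<and> ennreal (\<mu> * \<kappa> z) \<le> (\<integral>\<^sup>+w. ennreal (S_plus_kernel m n a b c z w * indicator E w) \<partial>lborel)"
      using k0 \<mu> by simp
  qed (use E U in \<open>auto simp: indicator_def\<close>)
  also have "\<dots> < \<infinity>" unfolding ind by (simp add: ennreal_mult_less_top)
  also have "(\<integral>\<^sup>+z. ennreal ((\<mu> * \<kappa> z) powr p) * indicator U z \<partial>lborel) = (\<integral>\<^sup>+z. ennreal (\<mu> powr p) * (ennreal (\<kappa> z powr p) * indicator U z) \<partial>lborel)"
    by (intro nn_integral_cong) (simp add: powr_mult ennreal_mult mult.assoc)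
  also have "\<dots> = ennreal (\<mu> powr p) * (\<integral>\<^sup>+z. ennreal (\<kappa> z powr p) * indicator U z \<partial>lborel)"
    using \<kappa>m by (intro nn_integral_cmult) simp
  finally show ?thesis using \<mu> by (auto simp: ennreal_mult_less_top)
qed

text \<open>The dual statement, obtained without forming the adjoint. The test function is
  \<kappa>^(q-1) on U. Its p-th power is \<kappa>^q because (q - 1) p = q, and on E its image is at
  least J, the integral of \<kappa>^q; boundedness then reads J^p \<mu> <= C J, which bounds
  J.\<close>

lemma S_plus_bounded_imp_right:
  assumes m: "0 < m" and n: "0 < n" and p: "1 < p" "1 < q" "1/p + 1/q = 1"
    and bd: "bounded_integral_operator_on_Lp (hartogs m n) p (S_plus_kernel m n a b c)"
    and E: "E \<subseteq> hartogs m n" "E \<in> sets borel" "emeasure lborel E \<noteq> 0" and U: "U \<subseteq> hartogs m n" "U \<in> sets borel"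
    and \<kappa>: "\<And>z w. z \<in> E \<Longrightarrow> w \<in> U \<Longrightarrow> \<kappa> w \<le> S_plus_kernel m n a b c z w" and \<kappa>0: "\<And>w. 0 \<le> \<kappa> w"
    and \<kappa>m[measurable]: "\<kappa> \<in> borel_measurable borel"
  shows "(\<integral>\<^sup>+w. ennreal (\<kappa> w powr q) * indicator U w \<partial>lborel) < \<infinity>"
proof -
  obtain C where C: "0 \<le> C" "\<And>f \<kappa> U. f \<in> borel_measurable borel \<Longrightarrow> (\<And>w. 0 \<le> f w) \<Longrightarrow> (\<And>w. w \<notin> hartogs m n \<Longrightarrow> f w = 0) \<Longrightarrow>
     (\<integral>\<^sup>+w. ennreal (f w powr p) \<partial>lborel) < \<infinity> \<Longrightarrow> U \<subseteq> hartogs m n \<Longrightarrow>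
     (\<And>z. z \<in> U \<Longrightarrow> 0 \<le> \<kappa> z \<and> ennreal (\<kappa> z) \<le> (\<integral>\<^sup>+w. ennreal (S_plus_kernel m n a b c z w * f w) \<partial>lborel)) \<Longrightarrow>
     (\<integral>\<^sup>+z. ennreal (\<kappa> z powr p) * indicator U z \<partial>lborel) \<le> ennreal C * (\<integral>\<^sup>+w. ennreal (f w powr p) \<partial>lborel)"
  proof (rule S_plus_bounded_test[OF m n p(1) bd], goal_cases)
    case (1 C)
    show ?case by (rule 1(1)[OF 1(2)]) (rule 1(3))
  qed
  note [measurable] = U(2) E(2)
  obtain \<mu> where \<mu>: "emeasure lborel E = ennreal \<mu>" "0 < \<mu>"
    using subset_hartogs_finite[OF E(1) m n] E(3)
    by (cases "emeasure lborel E") (auto simp: ennreal_eq_0_iff not_le)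
  have qp: "(q - 1) * p = q" "(q - 1) + 1 = q"
    using p by (simp_all add: field_simps)
  \<comment> \<open>Truncation makes the integral finite, so that a factor of it can be cancelled.
    The bound obtained is independent of k and passes to the limit by monotone convergence.\<close>
  define V where "V k = U \<inter> {w. \<kappa> w \<le> real k}" for k :: nat
  have [measurable]: "V k \<in> sets borel" for k unfolding V_def by measurable
  define J where "J k = (\<integral>\<^sup>+w. ennreal (\<kappa> w powr q) * indicator (V k) w \<partial>lborel)" for k
  have Jle: "J k \<le> ennreal ((C / \<mu>) powr (1 / (p - 1)))" for k
  proof -
    have "J k \<le> (\<integral>\<^sup>+w. ennreal (real k powr q) * indicator (hartogs m n) w \<partial>lborel)"
      unfolding J_def using U(1) \<kappa>0 p by (intro nn_integral_mono) (auto simp: V_def indicator_def intro!: ennreal_leI powr_mono2)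
    also have "\<dots> = ennreal (real k powr q) * emeasure lborel (hartogs m n)"
      by (rule nn_integral_cmult_indicator) (simp add: hartogs_measurable)
    also have "\<dots> < \<infinity>" using hartogs_finite_measure[OF m n] by (simp add: ennreal_mult_less_top)
    finally obtain j where j: "J k = ennreal j" "0 \<le> j" by (cases "J k") auto
    let ?f = "\<lambda>w. \<kappa> w powr (q - 1) * indicator (V k) w"
    have fp: "(\<integral>\<^sup>+w. ennreal (?f w powr p) \<partial>lborel) = ennreal j"
    proof -
      have "ennreal (?f w powr p) = ennreal (\<kappa> w powr q) * indicator (V k) w" for w
        using \<kappa>0[of w] qp p by (auto simp: indicator_def powr_powr)
      then show ?thesis using j by (simp add: J_def)
    qed
    have "(\<integral>\<^sup>+z. ennreal (j powr p) * indicator E z \<partial>lborel) \<le> ennreal C * (\<integral>\<^sup>+w. ennreal (?f w powr p) \<partial>lborel)"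
    proof (rule C(2))
      show "?f \<in> borel_measurable borel" by measurable
      show "(\<integral>\<^sup>+w. ennreal (?f w powr p) \<partial>lborel) < \<infinity>" unfolding fp by simp
      fix z assume z: "z \<in> E"
      have "ennreal j = J k" by (simp add: j)
      also have "\<dots> \<le> (\<integral>\<^sup>+w. ennreal (S_plus_kernel m n a b c z w * ?f w) \<partial>lborel)"
        unfolding J_def
      proof (rule nn_integral_mono)
        fix w
        show "ennreal (\<kappa> w powr q) * indicator (V k) w \<le> ennreal (S_plus_kernel m n a b c z w * ?f w)"
        proof (cases "w \<in> V k")
          case True
          then have "\<kappa> w \<le> S_plus_kernel m n a b c z w" using \<kappa>[OF z] by (simp add: V_def)
          moreover have "\<kappa> w powr q = \<kappa> w * \<kappa> w powr (q - 1)"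
            using \<kappa>0[of w] powr_add[of "\<kappa> w" "q - 1" 1] by simp
          ultimately have "\<kappa> w powr q \<le> S_plus_kernel m n a b c z w * \<kappa> w powr (q - 1)"
            by (simp add: mult_right_mono)
          then show ?thesis using True by (simp add: ennreal_leI)
        qed simp
      qed
      finally show "0 \<le> j \<and> ennreal j \<le> (\<integral>\<^sup>+w. ennreal (S_plus_kernel m n a b c z w * ?f w) \<partial>lborel)" using j by simp
    qed (use E(1) U(1) in \<open>auto simp: indicator_def V_def\<close>)
    then have "ennreal (j powr p * \<mu>) \<le> ennreal (C * j)"
      using E(2) \<mu> C(1) j by (simp add: fp nn_integral_cmult_indicator ennreal_mult)
    then have le: "j powr p * \<mu> \<le> C * j" using C(1) j by simp
    have "j \<le> (C / \<mu>) powr (1 / (p - 1))"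
    proof (cases "j = 0")
      case False
      then have j0: "0 < j" using j by simp
      have "j powr p = j powr (p - 1) * j" using j0 powr_add[of j "p - 1" 1] by simp
      then have "j powr (p - 1) * \<mu> \<le> C" using le j0 by (simp add: mult.assoc mult.left_commute)
      then have "j powr (p - 1) \<le> C / \<mu>" using \<mu> by (simp add: pos_le_divide_eq)
      then have "(j powr (p - 1)) powr (1 / (p - 1)) \<le> (C / \<mu>) powr (1 / (p - 1))"
        using p by (intro powr_mono2) auto
      then show ?thesis using p j0 by (simp add: powr_powr)
    qed simp
    then show ?thesis by (simp add: j ennreal_leI)
  qed
  have "(\<integral>\<^sup>+w. ennreal (\<kappa> w powr q) * indicator U w \<partial>lborel) = (\<integral>\<^sup>+w. (SUP k. ennreal (\<kappa> w powr q) * indicator (V k) w) \<partial>lborel)"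
  proof (rule nn_integral_cong)
    fix w
    show "ennreal (\<kappa> w powr q) * indicator U w = (SUP k. ennreal (\<kappa> w powr q) * indicator (V k) w)"
    proof (rule antisym)
      obtain k :: nat where "\<kappa> w \<le> real k" using real_arch_simple by blast
      then have "ennreal (\<kappa> w powr q) * indicator U w = ennreal (\<kappa> w powr q) * indicator (V k) w"
        by (simp add: V_def indicator_def)
      also have "\<dots> \<le> (SUP k. ennreal (\<kappa> w powr q) * indicator (V k) w)" by (rule SUP_upper) simp
      finally show "ennreal (\<kappa> w powr q) * indicator U w \<le> (SUP k. ennreal (\<kappa> w powr q) * indicator (V k) w)" .
      show "(SUP k. ennreal (\<kappa> w powr q) * indicator (V k) w) \<le> ennreal (\<kappa> w powr q) * indicator U w"
        by (rule SUP_least) (auto simp: V_def indicator_def)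
    qed
  qed
  also have "\<dots> = (SUP k. J k)"
    unfolding J_def
    by (intro nn_integral_monotone_convergence_SUP) (auto simp: incseq_def le_fun_def V_def indicator_def)
  also have "\<dots> \<le> ennreal ((C / \<mu>) powr (1 / (p - 1)))" by (rule SUP_least) (rule Jle)
  also have "\<dots> < \<infinity>" by simp
  finally show ?thesis .
qed

section \<open>Lower bounds for the kernel\<close>

text \<open>For fixed r the index condition is a congruence modulo m, and two solutions in 1..m
  differ by less than m.\<close>

lemma bk_idx_unique_left:
  assumes "(r, l) \<in> bk_idx m n" "(r, l') \<in> bk_idx m n"
  shows "l = l'"
proof -
  have "l = l'" if "l \<le> l'" "(r, l) \<in> bk_idx m n" "(r, l') \<in> bk_idx m n" for l l'
  proof -
    have "m dvd (l' + n * (m - r)) - (l + n * (m - r))" using that by (intro dvd_diff_nat) (auto simp: bk_idx_def)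
    then have "m dvd l' - l" by simp
    moreover have "l' - l < m" using that by (auto simp: bk_idx_def)
    ultimately show ?thesis using that(1) by (auto dest: dvd_imp_le)
  qed
  then show ?thesis using assms by (metis nat_le_linear)
qed

text \<open>Coprimality makes n invertible modulo m, so n r determines r.\<close>

lemma bk_idx_unique_right:
  assumes "coprime m n" "(r, l) \<in> bk_idx m n" "(r', l) \<in> bk_idx m n"
  shows "r = r'"
proof -
  have "r = r'" if "r \<le> r'" "(r, l) \<in> bk_idx m n" "(r', l) \<in> bk_idx m n" for r r'
  proof -
    have "m dvd (l + n * (m - r)) - (l + n * (m - r'))" using that by (intro dvd_diff_nat) (auto simp: bk_idx_def)
    also have "(l + n * (m - r)) - (l + n * (m - r')) = n * (r' - r)"
      using that by (auto simp: bk_idx_def diff_mult_distrib2[symmetric])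
    finally have "m dvd r' - r" using assms(1) by (simp add: coprime_dvd_mult_right_iff)
    moreover have "r' - r < m" using that by (auto simp: bk_idx_def)
    ultimately show ?thesis using that(1) by (auto dest: dvd_imp_le)
  qed
  then show ?thesis using assms(2,3) by (metis nat_le_linear)
qed

text \<open>Supplies the monomial without p, responsible for the full pole at the origin. Its index
  r is the inverse of n modulo m.\<close>

lemma bk_idx_second:
  assumes m: "0 < m" and cop: "coprime m n"
  obtains r where "(r, 1) \<in> bk_idx m n"
proof -
  obtain u v :: int where uv: "u * int m + v * int n = 1"
    using bezout_int[of "int m" "int n"] cop by auto
  \<comment> \<open>By Bezout v n = 1 modulo m, so x = -v solves 1 + n x = 0 modulo m, and r = m - x
    is the index.\<close>
  define x where "x = nat ((- v) mod int m)"
  have x: "int x = (- v) mod int m" "x < m" using m by (simp_all add: x_def nat_less_iff)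
  have "int (1 + n * x) = 1 + int n * (- v - int m * ((- v) div int m))"
    by (simp add: x(1) minus_mult_div_eq_mod)
  also have "\<dots> = int m * (u - int n * ((- v) div int m))" using uv by (simp add: algebra_simps)
  finally have "int m dvd int (1 + n * x)" by simp
  then have "m dvd 1 + n * x" by (simp only: int_dvd_int_iff)
  then have "(m - x, 1) \<in> bk_idx m n" using x(2) by (simp add: bk_idx_def)
  then show thesis by (rule that)
qed

text \<open>Either u is so small that it perturbs r >= 1 by at most 1/2, or it has nonnegative real
  part and cannot cancel r.\<close>

lemma norm_residue_coef_ge:
  assumes "1 \<le> r" "real m * norm (u::complex) \<le> 1/2 \<or> 0 \<le> Re u"
  shows "1/2 \<le> norm (of_nat r + of_nat (m - r) * u)"
  using assms(2)
proof
  assume u: "real m * norm u \<le> 1/2"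
  have "norm (of_nat (m - r) * u) \<le> real m * norm u"
    unfolding norm_mult by (intro mult_right_mono) (auto simp del: of_nat_diff)
  moreover have "norm (of_nat r :: complex) - norm (of_nat (m - r) * u) \<le> norm (of_nat r + of_nat (m - r) * u)"
    by (rule norm_diff_ineq)
  moreover have "1 \<le> norm (of_nat r :: complex)" using assms(1) by simp
  ultimately show ?thesis using u by linarith
next
  assume u: "0 \<le> Re u"
  have "real r + real (m - r) * Re u = Re (of_nat r + of_nat (m - r) * u)" by (simp del: of_nat_diff)
  also have "\<dots> \<le> norm (of_nat r + of_nat (m - r) * u)" by (rule complex_Re_le_cmod)
  finally have "real r + real (m - r) * Re u \<le> norm (of_nat r + of_nat (m - r) * u)" .
  moreover have "0 \<le> real (m - r) * Re u" using u by (simp del: of_nat_diff)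
  moreover have "1 \<le> real r" using assms(1) by simp
  ultimately show ?thesis by linarith
qed

text \<open>One monomial against the rest: its two coefficients are at least 1/2 each, which gives
  1/4, and the others contribute at most m^2 terms with coefficients at most m^2.\<close>

lemma norm_bk_poly_ge:
  assumes ix: "(r0, l0) \<in> bk_idx m n" and v: "norm v \<le> 1" and p: "norm p \<le> 1" and e: "0 \<le> e"
    and small: "\<And>r l. (r, l) \<in> bk_idx m n \<Longrightarrow> (r, l) \<noteq> (r0, l0) \<Longrightarrow> norm (v ^ (r - 1) * p ^ (l - 1)) \<le> e"
    and A: "1/2 \<le> norm (of_nat r0 + of_nat (m - r0) * v ^ m)" and B: "1/2 \<le> norm (of_nat l0 + of_nat (m - l0) * p ^ m)"
  shows "1/4 * (norm v ^ (r0 - 1) * norm p ^ (l0 - 1)) - real m ^ 4 * e \<le> norm (bk_poly m n v p)"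
proof -
  let ?f = "\<lambda>(r,l). (of_nat r + of_nat (m - r) * v ^ m) * (of_nat l + of_nat (m - l) * p ^ m) * (v ^ (r - 1) * p ^ (l - 1))"
  let ?R = "sum ?f (bk_idx m n - {(r0, l0)})"
  have split: "bk_poly m n v p = ?f (r0, l0) + ?R"
    unfolding bk_poly_def using ix finite_bk_idx by (intro sum.remove) auto
  have "norm ?R \<le> (\<Sum>x\<in>bk_idx m n - {(r0, l0)}. real m * real m * e)"
  proof (rule sum_norm_le)
    fix x assume x: "x \<in> bk_idx m n - {(r0, l0)}"
    obtain r l where x': "x = (r, l)" by (cases x)
    have r: "r \<le> m" "l \<le> m" using x x' by (auto simp: bk_idx_def)
    have "norm (v ^ (r - 1) * p ^ (l - 1)) \<le> e" using small[of r l] x x' by auto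
    then show "norm (?f x) \<le> real m * real m * e"
      unfolding x' prod.case norm_mult[of "_ * _" "_ ^ _ * _"] norm_mult[of "of_nat r + _"]
      by (intro mult_mono norm_residue_coef_le r v p) auto
  qed
  also have "\<dots> = real (card (bk_idx m n - {(r0, l0)})) * (real m * real m * e)" by simp
  also have "\<dots> \<le> real (m * m) * (real m * real m * e)"
  proof -
    have "card (bk_idx m n - {(r0, l0)}) \<le> m * m"
      using card_bk_idx[of m n] card_mono[OF finite_bk_idx[of m n], of "bk_idx m n - {(r0, l0)}"] by auto
    then show ?thesis using e by (intro mult_right_mono of_nat_mono) auto
  qed
  also have "\<dots> = real m ^ 4 * e" by (simp add: power4_eq_xxxx)
  finally have R: "norm ?R \<le> real m ^ 4 * e" .
  have "1/2 * (1/2) * (norm v ^ (r0 - 1) * norm p ^ (l0 - 1)) \<le> norm (?f (r0, l0))"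
    unfolding prod.case norm_mult[of "_ * _" "_ ^ _ * _"] norm_mult[of "of_nat r0 + _"] norm_mult[of "v ^ _"] norm_power
    using A B by (intro mult_right_mono mult_mono) auto
  moreover have "norm (?f (r0, l0)) - norm ?R \<le> norm (bk_poly m n v p)" unfolding split by (rule norm_diff_ineq)
  ultimately show ?thesis using R by linarith
qed

text \<open>Both points are lifted to the cover. The factor |1 - v^m|^2 is replaced by its upper
  bound 4, since the lower bounds below need only the singularities in z2.\<close>

lemma norm_hk_ge_bk_poly:
  assumes z: "z \<in> hartogs m n" and w: "w \<in> hartogs m n" and m: "0 < m" and n: "0 < n"
  obtains v p where "norm v < 1" "p \<noteq> 0" "norm p < 1" "norm v ^ m = norm (hbase m n z) * norm (hbase m n w)"
    "p ^ m = snd z * cnj (snd w)" "norm p ^ (m + n - 1) = norm (snd z * cnj (snd w)) powr (real (m + n - 1) / real m)"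
    "norm (bk_poly m n v p) / (4 * pi\<^sup>2 * real m * norm p ^ (m + n - 1) * (norm (1 - p ^ m))\<^sup>2) \<le> norm (hk m n z w)"
proof -
  obtain x l where x: "norm x < 1" "l \<noteq> 0" "norm l < 1" and z': "z = hmap m n (x, l)"
    by (rule hartogs_lift[OF z m n]) (rule that)
  obtain y k where y: "norm y < 1" "k \<noteq> 0" "norm k < 1" and w': "w = hmap m n (y, k)"
    by (rule hartogs_lift[OF w m n]) (rule that)
  let ?v = "x * cnj y" and ?p = "l * cnj k"
  have xy: "norm x * norm y < 1" using mult_strict_mono[of "norm x" 1 "norm y" 1] x y by simp
  have lk: "norm l * norm k < 1" using mult_strict_mono[of "norm l" 1 "norm k" 1] x y by simp
  show thesis
  proof (rule that[of ?v ?p])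
    show v: "norm ?v < 1" and p0: "?p \<noteq> 0" and p: "norm ?p < 1" using x y xy lk by (auto simp: norm_mult)
    show "norm ?v ^ m = norm (hbase m n z) * norm (hbase m n w)"
      using x y by (simp add: z' w' hbase_hmap[OF m] norm_mult norm_power power_mult_distrib)
    show pm: "?p ^ m = snd z * cnj (snd w)" by (simp add: z' w' hmap_def power_mult_distrib)
    have "norm (snd z * cnj (snd w)) = norm ?p powr real m"
      unfolding pm[symmetric] norm_power by (rule powr_realpow[symmetric]) (use p0 in \<open>simp only: zero_less_norm_iff not_False_eq_True\<close>)
    then have "norm (snd z * cnj (snd w)) powr (real (m + n - 1) / real m) = norm ?p powr (real m * (real (m + n - 1) / real m))"
      by (simp only: powr_powr)
    also have "\<dots> = norm ?p ^ (m + n - 1)"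
    proof -
      have "real m * (real (m + n - 1) / real m) = real (m + n - 1)" using m by (simp del: of_nat_diff)
      then show ?thesis using powr_realpow[of "norm ?p" "m + n - 1"] p0 by (simp only: zero_less_norm_iff not_False_eq_True)
    qed
    finally show "norm ?p ^ (m + n - 1) = norm (snd z * cnj (snd w)) powr (real (m + n - 1) / real m)" ..
    have pow: "norm (c ^ m) < 1" if "norm c < 1" for c :: complex using that m by (simp add: norm_power power_less_one_iff)
    note vm = pow[OF v] and pm1 = pow[OF p]
    have "norm (1 - ?v ^ m) \<le> 2" using norm_triangle_ineq4[of 1 "?v ^ m"] vm by simp
    then have "(norm (1 - ?v ^ m))\<^sup>2 \<le> 2\<^sup>2" by (intro power_mono) auto
    then have 4: "(norm (1 - ?v ^ m))\<^sup>2 \<le> 4" by simp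
    have ne: "norm (1 - ?v ^ m) \<noteq> 0" "norm (1 - ?p ^ m) \<noteq> 0" using vm pm1 by auto
    let ?A = "pi\<^sup>2 * real m * norm ?p ^ (m + n - 1)" and ?B = "(norm (1 - ?p ^ m))\<^sup>2"
    have A: "0 < ?A" using m p0 by (intro mult_pos_pos zero_less_power) auto
    have B: "0 < ?B" "0 < (norm (1 - ?v ^ m))\<^sup>2" using ne by auto
    have "norm (bk_poly m n ?v ?p) / (4 * pi\<^sup>2 * real m * norm ?p ^ (m + n - 1) * ?B)
        \<le> norm (bk_poly m n ?v ?p) / (?A * (norm (1 - ?v ^ m))\<^sup>2 * ?B)"
    proof (rule divide_left_mono)
      have "?A * (norm (1 - ?v ^ m))\<^sup>2 * ?B \<le> ?A * 4 * ?B"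
        using 4 A B by (intro mult_right_mono mult_left_mono) auto
      then show "?A * (norm (1 - ?v ^ m))\<^sup>2 * ?B \<le> 4 * pi\<^sup>2 * real m * norm ?p ^ (m + n - 1) * ?B" by (simp only: mult_ac)
      have "0 < (4 * ?A * ?B) * (?A * (norm (1 - ?v ^ m))\<^sup>2 * ?B)" by (intro A B mult_pos_pos) simp
      then show "0 < (4 * pi\<^sup>2 * real m * norm ?p ^ (m + n - 1) * ?B) * (?A * (norm (1 - ?v ^ m))\<^sup>2 * ?B)"
        by (simp only: mult_ac)
    qed simp
    also have "\<dots> = norm (hk m n z w)"
      unfolding z' w' hk_hmap[OF m n x y] norm_divide norm_mult[of "of_real (pi\<^sup>2) * of_nat m * ?p ^ (m + n - 1) * _"]
        norm_mult[of "of_real (pi\<^sup>2) * of_nat m * ?p ^ (m + n - 1)"] norm_mult[of "of_real (pi\<^sup>2) * of_nat m"]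
        norm_mult[of "of_real (pi\<^sup>2)"] norm_power norm_of_nat norm_of_real by simp
    finally show "norm (bk_poly m n ?v ?p) / (4 * pi\<^sup>2 * real m * norm ?p ^ (m + n - 1) * ?B) \<le> norm (hk m n z w)" .
  qed
qed

text \<open>For small v the monomial with r = 1 dominates. It is at least |p|^m >= \<tau>, so its
  share is \<tau>/4; the smallness of the \<open>hbase\<close> product makes m^4 |v| <= \<tau>/8,
  and \<tau>/8 survives. Division by 4 pi^2 m yields the constant 32. The alternative
  \<open>t'\<close> keeps the p-coefficient of this monomial away from 0.\<close>

lemma norm_hk_ge_edge:
  assumes m: "0 < m" and n: "0 < n" and \<tau>: "0 < \<tau>" "\<tau> \<le> 1"
    and z: "z \<in> hartogs m n" and w: "w \<in> hartogs m n"
    and h: "norm (hbase m n z) * norm (hbase m n w) \<le> (\<tau> / (8 * real m ^ 4)) ^ m"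
    and t: "\<tau> \<le> norm (snd z * cnj (snd w))"
    and t': "real m * norm (snd z * cnj (snd w)) \<le> 1/2 \<or> 0 \<le> Re (snd z * cnj (snd w))"
  shows "\<tau> / (32 * pi\<^sup>2 * real m) / (norm (1 - snd z * cnj (snd w)))\<^sup>2 \<le> norm (hk m n z w)"
proof -
  obtain v p where v: "norm v < 1" and p: "p \<noteq> 0" "norm p < 1" and vm: "norm v ^ m = norm (hbase m n z) * norm (hbase m n w)"
    and pm: "p ^ m = snd z * cnj (snd w)"
    and le: "norm (bk_poly m n v p) / (4 * pi\<^sup>2 * real m * norm p ^ (m + n - 1) * (norm (1 - p ^ m))\<^sup>2) \<le> norm (hk m n z w)"
    by (rule norm_hk_ge_bk_poly[OF z w m n]) (rule that)
  obtain q where q: "(1, q) \<in> bk_idx m n" by (rule bk_idx_first[OF m]) (rule that)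
  have m4: "1 \<le> real m ^ 4" "real m \<le> real m ^ 4" using m by (auto intro!: one_le_power self_le_power)
  have m4': "0 < real m ^ 4" using m by simp
  have v0: "norm v \<le> \<tau> / (8 * real m ^ 4)"
    by (rule power_le_imp_le_base[of _ "m - 1"]) (use h vm \<tau> m4' m in auto)
  then have mv: "real m ^ 4 * norm v \<le> \<tau> / 8" using m4' by (simp add: field_simps)
  have "real m * norm (v ^ m) \<le> real m ^ 4 * norm v"
    unfolding norm_power using v m m4 power_decreasing[of 1 m "norm v"] by (intro mult_mono) auto
  then have cv: "real m * norm (v ^ m) \<le> 1/2" using mv \<tau> by linarith
  have p1: "norm (p ^ m) < 1" using p m by (simp add: norm_power power_less_one_iff)
  have "norm (p ^ m) \<le> norm p ^ (q - 1)"
    unfolding norm_power using p q by (intro power_decreasing) (auto simp: bk_idx_def)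
  moreover have "1/4 * (norm v ^ (1 - 1) * norm p ^ (q - 1)) - real m ^ 4 * norm v \<le> norm (bk_poly m n v p)"
  proof (rule norm_bk_poly_ge[OF q])
    show "norm (v ^ (r - 1) * p ^ (l - 1)) \<le> norm v" if rl: "(r, l) \<in> bk_idx m n" "(r, l) \<noteq> (1, q)" for r l
    proof -
      have "r \<noteq> 1" using bk_idx_unique_left q rl by blast
      then have "norm v ^ (r - 1) \<le> norm v ^ 1" using rl v by (intro power_decreasing) (auto simp: bk_idx_def)
      then have "norm v ^ (r - 1) * norm p ^ (l - 1) \<le> norm v * 1"
        using p by (intro mult_mono power_le_one) auto
      then show ?thesis by (simp add: norm_mult norm_power)
    qed
    show "1/2 \<le> norm (of_nat q + of_nat (m - q) * p ^ m)" using q t'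
      by (intro norm_residue_coef_ge) (auto simp: bk_idx_def pm)
    show "1/2 \<le> norm (of_nat 1 + of_nat (m - 1) * v ^ m)" by (intro norm_residue_coef_ge disjI1 cv) simp
  qed (use v p in auto)
  ultimately have poly: "\<tau> / 8 \<le> norm (bk_poly m n v p)" using mv t unfolding pm by simp
  have d: "0 < norm (1 - p ^ m)" using p1 by auto
  have pN: "0 < norm p ^ (m + n - 1)" "norm p ^ (m + n - 1) \<le> 1" using p by (auto intro!: power_le_one)
  have "\<tau> / (32 * pi\<^sup>2 * real m) / (norm (1 - p ^ m))\<^sup>2 = (\<tau> / 8) / (4 * pi\<^sup>2 * real m * 1 * (norm (1 - p ^ m))\<^sup>2)" by simp
  also have "\<dots> \<le> norm (bk_poly m n v p) / (4 * pi\<^sup>2 * real m * norm p ^ (m + n - 1) * (norm (1 - p ^ m))\<^sup>2)"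
    using pN d m \<tau> poly by (intro frac_le mult_right_mono mult_left_mono) auto
  also note le
  finally show ?thesis unfolding pm .
qed

text \<open>The mirror image of the edge estimate: for small p the monomial with l = 1 dominates,
  provided v stays away from 0. It carries no power of p, so the whole factor |p|^(-(m+n-1))
  survives. The constant 128 is 8 times 4 times the bound 4 on |1 - p^m|^2.\<close>

lemma norm_hk_ge_origin:
  assumes m: "0 < m" and n: "0 < n" and cop: "coprime m n" and u: "0 < u"
    and z: "z \<in> hartogs m n" and w: "w \<in> hartogs m n"
    and h: "u \<le> norm (hbase m n z) * norm (hbase m n w)" "real m * (norm (hbase m n z) * norm (hbase m n w)) \<le> 1/2"
    and t: "norm (snd z * cnj (snd w)) \<le> (u / (8 * real m ^ 4)) ^ m"
  shows "u / (128 * pi\<^sup>2 * real m) * norm (snd z * cnj (snd w)) powr (- (real (m + n - 1) / real m)) \<le> norm (hk m n z w)"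
proof -
  obtain v p where v: "norm v < 1" and p: "p \<noteq> 0" "norm p < 1" and vm: "norm v ^ m = norm (hbase m n z) * norm (hbase m n w)"
    and pm: "p ^ m = snd z * cnj (snd w)" and pN: "norm p ^ (m + n - 1) = norm (snd z * cnj (snd w)) powr (real (m + n - 1) / real m)"
    and le: "norm (bk_poly m n v p) / (4 * pi\<^sup>2 * real m * norm p ^ (m + n - 1) * (norm (1 - p ^ m))\<^sup>2) \<le> norm (hk m n z w)"
    by (rule norm_hk_ge_bk_poly[OF z w m n]) (rule that)
  obtain q where q: "(q, 1) \<in> bk_idx m n" by (rule bk_idx_second[OF m cop]) (rule that)
  have m4: "1 \<le> real m ^ 4" "real m \<le> real m ^ 4" using m by (auto intro!: one_le_power self_le_power)
  have m4': "0 < real m ^ 4" using m by simp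
  have "norm v ^ m < 1" using v m by (simp add: power_less_one_iff)
  then have u1: "u \<le> 1" using h vm by simp
  have p0: "norm p \<le> u / (8 * real m ^ 4)"
    by (rule power_le_imp_le_base[of _ "m - 1"]) (use t pm[symmetric] u m4' m in \<open>auto simp: norm_power\<close>)
  then have mp: "real m ^ 4 * norm p \<le> u / 8" using m4' by (simp add: field_simps)
  have "real m * norm (p ^ m) \<le> real m ^ 4 * norm p"
    unfolding norm_power using p m m4 power_decreasing[of 1 m "norm p"] by (intro mult_mono) auto
  then have cp: "real m * norm (p ^ m) \<le> 1/2" using mp u1 by linarith
  have cv: "real m * norm (v ^ m) \<le> 1/2" using h vm by (simp add: norm_power)
  have "norm v ^ m \<le> norm v ^ (q - 1)"
    using v q by (intro power_decreasing) (auto simp: bk_idx_def)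
  moreover have "1/4 * (norm v ^ (q - 1) * norm p ^ (1 - 1)) - real m ^ 4 * norm p \<le> norm (bk_poly m n v p)"
  proof (rule norm_bk_poly_ge[OF q])
    show "norm (v ^ (r - 1) * p ^ (l - 1)) \<le> norm p" if rl: "(r, l) \<in> bk_idx m n" "(r, l) \<noteq> (q, 1)" for r l
    proof -
      have "l \<noteq> 1" using bk_idx_unique_right[OF cop] q rl by blast
      then have "norm p ^ (l - 1) \<le> norm p ^ 1" using rl p by (intro power_decreasing) (auto simp: bk_idx_def)
      then have "norm v ^ (r - 1) * norm p ^ (l - 1) \<le> 1 * norm p"
        using v by (intro mult_mono power_le_one) auto
      then show ?thesis by (simp add: norm_mult norm_power)
    qed
    show "1/2 \<le> norm (of_nat q + of_nat (m - q) * v ^ m)" using q cv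
      by (intro norm_residue_coef_ge) (auto simp: bk_idx_def)
    show "1/2 \<le> norm (of_nat 1 + of_nat (m - 1) * p ^ m)" by (intro norm_residue_coef_ge disjI1 cp) simp
  qed (use v p in auto)
  ultimately have poly: "u / 8 \<le> norm (bk_poly m n v p)" using mp h vm by simp
  have p1: "norm (p ^ m) < 1" using p m by (simp add: norm_power power_less_one_iff)
  then have d: "0 < norm (1 - p ^ m)" by auto
  have "norm (1 - p ^ m) \<le> 2" using norm_triangle_ineq4[of 1 "p ^ m"] p1 by simp
  then have "(norm (1 - p ^ m))\<^sup>2 \<le> 2\<^sup>2" by (intro power_mono) auto
  then have 4: "(norm (1 - p ^ m))\<^sup>2 \<le> 4" by simp
  have "u / (128 * pi\<^sup>2 * real m) * norm (snd z * cnj (snd w)) powr (- (real (m + n - 1) / real m))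
      = (u / 8) / (4 * pi\<^sup>2 * real m * norm p ^ (m + n - 1) * 4)"
    unfolding pN powr_minus by (simp add: field_simps)
  also have "\<dots> \<le> norm (bk_poly m n v p) / (4 * pi\<^sup>2 * real m * norm p ^ (m + n - 1) * (norm (1 - p ^ m))\<^sup>2)"
    using p d m u poly 4 by (intro frac_le mult_left_mono mult_pos_pos zero_less_power) auto
  also note le
  finally show ?thesis .
qed

section \<open>The weights on test regions\<close>

definition hartogs_annulus :: "nat \<Rightarrow> nat \<Rightarrow> real \<Rightarrow> real \<Rightarrow> real \<Rightarrow> real \<Rightarrow> (complex \<times> complex) set" where
  "hartogs_annulus m n \<alpha>1 \<alpha>2 \<beta>1 \<beta>2 =
     {z \<in> hartogs m n. norm (hbase m n z) \<in> {\<alpha>1..\<alpha>2} \<and> norm (snd z) \<in> {\<beta>1..\<beta>2}}"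

lemma hartogs_annulus_subset: "hartogs_annulus m n \<alpha>1 \<alpha>2 \<beta>1 \<beta>2 \<subseteq> hartogs m n"
  by (auto simp: hartogs_annulus_def)

lemma hartogs_annulus_eq: "indicator (hartogs_annulus m n \<alpha>1 \<alpha>2 \<beta>1 \<beta>2) z
    = indicator {\<alpha>1..\<alpha>2} (norm (hbase m n z)) * indicator {\<beta>1..\<beta>2} (norm (snd z)) * (indicator (hartogs m n) z :: ennreal)"
  by (auto simp: hartogs_annulus_def indicator_def)

lemma hartogs_annulus_measurable[measurable]: "hartogs_annulus m n \<alpha>1 \<alpha>2 \<beta>1 \<beta>2 \<in> sets borel"
proof -
  have "hartogs_annulus m n \<alpha>1 \<alpha>2 \<beta>1 \<beta>2 = hartogs m n \<inter> ((\<lambda>z. norm (hbase m n z)) -` {\<alpha>1..\<alpha>2} \<inter> space borel)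
      \<inter> ((\<lambda>z. norm (snd z)) -` {\<beta>1..\<beta>2} \<inter> space borel)"
    by (auto simp: hartogs_annulus_def)
  also have "\<dots> \<in> sets borel"
    by (intro sets.Int hartogs_measurable measurable_sets[where A=borel and M=borel]) measurable
  finally show ?thesis .
qed

text \<open>The minimum serves both signs of the exponent, so two-sided bounds on a quantity give a
  lower bound for any real power of it.\<close>

lemma powr_between:
  fixes A B X h e :: real
  assumes "0 < A" "A \<le> B" "0 < X" "A * X \<le> h" "h \<le> B * X"
  shows "min (A powr e) (B powr e) * X powr e \<le> h powr e"
proof (cases "0 \<le> e")
  case True
  have "min (A powr e) (B powr e) * X powr e \<le> (A * X) powr e"
    unfolding powr_mult by (intro mult_right_mono) auto
  also have "\<dots> \<le> h powr e" using assms True by (intro powr_mono2) auto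
  finally show ?thesis .
next
  case False
  have h: "0 < h" using assms by (meson less_le_trans mult_pos_pos)
  have "min (A powr e) (B powr e) * X powr e \<le> (B * X) powr e"
    unfolding powr_mult by (intro mult_right_mono) auto
  also have "\<dots> \<le> h powr e" using assms False h by (intro powr_mono2') auto
  finally show ?thesis .
qed

text \<open>The monomial with l = 1 shows that away from \<open>hbase\<close> = 0 the pole of
  \<open>hsize\<close> has the full order of the upper bound in \<open>hsize_bounds\<close>. This is
  why the test regions at the origin keep \<open>hbase\<close> away from 0.\<close>

lemma hsize_ge:
  assumes z: "z \<in> hartogs m n" and m: "0 < m" and n: "0 < n" and cop: "coprime m n"
  shows "(norm (hbase m n z))\<^sup>2 / (pi\<^sup>2 * real m) * norm (snd z) powr (- (real (2 * (m + n - 1)) / real m)) \<le> hsize m n z"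
proof -
  obtain x l where x: "norm x < 1" "l \<noteq> 0" "norm l < 1" and z': "z = hmap m n (x, l)"
    by (rule hartogs_lift[OF z m n]) (rule that)
  obtain q where q: "(q, 1) \<in> bk_idx m n" by (rule bk_idx_second[OF m cop]) (rule that)
  have "(norm (hbase m n z))\<^sup>2 = (norm x ^ 2) ^ m"
    using x by (simp add: z' hbase_hmap[OF m] norm_power power_mult[symmetric] mult.commute)
  also have "\<dots> \<le> (norm x ^ 2) ^ (q - 1)"
    using x q by (intro power_decreasing power_le_one) (auto simp: bk_idx_def)
  also have "\<dots> \<le> bkr m n ((norm x)\<^sup>2) ((norm l)\<^sup>2)" using bkr_ge[OF q, of "(norm x)\<^sup>2" "(norm l)\<^sup>2"] by simp
  finally have "(norm (hbase m n z))\<^sup>2 / (pi\<^sup>2 * real m) * (1 / norm l ^ (2 * (m + n - 1)))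
      \<le> bkr m n ((norm x)\<^sup>2) ((norm l)\<^sup>2) / (pi\<^sup>2 * real m) * (1 / norm l ^ (2 * (m + n - 1)))"
    by (intro mult_right_mono divide_right_mono) auto
  then show ?thesis
    unfolding z' hk_diag[OF m n x] norm_snd_hmap_powr[OF m x(2)] by simp
qed

lemma hdist_between:
  assumes z: "z \<in> hartogs m n" and m: "0 < m" and n: "0 < n" and a: "norm (hbase m n z) \<le> \<alpha>"
  shows "(1 - \<alpha>\<^sup>2) * (1 - (norm (snd z))\<^sup>2) \<le> hdist m n z" "hdist m n z \<le> 1 * (1 - (norm (snd z))\<^sup>2)"
    "0 < 1 - (norm (snd z))\<^sup>2"
proof -
  show s: "0 < 1 - (norm (snd z))\<^sup>2" using hartogs_snd[OF z n] by (simp add: abs_square_less_1)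
  have "(norm (hbase m n z))\<^sup>2 \<le> \<alpha>\<^sup>2" using a by (intro power_mono) auto
  then show "(1 - \<alpha>\<^sup>2) * (1 - (norm (snd z))\<^sup>2) \<le> hdist m n z" "hdist m n z \<le> 1 * (1 - (norm (snd z))\<^sup>2)"
    unfolding hdist_def using s by (auto intro!: mult_right_mono)
qed

text \<open>Away from z2 = 0 and from |\<open>hbase\<close>| = 1, \<open>hsize\<close> lies between
  positive constants and \<open>hdist\<close> is comparable to 1 - |z2|^2.\<close>

lemma weight_ge_edge:
  assumes m: "0 < m" and n: "0 < n" and \<alpha>: "0 \<le> \<alpha>2" "\<alpha>2 < 1" and \<beta>: "0 < \<beta>1"
  obtains d where "0 < d" "\<And>z. z \<in> hartogs_annulus m n \<alpha>1 \<alpha>2 \<beta>1 \<beta>2 \<Longrightarrow>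
    d * (1 - (norm (snd z))\<^sup>2) powr e \<le> hsize m n z powr (- e / 2) * hdist m n z powr e"
proof -
  define \<kappa> where "\<kappa> = real (2 * (m + n - 1)) / real m"
  define A where "A = 1 / (pi\<^sup>2 * real m)"
  define B where "B = max A (real m ^ 3 / pi\<^sup>2 * \<beta>1 powr (- \<kappa>))"
  define d1 where "d1 = min (A powr (- e / 2)) (B powr (- e / 2))"
  define d2 where "d2 = min ((1 - \<alpha>2\<^sup>2) powr e) (1 powr e)"
  have A: "0 < A" "A \<le> B" using m by (auto simp: A_def B_def)
  have a2: "0 < 1 - \<alpha>2\<^sup>2" using \<alpha> by (simp add: abs_square_less_1)
  show thesis
  proof (rule that[of "d1 * d2"])
    show "0 < d1 * d2" using A a2 by (auto simp: d1_def d2_def)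
    fix z assume "z \<in> hartogs_annulus m n \<alpha>1 \<alpha>2 \<beta>1 \<beta>2"
    then have z: "z \<in> hartogs m n" "norm (hbase m n z) \<le> \<alpha>2" "\<beta>1 \<le> norm (snd z)" by (auto simp: hartogs_annulus_def)
    have "hsize m n z \<le> real m ^ 3 / pi\<^sup>2 * norm (snd z) powr (- \<kappa>)" using hsize_bounds(2)[OF z(1) m n] by (simp only: \<kappa>_def)
    also have "\<dots> \<le> real m ^ 3 / pi\<^sup>2 * \<beta>1 powr (- \<kappa>)"
      using z \<beta> by (intro mult_left_mono powr_mono2') (auto simp: \<kappa>_def simp del: of_nat_diff)
    finally have "hsize m n z \<le> B * 1" by (simp add: B_def)
    then have 1: "d1 * 1 powr (- e / 2) \<le> hsize m n z powr (- e / 2)"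
      unfolding d1_def using hsize_bounds(1)[OF z(1) m n] A by (intro powr_between) (auto simp: A_def)
    note h = hdist_between[OF z(1) m n z(2)]
    have 2: "d2 * (1 - (norm (snd z))\<^sup>2) powr e \<le> hdist m n z powr e"
      unfolding d2_def using h a2 by (intro powr_between) auto
    have "d1 * (d2 * (1 - (norm (snd z))\<^sup>2) powr e) \<le> hsize m n z powr (- e / 2) * hdist m n z powr e"
      using 1 2 A a2 by (intro mult_mono) (auto simp: d1_def d2_def)
    then show "d1 * d2 * (1 - (norm (snd z))\<^sup>2) powr e \<le> hsize m n z powr (- e / 2) * hdist m n z powr e" by (simp only: mult.assoc)
  qed
qed

lemma weight_ge_interior:
  assumes m: "0 < m" and n: "0 < n" and \<alpha>: "0 \<le> \<alpha>2" "\<alpha>2 < 1" and \<beta>: "0 < \<beta>1" "0 \<le> \<beta>2" "\<beta>2 < 1"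
  obtains d where "0 < d" "\<And>z. z \<in> hartogs_annulus m n \<alpha>1 \<alpha>2 \<beta>1 \<beta>2 \<Longrightarrow>
    d \<le> hsize m n z powr (- e / 2) * hdist m n z powr e"
proof -
  obtain d where d: "0 < d" "\<And>z. z \<in> hartogs_annulus m n \<alpha>1 \<alpha>2 \<beta>1 \<beta>2 \<Longrightarrow>
    d * (1 - (norm (snd z))\<^sup>2) powr e \<le> hsize m n z powr (- e / 2) * hdist m n z powr e"
    by (rule weight_ge_edge[OF m n \<alpha> \<beta>(1)]) (rule that)
  define d2 where "d2 = min ((1 - \<beta>2\<^sup>2) powr e) (1 powr e)"
  have b2: "0 < 1 - \<beta>2\<^sup>2" using \<beta> by (simp add: abs_square_less_1)
  show thesis
  proof (rule that[of "d * d2"])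
    show "0 < d * d2" using b2 d(1) by (auto simp: d2_def)
    fix z assume z: "z \<in> hartogs_annulus m n \<alpha>1 \<alpha>2 \<beta>1 \<beta>2"
    then have "(norm (snd z))\<^sup>2 \<le> \<beta>2\<^sup>2" by (intro power_mono) (auto simp: hartogs_annulus_def)
    then have "d2 * 1 powr e \<le> (1 - (norm (snd z))\<^sup>2) powr e"
      unfolding d2_def using b2 by (intro powr_between) auto
    then have "d * d2 \<le> d * (1 - (norm (snd z))\<^sup>2) powr e" using d(1) by (intro mult_left_mono) auto
    also note d(2)[OF z]
    finally show "d * d2 \<le> hsize m n z powr (- e / 2) * hdist m n z powr e" .
  qed
qed

text \<open>On this region \<open>hdist\<close> lies between positive constants and
  \<open>hsize\<close> is comparable to |z2|^(-2(m+n-1)/m); the power -e/2 turns this into the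
  stated exponent.\<close>

lemma weight_ge_origin:
  assumes m: "0 < m" and n: "0 < n" and cop: "coprime m n" and \<alpha>: "0 < \<alpha>1" "\<alpha>1 \<le> \<alpha>2" "\<alpha>2 < 1" and \<beta>: "0 \<le> \<beta>2" "\<beta>2 < 1"
  obtains d where "0 < d" "\<And>z. z \<in> hartogs_annulus m n \<alpha>1 \<alpha>2 \<beta>1 \<beta>2 \<Longrightarrow>
    d * norm (snd z) powr (real (m + n - 1) / real m * e) \<le> hsize m n z powr (- e / 2) * hdist m n z powr e"
proof -
  define \<kappa> where "\<kappa> = real (2 * (m + n - 1)) / real m"
  define A where "A = \<alpha>1\<^sup>2 / (pi\<^sup>2 * real m)"
  define B where "B = max A (real m ^ 3 / pi\<^sup>2)"
  define d1 where "d1 = min (A powr (- e / 2)) (B powr (- e / 2))"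
  define d2 where "d2 = min (((1 - \<alpha>2\<^sup>2) * (1 - \<beta>2\<^sup>2)) powr e) (1 powr e)"
  have A: "0 < A" "A \<le> B" using m \<alpha> by (auto simp: A_def B_def)
  have a2: "0 < 1 - \<alpha>2\<^sup>2" "0 < 1 - \<beta>2\<^sup>2" using \<alpha> \<beta> by (simp_all add: abs_square_less_1)
  have ab: "0 < (1 - \<alpha>2\<^sup>2) * (1 - \<beta>2\<^sup>2)" "(1 - \<alpha>2\<^sup>2) * (1 - \<beta>2\<^sup>2) \<le> 1" using a2 by (auto intro!: mult_le_one)
  show thesis
  proof (rule that[of "d1 * d2"])
    show "0 < d1 * d2" unfolding d1_def d2_def using A ab by (intro mult_pos_pos) auto
    fix z assume "z \<in> hartogs_annulus m n \<alpha>1 \<alpha>2 \<beta>1 \<beta>2"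
    then have z: "z \<in> hartogs m n" "\<alpha>1 \<le> norm (hbase m n z)" "norm (hbase m n z) \<le> \<alpha>2" "norm (snd z) \<le> \<beta>2" by (auto simp: hartogs_annulus_def)
    let ?X = "norm (snd z) powr (- \<kappa>)"
    have z0: "snd z \<noteq> 0" by (rule hartogs_snd(1)[OF z(1) n])
    have "hsize m n z \<le> real m ^ 3 / pi\<^sup>2 * ?X" using hsize_bounds(2)[OF z(1) m n] by (simp only: \<kappa>_def)
    also have "\<dots> \<le> B * ?X" by (intro mult_right_mono) (auto simp: B_def)
    finally have u: "hsize m n z \<le> B * ?X" .
    have "A * ?X \<le> (norm (hbase m n z))\<^sup>2 / (pi\<^sup>2 * real m) * ?X"
      unfolding A_def using z \<alpha> by (intro mult_right_mono divide_right_mono power_mono) auto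
    also have "\<dots> \<le> hsize m n z" using hsize_ge[OF z(1) m n cop] by (simp only: \<kappa>_def)
    finally have l: "A * ?X \<le> hsize m n z" .
    have 1: "d1 * ?X powr (- e / 2) \<le> hsize m n z powr (- e / 2)"
      unfolding d1_def using u l A z0 by (intro powr_between) auto
    have X: "?X powr (- e / 2) = norm (snd z) powr (real (m + n - 1) / real m * e)"
      unfolding powr_powr \<kappa>_def of_nat_mult by (simp add: algebra_simps del: of_nat_diff)
    note h = hdist_between[OF z(1) m n z(3)]
    have "(norm (snd z))\<^sup>2 \<le> \<beta>2\<^sup>2" using z by (intro power_mono) auto
    then have "(1 - \<alpha>2\<^sup>2) * (1 - \<beta>2\<^sup>2) \<le> (1 - \<alpha>2\<^sup>2) * (1 - (norm (snd z))\<^sup>2)" using a2 by (intro mult_left_mono) auto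
    then have 2: "d2 * 1 powr e \<le> hdist m n z powr e"
      unfolding d2_def using h hdist_pos(2)[OF z(1) m n] ab by (intro powr_between) auto
    have "(d1 * ?X powr (- e / 2)) * (d2 * 1 powr e) \<le> hsize m n z powr (- e / 2) * hdist m n z powr e"
      by (intro mult_mono 1 2) (auto simp: d2_def)
    then show "d1 * d2 * norm (snd z) powr (real (m + n - 1) / real m * e) \<le> hsize m n z powr (- e / 2) * hdist m n z powr e"
      unfolding X by (simp add: mult_ac)
  qed
qed

section \<open>Necessity\<close>

text \<open>For integrands depending on |z2| alone the product formula reduces to one variable s =
  |z2|^2. The integral over \<open>hbase\<close> is the constant C, and C being nonzero lets
  divergence in s carry over to the triangle.\<close>

lemma nn_integral_hartogs_annulus:
  assumes m: "0 < m" and n: "0 < n" and \<alpha>: "0 \<le> \<alpha>1" "\<alpha>1 < \<alpha>2" "\<alpha>2 \<le> 1" and \<beta>: "0 \<le> \<beta>1" "0 \<le> \<beta>2"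
  obtains C where "C \<noteq> 0" "\<And>\<phi>. \<phi> \<in> borel_measurable borel \<Longrightarrow>
    (\<integral>\<^sup>+z. \<phi> ((norm (snd z))\<^sup>2) * indicator (hartogs_annulus m n \<alpha>1 \<alpha>2 \<beta>1 \<beta>2) z \<partial>lborel)
     = C * (\<integral>\<^sup>+s. \<phi> s * indicator {\<beta>1\<^sup>2..\<beta>2\<^sup>2} s * ennreal (s powr (real n / real m)) * indicator {0<..<1} s \<partial>lborel)"
proof -
  have sq: "(indicator {a..b} (norm y) :: ennreal) = indicator {a\<^sup>2..b\<^sup>2} ((norm y)\<^sup>2)" if "0 \<le> a" "0 \<le> b" for a b and y :: complex
    using that by (auto simp: indicator_def abs_le_square_iff[symmetric])
  have pw: "norm y powr (2 * e) = (norm y)\<^sup>2 powr e" for y :: complex and e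
    by (simp add: power2_eq_square powr_mult powr_add[symmetric])
  define J where "J = (\<integral>\<^sup>+s. indicator {\<alpha>1\<^sup>2..\<alpha>2\<^sup>2} s * ennreal (s powr (1 / real m - 1)) * indicator {0<..<1} s \<partial>lborel)"
  have J: "J \<noteq> 0"
  proof -
    have a2: "\<alpha>1\<^sup>2 < \<alpha>2\<^sup>2" "\<alpha>2\<^sup>2 \<le> 1" using \<alpha> by (auto intro!: power_strict_mono simp: abs_square_le_1)
    have "ennreal (\<alpha>2\<^sup>2 - \<alpha>1\<^sup>2) = (\<integral>\<^sup>+s. indicator {\<alpha>1\<^sup>2<..<\<alpha>2\<^sup>2} s \<partial>lborel)" using a2 by simp
    also have "\<dots> \<le> J"
      unfolding J_def
    proof (rule nn_integral_mono)
      fix s :: real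
      have "ennreal 1 \<le> ennreal (s powr (1 / real m - 1))" if "0 < s" "s < 1"
        using powr_mono'[of "1 / real m - 1" 0 s] that m by (intro ennreal_leI) simp
      then show "indicator {\<alpha>1\<^sup>2<..<\<alpha>2\<^sup>2} s \<le> indicator {\<alpha>1\<^sup>2..\<alpha>2\<^sup>2} s * ennreal (s powr (1 / real m - 1)) * indicator {0<..<1} s"
        using a2 by (auto simp: indicator_def dest: order_le_less_trans[OF zero_le_power2])
    qed
    finally show ?thesis using a2 by (auto simp: ennreal_eq_0_iff)
  qed
  show thesis
  proof (rule that[of "ennreal (1 / real m) * (ennreal pi * J) * ennreal pi"])
    show "ennreal (1 / real m) * (ennreal pi * J) * ennreal pi \<noteq> 0" using J m by (simp add: ennreal_eq_0_iff not_le)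
    fix \<phi> :: "real \<Rightarrow> ennreal" assume [measurable]: "\<phi> \<in> borel_measurable borel"
    have "(\<integral>\<^sup>+z. \<phi> ((norm (snd z))\<^sup>2) * indicator (hartogs_annulus m n \<alpha>1 \<alpha>2 \<beta>1 \<beta>2) z \<partial>lborel)
        = (\<integral>\<^sup>+z. indicator {\<alpha>1\<^sup>2..\<alpha>2\<^sup>2} ((norm (hbase m n z))\<^sup>2) * (\<phi> ((norm (snd z))\<^sup>2) * indicator {\<beta>1\<^sup>2..\<beta>2\<^sup>2} ((norm (snd z))\<^sup>2))
          * indicator (hartogs m n) z \<partial>lborel)"
      unfolding hartogs_annulus_eq using \<alpha> \<beta> by (intro nn_integral_cong) (simp add: sq mult_ac)
    also have "\<dots> = ennreal (1 / real m) * (\<integral>\<^sup>+y. indicator {\<alpha>1\<^sup>2..\<alpha>2\<^sup>2} ((norm (y::complex))\<^sup>2) * ennreal (norm y powr (2 / real m - 2)) * indicator (ball 0 1) y \<partial>lborel)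
       * (\<integral>\<^sup>+y. \<phi> ((norm (y::complex))\<^sup>2) * indicator {\<beta>1\<^sup>2..\<beta>2\<^sup>2} ((norm y)\<^sup>2) * ennreal (norm y powr (2 * real n / real m)) * indicator (ball 0 1) y \<partial>lborel)"
      by (rule nn_integral_hartogs_product[where f="\<lambda>y::complex. indicator {\<alpha>1\<^sup>2..\<alpha>2\<^sup>2} ((norm y)\<^sup>2)"
            and g="\<lambda>y::complex. \<phi> ((norm y)\<^sup>2) * indicator {\<beta>1\<^sup>2..\<beta>2\<^sup>2} ((norm y)\<^sup>2)", OF _ _ m n]) measurable
    also have "(\<integral>\<^sup>+y. indicator {\<alpha>1\<^sup>2..\<alpha>2\<^sup>2} ((norm (y::complex))\<^sup>2) * ennreal (norm y powr (2 / real m - 2)) * indicator (ball 0 1) y \<partial>lborel)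
       = ennreal pi * J"
    proof -
      have "2 / real m - 2 = 2 * (1 / real m - 1)" by simp
      then show ?thesis unfolding J_def
        by (simp only: pw) (rule nn_integral_disc_radial, measurable)
    qed
    also have "(\<integral>\<^sup>+y. \<phi> ((norm (y::complex))\<^sup>2) * indicator {\<beta>1\<^sup>2..\<beta>2\<^sup>2} ((norm y)\<^sup>2) * ennreal (norm y powr (2 * real n / real m)) * indicator (ball 0 1) y \<partial>lborel)
       = ennreal pi * (\<integral>\<^sup>+s. \<phi> s * indicator {\<beta>1\<^sup>2..\<beta>2\<^sup>2} s * ennreal (s powr (real n / real m)) * indicator {0<..<1} s \<partial>lborel)"
    proof -
      have "2 * real n / real m = 2 * (real n / real m)" by simp
      then show ?thesis
        by (simp only: pw) (rule nn_integral_disc_radial, measurable)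
    qed
    finally show "(\<integral>\<^sup>+z. \<phi> ((norm (snd z))\<^sup>2) * indicator (hartogs_annulus m n \<alpha>1 \<alpha>2 \<beta>1 \<beta>2) z \<partial>lborel)
      = ennreal (1 / real m) * (ennreal pi * J) * ennreal pi *
        (\<integral>\<^sup>+s. \<phi> s * indicator {\<beta>1\<^sup>2..\<beta>2\<^sup>2} s * ennreal (s powr (real n / real m)) * indicator {0<..<1} s \<partial>lborel)"
      by (simp only: mult_ac)
  qed
qed

lemma nn_integral_inverse_power_infinite:
  fixes K b e :: real
  assumes K: "0 < K" and b: "0 < b" "b \<le> 1" and e: "e \<le> -1"
  shows "(\<integral>\<^sup>+s. ennreal (K * s powr e) * indicator {0<..<b} s \<partial>lborel) = \<infinity>"
proof -
  let ?I = "\<integral>\<^sup>+s. ennreal (K * s powr e) * indicator {0<..<b} s \<partial>lborel"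
  have ge: "ennreal (K * real k) \<le> ?I" for k :: nat
  proof -
    \<comment> \<open>With this lower limit the integral of K/s over the interval from r to b is
      exactly K k.\<close>
    define r where "r = b * exp (- real k)"
    have r: "0 < r" "r \<le> b" using b by (auto simp: r_def)
    have "(\<integral>\<^sup>+s. ennreal (K / s) * indicator {r..b} s \<partial>lborel) = ennreal (K * ln b - K * ln r)"
      by (rule nn_integral_FTC_Icc[where F="\<lambda>s. K * ln s"])
        (use r K in \<open>auto intro!: derivative_eq_intros simp: has_real_derivative_iff_has_vector_derivative[symmetric]\<close>)
    also have "K * ln b - K * ln r = K * real k" using b by (simp add: r_def ln_mult algebra_simps)
    finally have "ennreal (K * real k) = (\<integral>\<^sup>+s. ennreal (K / s) * indicator {r..b} s \<partial>lborel)" ..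
    also have "\<dots> \<le> ?I"
    proof (rule nn_integral_mono_AE)
      have "AE s in lborel. s \<noteq> b" by (rule AE_lborel_singleton)
      then show "AE s in lborel. ennreal (K / s) * indicator {r..b} s \<le> ennreal (K * s powr e) * indicator {0<..<b} s"
      proof eventually_elim
        fix s assume s: "s \<noteq> b"
        have "K / s \<le> K * s powr e" if "r \<le> s" "s \<le> b"
          using powr_mono'[of e "-1" s] e r b K that by (auto simp: powr_minus divide_inverse powr_one)
        then show "ennreal (K / s) * indicator {r..b} s \<le> ennreal (K * s powr e) * indicator {0<..<b} s"
          using r s by (auto simp: indicator_def ennreal_leI)
      qed
    qed
    finally show ?thesis .
  qed
  show ?thesis
  proof (rule ccontr)
    assume "?I \<noteq> \<infinity>"
    then obtain x where x: "?I = ennreal x" "0 \<le> x" by (cases ?I) auto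
    obtain k :: nat where "x / K < real k" using reals_Archimedean2 by blast
    then have "x < K * real k" using K by (simp add: field_simps)
    then show False using ge[of k] x K by (simp add: ennreal_le_iff)
  qed
qed

lemma nn_integral_inverse_power_infinite_edge:
  fixes K b e :: real
  assumes K: "0 < K" and b: "0 \<le> b" "b < 1" and e: "e \<le> -1"
  shows "(\<integral>\<^sup>+s. ennreal (K * (1 - s) powr e) * indicator {b<..<1} s \<partial>lborel) = \<infinity>"
proof -
  let ?h = "\<lambda>q. ennreal (K * q powr e) * indicator {0<..<1 - b} q"
  have "(\<integral>\<^sup>+s. ennreal (K * (1 - s) powr e) * indicator {b<..<1} s \<partial>lborel) = (\<integral>\<^sup>+s. ?h (1 + - s) \<partial>lborel)"
    by (intro nn_integral_cong) (auto simp: indicator_def)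
  also have "\<dots> = (\<integral>\<^sup>+s. ?h (1 + s) \<partial>lborel)"
    by (rule nn_integral_lborel_uminus[where f="\<lambda>s. ?h (1 + s)"]) measurable
  also have "\<dots> = (\<integral>\<^sup>+q. ?h q \<partial>lborel)" by (rule nn_integral_lborel_plus) measurable
  also have "\<dots> = \<infinity>" by (rule nn_integral_inverse_power_infinite) (use assms in auto)
  finally show ?thesis .
qed

lemma emeasure_hartogs_annulus_nonzero:
  assumes m: "0 < m" and n: "0 < n" and \<alpha>: "0 \<le> \<alpha>1" "\<alpha>1 < \<alpha>2" "\<alpha>2 \<le> 1" and \<beta>: "0 < \<beta>1" "\<beta>1 < \<beta>2" "\<beta>2 \<le> 1"
  shows "emeasure lborel (hartogs_annulus m n \<alpha>1 \<alpha>2 \<beta>1 \<beta>2) \<noteq> 0"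
proof -
  obtain C where C: "C \<noteq> 0" "\<And>\<phi>. \<phi> \<in> borel_measurable borel \<Longrightarrow>
    (\<integral>\<^sup>+z. \<phi> ((norm (snd z))\<^sup>2) * indicator (hartogs_annulus m n \<alpha>1 \<alpha>2 \<beta>1 \<beta>2) z \<partial>lborel)
     = C * (\<integral>\<^sup>+s. \<phi> s * indicator {\<beta>1\<^sup>2..\<beta>2\<^sup>2} s * ennreal (s powr (real n / real m)) * indicator {0<..<1} s \<partial>lborel)"
    using \<beta> by (rule_tac nn_integral_hartogs_annulus[OF m n \<alpha>, of \<beta>1 \<beta>2]) auto
  have b2: "0 < \<beta>1\<^sup>2" "\<beta>1\<^sup>2 < \<beta>2\<^sup>2" "\<beta>2\<^sup>2 \<le> 1" using \<beta> by (auto intro!: power_strict_mono simp: abs_square_le_1)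
  let ?d = "(\<beta>1\<^sup>2) powr (real n / real m)"
  have "ennreal ?d * ennreal (\<beta>2\<^sup>2 - \<beta>1\<^sup>2) = (\<integral>\<^sup>+s. ennreal ?d * indicator {\<beta>1\<^sup>2<..<\<beta>2\<^sup>2} s \<partial>lborel)"
    using b2 by (simp add: nn_integral_cmult)
  also have "\<dots> \<le> (\<integral>\<^sup>+s. 1 * indicator {\<beta>1\<^sup>2..\<beta>2\<^sup>2} s * ennreal (s powr (real n / real m)) * indicator {0<..<1} s \<partial>lborel)"
    (is "_ \<le> ?J") using b2 by (intro nn_integral_mono) (auto simp: indicator_def intro!: ennreal_leI powr_mono2 dest: order_le_less_trans[OF zero_le_power2])
  finally have "?J \<noteq> 0" using b2 by (auto simp: ennreal_mult[symmetric] ennreal_eq_0_iff mult_le_0_iff)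
  then show ?thesis using C(1) C(2)[of "\<lambda>_. 1"] by simp
qed

text \<open>On the region s is bounded below, hence so is the density s^(n/m); finiteness is
  integrability of (1 - s)^(e p) at s = 1.\<close>

lemma annulus_edge_finite:
  assumes m: "0 < m" and n: "0 < n" and d: "0 < d" and \<alpha>: "0 < \<alpha>" "\<alpha> \<le> 1" and \<beta>: "0 < \<beta>" "\<beta> < 1"
    and fin: "(\<integral>\<^sup>+z. ennreal ((d * (1 - (norm (snd z))\<^sup>2) powr e) powr p) * indicator (hartogs_annulus m n 0 \<alpha> \<beta> 1) z \<partial>lborel) < \<infinity>"
  shows "- 1 < e * p"
proof (rule ccontr)
  assume "\<not> - 1 < e * p"
  then have ep: "e * p \<le> -1" by simp
  obtain C where C: "C \<noteq> 0" "\<And>\<phi>. \<phi> \<in> borel_measurable borel \<Longrightarrow>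
    (\<integral>\<^sup>+z. \<phi> ((norm (snd z))\<^sup>2) * indicator (hartogs_annulus m n 0 \<alpha> \<beta> 1) z \<partial>lborel)
     = C * (\<integral>\<^sup>+s. \<phi> s * indicator {\<beta>\<^sup>2..1\<^sup>2} s * ennreal (s powr (real n / real m)) * indicator {0<..<1} s \<partial>lborel)"
    using \<beta> \<alpha> by (rule_tac nn_integral_hartogs_annulus[OF m n, of 0 \<alpha> \<beta> 1]) auto
  have b2: "0 < \<beta>\<^sup>2" "\<beta>\<^sup>2 < 1" using \<beta> by (auto simp: abs_square_less_1)
  let ?K = "d powr p * (\<beta>\<^sup>2) powr (real n / real m)"
  have "\<infinity> = (\<integral>\<^sup>+s. ennreal (?K * (1 - s) powr (e * p)) * indicator {\<beta>\<^sup>2<..<1} s \<partial>lborel)"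
    by (rule nn_integral_inverse_power_infinite_edge[symmetric]) (use b2 d ep in auto)
  also have "\<dots> \<le> (\<integral>\<^sup>+s. ennreal ((d * (1 - s) powr e) powr p) * indicator {\<beta>\<^sup>2..1\<^sup>2} s * ennreal (s powr (real n / real m)) * indicator {0<..<1} s \<partial>lborel)"
  proof (rule nn_integral_mono)
    fix s :: real
    have "ennreal (?K * (1 - s) powr (e * p)) \<le> ennreal ((d * (1 - s) powr e) powr p) * ennreal (s powr (real n / real m))" if "\<beta>\<^sup>2 < s" "s < 1"
    proof -
      have "(\<beta>\<^sup>2) powr (real n / real m) \<le> s powr (real n / real m)" using that b2 by (intro powr_mono2) auto
      then have "?K * (1 - s) powr (e * p) \<le> d powr p * s powr (real n / real m) * (1 - s) powr (e * p)"
        by (intro mult_right_mono mult_left_mono) auto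
      also have "\<dots> = (d * (1 - s) powr e) powr p * s powr (real n / real m)" by (simp add: powr_mult powr_powr)
      finally show ?thesis by (simp add: ennreal_mult[symmetric] ennreal_leI)
    qed
    then show "ennreal (?K * (1 - s) powr (e * p)) * indicator {\<beta>\<^sup>2<..<1} s
      \<le> ennreal ((d * (1 - s) powr e) powr p) * indicator {\<beta>\<^sup>2..1\<^sup>2} s * ennreal (s powr (real n / real m)) * indicator {0<..<1} s"
      using b2 by (auto simp: indicator_def dest: order_le_less_trans[OF zero_le_power2])
  qed
  finally have "(\<integral>\<^sup>+s. ennreal ((d * (1 - s) powr e) powr p) * indicator {\<beta>\<^sup>2..1\<^sup>2} s * ennreal (s powr (real n / real m)) * indicator {0<..<1} s \<partial>lborel) = \<infinity>"
    by (simp only: infinity_ennreal_def top_unique)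
  then show False using fin C(1) C(2)[of "\<lambda>s. ennreal ((d * (1 - s) powr e) powr p)"] by (simp add: ennreal_mult_top)
qed

text \<open>In the variable s = |z2|^2 the integrand is a constant times s^(-\<theta> p / 2 + n/m),
  so the exponent must exceed -1.\<close>

lemma annulus_origin_finite:
  assumes m: "0 < m" and n: "0 < n" and d: "0 < d" and \<alpha>: "0 \<le> \<alpha>1" "\<alpha>1 < \<alpha>2" "\<alpha>2 \<le> 1" and \<beta>: "0 < \<beta>" "\<beta> \<le> 1"
    and fin: "(\<integral>\<^sup>+z. ennreal ((d * norm (snd z) powr (- \<theta>)) powr p) * indicator (hartogs_annulus m n \<alpha>1 \<alpha>2 0 \<beta>) z \<partial>lborel) < \<infinity>"
  shows "\<theta> * p < 2 * (real n / real m) + 2"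
proof (rule ccontr)
  assume "\<not> \<theta> * p < 2 * (real n / real m) + 2"
  then have ep: "- \<theta> / 2 * p + real n / real m \<le> -1" by (simp add: field_simps)
  obtain C where C: "C \<noteq> 0" "\<And>\<phi>. \<phi> \<in> borel_measurable borel \<Longrightarrow>
    (\<integral>\<^sup>+z. \<phi> ((norm (snd z))\<^sup>2) * indicator (hartogs_annulus m n \<alpha>1 \<alpha>2 0 \<beta>) z \<partial>lborel)
     = C * (\<integral>\<^sup>+s. \<phi> s * indicator {0\<^sup>2..\<beta>\<^sup>2} s * ennreal (s powr (real n / real m)) * indicator {0<..<1} s \<partial>lborel)"
    using \<beta> by (rule_tac nn_integral_hartogs_annulus[OF m n \<alpha>, of 0 \<beta>]) auto
  have b2: "0 < \<beta>\<^sup>2" "\<beta>\<^sup>2 \<le> 1" using \<beta> by (auto simp: abs_square_le_1)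
  let ?\<phi> = "\<lambda>s. ennreal ((d * s powr (- \<theta> / 2)) powr p)"
  have "\<infinity> = (\<integral>\<^sup>+s. ennreal (d powr p * s powr (- \<theta> / 2 * p + real n / real m)) * indicator {0<..<\<beta>\<^sup>2} s \<partial>lborel)"
    by (rule nn_integral_inverse_power_infinite[symmetric]) (use b2 d ep in auto)
  also have "\<dots> \<le> (\<integral>\<^sup>+s. ?\<phi> s * indicator {0\<^sup>2..\<beta>\<^sup>2} s * ennreal (s powr (real n / real m)) * indicator {0<..<1} s \<partial>lborel)"
  proof (rule nn_integral_mono)
    fix s :: real
    have "ennreal (d powr p * s powr (- \<theta> / 2 * p + real n / real m)) = ?\<phi> s * ennreal (s powr (real n / real m))"
      unfolding powr_mult powr_powr powr_add by (subst ennreal_mult[symmetric]) (auto simp: mult.assoc)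
    then show "ennreal (d powr p * s powr (- \<theta> / 2 * p + real n / real m)) * indicator {0<..<\<beta>\<^sup>2} s
      \<le> ?\<phi> s * indicator {0\<^sup>2..\<beta>\<^sup>2} s * ennreal (s powr (real n / real m)) * indicator {0<..<1} s"
      using b2 by (auto simp: indicator_def)
  qed
  finally have inf: "(\<integral>\<^sup>+s. ?\<phi> s * indicator {0\<^sup>2..\<beta>\<^sup>2} s * ennreal (s powr (real n / real m)) * indicator {0<..<1} s \<partial>lborel) = \<infinity>"
    by (simp only: infinity_ennreal_def top_unique)
  have "((norm y)\<^sup>2) powr (- \<theta> / 2) = norm y powr (- \<theta>)" for y :: complex
    by (simp add: power2_eq_square powr_mult powr_add[symmetric])
  then have "(\<integral>\<^sup>+z. ennreal ((d * norm (snd z) powr (- \<theta>)) powr p) * indicator (hartogs_annulus m n \<alpha>1 \<alpha>2 0 \<beta>) z \<partial>lborel)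
     = (\<integral>\<^sup>+z. ?\<phi> ((norm (snd z))\<^sup>2) * indicator (hartogs_annulus m n \<alpha>1 \<alpha>2 0 \<beta>) z \<partial>lborel)" by (simp only:)
  also have "\<dots> = C * (\<integral>\<^sup>+s. ?\<phi> s * indicator {0\<^sup>2..\<beta>\<^sup>2} s * ennreal (s powr (real n / real m)) * indicator {0<..<1} s \<partial>lborel)"
    by (rule C(2)) measurable
  also have "\<dots> = \<infinity>" unfolding inf using C(1) by (simp add: ennreal_mult_top)
  finally show False using fin by simp
qed

lemma bk_poly_cnj: "bk_poly m n (cnj v) (cnj p) = cnj (bk_poly m n v p)"
  unfolding bk_poly_def by (simp add: case_prod_beta')

text \<open>Hermitian symmetry of the kernel. Exchanging the variables exchanges a and b, so lower
  bounds in z for exponent a become lower bounds in w for exponent b.\<close>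

lemma S_plus_kernel_swap:
  assumes z: "z \<in> hartogs m n" and w: "w \<in> hartogs m n" and m: "0 < m" and n: "0 < n"
  shows "S_plus_kernel m n b a c z w = S_plus_kernel m n a b c w z"
proof -
  obtain x l where x: "norm x < 1" "l \<noteq> 0" "norm l < 1" and z': "z = hmap m n (x, l)"
    by (rule hartogs_lift[OF z m n]) (rule that)
  obtain y k where y: "norm y < 1" "k \<noteq> 0" "norm k < 1" and w': "w = hmap m n (y, k)"
    by (rule hartogs_lift[OF w m n]) (rule that)
  have e: "y * cnj x = cnj (x * cnj y)" "k * cnj l = cnj (l * cnj k)" by simp_all
  have "hk m n w z = cnj (hk m n z w)"
    unfolding z' w' hk_hmap[OF m n x y] hk_hmap[OF m n y x] e bk_poly_cnj by simp
  then show ?thesis unfolding S_plus_kernel_eq[OF z w m n] S_plus_kernel_eq[OF w z m n] by simp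
qed

text \<open>On E both \<open>hbase\<close> and z2 are small, with |z2| between 1/(4m) and 1/(2m).
  Then t = z2 cnj w2 satisfies m |t| <= 1/2, so the p-coefficient does not vanish, and |t| >=
  1/(8m), which is \<tau>. The kernel itself is bounded below, and only the weight in z depends on
  the distance to |z2| = 1.\<close>

lemma S_plus_kernel_ge_edge:
  assumes m: "0 < m" and n: "0 < n" and c: "0 < c"
  obtains d E where "0 < d" "E \<subseteq> hartogs m n" "E \<in> sets borel" "emeasure lborel E \<noteq> 0"
    "\<And>z w. z \<in> hartogs_annulus m n 0 (1/2) (1/2) 1 \<Longrightarrow> w \<in> E \<Longrightarrow>
       d * (1 - (norm (snd z))\<^sup>2) powr a \<le> S_plus_kernel m n a b c z w"
proof -
  define \<tau> where "\<tau> = 1 / (8 * real m)"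
  define \<alpha> where "\<alpha> = min ((\<tau> / (8 * real m ^ 4)) ^ m) (1/2)"
  define \<delta> where "\<delta> = \<tau> / (32 * pi\<^sup>2 * real m) / 4"
  let ?E = "hartogs_annulus m n 0 \<alpha> (1 / (4 * real m)) (1 / (2 * real m))"
  have \<tau>: "0 < \<tau>" "\<tau> \<le> 1" using m by (simp_all add: \<tau>_def divide_le_eq)
  have \<alpha>: "0 < \<alpha>" "\<alpha> < 1" using \<tau> m by (simp_all add: \<alpha>_def)
  have \<delta>: "0 < \<delta>" using \<tau> m by (simp add: \<delta>_def)
  have b: "0 < 1 / (4 * real m)" "1 / (4 * real m) < 1 / (2 * real m)" "1 / (2 * real m) < 1" "0 < 1 / (2 * real m)" using m by (auto simp: field_simps)
  have half: "0 \<le> (1/2 :: real)" "(1/2 :: real) < 1" "0 < (1/2 :: real)" by auto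
  obtain d1 where d1: "0 < d1" "\<And>z. z \<in> hartogs_annulus m n 0 (1/2) (1/2) 1 \<Longrightarrow>
    d1 * (1 - (norm (snd z))\<^sup>2) powr a \<le> hsize m n z powr (- a / 2) * hdist m n z powr a"
    by (rule weight_ge_edge[OF m n half]) (rule that)
  obtain d2 where d2: "0 < d2" "\<And>w. w \<in> ?E \<Longrightarrow> d2 \<le> hsize m n w powr (- b / 2) * hdist m n w powr b"
    by (rule weight_ge_interior[OF m n less_imp_le[OF \<alpha>(1)] \<alpha>(2) b(1) less_imp_le[OF b(4)] b(3)]) (rule that)
  show thesis
  proof (rule that[of "\<delta> powr (c / 2) * d1 * d2" ?E])
    show "0 < \<delta> powr (c / 2) * d1 * d2" using \<delta> d1 d2 by simp
    show "?E \<subseteq> hartogs m n" "?E \<in> sets borel" by (rule hartogs_annulus_subset, rule hartogs_annulus_measurable)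
    show "emeasure lborel ?E \<noteq> 0" by (intro emeasure_hartogs_annulus_nonzero m n order_refl \<alpha>(1) less_imp_le[OF \<alpha>(2)] b(1,2) less_imp_le[OF b(3)])
    fix z w assume zU: "z \<in> hartogs_annulus m n 0 (1/2) (1/2) 1" and wE: "w \<in> ?E"
    have z: "z \<in> hartogs m n" "1/2 \<le> norm (snd z)" and w: "w \<in> hartogs m n" "norm (hbase m n w) \<le> \<alpha>"
      "1 / (4 * real m) \<le> norm (snd w)" "norm (snd w) \<le> 1 / (2 * real m)"
      using zU wE by (auto simp: hartogs_annulus_def)
    have z1: "norm (snd z) \<le> 1" using hartogs_snd(2)[OF z(1) n] by simp
    have "norm (hbase m n z) * norm (hbase m n w) \<le> 1 * \<alpha>"
      using norm_hbase_less[OF z(1) m n] w by (intro mult_mono) auto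
    then have hb: "norm (hbase m n z) * norm (hbase m n w) \<le> (\<tau> / (8 * real m ^ 4)) ^ m" by (simp add: \<alpha>_def)
    have "1/2 * (1 / (4 * real m)) \<le> norm (snd z) * norm (snd w)" using z w b by (intro mult_mono) auto
    then have t1: "\<tau> \<le> norm (snd z * cnj (snd w))" by (simp add: \<tau>_def norm_mult)
    have "norm (snd z) * norm (snd w) \<le> 1 * (1 / (2 * real m))" using z1 w by (intro mult_mono) auto
    then have t2: "real m * norm (snd z * cnj (snd w)) \<le> 1/2" using m by (simp add: norm_mult field_simps)
    let ?t = "norm (1 - snd z * cnj (snd w))"
    have zw: "norm (snd z * cnj (snd w)) < 1"
      using mult_strict_mono[of "norm (snd z)" 1 "norm (snd w)" 1] hartogs_snd[OF z(1) n] hartogs_snd[OF w(1) n] by (simp add: norm_mult)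
    have "?t \<le> 2" using norm_triangle_ineq4[of 1 "snd z * cnj (snd w)"] zw by simp
    then have "?t\<^sup>2 \<le> 2\<^sup>2" by (intro power_mono) auto
    moreover have "0 < ?t" using zw by auto
    ultimately have "\<delta> \<le> \<tau> / (32 * pi\<^sup>2 * real m) / ?t\<^sup>2"
      unfolding \<delta>_def using \<tau> m by (intro divide_left_mono) auto
    also have "\<dots> \<le> norm (hk m n z w)"
      by (rule norm_hk_ge_edge[OF m n \<tau> z(1) w(1) hb t1 disjI1[OF t2]])
    finally have F: "\<delta> powr (c / 2) \<le> norm (hk m n z w) powr (c / 2)" using \<delta> c by (intro powr_mono2) auto
    have "\<delta> powr (c / 2) * (d1 * (1 - (norm (snd z))\<^sup>2) powr a) * d2 \<le> S_plus_kernel m n a b c z w"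
      unfolding S_plus_kernel_eq[OF z(1) w(1) m n]
      by (rule mult_mono[OF mult_mono[OF F d1(2)[OF zU]] d2(2)[OF wE]]) (use d1(1) d2(1) in auto)
    then show "\<delta> powr (c / 2) * d1 * d2 * (1 - (norm (snd z))\<^sup>2) powr a \<le> S_plus_kernel m n a b c z w"
      by (simp only: mult_ac)
  qed
qed

text \<open>The \<open>hbase\<close> values on E lie between 1/(4m) and 1/(2m), those of z between
  1/2 and 3/4: their product is at least u = 1/(8m), and m times it is at most 1/2, as
  \<open>norm_hk_ge_origin\<close> requires. The pole of the kernel to the power c/2 and the weight
  in z combine to the exponent c/2 - a.\<close>

lemma S_plus_kernel_ge_origin:
  assumes m: "0 < m" and n: "0 < n" and cop: "coprime m n" and c: "0 < c"
  obtains d E \<beta> where "0 < d" "E \<subseteq> hartogs m n" "E \<in> sets borel" "emeasure lborel E \<noteq> 0" "0 < \<beta>" "\<beta> \<le> 1"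
    "\<And>z w. z \<in> hartogs_annulus m n (1/2) (3/4) 0 \<beta> \<Longrightarrow> w \<in> E \<Longrightarrow>
       d * norm (snd z) powr (- (real (m + n - 1) / real m * (c / 2 - a))) \<le> S_plus_kernel m n a b c z w"
proof -
  define \<kappa> where "\<kappa> = real (m + n - 1) / real m"
  define u where "u = 1 / (8 * real m)"
  define \<beta> where "\<beta> = min ((u / (8 * real m ^ 4)) ^ m) (1/2)"
  define \<delta> where "\<delta> = u / (128 * pi\<^sup>2 * real m)"
  let ?E = "hartogs_annulus m n (1 / (4 * real m)) (1 / (2 * real m)) (1/4) (1/2)"
  have u: "0 < u" using m by (simp add: u_def)
  have \<beta>: "0 < \<beta>" "\<beta> < 1" using u m by (simp_all add: \<beta>_def)
  have \<delta>: "0 < \<delta>" using u m by (simp add: \<delta>_def)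
  have \<kappa>: "0 \<le> \<kappa>" by (simp add: \<kappa>_def)
  have b: "0 < 1 / (4 * real m)" "1 / (4 * real m) < 1 / (2 * real m)" "1 / (2 * real m) < 1" "0 < 1 / (2 * real m)" using m by (auto simp: field_simps)
  have half: "0 < (1/2 :: real)" "1/2 \<le> (3/4 :: real)" "(3/4 :: real) < 1" "0 < (1/4 :: real)" "0 \<le> (1/2 :: real)" "(1/2 :: real) < 1" by auto
  obtain d1 where d1: "0 < d1" "\<And>z. z \<in> hartogs_annulus m n (1/2) (3/4) 0 \<beta> \<Longrightarrow>
    d1 * norm (snd z) powr (real (m + n - 1) / real m * a) \<le> hsize m n z powr (- a / 2) * hdist m n z powr a"
    by (rule weight_ge_origin[OF m n cop half(1-3) less_imp_le[OF \<beta>(1)] \<beta>(2)]) (rule that)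
  note d1 = d1[folded \<kappa>_def]
  obtain d2 where d2: "0 < d2" "\<And>w. w \<in> ?E \<Longrightarrow> d2 \<le> hsize m n w powr (- b / 2) * hdist m n w powr b"
    by (rule weight_ge_interior[OF m n less_imp_le[OF b(4)] b(3) half(4-6)]) (rule that)
  show thesis
  proof (rule that[of "\<delta> powr (c / 2) * d1 * d2" ?E \<beta>])
    show "0 < \<delta> powr (c / 2) * d1 * d2" using \<delta> d1 d2 by simp
    show "?E \<subseteq> hartogs m n" "?E \<in> sets borel" by (rule hartogs_annulus_subset, rule hartogs_annulus_measurable)
    show "emeasure lborel ?E \<noteq> 0" by (intro emeasure_hartogs_annulus_nonzero m n less_imp_le[OF b(1)] b(2) less_imp_le[OF b(3)]) auto
    show "0 < \<beta>" "\<beta> \<le> 1" using \<beta> by auto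
    fix z w assume zU: "z \<in> hartogs_annulus m n (1/2) (3/4) 0 \<beta>" and wE: "w \<in> ?E"
    have z: "z \<in> hartogs m n" "1/2 \<le> norm (hbase m n z)" "norm (hbase m n z) \<le> 1" "norm (snd z) \<le> \<beta>"
      and w: "w \<in> hartogs m n" "1 / (4 * real m) \<le> norm (hbase m n w)" "norm (hbase m n w) \<le> 1 / (2 * real m)" "norm (snd w) \<le> 1"
      using zU wE by (auto simp: hartogs_annulus_def)
    have "1/2 * (1 / (4 * real m)) \<le> norm (hbase m n z) * norm (hbase m n w)" using z w b by (intro mult_mono) auto
    then have h1: "u \<le> norm (hbase m n z) * norm (hbase m n w)" by (simp add: u_def)
    have "norm (hbase m n z) * norm (hbase m n w) \<le> 1 * (1 / (2 * real m))" using z w by (intro mult_mono) auto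
    then have h2: "real m * (norm (hbase m n z) * norm (hbase m n w)) \<le> 1/2" using m by (simp add: field_simps)
    have nz: "snd z \<noteq> 0" "snd w \<noteq> 0" using hartogs_snd(1)[OF z(1) n] hartogs_snd(1)[OF w(1) n] by auto
    have tz: "norm (snd z * cnj (snd w)) \<le> norm (snd z)" unfolding norm_mult using w by (simp add: mult_left_le)
    then have "norm (snd z * cnj (snd w)) \<le> (u / (8 * real m ^ 4)) ^ m" using z(4) by (simp add: \<beta>_def)
    from norm_hk_ge_origin[OF m n cop u z(1) w(1) h1 h2 this]
    have k: "\<delta> * norm (snd z * cnj (snd w)) powr (- \<kappa>) \<le> norm (hk m n z w)" by (simp only: \<delta>_def \<kappa>_def)
    have "\<delta> * norm (snd z) powr (- \<kappa>) \<le> \<delta> * norm (snd z * cnj (snd w)) powr (- \<kappa>)"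
      using tz nz \<delta> \<kappa> by (intro mult_left_mono powr_mono2') auto
    also note k
    finally have F: "(\<delta> * norm (snd z) powr (- \<kappa>)) powr (c / 2) \<le> norm (hk m n z w) powr (c / 2)" using \<delta> c by (intro powr_mono2) auto
    have "(\<delta> * norm (snd z) powr (- \<kappa>)) powr (c / 2) * (d1 * norm (snd z) powr (\<kappa> * a)) * d2 \<le> S_plus_kernel m n a b c z w"
      unfolding S_plus_kernel_eq[OF z(1) w(1) m n]
      by (rule mult_mono[OF mult_mono[OF F d1(2)[OF zU]] d2(2)[OF wE]]) (use d1(1) d2(1) in auto)
    also have "(\<delta> * norm (snd z) powr (- \<kappa>)) powr (c / 2) * (d1 * norm (snd z) powr (\<kappa> * a)) * d2
      = \<delta> powr (c / 2) * d1 * d2 * (norm (snd z) powr (- \<kappa> * (c / 2)) * norm (snd z) powr (\<kappa> * a))"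
      unfolding powr_mult powr_powr by (simp only: mult_ac)
    also have "norm (snd z) powr (- \<kappa> * (c / 2)) * norm (snd z) powr (\<kappa> * a) = norm (snd z) powr (- (\<kappa> * (c / 2 - a)))"
      unfolding powr_add[symmetric] by (simp add: algebra_simps)
    finally show "\<delta> powr (c / 2) * d1 * d2 * norm (snd z) powr (- (real (m + n - 1) / real m * (c / 2 - a))) \<le> S_plus_kernel m n a b c z w"
      by (simp only: \<kappa>_def)
  qed
qed

text \<open>The conditions on a use the indicator test with exponent p. Those on b use the dual test
  with exponent q, for which the kernel bounds are taken with a and b exchanged and carried over by
  \<open>S_plus_kernel_swap\<close>.\<close>

lemma S_plus_bounded_imp_weights:
  assumes m: "0 < m" and n: "0 < n" and cop: "coprime m n" and c: "0 < c" and p: "1 < p" "1 < q" "1/p + 1/q = 1"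
    and bd: "bounded_integral_operator_on_Lp (hartogs m n) p (S_plus_kernel m n a b c)"
  shows "- 1 < a * p" "real (m + n - 1) / real m * (c / 2 - a) * p < 2 * (real n / real m) + 2"
    "- 1 < b * q" "real (m + n - 1) / real m * (c / 2 - b) * q < 2 * (real n / real m) + 2"
proof -
  let ?U = "hartogs_annulus m n 0 (1/2) (1/2) 1"
  have U0: "0 \<le> 1 - (norm (snd z))\<^sup>2" if "z \<in> hartogs m n" for z
    using hartogs_snd(2)[OF that n] by (simp add: abs_square_le_1)
  obtain d E where E: "0 < d" "E \<subseteq> hartogs m n" "E \<in> sets borel" "emeasure lborel E \<noteq> 0"
    "\<And>z w. z \<in> ?U \<Longrightarrow> w \<in> E \<Longrightarrow> d * (1 - (norm (snd z))\<^sup>2) powr a \<le> S_plus_kernel m n a b c z w"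
    by (rule S_plus_kernel_ge_edge[OF m n c]) (rule that)
  show "- 1 < a * p"
  proof (rule annulus_edge_finite[OF m n E(1)])
    show "(\<integral>\<^sup>+z. ennreal ((d * (1 - (norm (snd z))\<^sup>2) powr a) powr p) * indicator ?U z \<partial>lborel) < \<infinity>"
      by (rule S_plus_bounded_imp_left[OF m n p(1) bd E(2-4) hartogs_annulus_subset]) (use E(1,5) in auto)
  qed auto
  obtain d E where E: "0 < d" "E \<subseteq> hartogs m n" "E \<in> sets borel" "emeasure lborel E \<noteq> 0"
    "\<And>z w. z \<in> ?U \<Longrightarrow> w \<in> E \<Longrightarrow> d * (1 - (norm (snd z))\<^sup>2) powr b \<le> S_plus_kernel m n b a c z w"
    by (rule S_plus_kernel_ge_edge[OF m n c]) (rule that)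
  show "- 1 < b * q"
  proof (rule annulus_edge_finite[OF m n E(1)])
    show "(\<integral>\<^sup>+z. ennreal ((d * (1 - (norm (snd z))\<^sup>2) powr b) powr q) * indicator ?U z \<partial>lborel) < \<infinity>"
    proof (rule S_plus_bounded_imp_right[OF m n p bd E(2-4) hartogs_annulus_subset hartogs_annulus_measurable])
      fix z w assume zw: "z \<in> E" "w \<in> ?U"
      have "z \<in> hartogs m n" "w \<in> hartogs m n" using zw E(2) by (auto simp: hartogs_annulus_def)
      then show "d * (1 - (norm (snd w))\<^sup>2) powr b \<le> S_plus_kernel m n a b c z w"
        using E(5)[OF zw(2,1)] S_plus_kernel_swap[OF _ _ m n] by simp
    qed (use E(1) in auto)
  qed auto
  obtain d E \<beta> where E: "0 < d" "E \<subseteq> hartogs m n" "E \<in> sets borel" "emeasure lborel E \<noteq> 0" "0 < \<beta>" "\<beta> \<le> 1"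
    "\<And>z w. z \<in> hartogs_annulus m n (1/2) (3/4) 0 \<beta> \<Longrightarrow> w \<in> E \<Longrightarrow>
       d * norm (snd z) powr (- (real (m + n - 1) / real m * (c / 2 - a))) \<le> S_plus_kernel m n a b c z w"
    by (rule S_plus_kernel_ge_origin[OF m n cop c]) (rule that)
  show "real (m + n - 1) / real m * (c / 2 - a) * p < 2 * (real n / real m) + 2"
  proof (rule annulus_origin_finite[OF m n E(1)])
    show "(\<integral>\<^sup>+z. ennreal ((d * norm (snd z) powr (- (real (m + n - 1) / real m * (c / 2 - a)))) powr p)
        * indicator (hartogs_annulus m n (1/2) (3/4) 0 \<beta>) z \<partial>lborel) < \<infinity>"
      by (rule S_plus_bounded_imp_left[OF m n p(1) bd E(2-4) hartogs_annulus_subset]) (use E(1,7) in \<open>auto simp del: of_nat_diff\<close>)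
  qed (use E in auto)
  obtain d E \<beta> where E: "0 < d" "E \<subseteq> hartogs m n" "E \<in> sets borel" "emeasure lborel E \<noteq> 0" "0 < \<beta>" "\<beta> \<le> 1"
    "\<And>z w. z \<in> hartogs_annulus m n (1/2) (3/4) 0 \<beta> \<Longrightarrow> w \<in> E \<Longrightarrow>
       d * norm (snd z) powr (- (real (m + n - 1) / real m * (c / 2 - b))) \<le> S_plus_kernel m n b a c z w"
    by (rule S_plus_kernel_ge_origin[OF m n cop c]) (rule that)
  show "real (m + n - 1) / real m * (c / 2 - b) * q < 2 * (real n / real m) + 2"
  proof (rule annulus_origin_finite[OF m n E(1)])
    show "(\<integral>\<^sup>+z. ennreal ((d * norm (snd z) powr (- (real (m + n - 1) / real m * (c / 2 - b)))) powr q)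
        * indicator (hartogs_annulus m n (1/2) (3/4) 0 \<beta>) z \<partial>lborel) < \<infinity>"
    proof (rule S_plus_bounded_imp_right[OF m n p bd E(2-4) hartogs_annulus_subset hartogs_annulus_measurable])
      fix z w assume zw: "z \<in> E" "w \<in> hartogs_annulus m n (1/2) (3/4) 0 \<beta>"
      have "z \<in> hartogs m n" "w \<in> hartogs m n" using zw E(2) by (auto simp: hartogs_annulus_def)
      then show "d * norm (snd w) powr (- (real (m + n - 1) / real m * (c / 2 - b))) \<le> S_plus_kernel m n a b c z w"
        using E(7)[OF zw(2,1)] S_plus_kernel_swap[OF _ _ m n] by simp
    qed (use E(1) in \<open>auto simp del: of_nat_diff\<close>)
  qed (use E in auto)
qed

text \<open>A region approaching the boundary point z2 = 1 at scale \<eta>: both |1 - z2| and 1 -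
  |z2| are comparable to \<eta> on it, so kernel and weights are pure powers of \<eta> up to
  constants.\<close>

definition edge_bidisc :: "nat \<Rightarrow> nat \<Rightarrow> real \<Rightarrow> real \<Rightarrow> (complex \<times> complex) set" where
  "edge_bidisc m n \<alpha> \<eta> = {z \<in> hartogs m n. hbase m n z \<in> ball 0 \<alpha> \<and> snd z \<in> ball (1 - of_real \<eta>) (\<eta> / 2)}"

lemma edge_bidisc_measurable: "edge_bidisc m n \<alpha> \<eta> \<in> sets borel"
proof -
  have "edge_bidisc m n \<alpha> \<eta> = hartogs m n \<inter> (hbase m n -` ball 0 \<alpha> \<inter> space borel)
      \<inter> (snd -` ball (1 - of_real \<eta>) (\<eta> / 2) \<inter> space borel)"
    by (auto simp: edge_bidisc_def)
  also have "\<dots> \<in> sets borel"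
    by (intro sets.Int hartogs_measurable measurable_sets[where A=borel and M=borel] hbase_measurable snd_borel_measurable) auto
  finally show ?thesis .
qed

lemma edge_bidisc_snd:
  assumes z: "z \<in> edge_bidisc m n \<alpha> \<eta>" and \<eta>: "0 < \<eta>" "\<eta> \<le> 1/4"
  shows "1 - 3 * \<eta> / 2 \<le> norm (snd z)" "norm (snd z) \<le> 1 - \<eta> / 2" "norm (1 - snd z) \<le> 3 * \<eta> / 2"
    "1/2 * \<eta> \<le> 1 - (norm (snd z))\<^sup>2" "1 - (norm (snd z))\<^sup>2 \<le> 3 * \<eta>"
proof -
  have d: "norm ((1 - of_real \<eta>) - snd z) < \<eta> / 2" using z by (simp add: edge_bidisc_def dist_norm)
  have e: "norm (1 - complex_of_real \<eta>) = 1 - \<eta>"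
    using \<eta> norm_of_real[of "1 - \<eta>", where 'a=complex] by simp
  show 3: "norm (1 - snd z) \<le> 3 * \<eta> / 2"
    using norm_triangle_ineq[of "(1 - of_real \<eta>) - snd z" "of_real \<eta>"] d \<eta> by simp
  show 1: "1 - 3 * \<eta> / 2 \<le> norm (snd z)"
    using norm_triangle_ineq2[of 1 "1 - snd z"] 3 by simp
  show 2: "norm (snd z) \<le> 1 - \<eta> / 2"
    using norm_triangle_ineq[of "1 - of_real \<eta>" "snd z - (1 - of_real \<eta>)"] d e by (simp add: norm_minus_commute)
  have sq: "1 - (norm (snd z))\<^sup>2 = (1 - norm (snd z)) * (1 + norm (snd z))" by (simp add: power2_eq_square algebra_simps)
  have "1/2 * \<eta> = (\<eta> / 2) * 1" by simp
  also have "\<dots> \<le> (1 - norm (snd z)) * (1 + norm (snd z))" using 2 \<eta> by (intro mult_mono) auto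
  finally show "1/2 * \<eta> \<le> 1 - (norm (snd z))\<^sup>2" by (simp only: sq)
  have "(1 - norm (snd z)) * (1 + norm (snd z)) \<le> (3 * \<eta> / 2) * 2" using 1 2 \<eta> by (intro mult_mono) auto
  then show "1 - (norm (snd z))\<^sup>2 \<le> 3 * \<eta>" by (simp add: sq)
qed

text \<open>Both weights of the product formula are bounded below: |y|^(2/m - 2) >= 1 on the
  punctured unit disc, and |y| >= 1/2 on the small ball as \<eta> <= 1/4. The factor \<eta>^2 comes
  from the area of that ball.\<close>

lemma emeasure_edge_bidisc_ge:
  assumes m: "0 < m" and n: "0 < n" and \<alpha>: "0 < \<alpha>" "\<alpha> \<le> 1" and \<eta>: "0 < \<eta>" "\<eta> \<le> 1/4"
  shows "ennreal (1 / real m * (pi * \<alpha>\<^sup>2) * ((1/2) powr (2 * real n / real m) * (pi / 4)) * \<eta>\<^sup>2)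
    \<le> emeasure lborel (edge_bidisc m n \<alpha> \<eta>)"
proof -
  let ?B = "ball (1 - of_real \<eta>) (\<eta> / 2) :: complex set"
  have B: "1/2 \<le> norm y \<and> norm y < 1" if "y \<in> ?B" for y
  proof -
    have d: "norm (y - (1 - of_real \<eta>)) < \<eta> / 2" using that by (simp add: dist_norm norm_minus_commute)
    have e: "norm (1 - complex_of_real \<eta>) = 1 - \<eta>"
      using \<eta> norm_of_real[of "1 - \<eta>", where 'a=complex] by simp
    show ?thesis
      using norm_triangle_ineq[of "1 - of_real \<eta>" "y - (1 - of_real \<eta>)"] norm_triangle_ineq2[of "1 - of_real \<eta>" "(1 - of_real \<eta>) - y"] d e \<eta>
      by (simp add: norm_minus_commute)
  qed
  have J: "ennreal (pi * \<alpha>\<^sup>2) \<le> (\<integral>\<^sup>+y. indicator (ball 0 \<alpha>) y * ennreal (norm y powr (2 / real m - 2)) * indicator (ball 0 1) (y :: complex) \<partial>lborel)"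
  proof -
    have "ennreal (pi * \<alpha>\<^sup>2) = emeasure lborel (ball (0::complex) \<alpha>)" using \<alpha> by (simp add: emeasure_ball_complex)
    also have "\<dots> = (\<integral>\<^sup>+y. indicator (ball (0::complex) \<alpha>) y \<partial>lborel)" by simp
    also have "\<dots> \<le> (\<integral>\<^sup>+y. indicator (ball 0 \<alpha>) y * ennreal (norm y powr (2 / real m - 2)) * indicator (ball 0 1) (y :: complex) \<partial>lborel)"
    proof (rule nn_integral_mono_AE)
      have "AE y in lborel. y \<noteq> (0::complex)" by (rule AE_lborel_singleton)
      then show "AE y in lborel. indicator (ball 0 \<alpha>) y \<le> indicator (ball 0 \<alpha>) y * ennreal (norm y powr (2 / real m - 2)) * indicator (ball 0 1) (y :: complex)"
      proof eventually_elim
        fix y :: complex assume y: "y \<noteq> 0"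
        have "ennreal 1 \<le> ennreal (norm y powr (2 / real m - 2))" if "norm y < 1"
          using powr_mono'[of "2 / real m - 2" 0 "norm y"] that m y by (intro ennreal_leI) (simp add: divide_le_eq)
        then show "indicator (ball 0 \<alpha>) y \<le> indicator (ball 0 \<alpha>) y * ennreal (norm y powr (2 / real m - 2)) * indicator (ball 0 1) y"
          using \<alpha> by (auto simp: indicator_def)
      qed
    qed
    finally show ?thesis .
  qed
  have G: "ennreal ((1/2) powr (2 * real n / real m) * (pi / 4) * \<eta>\<^sup>2)
      \<le> (\<integral>\<^sup>+y. indicator ?B y * ennreal (norm y powr (2 * real n / real m)) * indicator (ball 0 1) y \<partial>lborel)"
  proof -
    have "ennreal ((1/2) powr (2 * real n / real m) * (pi / 4) * \<eta>\<^sup>2) = ennreal ((1/2) powr (2 * real n / real m)) * emeasure lborel ?B"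
      using \<eta> by (simp add: emeasure_ball_complex ennreal_mult[symmetric] power_divide)
    also have "\<dots> = (\<integral>\<^sup>+y. ennreal ((1/2) powr (2 * real n / real m)) * indicator ?B y \<partial>lborel)" by (simp add: nn_integral_cmult)
    also have "\<dots> \<le> (\<integral>\<^sup>+y. indicator ?B y * ennreal (norm y powr (2 * real n / real m)) * indicator (ball 0 1) y \<partial>lborel)"
    proof (rule nn_integral_mono)
      fix y :: complex
      have "ennreal ((1/2) powr (2 * real n / real m)) \<le> ennreal (norm y powr (2 * real n / real m))" if "1/2 \<le> norm y"
        using that by (intro ennreal_leI powr_mono2) auto
      then show "ennreal ((1/2) powr (2 * real n / real m)) * indicator ?B y
        \<le> indicator ?B y * ennreal (norm y powr (2 * real n / real m)) * indicator (ball 0 1) y"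
        using B[of y] by (cases "y \<in> ?B") (simp_all add: indicator_def)
    qed
    finally show ?thesis .
  qed
  have "ennreal (1 / real m * (pi * \<alpha>\<^sup>2) * ((1/2) powr (2 * real n / real m) * (pi / 4)) * \<eta>\<^sup>2)
      = ennreal (1 / real m) * ennreal (pi * \<alpha>\<^sup>2) * ennreal ((1/2) powr (2 * real n / real m) * (pi / 4) * \<eta>\<^sup>2)"
    by (simp add: ennreal_mult[symmetric] mult_ac)
  also have "\<dots> \<le> ennreal (1 / real m) * (\<integral>\<^sup>+y. indicator (ball 0 \<alpha>) y * ennreal (norm y powr (2 / real m - 2)) * indicator (ball 0 1) (y :: complex) \<partial>lborel)
     * (\<integral>\<^sup>+y. indicator ?B y * ennreal (norm y powr (2 * real n / real m)) * indicator (ball 0 1) y \<partial>lborel)"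
    by (intro mult_mono J G) auto
  also have "\<dots> = (\<integral>\<^sup>+z. indicator (ball 0 \<alpha>) (hbase m n z) * indicator ?B (snd z) * indicator (hartogs m n) z \<partial>lborel)"
    by (rule nn_integral_hartogs_product[symmetric, OF _ _ m n]) measurable
  also have "\<dots> = (\<integral>\<^sup>+z. indicator (edge_bidisc m n \<alpha> \<eta>) z \<partial>lborel)"
    by (intro nn_integral_cong) (auto simp: edge_bidisc_def indicator_def)
  also have "\<dots> = emeasure lborel (edge_bidisc m n \<alpha> \<eta>)" using edge_bidisc_measurable by simp
  finally show ?thesis .
qed

text \<open>For two points of the same region |1 - z2 cnj w2| <= 3 \<eta>, so the kernel is at least
  a constant times \<eta>^(-2), with 9 = 3^2 in \<delta>. Its power c/2 contributes \<eta>^(-c), and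
  the two weights contribute \<eta>^a and \<eta>^b.\<close>

lemma S_plus_kernel_ge_diagonal:
  assumes m: "0 < m" and n: "0 < n" and c: "0 < c"
  obtains d \<alpha> where "0 < d" "0 < \<alpha>" "\<alpha> \<le> 1" "\<And>\<eta> z w. 0 < \<eta> \<Longrightarrow> \<eta> \<le> 1/4 \<Longrightarrow> z \<in> edge_bidisc m n \<alpha> \<eta> \<Longrightarrow> w \<in> edge_bidisc m n \<alpha> \<eta> \<Longrightarrow>
       d * \<eta> powr (a + b - c) \<le> S_plus_kernel m n a b c z w"
proof -
  define \<alpha> where "\<alpha> = min ((1/4 / (8 * real m ^ 4)) ^ m) (1/2)"
  define \<delta> where "\<delta> = 1/4 / (32 * pi\<^sup>2 * real m) / 9"
  have \<alpha>: "0 < \<alpha>" "\<alpha> < 1" using m by (simp_all add: \<alpha>_def)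
  have \<delta>: "0 < \<delta>" using m by (simp add: \<delta>_def)
  have half: "0 < (1/2 :: real)" by simp
  have W: "\<exists>d>0. \<forall>\<eta> z. 0 < \<eta> \<longrightarrow> \<eta> \<le> 1/4 \<longrightarrow> z \<in> edge_bidisc m n \<alpha> \<eta> \<longrightarrow>
      d * \<eta> powr e \<le> hsize m n z powr (- e / 2) * hdist m n z powr e" for e
  proof -
    obtain d1 where d1: "0 < d1" "\<And>z. z \<in> hartogs_annulus m n 0 \<alpha> (1/2) 1 \<Longrightarrow>
      d1 * (1 - (norm (snd z))\<^sup>2) powr e \<le> hsize m n z powr (- e / 2) * hdist m n z powr e"
      by (rule weight_ge_edge[OF m n less_imp_le[OF \<alpha>(1)] \<alpha>(2) half]) (rule that)
    define d2 where "d2 = min ((1/2) powr e) (3 powr e)"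
    have "d1 * d2 * \<eta> powr e \<le> hsize m n z powr (- e / 2) * hdist m n z powr e"
      if \<eta>: "0 < \<eta>" "\<eta> \<le> 1/4" and z: "z \<in> edge_bidisc m n \<alpha> \<eta>" for \<eta> z
    proof -
      note s = edge_bidisc_snd[OF z \<eta>]
      have "d2 * \<eta> powr e \<le> (1 - (norm (snd z))\<^sup>2) powr e"
        unfolding d2_def using s \<eta> by (intro powr_between) auto
      then have "d1 * (d2 * \<eta> powr e) \<le> d1 * (1 - (norm (snd z))\<^sup>2) powr e" using d1(1) by (intro mult_left_mono) auto
      also have "\<dots> \<le> hsize m n z powr (- e / 2) * hdist m n z powr e"
        using z s(1,2) \<eta> by (intro d1(2)) (auto simp: edge_bidisc_def hartogs_annulus_def)
      finally show ?thesis by (simp only: mult.assoc)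
    qed
    moreover have "0 < d1 * d2" using d1 by (simp add: d2_def)
    ultimately show ?thesis by blast
  qed
  obtain d1 where d1: "0 < d1" "\<And>\<eta> z. 0 < \<eta> \<Longrightarrow> \<eta> \<le> 1/4 \<Longrightarrow> z \<in> edge_bidisc m n \<alpha> \<eta> \<Longrightarrow>
      d1 * \<eta> powr a \<le> hsize m n z powr (- a / 2) * hdist m n z powr a" using W[of a] by blast
  obtain d2 where d2: "0 < d2" "\<And>\<eta> z. 0 < \<eta> \<Longrightarrow> \<eta> \<le> 1/4 \<Longrightarrow> z \<in> edge_bidisc m n \<alpha> \<eta> \<Longrightarrow>
      d2 * \<eta> powr b \<le> hsize m n z powr (- b / 2) * hdist m n z powr b" using W[of b] by blast
  show thesis
  proof (rule that[of "\<delta> powr (c / 2) * d1 * d2" \<alpha>])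
    show "0 < \<delta> powr (c / 2) * d1 * d2" "0 < \<alpha>" "\<alpha> \<le> 1" using \<delta> d1 d2 \<alpha> by simp_all
    fix \<eta> z w assume \<eta>: "0 < \<eta>" "\<eta> \<le> (1/4 :: real)" and zQ: "z \<in> edge_bidisc m n \<alpha> \<eta>" and wQ: "w \<in> edge_bidisc m n \<alpha> \<eta>"
    have z: "z \<in> hartogs m n" "norm (hbase m n z) \<le> \<alpha>" and w: "w \<in> hartogs m n" "norm (hbase m n w) \<le> \<alpha>"
      using zQ wQ by (auto simp: edge_bidisc_def)
    note sz = edge_bidisc_snd[OF zQ \<eta>] and sw = edge_bidisc_snd[OF wQ \<eta>]
    have "norm (hbase m n z) * norm (hbase m n w) \<le> \<alpha> * 1" using z w \<alpha> by (intro mult_mono) auto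
    then have hb: "norm (hbase m n z) * norm (hbase m n w) \<le> (1/4 / (8 * real m ^ 4)) ^ m" by (simp add: \<alpha>_def)
    have "1/2 * (1/2) \<le> norm (snd z) * norm (snd w)" using sz(1) sw(1) \<eta> by (intro mult_mono) auto
    then have t1: "1/4 \<le> norm (snd z * cnj (snd w))" by (simp add: norm_mult)
    have "1 - snd z * cnj (snd w) = (1 - snd z) + snd z * cnj (1 - snd w)" by (simp add: algebra_simps)
    then have "norm (1 - snd z * cnj (snd w)) \<le> norm (1 - snd z) + norm (snd z) * norm (1 - snd w)"
      by (metis norm_triangle_ineq norm_mult complex_mod_cnj)
    also have "\<dots> \<le> 3 * \<eta> / 2 + 1 * (3 * \<eta> / 2)" using sz sw \<eta> by (intro add_mono mult_mono) auto
    finally have t3: "norm (1 - snd z * cnj (snd w)) \<le> 3 * \<eta>" by simp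
    then have "Re (1 - snd z * cnj (snd w)) \<le> 3 * \<eta>" by (rule order_trans[OF complex_Re_le_cmod])
    \<comment> \<open>Here z2 cnj w2 is close to 1, so the second alternative of
      \<open>norm_hk_ge_edge\<close> is the one available; \<eta> <= 1/4 makes the real part
      positive.\<close>
    then have t2: "0 \<le> Re (snd z * cnj (snd w))" using \<eta> unfolding minus_complex.sel one_complex.sel by linarith
    let ?t = "norm (1 - snd z * cnj (snd w))"
    have "norm (snd z * cnj (snd w)) < 1"
      using mult_strict_mono[of "norm (snd z)" 1 "norm (snd w)" 1] hartogs_snd[OF z(1) n] hartogs_snd[OF w(1) n] by (simp add: norm_mult)
    then have tp: "0 < ?t" by auto
    have "?t\<^sup>2 \<le> (3 * \<eta>)\<^sup>2" using t3 by (intro power_mono) auto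
    then have "\<delta> / \<eta>\<^sup>2 \<le> 1/4 / (32 * pi\<^sup>2 * real m) / ?t\<^sup>2"
      using divide_left_mono[of "?t\<^sup>2" "(3 * \<eta>)\<^sup>2" "1/4 / (32 * pi\<^sup>2 * real m)"] m tp \<eta>
      by (simp add: \<delta>_def power_mult_distrib)
    also have "\<dots> \<le> norm (hk m n z w)"
      by (rule norm_hk_ge_edge[OF m n _ _ z(1) w(1) hb t1 disjI2[OF t2]]) auto
    finally have F: "(\<delta> / \<eta>\<^sup>2) powr (c / 2) \<le> norm (hk m n z w) powr (c / 2)" using \<delta> c \<eta> by (intro powr_mono2) auto
    have "(\<delta> / \<eta>\<^sup>2) powr (c / 2) * (d1 * \<eta> powr a) * (d2 * \<eta> powr b) \<le> S_plus_kernel m n a b c z w"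
      unfolding S_plus_kernel_eq[OF z(1) w(1) m n]
      by (rule mult_mono[OF mult_mono[OF F d1(2)[OF \<eta> zQ]] d2(2)[OF \<eta> wQ]]) (use d1(1) d2(1) in auto)
    also have "(\<delta> / \<eta>\<^sup>2) powr (c / 2) = \<delta> powr (c / 2) * \<eta> powr (- c)"
    proof -
      have "(\<eta>\<^sup>2) powr (c / 2) = \<eta> powr c" using \<eta> by (intro square_powr_half) simp
      then show ?thesis using \<eta> \<delta> by (simp add: powr_divide powr_minus_divide)
    qed
    also have "\<delta> powr (c / 2) * \<eta> powr (- c) * (d1 * \<eta> powr a) * (d2 * \<eta> powr b)
        = \<delta> powr (c / 2) * d1 * d2 * (\<eta> powr a * \<eta> powr b * \<eta> powr (- c))" by (simp only: mult_ac)
    also have "\<eta> powr a * \<eta> powr b * \<eta> powr (- c) = \<eta> powr (a + b - c)" by (simp add: powr_add[symmetric])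
    finally show "\<delta> powr (c / 2) * d1 * d2 * \<eta> powr (a + b - c) \<le> S_plus_kernel m n a b c z w" .
  qed
qed

text \<open>Testing with the indicator of \<open>edge_bidisc\<close> on the same set, the measure
  cancels and leaves d \<eta>^(a+b-c) \<mu> <= C^(1/p). As \<mu> >= c2 \<eta>^2, the quantity
  \<eta>^(a+b+2-c) stays bounded as \<eta> tends to 0.\<close>

lemma S_plus_bounded_imp_order:
  assumes m: "0 < m" and n: "0 < n" and c: "0 < c" and p: "1 < p"
    and bd: "bounded_integral_operator_on_Lp (hartogs m n) p (S_plus_kernel m n a b c)"
  shows "c \<le> a + b + 2"
proof (rule ccontr)
  assume "\<not> c \<le> a + b + 2"
  define \<epsilon> where "\<epsilon> = c - a - b - 2"
  have \<epsilon>: "0 < \<epsilon>" using \<open>\<not> c \<le> a + b + 2\<close> by (simp add: \<epsilon>_def)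
  obtain C where C: "0 \<le> C" "\<And>f \<kappa> U. f \<in> borel_measurable borel \<Longrightarrow> (\<And>w. 0 \<le> f w) \<Longrightarrow> (\<And>w. w \<notin> hartogs m n \<Longrightarrow> f w = 0) \<Longrightarrow>
     (\<integral>\<^sup>+w. ennreal (f w powr p) \<partial>lborel) < \<infinity> \<Longrightarrow> U \<subseteq> hartogs m n \<Longrightarrow>
     (\<And>z. z \<in> U \<Longrightarrow> 0 \<le> \<kappa> z \<and> ennreal (\<kappa> z) \<le> (\<integral>\<^sup>+w. ennreal (S_plus_kernel m n a b c z w * f w) \<partial>lborel)) \<Longrightarrow>
     (\<integral>\<^sup>+z. ennreal (\<kappa> z powr p) * indicator U z \<partial>lborel) \<le> ennreal C * (\<integral>\<^sup>+w. ennreal (f w powr p) \<partial>lborel)"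
  proof (rule S_plus_bounded_test[OF m n p bd], goal_cases)
    case (1 C)
    show ?case by (rule 1(1)[OF 1(2)]) (rule 1(3))
  qed
  obtain d \<alpha> where d: "0 < d" and \<alpha>: "0 < \<alpha>" "\<alpha> \<le> 1" and S: "\<And>\<eta> z w. 0 < \<eta> \<Longrightarrow> \<eta> \<le> 1/4 \<Longrightarrow> z \<in> edge_bidisc m n \<alpha> \<eta> \<Longrightarrow> w \<in> edge_bidisc m n \<alpha> \<eta> \<Longrightarrow>
       d * \<eta> powr (a + b - c) \<le> S_plus_kernel m n a b c z w"
    by (rule S_plus_kernel_ge_diagonal[OF m n c]) (rule that)
  define c2 where "c2 = 1 / real m * (pi * \<alpha>\<^sup>2) * ((1/2) powr (2 * real n / real m) * (pi / 4))"
  have c2: "0 < c2" using m \<alpha> by (simp add: c2_def)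
  have main: "d * c2 * \<eta> powr (- \<epsilon>) \<le> C powr (1 / p)" if \<eta>: "0 < \<eta>" "\<eta> \<le> 1/4" for \<eta>
  proof -
    let ?Q = "edge_bidisc m n \<alpha> \<eta>"
    have Qm[measurable]: "?Q \<in> sets borel" by (rule edge_bidisc_measurable)
    have QH: "?Q \<subseteq> hartogs m n" by (auto simp: edge_bidisc_def)
    have ge: "ennreal (c2 * \<eta>\<^sup>2) \<le> emeasure lborel ?Q"
      using emeasure_edge_bidisc_ge[OF m n \<alpha> \<eta>] by (simp only: c2_def)
    have fin: "emeasure lborel ?Q < \<infinity>" by (rule subset_hartogs_finite[OF QH m n])
    define \<mu> where "\<mu> = measure lborel ?Q"
    have \<mu>: "emeasure lborel ?Q = ennreal \<mu>" using fin by (simp add: \<mu>_def emeasure_eq_ennreal_measure)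
    have \<mu>0: "c2 * \<eta>\<^sup>2 \<le> \<mu>" using ge by (simp add: \<mu> \<mu>_def ennreal_le_iff)
    have \<mu>1: "0 < \<mu>" using \<mu>0 c2 \<eta> by (meson less_le_trans mult_pos_pos zero_less_power)
    define K where "K = d * \<eta> powr (a + b - c) * \<mu>"
    have K: "0 \<le> K" using d \<mu>1 by (simp add: K_def)
    have f: "(\<integral>\<^sup>+w. ennreal (indicator ?Q w powr p) \<partial>lborel) = ennreal \<mu>"
    proof -
      have "(\<integral>\<^sup>+w. ennreal (indicator ?Q w powr p) \<partial>lborel) = (\<integral>\<^sup>+w. indicator ?Q w \<partial>lborel)"
        by (intro nn_integral_cong) (simp add: indicator_def)
      then show ?thesis by (simp add: \<mu>)
    qed
    have "(\<integral>\<^sup>+z. ennreal (K powr p) * indicator ?Q z \<partial>lborel) \<le> ennreal C * (\<integral>\<^sup>+w. ennreal (indicator ?Q w powr p) \<partial>lborel)"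
    proof (rule C(2)[OF _ _ _ _ QH])
      show "(indicator ?Q :: _ \<Rightarrow> real) \<in> borel_measurable borel" by measurable
      show "indicator ?Q w = (0::real)" if "w \<notin> hartogs m n" for w using QH that by (auto simp: indicator_def)
      show "(\<integral>\<^sup>+w. ennreal (indicator ?Q w powr p) \<partial>lborel) < \<infinity>" unfolding f by simp
      fix z assume z: "z \<in> ?Q"
      have "ennreal K = ennreal (d * \<eta> powr (a + b - c)) * ennreal \<mu>" using d \<mu>1 by (simp add: K_def ennreal_mult[symmetric])
      also have "\<dots> = (\<integral>\<^sup>+w. ennreal (d * \<eta> powr (a + b - c)) * indicator ?Q w \<partial>lborel)"
        by (simp add: nn_integral_cmult \<mu>)
      also have "\<dots> \<le> (\<integral>\<^sup>+w. ennreal (S_plus_kernel m n a b c z w * indicator ?Q w) \<partial>lborel)"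
        using S[OF \<eta> z] by (intro nn_integral_mono) (auto simp: indicator_def intro!: ennreal_leI)
      finally show "0 \<le> K \<and> ennreal K \<le> (\<integral>\<^sup>+w. ennreal (S_plus_kernel m n a b c z w * indicator ?Q w) \<partial>lborel)"
        using K by simp
    qed simp
    then have "ennreal (K powr p * \<mu>) \<le> ennreal (C * \<mu>)"
      unfolding f using C(1) \<mu>1 by (simp add: nn_integral_cmult \<mu> ennreal_mult)
    then have "K powr p * \<mu> \<le> C * \<mu>" using C(1) \<mu>1 by (simp add: ennreal_le_iff)
    then have "K powr p \<le> C" using \<mu>1 by simp
    then have "(K powr p) powr (1 / p) \<le> C powr (1 / p)" using p by (intro powr_mono2) auto
    then have KC: "K \<le> C powr (1 / p)" using p K by (simp add: powr_powr)
    have "d * c2 * \<eta> powr (- \<epsilon>) = d * \<eta> powr (a + b - c) * (c2 * \<eta>\<^sup>2)"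
    proof -
      have "\<eta> powr (- \<epsilon>) = \<eta> powr (a + b - c) * \<eta> powr 2" by (simp add: powr_add[symmetric] \<epsilon>_def algebra_simps)
      then show ?thesis using \<eta> by (simp add: powr_numeral)
    qed
    also have "\<dots> \<le> K" unfolding K_def using \<mu>0 d by (intro mult_left_mono) auto
    finally show ?thesis using KC by simp
  qed
  define M where "M = C powr (1 / p) + 1"
  \<comment> \<open>Chosen so that d c2 \<eta>^(-\<epsilon>) is at least M, which exceeds the bound
    C^(1/p); the minimum with 1/4 keeps \<open>main\<close> applicable.\<close>
  define \<eta> where "\<eta> = min (1/4) ((d * c2 / M) powr (1 / \<epsilon>))"
  have M: "0 < M" by (auto simp: M_def intro: add_nonneg_pos)
  have X: "0 < d * c2 / M" using d c2 M by simp
  have \<eta>: "0 < \<eta>" "\<eta> \<le> 1/4" unfolding \<eta>_def using X by auto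
  have "\<eta> powr \<epsilon> \<le> ((d * c2 / M) powr (1 / \<epsilon>)) powr \<epsilon>" using \<eta> \<epsilon> by (intro powr_mono2) (auto simp: \<eta>_def)
  also have "\<dots> = d * c2 / M" using X d c2 M \<epsilon> by (simp add: powr_powr)
  finally have "M * \<eta> powr \<epsilon> \<le> d * c2" using M by (simp add: field_simps)
  then have "M \<le> d * c2 / \<eta> powr \<epsilon>" using \<eta> by (simp add: field_simps)
  also have "\<dots> = d * c2 * \<eta> powr (- \<epsilon>)" by (simp add: powr_minus divide_inverse)
  also have "\<dots> \<le> C powr (1 / p)" by (rule main[OF \<eta>])
  finally show False by (simp add: M_def)
qed

theorem theorem1p1:
  fixes m n :: nat and p a b c :: real
  assumes "0 < m" and "0 < n" and "coprime m n"
    and "1 < p" and "0 < c"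
  shows "bounded_integral_operator_on_Lp (hartogs m n) p (S_plus_kernel m n a b c) \<longleftrightarrow>
    (- a * p < 1 \<and> 1 < (b + 1) * p) \<and>
    ((c - 2 * a) * (real m + real n - 1) * p < 4 * (real m + real n) \<and>
     4 * (real m + real n) <
       ((2 * b - c) * (real m + real n - 1) + 4 * (real m + real n)) * p) \<and>
    c \<le> a + b + 2"
proof -
  define q where "q = p / (p - 1)"
  have q: "1 < q" "1 / p + 1 / q = 1" using \<open>1 < p\<close> by (auto simp: q_def field_simps)
  have dual: "x * q < y \<longleftrightarrow> x * p < y * (p - 1)" for x y :: real
    using \<open>1 < p\<close> by (simp add: q_def field_simps)
  have N: "real (m + n - 1) = real m + real n - 1" using \<open>0 < m\<close> by (simp add: of_nat_diff)
  \<comment> \<open>Multiplying by p - 1 shows that the right half of the second condition is the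
    left half with b and q in place of a and p, the form in which both directions use it.\<close>
  have B: "4 * (real m + real n) < ((2 * b - c) * (real m + real n - 1) + 4 * (real m + real n)) * p
      \<longleftrightarrow> (c - 2 * b) * (real m + real n - 1) * q < 4 * (real m + real n)"
    unfolding dual by (simp add: algebra_simps)
  \<comment> \<open>The conditions found at the origin, multiplied by 2 m.\<close>
  have scale: "(real m + real n - 1) / real m * (c / 2 - e) * r < 2 * (real n / real m) + 2
      \<longleftrightarrow> (c - 2 * e) * (real m + real n - 1) * r < 4 * (real m + real n)" for e r
  proof -
    have "(real m + real n - 1) / real m * (c / 2 - e) * r = (c - 2 * e) * (real m + real n - 1) * r / (2 * real m)"
      by (simp add: field_simps)
    moreover have "2 * (real n / real m) + 2 = 4 * (real m + real n) / (2 * real m)"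
      using \<open>0 < m\<close> by (simp add: field_simps)
    ultimately show ?thesis using \<open>0 < m\<close> by (simp add: divide_less_cancel)
  qed
  show ?thesis
  proof
    assume bd: "bounded_integral_operator_on_Lp (hartogs m n) p (S_plus_kernel m n a b c)"
    note w = S_plus_bounded_imp_weights[OF assms(1-3,5,4) q bd, unfolded N scale]
    \<comment> \<open>The dual condition -1 < b q, rewritten in terms of p.\<close>
    have "1 < (b + 1) * p" using w(3) dual[of "- b" 1] by (simp add: algebra_simps)
    then show "(- a * p < 1 \<and> 1 < (b + 1) * p) \<and>
      ((c - 2 * a) * (real m + real n - 1) * p < 4 * (real m + real n) \<and>
       4 * (real m + real n) < ((2 * b - c) * (real m + real n - 1) + 4 * (real m + real n)) * p) \<and> c \<le> a + b + 2"
      unfolding B using w S_plus_bounded_imp_order[OF assms(1,2,5,4) bd] by simp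
  next
    assume "(- a * p < 1 \<and> 1 < (b + 1) * p) \<and>
      ((c - 2 * a) * (real m + real n - 1) * p < 4 * (real m + real n) \<and>
       4 * (real m + real n) < ((2 * b - c) * (real m + real n - 1) + 4 * (real m + real n)) * p) \<and> c \<le> a + b + 2"
    then show "bounded_integral_operator_on_Lp (hartogs m n) p (S_plus_kernel m n a b c)"
      unfolding B by (intro S_plus_bounded_if[OF assms(1,2,4) q assms(5)]) auto
  qed
qed

end
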